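(* There exists a randomized cut strategy $\mathcal{C}$ such that, for any $\epsilon>0$, with probability $1-o_n(1)$, $\mathcal{C}$ is $\left(\Omega(\log n),\,O\!\left(\frac{\log^2 n}{1-\epsilon}\right)\right)$-good in the $(n,\epsilon,\boldsymbol{\mu})$-generalized cut-matching game. Furthermore, $\mathcal{C}$ outputs a cut in time that is nearly-linear in $n$.
   Context: $V$ is a finite set with $|V|=n$ and $\boldsymbol{\mu}\in\mathbb{Z}^V_{\ge0}$ is a vertex weighting with $\min_{i}\mu_i/\boldsymbol{\mu}(V)\ge1/\mathrm{poly}(n)$; $\boldsymbol{\mu}(S)=\sum_{i\in S}\mu_i$ and $\bar S=V\setminus S$. For a weighted graph $H$ on $V$, $\delta_H(S)$ is the total weight of edges with exactly one endpoint in $S$ and $\Psi_H=\min_S\frac{\delta_H(S)}{\min\{\boldsymbol{\mu}(S),\boldsymbol{\mu}(\bar S)\}}$. Seed of a cut: for $S\subseteq V$, $\mathbf{s}=\mathbf{1}^S-\frac{\boldsymbol{\mu}(S)}{\boldsymbol{\mu}(\bar S)}\mathbf{1}^{\bar S}$. Given $\epsilon>0$, an $\epsilon$-approximate matching action with respect to $S$ is a weighted bipartite graph $D$ between $S$ and $\bar S$ whose weighted degree vector $\mathbf{d}$ satisfies $\|\mathbf{d}-\boldsymbol{\mu}\circ|\mathbf{s}|\|_1\le\epsilon\|\boldsymbol{\mu}\circ|\mathbf{s}|\|_1$ and $d_i\le\mu_i|s_i|$ for all $i$. In the $(n,\epsilon,\boldsymbol{\mu})$-generalized cut-matching game, in round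 $t$ the cut strategy plays (possibly depending on the previous rounds) a cut $S_t\subset V$ with $S_t\ne\emptyset$ and $\boldsymbol{\mu}(S_t)\le\frac12\boldsymbol{\mu}(V)$, and a matching strategy responds with an $\epsilon$-approximate matching action $D_t$ with respect to $S_t$. For non-decreasing functions $f(n),g(n,\epsilon)$, a cut strategy is $\big(f(n),g(n,\epsilon)\big)$-good if, when it plays $S_1,\dots,S_{g(n,\epsilon)}$, for every sequence $D_1,\dots,D_{g(n,\epsilon)}$ with each $D_t$ an $\epsilon$-approximate matching action with respect to $S_t$, the edgewise sum $H=\sum_tD_t$ satisfies $\Psi_H\ge f(n)$.
   Formalization: Proved for 0 < ε < 1 (the round count is undefined or negative otherwise), and the time to output a cut is nearly linear in n plus the number of edges of the matching actions played so far, which is nearly linear in n when these have n·polylog(n) edges. *)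

theory Defs
  imports "HOL-Probability.Probability" "HOL-Library.Landau_Symbols" "HOL-Library.Log_Nat"
begin

section \<open>Weighted graphs, vertex weightings and expansion\<close>

type_synonym 'a wgraph = "'a \<Rightarrow> 'a \<Rightarrow> real"

text \<open>A weighted graph is its symmetric weight function; an unordered pair \<open>i, j\<close> is an edge iff
  its weight is nonzero.\<close>

definition weighted_graph :: "'a set \<Rightarrow> 'a wgraph \<Rightarrow> bool" where
  "weighted_graph V w \<longleftrightarrow>
     (\<forall>i j. w i j = w j i) \<and> (\<forall>i j. 0 \<le> w i j) \<and> (\<forall>i. w i i = 0) \<and>
     (\<forall>i j. w i j \<noteq> 0 \<longrightarrow> i \<in> V \<and> j \<in> V)"

definition wdegree :: "'a set \<Rightarrow> 'a wgraph \<Rightarrow> 'a \<Rightarrow> real" where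
  "wdegree V w i = (\<Sum>j\<in>V. w i j)"

definition cut_weight :: "'a set \<Rightarrow> 'a wgraph \<Rightarrow> 'a set \<Rightarrow> real" where
  "cut_weight V w S = (\<Sum>i\<in>S. \<Sum>j\<in>V - S. w i j)"

definition vol :: "('a \<Rightarrow> nat) \<Rightarrow> 'a set \<Rightarrow> real" where
  "vol \<mu> S = (\<Sum>i\<in>S. real (\<mu> i))"

definition expansion :: "'a set \<Rightarrow> ('a \<Rightarrow> nat) \<Rightarrow> 'a wgraph \<Rightarrow> real" where
  "expansion V \<mu> w =
     Min ((\<lambda>S. cut_weight V w S / min (vol \<mu> S) (vol \<mu> (V - S))) ` {S. S \<noteq> {} \<and> S \<subset> V})"

section \<open>The generalized cut-matching game\<close>

definition seed :: "'a set \<Rightarrow> ('a \<Rightarrow> nat) \<Rightarrow> 'a set \<Rightarrow> 'a \<Rightarrow> real" where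
  "seed V \<mu> S i = indicator S i - vol \<mu> S / vol \<mu> (V - S) * indicator (V - S) i"

definition matching_action ::
    "'a set \<Rightarrow> ('a \<Rightarrow> nat) \<Rightarrow> real \<Rightarrow> 'a set \<Rightarrow> 'a wgraph \<Rightarrow> bool" where
  "matching_action V \<mu> \<epsilon> S D \<longleftrightarrow>
     weighted_graph V D \<and>
     (\<forall>i j. D i j \<noteq> 0 \<longrightarrow> (i \<in> S \<longleftrightarrow> j \<notin> S)) \<and>
     (\<Sum>i\<in>V. \<bar>wdegree V D i - real (\<mu> i) * \<bar>seed V \<mu> S i\<bar>\<bar>)
        \<le> \<epsilon> * (\<Sum>i\<in>V. \<bar>real (\<mu> i) * \<bar>seed V \<mu> S i\<bar>\<bar>) \<and>
     (\<forall>i\<in>V. wdegree V D i \<le> real (\<mu> i) * \<bar>seed V \<mu> S i\<bar>)"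

definition valid_cut :: "'a set \<Rightarrow> ('a \<Rightarrow> nat) \<Rightarrow> 'a set \<Rightarrow> bool" where
  "valid_cut V \<mu> S \<longleftrightarrow> S \<subset> V \<and> S \<noteq> {} \<and> vol \<mu> S \<le> vol \<mu> V / 2"

text \<open>Histories list the rounds played so far, oldest first.\<close>

type_synonym 'a history = "('a set \<times> 'a wgraph) list"

definition legal_history :: "'a set \<Rightarrow> ('a \<Rightarrow> nat) \<Rightarrow> real \<Rightarrow> 'a history \<Rightarrow> bool" where
  "legal_history V \<mu> \<epsilon> h \<longleftrightarrow>
     (\<forall>(S, D)\<in>set h. valid_cut V \<mu> S \<and> matching_action V \<mu> \<epsilon> S D)"

definition edge_sum :: "'a history \<Rightarrow> 'a wgraph" where
  "edge_sum h i j = (\<Sum>(S, D)\<leftarrow>h. D i j)"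

text \<open>The cut player draws a cut with fresh randomness from a distribution determined by the
  history; the matching player answers knowing the history and that cut.\<close>

primrec play ::
    "('a history \<Rightarrow> 'a set pmf) \<Rightarrow> ('a history \<Rightarrow> 'a set \<Rightarrow> 'a wgraph) \<Rightarrow> nat \<Rightarrow> 'a history pmf"
where
  "play C M 0 = return_pmf []"
| "play C M (Suc t) =
     bind_pmf (play C M t) (\<lambda>h. bind_pmf (C h) (\<lambda>S. return_pmf (h @ [(S, M h S)])))"

definition matching_strategy ::
    "'a set \<Rightarrow> ('a \<Rightarrow> nat) \<Rightarrow> real \<Rightarrow> ('a history \<Rightarrow> 'a set \<Rightarrow> 'a wgraph) \<Rightarrow> bool" where
  "matching_strategy V \<mu> \<epsilon> M \<longleftrightarrow>
     (\<forall>h S. valid_cut V \<mu> S \<longrightarrow> matching_action V \<mu> \<epsilon> S (M h S))"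

text \<open>The probability is over the coins of the cut player.  Every sequence of legal answers is
  allowed, including adaptive ones, but an answer cannot depend on coins not yet tossed.\<close>

definition good_with_probability ::
    "'a set \<Rightarrow> ('a \<Rightarrow> nat) \<Rightarrow> real \<Rightarrow> ('a history \<Rightarrow> 'a set pmf) \<Rightarrow> real \<Rightarrow> nat \<Rightarrow> real \<Rightarrow> bool" where
  "good_with_probability V \<mu> \<epsilon> C \<phi> T p \<longleftrightarrow>
     (\<forall>M. matching_strategy V \<mu> \<epsilon> M \<longrightarrow>
        p \<le> measure_pmf.prob (play C M T) {h. \<phi> \<le> expansion V \<mu> (edge_sum h)})"

text \<open>The \<open>n\<close> vertices are \<open>0, \<dots>, n - 1\<close>; the polynomial bounding the imbalance of \<open>\<mu>\<close> is \<open>n ^ k\<close>.\<close>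

definition balanced_weighting :: "nat \<Rightarrow> nat \<Rightarrow> (nat \<Rightarrow> nat) \<Rightarrow> bool" where
  "balanced_weighting k n \<mu> \<longleftrightarrow> (\<forall>i<n. real (\<mu> i) / vol \<mu> {..<n} \<ge> 1 / real n ^ k)"

type_synonym cut_strategy = "nat \<Rightarrow> (nat \<Rightarrow> nat) \<Rightarrow> nat history \<Rightarrow> nat set pmf"

definition legal_cut_strategy :: "nat \<Rightarrow> cut_strategy \<Rightarrow> bool" where
  "legal_cut_strategy k C \<longleftrightarrow>
     (\<forall>n\<ge>2. \<forall>\<mu> h. balanced_weighting k n \<mu> \<longrightarrow> (\<forall>S\<in>set_pmf (C n \<mu> h). valid_cut {..<n} \<mu> S))"

section \<open>Running time: a randomized random access machine with exact real arithmetic\<close>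

text \<open>Real operations have unit cost, integer operations and addresses are charged by bit length.
  Reals cannot be rounded to integers, and the only constants are integers, so no information can be
  extracted from long numbers for free or hidden in the program.
  In memory instructions the first number selects one of finitely many arrays.\<close>

datatype iop = IAdd | ISub | IMul | IDiv

datatype rop = RAdd | RSub | RMul | RDiv

datatype test = ILess nat nat | RLess nat nat

datatype com =
    Skip
  | IConst nat nat            \<comment> \<open>integer register := constant\<close>
  | IOp iop nat nat nat       \<comment> \<open>target, two operands\<close>
  | ILoad nat nat nat         \<comment> \<open>array, target, register holding the address\<close>
  | IStore nat nat nat        \<comment> \<open>array, register holding the address, source\<close>
  | ROfInt nat nat            \<comment> \<open>real register := integer register\<close>
  | ROp rop nat nat nat
  | RLoad nat nat nat
  | RStore nat nat nat
  | Flip nat                  \<comment> \<open>integer register := fair random bit\<close>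
  | Seq com com
  | Cond test com com
  | While test com

record mem =
  ireg :: "nat \<Rightarrow> nat"
  rreg :: "nat \<Rightarrow> real"
  imem :: "nat \<Rightarrow> nat \<Rightarrow> nat"
  rmem :: "nat \<Rightarrow> nat \<Rightarrow> real"

fun iop_val :: "iop \<Rightarrow> nat \<Rightarrow> nat \<Rightarrow> nat" where
  "iop_val IAdd x y = x + y"
| "iop_val ISub x y = x - y"
| "iop_val IMul x y = x * y"
| "iop_val IDiv x y = x div y"

fun rop_val :: "rop \<Rightarrow> real \<Rightarrow> real \<Rightarrow> real" where
  "rop_val RAdd x y = x + y"
| "rop_val RSub x y = x - y"
| "rop_val RMul x y = x * y"
| "rop_val RDiv x y = x / y"

fun test_val :: "test \<Rightarrow> mem \<Rightarrow> bool" where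
  "test_val (ILess x y) s \<longleftrightarrow> ireg s x < ireg s y"
| "test_val (RLess x y) s \<longleftrightarrow> rreg s x < rreg s y"

definition bits :: "nat \<Rightarrow> nat" where
  "bits m = floorlog 2 m"

fun test_cost :: "test \<Rightarrow> mem \<Rightarrow> nat" where
  "test_cost (ILess x y) s = 1 + bits (ireg s x) + bits (ireg s y)"
| "test_cost (RLess x y) s = 1"

text \<open>A configuration consists of the commands still to be executed, the memory and the cost
  incurred so far.\<close>

type_synonym config = "com list \<times> mem \<times> nat"

fun step :: "config \<Rightarrow> config pmf" where
  "step ([], s, t) = return_pmf ([], s, t)"
| "step (Skip # cs, s, t) = return_pmf (cs, s, t + 1)"
| "step (IConst x c # cs, s, t) =
     return_pmf (cs, s\<lparr>ireg := (ireg s)(x := c)\<rparr>, t + 1 + bits c)"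
| "step (IOp f x y z # cs, s, t) =
     return_pmf (cs, s\<lparr>ireg := (ireg s)(x := iop_val f (ireg s y) (ireg s z))\<rparr>,
       t + 1 + bits (ireg s y) + bits (ireg s z))"
| "step (ILoad a x y # cs, s, t) =
     return_pmf (cs, s\<lparr>ireg := (ireg s)(x := imem s a (ireg s y))\<rparr>,
       t + 1 + bits (ireg s y) + bits (imem s a (ireg s y)))"
| "step (IStore a x y # cs, s, t) =
     return_pmf (cs, s\<lparr>imem := (imem s)(a := (imem s a)(ireg s x := ireg s y))\<rparr>,
       t + 1 + bits (ireg s x) + bits (ireg s y))"
| "step (ROfInt x y # cs, s, t) =
     return_pmf (cs, s\<lparr>rreg := (rreg s)(x := real (ireg s y))\<rparr>, t + 1 + bits (ireg s y))"
| "step (ROp f x y z # cs, s, t) =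
     return_pmf (cs, s\<lparr>rreg := (rreg s)(x := rop_val f (rreg s y) (rreg s z))\<rparr>, t + 1)"
| "step (RLoad a x y # cs, s, t) =
     return_pmf (cs, s\<lparr>rreg := (rreg s)(x := rmem s a (ireg s y))\<rparr>, t + 1 + bits (ireg s y))"
| "step (RStore a x y # cs, s, t) =
     return_pmf (cs, s\<lparr>rmem := (rmem s)(a := (rmem s a)(ireg s x := rreg s y))\<rparr>,
       t + 1 + bits (ireg s x))"
| "step (Flip x # cs, s, t) =
     map_pmf (\<lambda>b. (cs, s\<lparr>ireg := (ireg s)(x := of_bool b)\<rparr>, t + 1)) (bernoulli_pmf (1 / 2))"
| "step (Seq c d # cs, s, t) = return_pmf (c # d # cs, s, t + 1)"
| "step (Cond b c d # cs, s, t) =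
     return_pmf ((if test_val b s then c else d) # cs, s, t + test_cost b s)"
| "step (While b c # cs, s, t) =
     return_pmf (if test_val b s then c # While b c # cs else cs, s, t + test_cost b s)"

primrec run :: "nat \<Rightarrow> config \<Rightarrow> config pmf" where
  "run 0 c = return_pmf c"
| "run (Suc m) c = bind_pmf (step c) (run m)"

text \<open>Input format: each matching action is given by its edge list.  The edge lists of all rounds
  are stored one after another (endpoints in integer arrays 0 and 1, weights in real array 1);
  integer array 2 holds the offset at which each round starts, integer array 3 the indicator
  vectors of the earlier cuts, real array 0 the vertex weights.\<close>

definition edge_list :: "nat \<Rightarrow> nat wgraph \<Rightarrow> (nat \<times> nat \<times> real) list" where
  "edge_list n D =
     concat (map (\<lambda>i. map (\<lambda>j. (i, j, D i j)) (filter (\<lambda>j. i < j \<and> D i j \<noteq> 0) [0..<n])) [0..<n])"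

definition all_edges :: "nat \<Rightarrow> nat history \<Rightarrow> (nat \<times> nat \<times> real) list" where
  "all_edges n h = concat (map (\<lambda>(S, D). edge_list n D) h)"

definition input_mem :: "nat \<Rightarrow> (nat \<Rightarrow> nat) \<Rightarrow> nat history \<Rightarrow> mem" where
  "input_mem n \<mu> h = (let E = all_edges n h; m = length E; t = length h in
     \<lparr> ireg = (\<lambda>_. 0)(0 := n, 1 := t, 2 := m),
       rreg = (\<lambda>_. 0),
       imem = (\<lambda>_ _. 0)(
         0 := (\<lambda>e. if e < m then fst (E ! e) else 0),
         1 := (\<lambda>e. if e < m then fst (snd (E ! e)) else 0),
         2 := (\<lambda>r. if r \<le> t then length (all_edges n (take r h)) else 0),
         3 := (\<lambda>p. if p < t * n then of_bool (p mod n \<in> fst (h ! (p div n))) else 0)),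
       rmem = (\<lambda>_ _. 0)(
         0 := (\<lambda>i. if i < n then real (\<mu> i) else 0),
         1 := (\<lambda>e. if e < m then snd (snd (E ! e)) else 0)) \<rparr>)"

definition output_cut :: "nat \<Rightarrow> config \<Rightarrow> nat set" where
  "output_cut n = (\<lambda>(cs, s, t). {i. i < n \<and> imem s 4 i \<noteq> 0})"

definition outputs_within ::
    "com \<Rightarrow> nat \<Rightarrow> (nat \<Rightarrow> nat) \<Rightarrow> nat history \<Rightarrow> nat set pmf \<Rightarrow> real \<Rightarrow> bool" where
  "outputs_within P n \<mu> h X B \<longleftrightarrow>
     (\<exists>m. let R = run m ([P], input_mem n \<mu> h, 0) in
        (\<forall>(cs, s, t)\<in>set_pmf R. cs = [] \<and> real t \<le> B) \<and> map_pmf (output_cut n) R = X)"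

text \<open>One program serves all \<open>n\<close>, \<open>\<mu>\<close> and \<open>\<epsilon>\<close>.  The input of a round contains the matching actions
  played so far, so besides \<open>n\<close> their number of edges is counted; for matching actions with
  \<open>n\<close> times polylogarithmically many edges the bound is \<open>n\<close> times polylogarithmic.\<close>

definition nearly_linear_time :: "nat \<Rightarrow> (nat \<Rightarrow> real \<Rightarrow> nat) \<Rightarrow> cut_strategy \<Rightarrow> bool" where
  "nearly_linear_time k g C \<longleftrightarrow>
     (\<exists>P b. \<forall>\<epsilon>. 0 < \<epsilon> \<and> \<epsilon> < 1 \<longrightarrow> (\<exists>K. \<forall>n\<ge>2. \<forall>\<mu> h.
        balanced_weighting k n \<mu> \<and> legal_history {..<n} \<mu> \<epsilon> h \<and> length h < g n \<epsilon> \<longrightarrow>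
        outputs_within P n \<mu> h (C n \<mu> h)
          (K * real (n + length (all_edges n h)) * ln (real n) ^ b)))"

end

theory Submission
  imports "HOL-Probability.Probability" "HOL-Real_Asymp.Real_Asymp" Defs
begin

text \<open>The cut player runs the slow random walk \<open>A = I - \<beta> L\<close> on the union of the matchings played so
  far (\<open>L\<close> is the Laplacian relative to \<open>\<mu>\<close>) for a power \<open>G\<close>, a power of two of order
  \<open>(ln n)\<^sup>3\<close>, applied to a random sign vector, and takes a threshold cut of the result.
  The potential is \<open>tr A\<^sup>2\<^sup>G\<^sup>+\<^sup>1 - 1\<close>.  By a Young inequality for positive operators, adding
  a matching \<open>D\<close> lowers it by a constant times the energy \<open>\<Sum> D i j |v i - v j|\<^sup>2\<close>, where \<open>v i\<close> are
  the centred rows of \<open>A\<^sup>G\<close>.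
  If much of \<open>\<Sum> \<mu> i |v i|\<^sup>2\<close> comes from long vectors, a cut by norm at a random dyadic level
  has energy \<open>\<Omega>(1 / ln n)\<close> of the total.  Otherwise a random projection is moved by a constant
  amount on average by the random matching; a walk that follows such random matchings then gains
  entropy at every doubling of time, while its entropy never exceeds \<open>ln n\<close>, and this again forces
  energy \<open>\<Omega>(1 / ln n)\<close>.
  So the potential falls below \<open>1 / n\<close> within \<open>O((ln n)\<^sup>2)\<close> rounds, and then the Rayleigh quotient
  of every cut bounds its expansion below by \<open>ln n\<close>.\<close>


section \<open>Operators on a weighted space and the trace potential\<close>

text \<open>The delicate point is that the number of rounds be linear in 1 / \<delta>, \<delta> = 1
  - \<epsilon>, with a constant free of \<epsilon>. Norm cuts lose one factor \<delta>. Threshold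
  cuts of a projection, however, move it only by \<open>move1 \<delta>\<close>, a high power of
  \<delta>, and a direct comparison of projected with true distances would leave that power in the
  rate. The entropy argument removes it: each of \<open>S + 1\<close> doublings of time earns the
  same gain, and \<open>S\<close> may be as large as order ln ln n, so for n large in terms of
  \<delta> every fixed power of \<delta> is absorbed. Moreover the strategy must not know
  \<epsilon>. With G of order (ln n)^3, the number of rounds is eventually at most 16 G for every
  fixed \<epsilon>; degrees in the union are then at most 16 G times \<mu>, and \<beta> = 1 / (64 G)
  keeps the spectrum of A in [1/2, 1]. In the expansion bound G cancels against \<beta>, so a slow
  walk costs nothing but running time. The same G is the number of projections that estimate the
  norms.\<close>

lemma convex_seq_le_interpolation:
  fixes \<phi> :: "nat \<Rightarrow> real"
  assumes cv: "\<And>p. p + 2 \<le> M \<Longrightarrow> 2 * \<phi> (p + 1) \<le> \<phi> (p + 2) + \<phi> p" and a: "a \<le> M"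
  shows "real M * \<phi> a \<le> real a * \<phi> M + real (M - a) * \<phi> 0"
proof (cases "a = 0 \<or> a = M")
  case True then show ?thesis by auto
next
  case False
  then have a0: "0 < a" "a < M" using a by auto
  \<comment> \<open>Convexity makes these increments monotone, so \<open>d (a - 1)\<close> lies
    between the mean slope of the first \<open>a\<close> steps and the mean slope of the remaining
    \<open>M - a\<close>.\<close>
  define d where "d j = \<phi> (Suc j) - \<phi> j" for j
  have dm: "d j \<le> d (Suc j)" if "Suc j < M" for j
    using cv[of j] that by (simp add: d_def)
  have dmono: "i \<le> j \<Longrightarrow> j < M \<Longrightarrow> d i \<le> d j" for i j
  proof (induction j)
    case (Suc j) then show ?case using dm[of j] by (cases "i = Suc j") auto
  qed auto
  have s1: "\<phi> a - \<phi> 0 = (\<Sum>j<a. d j)" unfolding d_def by (simp add: sum_lessThan_telescope)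
  have s2: "\<phi> M - \<phi> a = (\<Sum>j\<in>{a..<M}. d j)" unfolding d_def using a by (simp add: sum_Suc_diff')
  have "(\<Sum>j<a. d j) \<le> real (card {..<a}) * d (a - 1)"
    using dmono a0 by (intro sum_bounded_above) auto
  then have u1: "\<phi> a - \<phi> 0 \<le> real a * d (a - 1)" using s1 by simp
  have "real (card {a..<M}) * d (a - 1) \<le> (\<Sum>j\<in>{a..<M}. d j)"
    using dmono a0 by (intro sum_bounded_below) auto
  then have u2: "real (M - a) * d (a - 1) \<le> \<phi> M - \<phi> a" using s2 by simp
  have "real (M - a) * (\<phi> a - \<phi> 0) \<le> real (M - a) * (real a * d (a - 1))"
    using u1 by (intro mult_left_mono) auto
  also have "\<dots> = real a * (real (M - a) * d (a - 1))" by simp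
  also have "\<dots> \<le> real a * (\<phi> M - \<phi> a)" using u2 by (intro mult_left_mono) auto
  finally have "real (M - a) * (\<phi> a - \<phi> 0) \<le> real a * (\<phi> M - \<phi> a)" .
  moreover have "real (M - a) = real M - real a" using a by (simp add: of_nat_diff)
  ultimately show ?thesis by (simp add: algebra_simps)
qed

text \<open>One locale serves two measures: the vertex weighting \<mu> for the operators and the
  potential, and its normalization \<pi> for the random walk of the entropy argument.\<close>

locale wspace =
  fixes V :: "'a set" and m :: "'a \<Rightarrow> real"
  assumes fin: "finite V" and pos: "\<And>i. i \<in> V \<Longrightarrow> 0 < m i"
begin

definition ip :: "('a \<Rightarrow> real) \<Rightarrow> ('a \<Rightarrow> real) \<Rightarrow> real" where
  "ip f g = (\<Sum>i\<in>V. m i * f i * g i)"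

definition e :: "'a \<Rightarrow> 'a \<Rightarrow> real" where
  "e l i = (if i = l then 1 else 0)"

text \<open>Operators act on all functions, but only the values on \<open>V\<close> are meaningful.\<close>

definition lin :: "(('a \<Rightarrow> real) \<Rightarrow> 'a \<Rightarrow> real) \<Rightarrow> bool" where
  "lin T \<longleftrightarrow> (\<forall>f. \<forall>i\<in>V. T f i = (\<Sum>l\<in>V. f l * T (e l) i))"

definition sa :: "(('a \<Rightarrow> real) \<Rightarrow> 'a \<Rightarrow> real) \<Rightarrow> bool" where
  "sa T \<longleftrightarrow> lin T \<and> (\<forall>f g. ip (T f) g = ip f (T g))"

definition psd :: "(('a \<Rightarrow> real) \<Rightarrow> 'a \<Rightarrow> real) \<Rightarrow> bool" where
  "psd T \<longleftrightarrow> sa T \<and> (\<forall>f. 0 \<le> ip f (T f))"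

text \<open>The Hilbert-Schmidt product, that is, the trace of \<open>T\<close> composed with the
  adjoint of \<open>S\<close>: the functions \<open>e l\<close> divided by the root of
  \<open>m l\<close> are orthonormal, which explains the division by \<open>m l\<close>. In
  particular \<open>hs id T\<close> is the trace of \<open>T\<close>.\<close>

definition hs :: "(('a \<Rightarrow> real) \<Rightarrow> 'a \<Rightarrow> real) \<Rightarrow> (('a \<Rightarrow> real) \<Rightarrow> 'a \<Rightarrow> real) \<Rightarrow> real" where
  "hs S T = (\<Sum>l\<in>V. ip (S (e l)) (T (e l)) / m l)"

lemma ip_commute: "ip f g = ip g f" by (simp add: ip_def mult_ac)

lemma ip_cong: "(\<And>i. i \<in> V \<Longrightarrow> f i = f' i) \<Longrightarrow> (\<And>i. i \<in> V \<Longrightarrow> g i = g' i) \<Longrightarrow> ip f g = ip f' g'"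
  by (auto simp: ip_def intro!: sum.cong)

lemma ip_add_right: "ip f (\<lambda>i. g i + h i) = ip f g + ip f h"
  by (simp add: ip_def sum.distrib algebra_simps)

lemma ip_diff_right: "ip f (\<lambda>i. g i - h i) = ip f g - ip f h"
  by (simp add: ip_def sum_subtractf algebra_simps)

lemma ip_scale_right: "ip f (\<lambda>i. c * g i) = c * ip f g"
  by (simp add: ip_def sum_distrib_left algebra_simps)

lemma ip_add_left: "ip (\<lambda>i. g i + h i) f = ip g f + ip h f"
  by (simp add: ip_def sum.distrib algebra_simps)

lemma ip_diff_left: "ip (\<lambda>i. g i - h i) f = ip g f - ip h f"
  by (simp add: ip_def sum_subtractf algebra_simps)

lemma ip_scale_left: "ip (\<lambda>i. c * g i) f = c * ip g f"
  by (simp add: ip_def sum_distrib_left algebra_simps)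

lemmas ip_simps = ip_add_right ip_diff_right ip_scale_right ip_add_left ip_diff_left ip_scale_left

lemma ip_self_nonneg: "0 \<le> ip f f"
  unfolding ip_def using pos by (intro sum_nonneg) (auto simp: mult.assoc less_imp_le)

lemma ip_e_left: "k \<in> V \<Longrightarrow> ip (e k) f = m k * f k"
proof -
  assume k: "k \<in> V"
  have "ip (e k) f = (\<Sum>i\<in>V. if i = k then m i * f i else 0)"
    unfolding ip_def e_def by (intro sum.cong) auto
  then show ?thesis using k fin by (simp add: sum.delta)
qed

lemma ip_e_right: "k \<in> V \<Longrightarrow> ip f (e k) = m k * f k"
  using ip_e_left ip_commute by metis

lemma ip_Cauchy: "(ip f g)\<^sup>2 \<le> ip f f * ip g g"
proof -
  have "0 \<le> ip (\<lambda>i. ip g g * f i - ip f g * g i) (\<lambda>i. ip g g * f i - ip f g * g i)"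
    by (rule ip_self_nonneg)
  also have "\<dots> = ip g g * (ip g g * ip f f - (ip f g)\<^sup>2)"
    by (simp add: ip_simps ip_commute[of g f]) (simp add: algebra_simps power2_eq_square)
  finally have 1: "0 \<le> ip g g * (ip g g * ip f f - (ip f g)\<^sup>2)" .
  show ?thesis
  proof (cases "ip g g = 0")
    case True
    have "m i * g i * g i = 0" if "i \<in> V" for i
      using True that fin pos unfolding ip_def
      by (subst (asm) sum_nonneg_eq_0_iff) (auto simp: mult.assoc less_imp_le)
    then have "g i = 0" if "i \<in> V" for i using that pos by fastforce
    then have "ip f g = 0" unfolding ip_def by auto
    then show ?thesis using True by simp
  next
    case False
    then have "0 < ip g g" using ip_self_nonneg[of g] by simp
    then show ?thesis using 1 by (simp add: zero_le_mult_iff mult.commute)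
  qed
qed

lemma linD: "lin T \<Longrightarrow> i \<in> V \<Longrightarrow> T f i = (\<Sum>l\<in>V. f l * T (e l) i)"
  unfolding lin_def by blast

lemma lin_cong: "lin T \<Longrightarrow> (\<And>l. l \<in> V \<Longrightarrow> f l = g l) \<Longrightarrow> i \<in> V \<Longrightarrow> T f i = T g i"
  using linD[of T i f] linD[of T i g] by (simp cong: sum.cong)

lemma lin_diff: "lin T \<Longrightarrow> i \<in> V \<Longrightarrow> T (\<lambda>i. f i - g i) i = T f i - T g i"
  by (simp add: linD[of T i] sum_subtractf algebra_simps)

lemma lin_scale: "lin T \<Longrightarrow> i \<in> V \<Longrightarrow> T (\<lambda>i. c * f i) i = c * T f i"
  by (simp add: linD[of T i "\<lambda>i. c * f i"] linD[of T i f] sum_distrib_left algebra_simps)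

lemma lin_comp: assumes "lin S" "lin T" shows "lin (S \<circ> T)"
  unfolding lin_def
proof (intro allI ballI)
  fix f i assume i: "i \<in> V"
  have "(S \<circ> T) f i = (\<Sum>k\<in>V. T f k * S (e k) i)" unfolding o_apply by (rule linD[OF assms(1) i])
  also have "\<dots> = (\<Sum>k\<in>V. (\<Sum>l\<in>V. f l * T (e l) k) * S (e k) i)"
    by (intro sum.cong refl arg_cong2[where f="(*)"] linD[OF assms(2)])
  also have "\<dots> = (\<Sum>k\<in>V. \<Sum>l\<in>V. f l * (T (e l) k * S (e k) i))"
    by (simp add: sum_distrib_left sum_distrib_right mult_ac)
  also have "\<dots> = (\<Sum>l\<in>V. \<Sum>k\<in>V. f l * (T (e l) k * S (e k) i))" by (rule sum.swap)
  also have "\<dots> = (\<Sum>l\<in>V. f l * (S \<circ> T) (e l) i)"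
  proof (intro sum.cong refl)
    fix l
    have "S (T (e l)) i = (\<Sum>k\<in>V. T (e l) k * S (e k) i)" by (rule linD[OF assms(1) i])
    then show "(\<Sum>k\<in>V. f l * (T (e l) k * S (e k) i)) = f l * (S \<circ> T) (e l) i"
      by (simp add: sum_distrib_left)
  qed
  finally show "(S \<circ> T) f i = (\<Sum>l\<in>V. f l * (S \<circ> T) (e l) i)" .
qed

lemma lin_id: "lin id"
  unfolding lin_def
proof (intro allI ballI)
  fix f and i assume "i \<in> V"
  have "(\<Sum>l\<in>V. f l * id (e l) i) = (\<Sum>l\<in>V. if l = i then f l else (0::real))"
    unfolding e_def by (intro sum.cong) auto
  then show "id f i = (\<Sum>l\<in>V. f l * id (e l) i)" using \<open>i \<in> V\<close> fin by simp
qed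

lemma lin_funpow: "lin T \<Longrightarrow> lin (T ^^ k)"
  by (induction k) (auto simp: lin_id[unfolded id_def] lin_comp intro: lin_id)

lemma sa_lin: "sa T \<Longrightarrow> lin T" by (simp add: sa_def)

lemma saD: "sa T \<Longrightarrow> ip (T f) g = ip f (T g)" by (simp add: sa_def)

lemma sa_funpow: assumes "sa T" shows "sa (T ^^ k)"
proof -
  have "ip ((T ^^ k) f) g = ip f ((T ^^ k) g)" for f g
    by (induction k arbitrary: f g) (auto simp: saD[OF assms] funpow_swap1)
  then show ?thesis using lin_funpow[OF sa_lin[OF assms]] by (simp add: sa_def)
qed

lemma psd_sa: "psd T \<Longrightarrow> sa T" by (simp add: psd_def)

lemma hs_cong: "(\<And>l i. l \<in> V \<Longrightarrow> i \<in> V \<Longrightarrow> S (e l) i = S' (e l) i) \<Longrightarrow>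
   (\<And>l i. l \<in> V \<Longrightarrow> i \<in> V \<Longrightarrow> T (e l) i = T' (e l) i) \<Longrightarrow> hs S T = hs S' T'"
  unfolding hs_def by (intro sum.cong arg_cong2[where f="(/)"] ip_cong) auto

lemma hs_diff_right: "hs S (\<lambda>f i. T f i - T' f i) = hs S T - hs S T'"
  by (simp add: hs_def ip_diff_right sum_subtractf diff_divide_distrib)

lemma hs_diff_left: "hs (\<lambda>f i. T f i - T' f i) S = hs T S - hs T' S"
  by (simp add: hs_def ip_diff_left sum_subtractf diff_divide_distrib)

lemma hs_left: "sa R \<Longrightarrow> hs (R \<circ> S) T = hs S (R \<circ> T)"
  by (simp add: hs_def saD)

lemma hs_mono: "(\<And>f. ip (S f) (T f) \<le> ip (S' f) (T' f)) \<Longrightarrow> hs S T \<le> hs S' T'"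
  unfolding hs_def using pos by (intro sum_mono divide_right_mono) (auto simp: less_imp_le)

lemma hs_nonneg: "(\<And>f. 0 \<le> ip (S f) (T f)) \<Longrightarrow> 0 \<le> hs S T"
  unfolding hs_def using pos by (intro sum_nonneg divide_nonneg_nonneg) (auto simp: less_imp_le)

lemma sa_entry: assumes "sa R" "k \<in> V" "l \<in> V" shows "R (e l) k / m l = R (e k) l / m k"
proof -
  have "m k * R (e l) k = m l * R (e k) l"
    using saD[OF assms(1), of "e k" "e l"] assms(2,3) by (simp add: ip_e_left ip_e_right)
  then show ?thesis using pos[OF assms(2)] pos[OF assms(3)] by (simp add: field_simps)
qed

text \<open>Cyclicity of the trace. On the left a self-adjoint factor moves by definition
  (\<open>hs_left\<close>); on the right the move is the symmetry \<open>sa_entry\<close> of matrix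
  entries, used between two exchanges of sums.\<close>

lemma hs_right: assumes R: "sa R" and S: "lin S" and T: "lin T"
  shows "hs (S \<circ> R) T = hs S (T \<circ> R)"
proof -
  have "hs (S \<circ> R) T = (\<Sum>l\<in>V. (\<Sum>i\<in>V. m i * (\<Sum>k\<in>V. R (e l) k * S (e k) i) * T (e l) i) / m l)"
    unfolding hs_def ip_def using linD[OF S] by (intro sum.cong) auto
  also have "\<dots> = (\<Sum>l\<in>V. \<Sum>i\<in>V. \<Sum>k\<in>V. m i * (R (e l) k / m l) * S (e k) i * T (e l) i)"
    by (simp add: sum_distrib_left sum_distrib_right sum_divide_distrib mult_ac)
  also have "\<dots> = (\<Sum>l\<in>V. \<Sum>i\<in>V. \<Sum>k\<in>V. m i * (R (e k) l / m k) * S (e k) i * T (e l) i)"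
    using sa_entry[OF R] by (intro sum.cong refl) simp
  also have "\<dots> = (\<Sum>l\<in>V. \<Sum>k\<in>V. \<Sum>i\<in>V. m i * (R (e k) l / m k) * S (e k) i * T (e l) i)"
    by (intro sum.cong refl sum.swap)
  also have "\<dots> = (\<Sum>k\<in>V. \<Sum>l\<in>V. \<Sum>i\<in>V. m i * (R (e k) l / m k) * S (e k) i * T (e l) i)"
    by (rule sum.swap)
  also have "\<dots> = (\<Sum>k\<in>V. \<Sum>i\<in>V. \<Sum>l\<in>V. m i * (R (e k) l / m k) * S (e k) i * T (e l) i)"
    by (intro sum.cong refl sum.swap)
  also have "\<dots> = (\<Sum>k\<in>V. (\<Sum>i\<in>V. m i * S (e k) i * (\<Sum>l\<in>V. R (e k) l * T (e l) i)) / m k)"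
    by (simp add: sum_distrib_left sum_distrib_right sum_divide_distrib mult_ac)
  also have "\<dots> = hs S (T \<circ> R)"
    unfolding hs_def ip_def using linD[OF T] by (intro sum.cong) auto
  finally show ?thesis .
qed

lemma hs_swap: assumes "sa Y" "lin T"
  shows "hs id (T \<circ> Y) = hs id (Y \<circ> T)"
  using hs_right[OF assms(1) lin_id assms(2)] hs_left[OF assms(1), of id T] by simp

lemma hs_psd_left: "psd X \<Longrightarrow> 0 \<le> hs K (X \<circ> K)"
  by (intro hs_nonneg) (auto simp: psd_def)

text \<open>The trace of \<open>Y\<close> conjugated by \<open>K\<close> is a weighted sum over
  \<open>i\<close> of the quadratic form of \<open>Y\<close> at the \<open>i\<close>-th row of
  \<open>K\<close>; a row becomes a function after division by \<open>m l\<close>.\<close>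

lemma hs_psd_right: assumes K: "lin K" and Y: "psd Y" shows "0 \<le> hs K (K \<circ> Y)"
proof -
  have "hs K (K \<circ> Y) = (\<Sum>l\<in>V. (\<Sum>i\<in>V. m i * K (e l) i * (\<Sum>k\<in>V. Y (e l) k * K (e k) i)) / m l)"
    unfolding hs_def ip_def using linD[OF K] by (intro sum.cong) auto
  also have "\<dots> = (\<Sum>l\<in>V. \<Sum>i\<in>V. m i * ((K (e l) i / m l) * (\<Sum>k\<in>V. Y (e l) k * K (e k) i)))"
    by (simp add: sum_divide_distrib mult_ac)
  also have "\<dots> = (\<Sum>i\<in>V. \<Sum>l\<in>V. m i * ((K (e l) i / m l) * (\<Sum>k\<in>V. Y (e l) k * K (e k) i)))"
    by (rule sum.swap)
  also have "\<dots> = (\<Sum>i\<in>V. m i * ip (\<lambda>l. K (e l) i / m l) (Y (\<lambda>l. K (e l) i / m l)))"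
  proof (intro sum.cong refl)
    fix i assume "i \<in> V"
    let ?g = "\<lambda>l. K (e l) i / m l"
    have "ip ?g (Y ?g) = (\<Sum>k\<in>V. K (e k) i * (\<Sum>l\<in>V. K (e l) i / m l * Y (e l) k))"
      unfolding ip_def
    proof (intro sum.cong refl)
      fix k assume k: "k \<in> V"
      have "m k \<noteq> 0" using pos[OF k] by simp
      then show "m k * ?g k * Y ?g k = K (e k) i * (\<Sum>l\<in>V. K (e l) i / m l * Y (e l) k)"
        using linD[OF sa_lin[OF psd_sa[OF Y]] k, of ?g] by simp
    qed
    also have "\<dots> = (\<Sum>k\<in>V. \<Sum>l\<in>V. K (e k) i * (K (e l) i / m l * Y (e l) k))"
      by (simp add: sum_distrib_left)
    also have "\<dots> = (\<Sum>l\<in>V. \<Sum>k\<in>V. K (e k) i * (K (e l) i / m l * Y (e l) k))" by (rule sum.swap)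
    also have "\<dots> = (\<Sum>l\<in>V. ?g l * (\<Sum>k\<in>V. Y (e l) k * K (e k) i))"
      by (simp add: sum_distrib_left mult_ac)
    finally show "(\<Sum>l\<in>V. m i * (?g l * (\<Sum>k\<in>V. Y (e l) k * K (e k) i))) = m i * ip ?g (Y ?g)"
      by (simp add: sum_distrib_left)
  qed
  also have "\<dots> \<ge> 0" using Y pos by (intro sum_nonneg mult_nonneg_nonneg) (auto simp: psd_def less_imp_le)
  finally show ?thesis .
qed

lemma lin_minus: "lin S \<Longrightarrow> lin T \<Longrightarrow> lin (\<lambda>f i. S f i - T f i)"
  unfolding lin_def by (simp add: sum_subtractf algebra_simps)

text \<open>Exactly one exponent is even. Its power splits into two halves, and the odd power into
  two halves around one middle factor; moving the outer halves onto \<open>K\<close> leaves a single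
  positive \<open>X\<close> or \<open>Y\<close>. Two odd exponents would call for square roots of
  operators. This is why the powers in the potential and in Young's inequality are odd.\<close>

lemma hs_sandwich_nonneg:
  assumes X: "psd X" and Y: "psd Y" and K: "lin K" and pq: "odd (p + q)"
  shows "0 \<le> hs K ((X ^^ p) \<circ> K \<circ> (Y ^^ q))"
proof -
  note sX = psd_sa[OF X] and sY = psd_sa[OF Y]
  note lX = lin_funpow[OF sa_lin[OF sX]] and lY = lin_funpow[OF sa_lin[OF sY]]
  show ?thesis
  proof (cases "even p")
    case True
    then obtain p' where p: "p = p' + p'" by (metis evenE mult_2)
    from pq True have "odd q" by simp
    then obtain q' where "q = 2 * q' + 1" by (rule oddE)
    then have q: "q = q' + (1 + q')" by simp
    have Yq: "Y ^^ q = (Y ^^ q') \<circ> Y \<circ> (Y ^^ q')"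
      unfolding q by (simp only: funpow_add o_assoc) simp
    have "hs K ((X ^^ p) \<circ> K \<circ> (Y ^^ q)) = hs ((X ^^ p') \<circ> K) (((X ^^ p') \<circ> K \<circ> (Y ^^ q') \<circ> Y) \<circ> (Y ^^ q'))"
      by (subst hs_left[OF sa_funpow[OF sX]]) (simp add: p Yq funpow_add o_assoc)
    also have "\<dots> = hs (((X ^^ p') \<circ> K) \<circ> (Y ^^ q')) ((X ^^ p') \<circ> K \<circ> (Y ^^ q') \<circ> Y)"
      by (intro hs_right[symmetric] sa_funpow sY lin_comp lX lY K sa_lin)
    also have "\<dots> \<ge> 0" using hs_psd_right[OF lin_comp[OF lin_comp[OF lX K] lY] Y]
      by (simp add: o_assoc)
    finally show ?thesis .
  next
    case False
    then obtain p' where "p = 2 * p' + 1" by (rule oddE)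
    then have p: "p = p' + (1 + p')" by simp
    have Xp: "X ^^ p = (X ^^ p') \<circ> X \<circ> (X ^^ p')"
      unfolding p by (simp only: funpow_add o_assoc) simp
    from pq False have "even q" by simp
    then obtain q' where q: "q = q' + q'" by (metis evenE mult_2)
    have "hs K ((X ^^ p) \<circ> K \<circ> (Y ^^ q)) = hs ((X ^^ p') \<circ> K) ((X \<circ> (X ^^ p') \<circ> K \<circ> (Y ^^ q')) \<circ> (Y ^^ q'))"
      by (subst hs_left[OF sa_funpow[OF sX]]) (simp add: Xp q funpow_add o_assoc)
    also have "\<dots> = hs (((X ^^ p') \<circ> K) \<circ> (Y ^^ q')) (X \<circ> (X ^^ p') \<circ> K \<circ> (Y ^^ q'))"
      by (intro hs_right[symmetric] sa_funpow sY lin_comp lX lY K sa_lin sX)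
    also have "\<dots> \<ge> 0" using hs_psd_left[OF X, of "((X ^^ p') \<circ> K) \<circ> (Y ^^ q')"]
      by (simp add: o_assoc)
    finally show ?thesis .
  qed
qed

text \<open>Young's inequality for two non-commuting positive operators: the left-hand side is a convex
  function of the exponent \<open>a\<close>.\<close>

lemma hs_Young:
  assumes X: "psd X" and Y: "psd Y" and E: "lin E" and M: "odd M" and a: "a \<le> M"
  shows "real M * hs E ((X ^^ a) \<circ> E \<circ> (Y ^^ (M - a)))
     \<le> real a * hs E ((X ^^ M) \<circ> E) + real (M - a) * hs E (E \<circ> (Y ^^ M))"
proof -
  define \<phi> where "\<phi> a = hs E ((X ^^ a) \<circ> E \<circ> (Y ^^ (M - a)))" for a
  note sX = psd_sa[OF X] and sY = psd_sa[OF Y]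
  note lX = lin_funpow[OF sa_lin[OF sX]] and lY = lin_funpow[OF sa_lin[OF sY]]
  have "2 * \<phi> (p + 1) \<le> \<phi> (p + 2) + \<phi> p" if "p + 2 \<le> M" for p
  proof -
    define q where "q = M - (p + 2)"
    have Mq: "M - p = q + 2" "M - (p + 1) = q + 1" "M - (p + 2) = q" using that by (auto simp: q_def)
    have od: "odd (p + q)" using M that by (auto simp: q_def)
    \<comment> \<open>The second difference of \<open>\<phi>\<close> at \<open>p\<close> is the
      sandwich form of this intertwining defect; its exponents add up to \<open>M - 2\<close>, which
      is odd.\<close>
    define K where "K = (\<lambda>f i. (X \<circ> E) f i - (E \<circ> Y) f i)"
    have K: "lin K" unfolding K_def by (intro lin_minus lin_comp E sa_lin sX sY)
    have "0 \<le> hs K ((X ^^ p) \<circ> K \<circ> (Y ^^ q))" by (rule hs_sandwich_nonneg[OF X Y K od])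
    also have "\<dots> = hs (X \<circ> E) ((X ^^ p) \<circ> K \<circ> (Y ^^ q)) - hs (E \<circ> Y) ((X ^^ p) \<circ> K \<circ> (Y ^^ q))"
      by (subst (1) K_def) (rule hs_diff_left)
    also have "hs (X \<circ> E) ((X ^^ p) \<circ> K \<circ> (Y ^^ q)) = hs E ((X ^^ (p + 1)) \<circ> K \<circ> (Y ^^ q))"
      by (simp add: hs_left[OF sX] o_assoc)
    also have "\<dots> = hs E (\<lambda>f i. ((X ^^ (p + 2)) \<circ> E \<circ> (Y ^^ q)) f i - ((X ^^ (p + 1)) \<circ> E \<circ> (Y ^^ (q + 1))) f i)"
    proof (rule hs_cong)
      fix l i assume "i \<in> V"
      then show "((X ^^ (p + 1)) \<circ> K \<circ> (Y ^^ q)) (e l) i = ((X ^^ (p + 2)) \<circ> E \<circ> (Y ^^ q)) (e l) i - ((X ^^ (p + 1)) \<circ> E \<circ> (Y ^^ (q + 1))) (e l) i"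
        unfolding o_apply K_def
        by (subst lin_diff[OF lX]) (auto simp: funpow_swap1)
    qed auto
    also have "\<dots> = \<phi> (p + 2) - \<phi> (p + 1)"
      by (simp only: hs_diff_right \<phi>_def Mq)
    also have "hs (E \<circ> Y) ((X ^^ p) \<circ> K \<circ> (Y ^^ q)) = hs E ((X ^^ p) \<circ> K \<circ> (Y ^^ (q + 1)))"
      by (subst hs_right[OF sY E]) (auto intro!: lin_comp lX lY K simp: o_assoc funpow_Suc_right simp del: funpow.simps)
    also have "\<dots> = hs E (\<lambda>f i. ((X ^^ (p + 1)) \<circ> E \<circ> (Y ^^ (q + 1))) f i - ((X ^^ p) \<circ> E \<circ> (Y ^^ (q + 2))) f i)"
    proof (rule hs_cong)
      fix l i assume "i \<in> V"
      then show "((X ^^ p) \<circ> K \<circ> (Y ^^ (q + 1))) (e l) i = ((X ^^ (p + 1)) \<circ> E \<circ> (Y ^^ (q + 1))) (e l) i - ((X ^^ p) \<circ> E \<circ> (Y ^^ (q + 2))) (e l) i"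
        unfolding o_apply K_def
        by (subst lin_diff[OF lX]) (auto simp: funpow_swap1)
    qed auto
    also have "\<dots> = \<phi> (p + 1) - \<phi> p"
      by (simp only: hs_diff_right \<phi>_def Mq)
    finally show ?thesis by simp
  qed
  from convex_seq_le_interpolation[of M \<phi>, OF this a] show ?thesis
    by (simp add: \<phi>_def o_def)
qed

lemma hs_ee: "sa E \<Longrightarrow> sa Y \<Longrightarrow> hs E (E \<circ> Y) = hs E (Y \<circ> E)"
proof -
  assume E: "sa E" and Y: "sa Y"
  have "hs E (E \<circ> Y) = hs (E \<circ> id) (E \<circ> Y)" by simp
  also have "\<dots> = hs id ((E \<circ> E) \<circ> Y)" using hs_left[OF E, of id "E \<circ> Y"] by (simp add: o_assoc)
  also have "\<dots> = hs id (Y \<circ> (E \<circ> E))" by (rule hs_swap) (use E Y in \<open>auto intro: lin_comp sa_lin\<close>)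
  also have "\<dots> = hs id ((Y \<circ> E) \<circ> E)" by (simp add: o_assoc)
  also have "\<dots> = hs (id \<circ> E) (Y \<circ> E)" by (rule hs_right[symmetric]) (use E Y in \<open>auto intro: lin_comp sa_lin lin_id\<close>)
  finally show ?thesis by simp
qed

end


section \<open>Laplacians, lazy walk operators and the drop of the trace\<close>

context wspace begin

definition lap :: "('a \<Rightarrow> 'a \<Rightarrow> real) \<Rightarrow> ('a \<Rightarrow> real) \<Rightarrow> 'a \<Rightarrow> real" where
  "lap D f i = (\<Sum>j\<in>V. D i j * (f i - f j)) / m i"

lemma e_expand: "i \<in> V \<Longrightarrow> (\<Sum>l\<in>V. f l * e l i) = f i"
  using linD[OF lin_id, of i f] by simp

lemma lin_lap: "lin (lap D)"
  unfolding lin_def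
proof (intro allI ballI)
  fix f i assume i: "i \<in> V"
  have "(\<Sum>l\<in>V. f l * lap D (e l) i) = (\<Sum>l\<in>V. \<Sum>j\<in>V. f l * (D i j * (e l i - e l j)) / m i)"
    by (simp add: lap_def sum_distrib_left sum_divide_distrib)
  also have "\<dots> = (\<Sum>j\<in>V. \<Sum>l\<in>V. f l * (D i j * (e l i - e l j)) / m i)" by (rule sum.swap)
  also have "\<dots> = (\<Sum>j\<in>V. D i j * ((\<Sum>l\<in>V. f l * e l i) - (\<Sum>l\<in>V. f l * e l j)) / m i)"
    by (simp add: sum_distrib_left sum_subtractf[symmetric] sum_divide_distrib algebra_simps)
  also have "\<dots> = lap D f i" by (simp add: lap_def e_expand i sum_divide_distrib)
  finally show "lap D f i = (\<Sum>l\<in>V. f l * lap D (e l) i)" by simp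
qed

lemma ip_lap:
  assumes "\<And>i j. D i j = D j i"
  shows "ip g (lap D f) = (\<Sum>i\<in>V. \<Sum>j\<in>V. D i j * (f i - f j) * (g i - g j)) / 2"
proof -
  let ?s = "\<Sum>i\<in>V. \<Sum>j\<in>V. D i j * (f i - f j) * g i"
  have 1: "ip g (lap D f) = ?s"
    unfolding ip_def lap_def
  proof (intro sum.cong refl)
    fix i assume "i \<in> V"
    then have "m i \<noteq> 0" using pos by force
    then have "m i * g i * ((\<Sum>j\<in>V. D i j * (f i - f j)) / m i) = (\<Sum>j\<in>V. D i j * (f i - f j)) * g i"
      by simp
    then show "m i * g i * ((\<Sum>j\<in>V. D i j * (f i - f j)) / m i) = (\<Sum>j\<in>V. D i j * (f i - f j) * g i)"
      by (simp only: sum_distrib_right)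
  qed
  have "?s = (\<Sum>j\<in>V. \<Sum>i\<in>V. D i j * (f i - f j) * g i)" by (rule sum.swap)
  also have "\<dots> = (\<Sum>i\<in>V. \<Sum>j\<in>V. D i j * (f j - f i) * g j)"
    by (intro sum.cong refl) (simp add: assms)
  finally have "?s + ?s = (\<Sum>i\<in>V. \<Sum>j\<in>V. D i j * (f i - f j) * g i) + (\<Sum>i\<in>V. \<Sum>j\<in>V. D i j * (f j - f i) * g j)"
    by simp
  also have "\<dots> = (\<Sum>i\<in>V. \<Sum>j\<in>V. D i j * (f i - f j) * (g i - g j))"
    unfolding sum.distrib[symmetric] by (intro sum.cong refl) (simp add: algebra_simps)
  finally show ?thesis using 1 by simp
qed

lemma sa_lap: assumes "\<And>i j. D i j = D j i" shows "sa (lap D)"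
  unfolding sa_def
proof (intro conjI allI lin_lap)
  fix f g
  have "ip (lap D f) g = ip g (lap D f)" by (rule ip_commute)
  then show "ip (lap D f) g = ip f (lap D g)"
    by (simp add: ip_lap[OF assms] mult_ac)
qed

lemma ip_lap_self:
  assumes "\<And>i j. D i j = D j i"
  shows "ip f (lap D f) = (\<Sum>i\<in>V. \<Sum>j\<in>V. D i j * (f i - f j)\<^sup>2) / 2"
  by (simp add: ip_lap[OF assms] power2_eq_square mult.assoc)

text \<open>Cauchy-Schwarz at every vertex against its degree. As operators, the square of the
  Laplacian is at most \<open>2 * c\<close> times the Laplacian; in this form the smallness of a
  perturbation enters \<open>trace_drop\<close>.\<close>

lemma lap_norm_le:
  assumes sym: "\<And>i j. D i j = D j i" and nn: "\<And>i j. 0 \<le> D i j"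
    and deg: "\<And>i. i \<in> V \<Longrightarrow> (\<Sum>j\<in>V. D i j) \<le> c * m i"
  shows "ip (lap D f) (lap D f) \<le> 2 * c * ip f (lap D f)"
proof -
  have "ip (lap D f) (lap D f) \<le> (\<Sum>i\<in>V. c * (\<Sum>j\<in>V. D i j * (f i - f j)\<^sup>2))"
    unfolding ip_def
  proof (rule sum_mono)
    fix i assume i: "i \<in> V"
    note mi = pos[OF i]
    have "(\<Sum>j\<in>V. D i j * (f i - f j))\<^sup>2 = (\<Sum>j\<in>V. sqrt (D i j) * (sqrt (D i j) * (f i - f j)))\<^sup>2"
      using nn by (simp add: mult.assoc[symmetric])
    also have "\<dots> \<le> (\<Sum>j\<in>V. (sqrt (D i j))\<^sup>2) * (\<Sum>j\<in>V. (sqrt (D i j) * (f i - f j))\<^sup>2)"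
      by (rule Cauchy_Schwarz_ineq_sum)
    also have "\<dots> = (\<Sum>j\<in>V. D i j) * (\<Sum>j\<in>V. D i j * (f i - f j)\<^sup>2)"
      using nn by (simp add: power_mult_distrib)
    also have "\<dots> \<le> (c * m i) * (\<Sum>j\<in>V. D i j * (f i - f j)\<^sup>2)"
      using deg[OF i] nn by (intro mult_right_mono sum_nonneg mult_nonneg_nonneg) auto
    finally have 1: "(\<Sum>j\<in>V. D i j * (f i - f j))\<^sup>2 \<le> m i * (c * (\<Sum>j\<in>V. D i j * (f i - f j)\<^sup>2))"
      by (simp add: mult_ac)
    have "m i * lap D f i * lap D f i = (\<Sum>j\<in>V. D i j * (f i - f j))\<^sup>2 / m i"
      using mi by (simp add: lap_def power2_eq_square)
    also have "\<dots> \<le> c * (\<Sum>j\<in>V. D i j * (f i - f j)\<^sup>2)"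
      using 1 mi by (simp add: divide_le_eq mult.commute)
    finally show "m i * lap D f i * lap D f i \<le> c * (\<Sum>j\<in>V. D i j * (f i - f j)\<^sup>2)" .
  qed
  also have "\<dots> = 2 * c * ip f (lap D f)"
    by (simp add: ip_lap_self[OF sym] sum_distrib_left[symmetric])
  finally show ?thesis .
qed

lemma lap_le:
  assumes sym: "\<And>i j. D i j = D j i" and nn: "\<And>i j. 0 \<le> D i j"
    and deg: "\<And>i. i \<in> V \<Longrightarrow> (\<Sum>j\<in>V. D i j) \<le> c * m i"
  shows "ip f (lap D f) \<le> 2 * c * ip f f"
proof -
  have "(\<Sum>i\<in>V. \<Sum>j\<in>V. D i j * (f i - f j)\<^sup>2) \<le> (\<Sum>i\<in>V. \<Sum>j\<in>V. 2 * (D i j * (f i)\<^sup>2) + 2 * (D i j * (f j)\<^sup>2))"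
  proof (intro sum_mono)
    fix i j
    have "(f i - f j)\<^sup>2 \<le> 2 * (f i)\<^sup>2 + 2 * (f j)\<^sup>2"
      using sum_squares_ge_zero[of "f i + f j" 0] by (simp add: power2_eq_square algebra_simps)
    then have "D i j * (f i - f j)\<^sup>2 \<le> D i j * (2 * (f i)\<^sup>2 + 2 * (f j)\<^sup>2)"
      using nn by (rule mult_left_mono)
    then show "D i j * (f i - f j)\<^sup>2 \<le> 2 * (D i j * (f i)\<^sup>2) + 2 * (D i j * (f j)\<^sup>2)"
      by (simp add: algebra_simps)
  qed
  also have "\<dots> = 2 * (\<Sum>i\<in>V. \<Sum>j\<in>V. D i j * (f i)\<^sup>2) + 2 * (\<Sum>i\<in>V. \<Sum>j\<in>V. D i j * (f j)\<^sup>2)"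
    by (simp add: sum.distrib sum_distrib_left)
  also have "(\<Sum>i\<in>V. \<Sum>j\<in>V. D i j * (f j)\<^sup>2) = (\<Sum>j\<in>V. \<Sum>i\<in>V. D i j * (f j)\<^sup>2)" by (rule sum.swap)
  also have "\<dots> = (\<Sum>i\<in>V. \<Sum>j\<in>V. D i j * (f i)\<^sup>2)" by (intro sum.cong refl) (simp add: sym)
  finally have "(\<Sum>i\<in>V. \<Sum>j\<in>V. D i j * (f i - f j)\<^sup>2) \<le> 4 * (\<Sum>i\<in>V. \<Sum>j\<in>V. D i j * (f i)\<^sup>2)" by simp
  also have "(\<Sum>i\<in>V. \<Sum>j\<in>V. D i j * (f i)\<^sup>2) \<le> c * ip f f"
    unfolding ip_def sum_distrib_left
  proof (rule sum_mono)
    fix i assume "i \<in> V"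
    then have "(\<Sum>j\<in>V. D i j) * (f i)\<^sup>2 \<le> (c * m i) * (f i)\<^sup>2"
      by (intro mult_right_mono deg) auto
    then show "(\<Sum>j\<in>V. D i j * (f i)\<^sup>2) \<le> c * (m i * f i * f i)"
      unfolding sum_distrib_right[symmetric] by (simp add: power2_eq_square mult_ac)
  qed
  finally show ?thesis by (simp add: ip_lap_self[OF sym])
qed

lemma lin_scaled: "lin T \<Longrightarrow> lin (\<lambda>f i. c * T f i)"
  unfolding lin_def by (simp add: sum_distrib_left mult_ac)

lemma sa_scaled: "sa T \<Longrightarrow> sa (\<lambda>f i. c * T f i)"
  unfolding sa_def by (simp add: lin_scaled ip_scale_left ip_scale_right)

lemma sa_minus: "sa S \<Longrightarrow> sa T \<Longrightarrow> sa (\<lambda>f i. S f i - T f i)"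
  unfolding sa_def by (simp add: lin_minus ip_diff_left ip_diff_right)

lemma sa_id: "sa id" by (simp add: sa_def lin_id)

text \<open>The spectrum lies in [1/2, 1]. The lower bound makes one more factor of the operator
  cost only a constant (\<open>tight_norm\<close>), so neighbouring powers are comparable.\<close>

definition tight :: "(('a \<Rightarrow> real) \<Rightarrow> 'a \<Rightarrow> real) \<Rightarrow> bool" where
  "tight A \<longleftrightarrow> sa A \<and> (\<forall>f. ip f f / 2 \<le> ip f (A f) \<and> ip f (A f) \<le> ip f f)"

lemma tight_psd: "tight A \<Longrightarrow> psd A"
  unfolding tight_def psd_def by (meson divide_nonneg_nonneg ip_self_nonneg order_trans zero_le_numeral)

lemma tight_norm: assumes "tight A" shows "ip f f \<le> 4 * ip (A f) (A f)"
proof -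
  let ?x = "ip f f" and ?y = "ip (A f) (A f)"
  have x0: "0 \<le> ?x" "0 \<le> ?y" by (rule ip_self_nonneg)+
  have "(?x / 2)\<^sup>2 \<le> (ip f (A f))\<^sup>2" using assms x0 by (intro power_mono) (auto simp: tight_def)
  also have "\<dots> \<le> ?x * ?y" by (rule ip_Cauchy)
  finally have "?x * ?x \<le> ?x * (4 * ?y)" by (simp add: power2_eq_square)
  then show ?thesis using x0 by (cases "?x = 0") (auto simp: mult_le_cancel_left)
qed

definition walk_op :: "real \<Rightarrow> ('a \<Rightarrow> 'a \<Rightarrow> real) \<Rightarrow> ('a \<Rightarrow> real) \<Rightarrow> 'a \<Rightarrow> real" where
  "walk_op \<beta> H f i = f i - \<beta> * lap H f i"

lemma tight_walk_op:
  assumes sym: "\<And>i j. H i j = H j i" and nn: "\<And>i j. 0 \<le> H i j"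
    and deg: "\<And>i. i \<in> V \<Longrightarrow> (\<Sum>j\<in>V. H i j) \<le> c * m i" and b: "0 \<le> \<beta>" "\<beta> * c \<le> 1 / 4"
  shows "tight (walk_op \<beta> H)"
proof -
  have "sa (\<lambda>f i. id f i - \<beta> * lap H f i)"
    by (intro sa_minus sa_id sa_scaled sa_lap sym)
  then have "sa (walk_op \<beta> H)" by (simp add: walk_op_def[abs_def])
  moreover have "ip f f / 2 \<le> ip f (walk_op \<beta> H f) \<and> ip f (walk_op \<beta> H f) \<le> ip f f" for f
  proof -
    have 1: "ip f (walk_op \<beta> H f) = ip f f - \<beta> * ip f (lap H f)"
      by (simp add: walk_op_def[abs_def] ip_simps)
    have "\<beta> * ip f (lap H f) \<le> \<beta> * (2 * c * ip f f)"
      using b lap_le[OF sym nn deg] by (intro mult_left_mono) auto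
    also have "\<dots> = 2 * (\<beta> * c) * ip f f" by simp
    also have "\<dots> \<le> 2 * (1 / 4) * ip f f" using b ip_self_nonneg[of f] by (intro mult_right_mono mult_left_mono) auto
    finally have 2: "\<beta> * ip f (lap H f) \<le> ip f f / 2" by simp
    have "0 \<le> \<beta> * ip f (lap H f)" using b nn by (auto simp: ip_lap_self[OF sym] intro!: mult_nonneg_nonneg sum_nonneg)
    with 1 2 show ?thesis by simp
  qed
  ultimately show ?thesis by (simp add: tight_def)
qed

lemma hs_odd_power: "sa A \<Longrightarrow> hs id (A ^^ (2 * a + 1)) = hs (A ^^ a) (A \<circ> (A ^^ a))"
proof -
  assume A: "sa A"
  have "A ^^ (2 * a + 1) = (A ^^ a) \<circ> (A \<circ> (A ^^ a))"
    using funpow_add[of a "1 + a" A] by (simp add: mult_2)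
  then show ?thesis using hs_left[OF sa_funpow[OF A], of a id] by simp
qed

lemma hs_even_power: assumes "sa A" "lin E" shows "hs id (E \<circ> (A ^^ (2 * a))) = hs (A ^^ a) (E \<circ> (A ^^ a))"
proof -
  have "A ^^ (2 * a) = (A ^^ a) \<circ> (A ^^ a)" by (simp add: mult_2 funpow_add)
  then have "hs id (E \<circ> (A ^^ (2 * a))) = hs id ((E \<circ> (A ^^ a)) \<circ> (A ^^ a))" by (simp add: o_assoc)
  also have "\<dots> = hs (id \<circ> (A ^^ a)) (E \<circ> (A ^^ a))"
    by (intro hs_right[symmetric] sa_funpow assms lin_id lin_comp lin_funpow sa_lin)
  finally show ?thesis by simp
qed

text \<open>The odd exponent first drops to \<open>2 * a - 2\<close> because the operator is at most
  1, then rises to \<open>2 * a\<close> by \<open>tight_norm\<close>, which costs the 4. The square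
  of \<open>E\<close> that remains is at most \<kappa> times \<open>E\<close>.\<close>

lemma hs_tight_odd_le:
  assumes A: "tight A" and E: "psd E" and k: "\<And>f. ip (E f) (E f) \<le> \<kappa> * ip f (E f)" and a: "1 \<le> a"
  shows "hs E ((A ^^ (2 * a - 1)) \<circ> E) \<le> 4 * \<kappa> * hs (A ^^ a) (E \<circ> (A ^^ a))"
proof -
  have sA: "sa A" and coin_avg: "sa E" using A E by (auto simp: tight_def psd_def)
  obtain b where b: "a = Suc b" using a by (cases a) auto
  have "A ^^ (2 * a - 1) = (A ^^ b) \<circ> (A \<circ> (A ^^ b))"
    using funpow_add[of b "1 + b" A] by (simp add: mult_2 b)
  then have "hs E ((A ^^ (2 * a - 1)) \<circ> E) = hs ((A ^^ b) \<circ> E) (A \<circ> ((A ^^ b) \<circ> E))"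
    by (simp add: hs_left[OF sa_funpow[OF sA]] o_assoc)
  also have "\<dots> \<le> hs ((A ^^ b) \<circ> E) ((A ^^ b) \<circ> E)"
    using A by (intro hs_mono) (auto simp: tight_def)
  also have "\<dots> \<le> hs (\<lambda>f i. 4 * (A \<circ> (A ^^ b) \<circ> E) f i) (A \<circ> (A ^^ b) \<circ> E)"
    by (intro hs_mono) (simp add: ip_scale_left tight_norm[OF A])
  also have "\<dots> = 4 * hs ((A ^^ a) \<circ> E) ((A ^^ a) \<circ> E)"
    by (simp add: hs_def ip_scale_left sum_distrib_left b o_assoc)
  also have "hs ((A ^^ a) \<circ> E) ((A ^^ a) \<circ> E) = hs E ((A ^^ (2 * a)) \<circ> E)"
    by (simp add: hs_left[OF sa_funpow[OF sA]] mult_2 funpow_add o_assoc)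
  also have "\<dots> = hs E (E \<circ> (A ^^ (2 * a)))" by (rule hs_ee[symmetric, OF coin_avg sa_funpow[OF sA]])
  also have "\<dots> = hs E ((E \<circ> (A ^^ a)) \<circ> (A ^^ a))" by (simp add: mult_2 funpow_add o_assoc)
  also have "\<dots> = hs (E \<circ> (A ^^ a)) (E \<circ> (A ^^ a))"
    by (intro hs_right[symmetric] sa_funpow sA coin_avg lin_comp lin_funpow sa_lin)
  also have "\<dots> \<le> hs (\<lambda>f i. \<kappa> * (A ^^ a) f i) (E \<circ> (A ^^ a))"
    by (intro hs_mono) (simp add: ip_scale_left k)
  also have "\<dots> = \<kappa> * hs (A ^^ a) (E \<circ> (A ^^ a))"
    by (simp add: hs_def ip_scale_left sum_distrib_left)
  finally show ?thesis by (simp add: o_def mult.assoc)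
qed

text \<open>Young's inequality with \<open>id\<close> in the middle is the gradient inequality at
  \<open>A'\<close> for the convex function that sends an operator to the trace of its power
  \<open>2 * a + 1\<close>. It yields a drop of \<open>2 * a + 1\<close> times the first-order term
  at \<open>A'\<close>; the rest of the proof bounds the first-order term at \<open>A\<close> by
  twice the one at \<open>A'\<close>.\<close>

lemma trace_drop:
  assumes A: "tight A" and A': "tight A'" and E: "psd E" and k: "\<And>f. ip (E f) (E f) \<le> \<kappa> * ip f (E f)"
    and AE: "\<And>f i. i \<in> V \<Longrightarrow> A f i - A' f i = E f i" and a: "1 \<le> a" and ka: "4 * real a * \<kappa> \<le> 1 / 8" "0 \<le> \<kappa>"
  shows "hs (A' ^^ a) (A' \<circ> (A' ^^ a)) \<le> hs (A ^^ a) (A \<circ> (A ^^ a)) - real a * hs (A ^^ a) (E \<circ> (A ^^ a))"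
proof -
  note pA = tight_psd[OF A] and pA' = tight_psd[OF A']
  note sA = psd_sa[OF pA] and sA' = psd_sa[OF pA'] and coin_avg = psd_sa[OF E]
  note lA = sa_lin[OF sA] and lA' = sa_lin[OF sA'] and lE = sa_lin[OF coin_avg]
  define X where "X = hs (A ^^ a) (E \<circ> (A ^^ a))"
  define X' where "X' = hs (A' ^^ a) (E \<circ> (A' ^^ a))"
  have X0: "0 \<le> X" "0 \<le> X'" unfolding X_def X'_def using hs_psd_left[OF E] by auto
  define N where "N = 2 * a + 1"
  define M where "M = 2 * a - 1"
  have oM: "odd M" and M1: "M + 1 = 2 * a" using a by (auto simp: M_def)
  have n1: "N - 1 = 2 * a" and A1: "A ^^ 1 = A" by (auto simp: N_def fun_eq_iff)
  have "real N * hs id ((A ^^ 1) \<circ> id \<circ> (A' ^^ (N - 1))) \<le> real 1 * hs id ((A ^^ N) \<circ> id) + real (N - 1) * hs id (id \<circ> (A' ^^ N))"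
    by (rule hs_Young[OF pA pA' lin_id]) (auto simp: N_def)
  then have y1: "real N * hs id (A \<circ> (A' ^^ (2 * a))) \<le> hs id (A ^^ N) + real (2 * a) * hs id (A' ^^ N)"
    by (simp only: n1 A1 o_id id_o of_nat_1 mult_1)
  have y2: "hs id (A \<circ> (A' ^^ (2 * a))) - hs id (A' \<circ> (A' ^^ (2 * a))) = hs id (E \<circ> (A' ^^ (2 * a)))"
    unfolding hs_diff_right[symmetric] by (rule hs_cong) (auto simp: AE)
  have y3: "A' \<circ> (A' ^^ (2 * a)) = A' ^^ N"
    unfolding N_def by (simp only: Suc_eq_plus1[symmetric] funpow.simps(2))
  have y4: "hs id (E \<circ> (A' ^^ (2 * a))) = X'" unfolding X'_def by (rule hs_even_power[OF sA' lE])
  have "hs id (A \<circ> (A' ^^ (2 * a))) = hs id (A' ^^ N) + X'"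
    using y2 unfolding y3 y4 by linarith
  with y1 have "real N * (hs id (A' ^^ N) + X') \<le> hs id (A ^^ N) + real (2 * a) * hs id (A' ^^ N)"
    by metis
  then have 1: "hs id (A' ^^ N) + real N * X' \<le> hs id (A ^^ N)"
    by (simp add: N_def algebra_simps del: funpow.simps)
  \<comment> \<open>Replaces the factors \<open>A'\<close> by \<open>A\<close> one at a time. Every
    exchange produces a second \<open>E\<close>, and Young's inequality bounds the mixed term
    \<open>\<psi>\<close> by its two pure endpoints.\<close>
  define \<tau> where "\<tau> j = hs id (E \<circ> (A ^^ j) \<circ> (A' ^^ (M + 1 - j)))" for j
  define \<psi> where "\<psi> j = hs E ((A ^^ j) \<circ> E \<circ> (A' ^^ (M - j)))" for j
  have step: "\<tau> (Suc j) - \<tau> j = \<psi> j" if "j \<le> M" for j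
  proof -
    have Mj: "M + 1 - Suc j = M - j" "M + 1 - j = Suc (M - j)" using that by auto
    have "\<tau> (Suc j) - \<tau> j = hs id (E \<circ> ((A ^^ j) \<circ> E \<circ> (A' ^^ (M - j))))"
      unfolding \<tau>_def hs_diff_right[symmetric] Mj
    proof (rule hs_cong)
      fix l i assume i: "i \<in> V"
      let ?g = "(A' ^^ (M - j)) (e l)"
      have "(A ^^ j) (A ?g) k - (A ^^ j) (A' ?g) k = (A ^^ j) (E ?g) k" if "k \<in> V" for k
        unfolding lin_diff[OF lin_funpow[OF lA] that, symmetric]
        by (rule lin_cong[OF lin_funpow[OF lA] _ that]) (rule AE)
      then have "E (\<lambda>k. (A ^^ j) (A ?g) k - (A ^^ j) (A' ?g) k) i = E ((A ^^ j) (E ?g)) i"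
        by (intro lin_cong[OF lE _ i])
      then show "(E \<circ> (A ^^ Suc j) \<circ> (A' ^^ (M - j))) (e l) i - (E \<circ> (A ^^ j) \<circ> (A' ^^ Suc (M - j))) (e l) i
          = (E \<circ> ((A ^^ j) \<circ> E \<circ> (A' ^^ (M - j)))) (e l) i"
        by (simp add: lin_diff[OF lE i] funpow_swap1)
    qed auto
    also have "\<dots> = \<psi> j" unfolding \<psi>_def using hs_left[OF coin_avg, of id] by simp
    finally show ?thesis .
  qed
  have "X - X' = \<tau> (Suc M) - \<tau> 0"
    unfolding X_def X'_def \<tau>_def
    by (simp add: hs_even_power[OF sA lE, symmetric] hs_even_power[OF sA' lE, symmetric] M1[symmetric] funpow.simps(1) del: funpow.simps(2))
  also have "\<dots> = (\<Sum>j<Suc M. \<psi> j)"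
    using step by (simp add: sum_lessThan_telescope[symmetric] del: sum.lessThan_Suc)
  also have "real M * \<dots> \<le> (\<Sum>j<Suc M. real j * \<psi> M + real (M - j) * \<psi> 0)"
    unfolding sum_distrib_left
  proof (rule sum_mono)
    fix j assume "j \<in> {..<Suc M}"
    then show "real M * \<psi> j \<le> real j * \<psi> M + real (M - j) * \<psi> 0"
      using hs_Young[OF pA pA' lE oM, of j] by (simp add: \<psi>_def o_def)
  qed
  also have "\<dots> = (\<Sum>j<Suc M. real j) * \<psi> M + (\<Sum>j<Suc M. real (M - j)) * \<psi> 0"
    by (simp only: sum.distrib sum_distrib_right)
  also have "(\<Sum>j<Suc M. real (M - j)) = (\<Sum>j<Suc M. real j)"
    using sum.nat_diff_reindex[of real "Suc M"] by simp
  also have "(\<Sum>j<Suc M. real j) = real M * real a"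
  proof -
    have "2 * (\<Sum>j<Suc k. real j) = real k * (real k + 1)" for k
      by (induction k) (auto simp: algebra_simps)
    moreover have "real M + 1 = 2 * real a" using M1 by (metis of_nat_1 of_nat_add of_nat_mult of_nat_numeral)
    ultimately have "2 * (\<Sum>j<Suc M. real j) = real M * (2 * real a)" by metis
    then show ?thesis by simp
  qed
  also have "real M * real a * \<psi> M + real M * real a * \<psi> 0 = real M * (real a * (\<psi> M + \<psi> 0))"
    by (simp add: algebra_simps)
  finally have "X - X' \<le> real a * (\<psi> M + \<psi> 0)"
    using a by (simp add: mult_le_cancel_left M_def)
  moreover have "\<psi> M \<le> 4 * \<kappa> * X"
    unfolding \<psi>_def X_def M_def using hs_tight_odd_le[OF A E k a] by simp
  moreover have "\<psi> 0 \<le> 4 * \<kappa> * X'"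
    unfolding \<psi>_def X'_def M_def using hs_tight_odd_le[OF A' E k a] hs_ee[OF coin_avg sa_funpow[OF sA']] by simp
  ultimately have "X - X' \<le> real a * (4 * \<kappa> * X + 4 * \<kappa> * X')"
    by (smt (verit) mult_left_mono of_nat_0_le_iff)
  also have "\<dots> = (4 * real a * \<kappa>) * (X + X')" by (simp add: algebra_simps)
  \<comment> \<open>Smallness of the perturbation closes the circular estimate: the difference of
    \<open>X\<close> and \<open>X'\<close> is at most an eighth of their sum.\<close>
  also have "\<dots> \<le> 1 / 8 * (X + X')" using ka X0 by (intro mult_right_mono) auto
  finally have "X \<le> 2 * X'" using X0 by simp
  then have "real N * X' \<ge> real a * X"
  proof -
    have "real a * X \<le> real a * (2 * X')" using \<open>X \<le> 2 * X'\<close> by (intro mult_left_mono) auto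
    also have "\<dots> \<le> real N * X'" using X0 by (simp add: N_def algebra_simps)
    finally show ?thesis .
  qed
  with 1 show ?thesis
    using hs_odd_power[OF sA, of a] hs_odd_power[OF sA', of a] by (simp add: N_def X_def)
qed

end


section \<open>Bessel's inequality, Rayleigh quotients and the centred trace\<close>

context wspace begin

lemma Bessel_two:
  assumes o: "ip w x = 0" and w: "0 < ip w w" and x: "0 < ip x x"
  shows "(ip g w)\<^sup>2 / ip w w + (ip g x)\<^sup>2 / ip x x \<le> ip g g"
proof -
  define \<alpha> \<gamma> where "\<alpha> = ip g w / ip w w" and "\<gamma> = ip g x / ip x x"
  have ag: "ip g w = \<alpha> * ip w w" "ip g x = \<gamma> * ip x x" using w x by (auto simp: \<alpha>_def \<gamma>_def)
  have "0 \<le> ip (\<lambda>i. g i - \<alpha> * w i - \<gamma> * x i) (\<lambda>i. g i - \<alpha> * w i - \<gamma> * x i)" by (rule ip_self_nonneg)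
  also have "\<dots> = ip g g - \<alpha> * (\<alpha> * ip w w) - \<gamma> * (\<gamma> * ip x x)"
    by (simp add: ip_simps ip_commute[of w g] ip_commute[of x g] ip_commute[of x w] o ag)
  finally show ?thesis using w x by (simp add: ag power2_eq_square)
qed

text \<open>Bessel's inequality for the two orthogonal functions 1 and \<open>f\<close>, applied to
  every row of \<open>T\<close> and summed. It stands in for a spectral decomposition: the 1 is the
  share of the constants, the quotient the share of the direction of \<open>f\<close>.\<close>

lemma hs_square_ge:
  assumes T: "sa T" and one: "\<And>i. i \<in> V \<Longrightarrow> T (\<lambda>_. 1) i = 1" and V: "V \<noteq> {}"
    and f: "ip (\<lambda>_. 1) f = 0" "0 < ip f f"
  shows "1 + ip (T f) (T f) / ip f f \<le> hs T T"
proof -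
  define g where "g i l = T (e l) i / m l" for i l
  have gf: "ip (g i) h = T h i" if "i \<in> V" for i h
  proof -
    have "ip (g i) h = (\<Sum>l\<in>V. h l * T (e l) i)"
      unfolding ip_def g_def using pos by (intro sum.cong) (auto simp: less_imp_neq[OF pos, symmetric])
    then show ?thesis using linD[OF sa_lin[OF T] that, of h] by simp
  qed
  have w: "0 < ip (\<lambda>_. 1) (\<lambda>_. 1)" using V fin pos by (auto simp: ip_def intro!: sum_pos)
  have "hs T T = (\<Sum>l\<in>V. \<Sum>i\<in>V. m i * (m l * (g i l * g i l)))"
    unfolding hs_def ip_def sum_divide_distrib
    by (intro sum.cong refl) (auto simp: g_def less_imp_neq[OF pos, symmetric])
  also have "\<dots> = (\<Sum>i\<in>V. m i * ip (g i) (g i))"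
    by (subst sum.swap) (simp add: ip_def sum_distrib_left mult_ac)
  also have "\<dots> \<ge> (\<Sum>i\<in>V. m i * (1 / ip (\<lambda>_. 1) (\<lambda>_. 1) + (T f i)\<^sup>2 / ip f f))"
  proof (intro sum_mono mult_left_mono)
    fix i assume i: "i \<in> V"
    show "1 / ip (\<lambda>_. 1) (\<lambda>_. 1) + (T f i)\<^sup>2 / ip f f \<le> ip (g i) (g i)"
      using Bessel_two[OF f(1) w f(2), of "g i"] by (simp add: gf[OF i] one[OF i])
    show "0 \<le> m i" using pos[OF i] by simp
  qed
  moreover have "(\<Sum>i\<in>V. m i * (1 / ip (\<lambda>_. 1) (\<lambda>_. 1) + (T f i)\<^sup>2 / ip f f)) =
      (\<Sum>i\<in>V. m i) / ip (\<lambda>_. 1) (\<lambda>_. 1) + ip (T f) (T f) / ip f f"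
    by (simp only: distrib_left sum.distrib sum_distrib_right[symmetric] times_divide_eq_right mult_1_right sum_divide_distrib[symmetric])
       (simp add: ip_def power2_eq_square mult.assoc)
  moreover have "(\<Sum>i\<in>V. m i) / ip (\<lambda>_. 1) (\<lambda>_. 1) = 1"
  proof -
    have "(\<Sum>i\<in>V. m i) = ip (\<lambda>_. 1) (\<lambda>_. 1)" by (simp add: ip_def)
    then show ?thesis using w by simp
  qed
  ultimately show ?thesis by simp
qed

text \<open>Jensen's inequality for the spectral measure of \<open>f\<close>, obtained by repeated
  squaring with Cauchy-Schwarz. Squaring reaches powers of two only, hence the choice of a power of
  two as the length of the walk.\<close>

lemma power_moment:
  assumes A: "psd A" and f: "0 < ip f f"
  shows "(ip f (A f) / ip f f) ^ (2 ^ p) \<le> ip f ((A ^^ (2 ^ p)) f) / ip f f"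
proof (induction p)
  case (Suc p)
  let ?T = "A ^^ (2 ^ p)"
  have "(ip f (A f) / ip f f) ^ (2 ^ Suc p) = ((ip f (A f) / ip f f) ^ (2 ^ p))\<^sup>2"
    by (simp add: power_mult[symmetric] mult.commute)
  also have "\<dots> \<le> (ip f (?T f) / ip f f)\<^sup>2"
    using Suc A f by (intro power_mono zero_le_power) (auto simp: psd_def)
  also have "\<dots> \<le> ip (?T f) (?T f) / ip f f"
    using ip_Cauchy[of f "?T f"] f by (simp add: power_divide power2_eq_square field_simps)
  also have "ip (?T f) (?T f) = ip f (?T (?T f))" by (rule saD[OF sa_funpow[OF psd_sa[OF A]]])
  also have "?T (?T f) = (A ^^ (2 ^ Suc p)) f" by (simp add: funpow_add mult_2)
  finally show ?case .
qed auto

definition vtot :: real where "vtot = (\<Sum>i\<in>V. m i)"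

text \<open>If \<open>T\<close> is self-adjoint and fixes constants, the subtracted number is the
  weighted mean of \<open>T (e l)\<close>, so this is the part of the column orthogonal to the
  constants.\<close>

definition col :: "(('a \<Rightarrow> real) \<Rightarrow> 'a \<Rightarrow> real) \<Rightarrow> 'a \<Rightarrow> 'a \<Rightarrow> real" where
  "col T l i = T (e l) i - m l / vtot"

lemma col_props:
  assumes T: "sa T" and one: "\<And>i. i \<in> V \<Longrightarrow> T (\<lambda>_. 1) i = 1" and l: "l \<in> V"
  shows "ip (\<lambda>_. 1) (T (e l)) = m l" "ip (col T l) (\<lambda>_. 1) = 0"
    "ip (T (e l)) (T (e l)) = ip (col T l) (col T l) + (m l)\<^sup>2 / vtot"
proof -
  have v: "0 < vtot" using l fin pos by (auto simp: vtot_def intro!: sum_pos)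
  have vv: "ip (\<lambda>_. 1) (\<lambda>_. 1) = vtot" by (simp add: ip_def vtot_def)
  have "ip (\<lambda>_. 1) (T (e l)) = ip (T (\<lambda>_. 1)) (e l)" by (simp add: saD[OF T])
  also have "\<dots> = ip (\<lambda>_. 1) (e l)" by (rule ip_cong) (auto simp: one)
  also have "\<dots> = m l" using l by (simp add: ip_e_right)
  finally show 1: "ip (\<lambda>_. 1) (T (e l)) = m l" .
  have cc: "col T l = (\<lambda>i. T (e l) i - (m l / vtot) * 1)" by (simp add: col_def fun_eq_iff)
  show 2: "ip (col T l) (\<lambda>_. 1) = 0"
    unfolding cc using 1 v vv by (simp only: ip_diff_left ip_scale_left ip_commute[of "T (e l)"]) simp
  show "ip (T (e l)) (T (e l)) = ip (col T l) (col T l) + (m l)\<^sup>2 / vtot"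
    unfolding cc using 1 v vv
    by (simp only: ip_simps ip_commute[of "T (e l)" "\<lambda>_. 1"]) (simp add: power2_eq_square)
qed

text \<open>The potential carries one factor \<open>A\<close> more than the weighted sum
  \<open>Q\<close> of squared centred columns, and \<open>Q\<close> is what the vectors of the cut
  player measure. Tightness makes the two equal up to a factor 2.\<close>

lemma trace_ge:
  fixes a :: nat
  assumes A: "tight A" and one: "\<And>i. i \<in> V \<Longrightarrow> A (\<lambda>_. 1) i = 1" and V: "V \<noteq> {}"
  defines "Q \<equiv> (\<Sum>l\<in>V. ip (col (A ^^ a) l) (col (A ^^ a) l) / m l)"
  shows "hs (A ^^ a) (A ^^ a) = 1 + Q" "hs (A ^^ a) (A \<circ> (A ^^ a)) - 1 \<le> Q" "Q \<le> 2 * (hs (A ^^ a) (A \<circ> (A ^^ a)) - 1)"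
proof -
  have sA: "sa A" using A by (simp add: tight_def)
  have sT: "sa (A ^^ a)" by (rule sa_funpow[OF sA])
  have oneT: "(A ^^ a) (\<lambda>_. 1) i = 1" if "i \<in> V" for i
    using that
  proof (induction a arbitrary: i)
    case (Suc a)
    have "A ((A ^^ a) (\<lambda>_. 1)) i = A (\<lambda>_. 1) i"
      by (rule lin_cong[OF sa_lin[OF sA] Suc.IH Suc.prems])
    then show ?case using one[OF Suc.prems] by simp
  qed auto
  note cp = col_props[OF sT oneT]
  have v: "0 < vtot" using V fin pos by (auto simp: vtot_def intro!: sum_pos)
  have s1: "(\<Sum>l\<in>V. (m l)\<^sup>2 / vtot / m l) = 1"
  proof -
    have "(\<Sum>l\<in>V. (m l)\<^sup>2 / vtot / m l) = (\<Sum>l\<in>V. m l / vtot)"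
      by (intro sum.cong refl) (auto simp: power2_eq_square less_imp_neq[OF pos, symmetric])
    also have "\<dots> = 1" using v by (simp add: sum_divide_distrib[symmetric] vtot_def)
    finally show ?thesis .
  qed
  show 1: "hs (A ^^ a) (A ^^ a) = 1 + Q"
    unfolding hs_def Q_def s1[symmetric] sum.distrib[symmetric]
    by (intro sum.cong refl) (simp add: cp(3) add_divide_distrib)
  have "hs (A ^^ a) (A \<circ> (A ^^ a)) \<le> hs (A ^^ a) (A ^^ a)"
    using A by (intro hs_mono) (auto simp: tight_def)
  with 1 show "hs (A ^^ a) (A \<circ> (A ^^ a)) - 1 \<le> Q" by simp
  have "1 + Q / 2 \<le> hs (A ^^ a) (A \<circ> (A ^^ a))"
    unfolding hs_def Q_def s1[symmetric] sum.distrib[symmetric] sum_divide_distrib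
  proof (rule sum_mono)
    fix l assume l: "l \<in> V"
    let ?y = "col (A ^^ a) l" and ?c = "m l / vtot"
    have Te: "ip g ((A ^^ a) (e l)) = ip g (\<lambda>i. ?y i + ?c * 1)" for g
      by (rule ip_cong) (auto simp: col_def)
    have "ip ((A ^^ a) (e l)) ((A \<circ> (A ^^ a)) (e l)) = ip (A (\<lambda>i. ?y i + ?c * 1)) (\<lambda>i. ?y i + ?c * 1)"
      unfolding o_apply saD[OF sA, symmetric]
      by (rule ip_cong) (auto simp: col_def)
    also have "\<dots> = ip (\<lambda>i. A ?y i + ?c * 1) (\<lambda>i. ?y i + ?c * 1)"
    proof (rule ip_cong)
      fix i assume i: "i \<in> V"
      have "A (\<lambda>i. ?y i - (- ?c) * (\<lambda>_. 1) i) i = A ?y i - A (\<lambda>i. (- ?c) * (\<lambda>_. 1) i) i"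
        by (rule lin_diff[OF sa_lin[OF sA] i])
      then show "A (\<lambda>i. ?y i + ?c * 1) i = A ?y i + ?c * 1"
        using lin_scale[OF sa_lin[OF sA] i, of "- ?c" "\<lambda>_. 1"] by (simp add: one[OF i])
    qed auto
    also have "\<dots> = ip (A ?y) ?y + ?c * ip (A ?y) (\<lambda>_. 1) + ?c * ip (\<lambda>_. 1) ?y + ?c * ?c * ip (\<lambda>_. 1) (\<lambda>_. 1)"
      by (simp only: ip_simps) (simp add: algebra_simps)
    also have "ip (A ?y) (\<lambda>_. 1) = ip ?y (A (\<lambda>_. 1))" by (rule saD[OF sA])
    also have "\<dots> = ip ?y (\<lambda>_. 1)" by (rule ip_cong) (auto simp: one)
    also have "ip (\<lambda>_. 1) ?y = ip ?y (\<lambda>_. 1)" by (rule ip_commute)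
    also have "ip ?y (\<lambda>_. 1) = 0" by (rule cp(2)[OF _ l])
    also have "ip (\<lambda>_. 1) (\<lambda>_. 1) = vtot" by (simp add: ip_def vtot_def)
    also have "ip (A ?y) ?y = ip ?y (A ?y)" by (rule ip_commute)
    finally have "ip ((A ^^ a) (e l)) ((A \<circ> (A ^^ a)) (e l)) = ip ?y (A ?y) + (m l)\<^sup>2 / vtot"
      using v by (simp add: power2_eq_square)
    also have "\<dots> \<ge> ip ?y ?y / 2 + (m l)\<^sup>2 / vtot" using A by (simp add: tight_def)
    finally have "(ip ?y ?y / 2 + (m l)\<^sup>2 / vtot) / m l \<le> ip ((A ^^ a) (e l)) ((A \<circ> (A ^^ a)) (e l)) / m l"
      using pos[OF l] by (intro divide_right_mono) auto
    then show "(m l)\<^sup>2 / vtot / m l + ip ?y ?y / m l / 2 \<le> ip ((A ^^ a) (e l)) ((A \<circ> (A ^^ a)) (e l)) / m l"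
      by (simp add: add_divide_distrib)
  qed
  then show "Q \<le> 2 * (hs (A ^^ a) (A \<circ> (A ^^ a)) - 1)" by simp
qed

lemma rayleigh_power_le:
  assumes A: "tight A" and one: "\<And>i. i \<in> V \<Longrightarrow> A (\<lambda>_. 1) i = 1" and V: "V \<noteq> {}"
    and f: "ip (\<lambda>_. 1) f = 0" "0 < ip f f" and a: "2 * a = 2 ^ p"
  shows "(ip f (A f) / ip f f) ^ (2 * a) \<le> 2 * (hs (A ^^ a) (A \<circ> (A ^^ a)) - 1)"
proof -
  have sA: "sa A" using A by (simp add: tight_def)
  have sT: "sa (A ^^ a)" by (rule sa_funpow[OF sA])
  have oneT: "(A ^^ a) (\<lambda>_. 1) i = 1" if "i \<in> V" for i
    using that
  proof (induction a arbitrary: i)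
    case (Suc a)
    have "A ((A ^^ a) (\<lambda>_. 1)) i = A (\<lambda>_. 1) i"
      by (rule lin_cong[OF sa_lin[OF sA] Suc.IH Suc.prems])
    then show ?case using one[OF Suc.prems] by simp
  qed auto
  have "(ip f (A f) / ip f f) ^ (2 * a) \<le> ip f ((A ^^ (2 * a)) f) / ip f f"
    unfolding a by (rule power_moment[OF tight_psd[OF A] f(2)])
  also have "ip f ((A ^^ (2 * a)) f) = ip ((A ^^ a) f) ((A ^^ a) f)"
    by (simp add: mult_2 funpow_add saD[OF sT])
  also have "\<dots> / ip f f \<le> hs (A ^^ a) (A ^^ a) - 1"
    using hs_square_ge[OF sT oneT V f] by simp
  also have "\<dots> \<le> 2 * (hs (A ^^ a) (A \<circ> (A ^^ a)) - 1)"
    using trace_ge(1,3)[OF A one V, of a] by simp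
  finally show ?thesis .
qed

lemma walk_op_one: "walk_op \<beta> H (\<lambda>_. 1) i = 1"
  by (simp add: walk_op_def lap_def)

text \<open>The perturbation is \<beta> times the Laplacian of the new matching. Its degrees are at
  most \<open>m\<close>, so \<open>lap_norm_le\<close> gives \<kappa> = 2 \<beta>, and
  \<open>64 * real a * \<beta> \<le> 1\<close> is exactly the smallness condition of
  \<open>trace_drop\<close>.\<close>

lemma walk_trace_drop:
  assumes H: "\<And>i j. H i j = H j i" "\<And>i j. 0 \<le> H i j" "\<And>i. i \<in> V \<Longrightarrow> (\<Sum>j\<in>V. H i j) \<le> c * m i"
    and D: "\<And>i j. D i j = D j i" "\<And>i j. 0 \<le> D i j" "\<And>i. i \<in> V \<Longrightarrow> (\<Sum>j\<in>V. D i j) \<le> m i"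
    and b: "0 \<le> \<beta>" "\<beta> * (c + 1) \<le> 1 / 4" "0 \<le> c" and a: "1 \<le> a" "64 * real a * \<beta> \<le> 1"
  defines "A \<equiv> walk_op \<beta> H" and "A' \<equiv> walk_op \<beta> (\<lambda>i j. H i j + D i j)"
  shows "hs (A' ^^ a) (A' \<circ> (A' ^^ a)) \<le> hs (A ^^ a) (A \<circ> (A ^^ a)) -
     real a * \<beta> / 2 * (\<Sum>l\<in>V. (\<Sum>i\<in>V. \<Sum>j\<in>V. D i j * ((A ^^ a) (e l) i - (A ^^ a) (e l) j)\<^sup>2) / m l)"
proof -
  define E where "E f i = \<beta> * lap D f i" for f i
  have "\<beta> * c \<le> 1 / 4" using b by (simp add: algebra_simps)
  then have A: "tight A" unfolding A_def by (intro tight_walk_op[OF H] b) auto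
  have "(\<Sum>j\<in>V. H i j + D i j) \<le> (c + 1) * m i" if "i \<in> V" for i
    using H(3)[OF that] D(3)[OF that] by (simp add: sum.distrib algebra_simps)
  then have A': "tight A'" unfolding A'_def
    by (intro tight_walk_op[where c = "c + 1"] b) (auto simp: H(1) D(1) H(2) D(2))
  have coin_avg: "sa E" unfolding E_def[abs_def] by (intro sa_scaled sa_lap D)
  have ipE: "ip f (E f) = \<beta> / 2 * (\<Sum>i\<in>V. \<Sum>j\<in>V. D i j * (f i - f j)\<^sup>2)" for f
    by (simp add: E_def[abs_def] ip_scale_right ip_lap_self[OF D(1)])
  have E: "psd E" using coin_avg b D(2) by (auto simp: psd_def ipE intro!: mult_nonneg_nonneg sum_nonneg)
  have k: "ip (E f) (E f) \<le> (2 * \<beta>) * ip f (E f)" for f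
  proof -
    have "ip (E f) (E f) = \<beta> * \<beta> * ip (lap D f) (lap D f)"
      by (simp add: E_def[abs_def] ip_scale_right ip_scale_left)
    also have "\<dots> \<le> \<beta> * \<beta> * (2 * 1 * ip f (lap D f))"
      using lap_norm_le[OF D(1,2), where c = 1 and f = f] D(3) by (intro mult_left_mono) auto
    also have "\<dots> = (2 * \<beta>) * ip f (E f)" by (simp add: E_def[abs_def] ip_scale_right)
    finally show ?thesis .
  qed
  have AE: "A f i - A' f i = E f i" for f i
    unfolding A_def A'_def walk_op_def E_def lap_def by (simp add: algebra_simps sum.distrib add_divide_distrib sum_subtractf diff_divide_distrib)
  have "hs (A' ^^ a) (A' \<circ> (A' ^^ a)) \<le> hs (A ^^ a) (A \<circ> (A ^^ a)) - real a * hs (A ^^ a) (E \<circ> (A ^^ a))"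
    by (rule trace_drop[OF A A' E k AE a(1)]) (use a b in \<open>auto simp: algebra_simps\<close>)
  also have "hs (A ^^ a) (E \<circ> (A ^^ a)) = \<beta> / 2 * (\<Sum>l\<in>V. (\<Sum>i\<in>V. \<Sum>j\<in>V. D i j * ((A ^^ a) (e l) i - (A ^^ a) (e l) j)\<^sup>2) / m l)"
    by (simp add: hs_def ipE sum_distrib_left)
  finally show ?thesis by (simp add: o_def mult.assoc)
qed

lemma walk_trace_init: "hs ((walk_op \<beta> (\<lambda>_ _. 0)) ^^ a) (walk_op \<beta> (\<lambda>_ _. 0) \<circ> (walk_op \<beta> (\<lambda>_ _. 0) ^^ a)) = card V"
proof -
  have 1: "walk_op \<beta> (\<lambda>_ _. 0) = id" by (simp add: walk_op_def lap_def fun_eq_iff)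
  have 2: "(id ^^ a) = (id :: ('a \<Rightarrow> real) \<Rightarrow> 'a \<Rightarrow> real)" by (induction a) auto
  have "hs id id = (\<Sum>l\<in>V. 1)" unfolding hs_def
  proof (intro sum.cong refl)
    fix l assume "l \<in> V"
    then show "ip (id (e l)) (id (e l)) / m l = 1" using pos[of l] by (simp add: ip_e_left) (simp add: e_def)
  qed
  then show ?thesis unfolding 1 2 by simp
qed

end


section \<open>Entropy of a random mixture of reversible walks\<close>

text \<open>At each step a kernel \<open>K \<omega>\<close> is drawn with probability \<open>p \<omega>\<close>; every kernel is reversible for \<open>\<pi>\<close>.\<close>

locale mixed_walk = wspace V \<pi> for V :: "'a set" and \<pi> :: "'a \<Rightarrow> real" +
  fixes Om :: "'w set" and p :: "'w \<Rightarrow> real" and K :: "'w \<Rightarrow> 'a \<Rightarrow> 'a \<Rightarrow> real"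
  assumes finOm: "finite Om" and pi1: "(\<Sum>x\<in>V. \<pi> x) = 1"
    and p0: "\<And>\<omega>. 0 \<le> p \<omega>" and p1: "(\<Sum>\<omega>\<in>Om. p \<omega>) = 1"
    and K0: "\<And>\<omega> x y. \<omega> \<in> Om \<Longrightarrow> x \<in> V \<Longrightarrow> y \<in> V \<Longrightarrow> 0 \<le> K \<omega> x y"
    and K1: "\<And>\<omega> x. \<omega> \<in> Om \<Longrightarrow> x \<in> V \<Longrightarrow> (\<Sum>y\<in>V. K \<omega> x y) = 1"
    and Krev: "\<And>\<omega> x y. \<omega> \<in> Om \<Longrightarrow> x \<in> V \<Longrightarrow> y \<in> V \<Longrightarrow> \<pi> x * K \<omega> x y = \<pi> y * K \<omega> y x"
begin

definition P :: "'a \<Rightarrow> 'a \<Rightarrow> real" where "P x y = (\<Sum>\<omega>\<in>Om. p \<omega> * K \<omega> x y)"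

primrec Pn :: "nat \<Rightarrow> 'a \<Rightarrow> 'a \<Rightarrow> real" where
  "Pn 0 x y = (if x = y then 1 else 0)"
| "Pn (Suc k) x y = (\<Sum>z\<in>V. P x z * Pn k z y)"

lemma P0: "x \<in> V \<Longrightarrow> y \<in> V \<Longrightarrow> 0 \<le> P x y"
  unfolding P_def by (intro sum_nonneg mult_nonneg_nonneg p0 K0)

lemma step_swap: "(\<Sum>\<omega>\<in>Om. p \<omega> * (\<Sum>y\<in>V. K \<omega> x y * f y)) = (\<Sum>y\<in>V. P x y * f y)"
proof -
  have "(\<Sum>\<omega>\<in>Om. p \<omega> * (\<Sum>y\<in>V. K \<omega> x y * f y)) = (\<Sum>\<omega>\<in>Om. \<Sum>y\<in>V. p \<omega> * K \<omega> x y * f y)"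
    by (simp add: sum_distrib_left mult.assoc)
  also have "\<dots> = (\<Sum>y\<in>V. \<Sum>\<omega>\<in>Om. p \<omega> * K \<omega> x y * f y)" by (rule sum.swap)
  also have "\<dots> = (\<Sum>y\<in>V. P x y * f y)" by (simp add: P_def sum_distrib_right)
  finally show ?thesis .
qed

lemma P1: "x \<in> V \<Longrightarrow> (\<Sum>y\<in>V. P x y) = 1"
  using step_swap[of x "\<lambda>_. 1"] K1[of _ x] p1 by simp

lemma Prev: "x \<in> V \<Longrightarrow> y \<in> V \<Longrightarrow> \<pi> x * P x y = \<pi> y * P y x"
proof -
  assume xy: "x \<in> V" "y \<in> V"
  have "\<pi> x * P x y = (\<Sum>\<omega>\<in>Om. p \<omega> * (\<pi> x * K \<omega> x y))" by (simp add: P_def sum_distrib_left mult_ac)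
  also have "\<dots> = (\<Sum>\<omega>\<in>Om. p \<omega> * (\<pi> y * K \<omega> y x))" using Krev xy by (intro sum.cong) auto
  also have "\<dots> = \<pi> y * P y x" by (simp add: P_def sum_distrib_left mult_ac)
  finally show ?thesis .
qed

lemma Pn0: "x \<in> V \<Longrightarrow> y \<in> V \<Longrightarrow> 0 \<le> Pn k x y"
  by (induction k arbitrary: x) (auto intro!: sum_nonneg mult_nonneg_nonneg P0)

lemma Pn1: "x \<in> V \<Longrightarrow> (\<Sum>y\<in>V. Pn k x y) = 1"
proof (induction k arbitrary: x)
  case 0 then show ?case using fin by simp
next
  case (Suc k)
  have "(\<Sum>y\<in>V. Pn (Suc k) x y) = (\<Sum>z\<in>V. P x z * (\<Sum>y\<in>V. Pn k z y))"
    by (simp add: sum_distrib_left) (rule sum.swap)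
  then show ?case using Suc P1 by simp
qed

lemma Pn_add: "x \<in> V \<Longrightarrow> Pn (j + k) x y = (\<Sum>z\<in>V. Pn j x z * Pn k z y)"
proof (induction j arbitrary: x)
  case 0
  have "(\<Sum>z\<in>V. Pn 0 x z * Pn k z y) = (\<Sum>z\<in>V. if z = x then Pn k z y else 0)"
    by (intro sum.cong) auto
  then show ?case using 0 fin by simp
next
  case (Suc j)
  have "Pn (Suc j + k) x y = (\<Sum>w\<in>V. \<Sum>z\<in>V. P x w * (Pn j w z * Pn k z y))"
    using Suc.IH by (simp add: sum_distrib_left)
  also have "\<dots> = (\<Sum>z\<in>V. \<Sum>w\<in>V. P x w * (Pn j w z * Pn k z y))" by (rule sum.swap)
  also have "\<dots> = (\<Sum>z\<in>V. Pn (Suc j) x z * Pn k z y)" by (simp add: sum_distrib_right mult.assoc)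
  finally show ?case .
qed

lemma Pn_one: "y \<in> V \<Longrightarrow> Pn 1 x y = P x y"
proof -
  assume y: "y \<in> V"
  have "Pn 1 x y = (\<Sum>z\<in>V. if z = y then P x z else 0)" by (simp, intro sum.cong) auto
  then show ?thesis using y fin by simp
qed

lemma Pn_rev: "x \<in> V \<Longrightarrow> y \<in> V \<Longrightarrow> \<pi> x * Pn k x y = \<pi> y * Pn k y x"
proof (induction k arbitrary: x y)
  case (Suc k)
  have "\<pi> x * Pn (Suc k) x y = (\<Sum>z\<in>V. (\<pi> x * P x z) * Pn k z y)" by (simp add: sum_distrib_left mult_ac)
  also have "\<dots> = (\<Sum>z\<in>V. P z x * (\<pi> z * Pn k z y))" using Suc Prev by (intro sum.cong) auto
  also have "\<dots> = (\<Sum>z\<in>V. P z x * (\<pi> y * Pn k y z))" using Suc by (intro sum.cong) auto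
  also have "\<dots> = \<pi> y * (\<Sum>z\<in>V. Pn k y z * Pn 1 z x)" 
    by (simp only: Pn_one[OF Suc.prems(1)] sum_distrib_left) (simp add: mult_ac)
  also have "\<dots> = \<pi> y * Pn (k + 1) y x" by (simp only: Pn_add[OF Suc.prems(2)])
  finally show ?case by simp
qed auto

lemma Pn_stationary: "y \<in> V \<Longrightarrow> (\<Sum>x\<in>V. \<pi> x * Pn k x y) = \<pi> y"
proof -
  assume y: "y \<in> V"
  have "(\<Sum>x\<in>V. \<pi> x * Pn k x y) = (\<Sum>x\<in>V. \<pi> y * Pn k y x)" using y Pn_rev by (intro sum.cong) auto
  then show ?thesis using Pn1[OF y, of k] by (simp add: sum_distrib_left[symmetric])
qed

lemma stationary_sum: "(\<Sum>x\<in>V. \<pi> x * (\<Sum>y\<in>V. Pn k x y * f y)) = (\<Sum>y\<in>V. \<pi> y * f y)"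
proof -
  have "(\<Sum>x\<in>V. \<pi> x * (\<Sum>y\<in>V. Pn k x y * f y)) = (\<Sum>x\<in>V. \<Sum>y\<in>V. (\<pi> x * Pn k x y) * f y)"
    by (simp add: sum_distrib_left mult.assoc)
  also have "\<dots> = (\<Sum>y\<in>V. \<Sum>x\<in>V. (\<pi> x * Pn k x y) * f y)" by (rule sum.swap)
  also have "\<dots> = (\<Sum>y\<in>V. \<pi> y * f y)"
    by (intro sum.cong refl) (simp add: sum_distrib_right[symmetric] Pn_stationary)
  finally show ?thesis .
qed

lemma K_stationary_sum: "\<omega> \<in> Om \<Longrightarrow> (\<Sum>x\<in>V. \<pi> x * (\<Sum>y\<in>V. K \<omega> x y * f y)) = (\<Sum>y\<in>V. \<pi> y * f y)"
proof -
  assume w: "\<omega> \<in> Om"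
  have "(\<Sum>x\<in>V. \<pi> x * (\<Sum>y\<in>V. K \<omega> x y * f y)) = (\<Sum>x\<in>V. \<Sum>y\<in>V. (\<pi> x * K \<omega> x y) * f y)"
    by (simp add: sum_distrib_left mult.assoc)
  also have "\<dots> = (\<Sum>x\<in>V. \<Sum>y\<in>V. (\<pi> y * K \<omega> y x) * f y)" using Krev[OF w] by (intro sum.cong) auto
  also have "\<dots> = (\<Sum>y\<in>V. \<Sum>x\<in>V. (\<pi> y * K \<omega> y x) * f y)" by (rule sum.swap)
  also have "\<dots> = (\<Sum>y\<in>V. \<pi> y * f y * (\<Sum>x\<in>V. K \<omega> y x))"
    by (simp add: sum_distrib_left mult_ac)
  also have "\<dots> = (\<Sum>y\<in>V. \<pi> y * f y)" using K1[OF w] by simp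
  finally show ?thesis .
qed

text \<open>Expectation over a path of \<open>k\<close> steps from \<open>x\<close>. The list passed
  to \<open>G\<close> holds, oldest step first, the index of the kernel and both endpoints;
  recursion on expectations takes the place of a measure on paths.\<close>

primrec pathE :: "nat \<Rightarrow> 'a \<Rightarrow> (('w \<times> 'a \<times> 'a) list \<Rightarrow> real) \<Rightarrow> real" where
  "pathE 0 x G = G []"
| "pathE (Suc k) x G = (\<Sum>\<omega>\<in>Om. p \<omega> * (\<Sum>y\<in>V. K \<omega> x y * pathE k y (\<lambda>es. G ((\<omega>, x, y) # es))))"

definition lst :: "'a \<Rightarrow> ('w \<times> 'a \<times> 'a) list \<Rightarrow> 'a" where
  "lst x es = (if es = [] then x else snd (snd (last es)))"

lemma lst_simps [simp]: "lst x [] = x" "lst x ((\<omega>, x', y) # es) = lst y es"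
  by (auto simp: lst_def)

lemma pathE_add: "pathE k x (\<lambda>es. G es + H es) = pathE k x G + pathE k x H"
  by (induction k arbitrary: x G H) (auto simp: sum.distrib algebra_simps)

lemma pathE_scale: "pathE k x (\<lambda>es. c * G es) = c * pathE k x G"
  by (induction k arbitrary: x G) (auto simp: sum_distrib_left mult_ac intro!: sum.cong)

lemma pathE_diff: "pathE k x (\<lambda>es. G es - H es) = pathE k x G - pathE k x H"
  using pathE_add[of k x G "\<lambda>es. (-1) * H es"] pathE_scale[of k x "-1" H] by simp

lemma pathE_sum: "finite S \<Longrightarrow> pathE k x (\<lambda>es. \<Sum>z\<in>S. G z es) = (\<Sum>z\<in>S. pathE k x (G z))"
proof (induction S rule: finite_induct)
  case empty
  show ?case using pathE_scale[of k x 0 "\<lambda>_. 0"] by simp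
qed (simp add: pathE_add)

lemma pathE_nonneg: "x \<in> V \<Longrightarrow> (\<And>es. lst x es \<in> V \<Longrightarrow> 0 \<le> G es) \<Longrightarrow> 0 \<le> pathE k x G"
  by (induction k arbitrary: x G) (auto intro!: sum_nonneg mult_nonneg_nonneg p0 K0)

lemma pathE_mono: "x \<in> V \<Longrightarrow> (\<And>es. lst x es \<in> V \<Longrightarrow> G es \<le> H es) \<Longrightarrow> pathE k x G \<le> pathE k x H"
  using pathE_nonneg[of x "\<lambda>es. H es - G es" k] by (simp add: pathE_diff)

lemma pathE_lst: "x \<in> V \<Longrightarrow> pathE k x (\<lambda>es. f (lst x es)) = (\<Sum>y\<in>V. Pn k x y * f y)"
proof (induction k arbitrary: x)
  case 0
  have "(\<Sum>y\<in>V. Pn 0 x y * f y) = (\<Sum>y\<in>V. if y = x then f y else 0)" by (intro sum.cong) auto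
  then show ?case using 0 fin by simp
next
  case (Suc k)
  have "pathE (Suc k) x (\<lambda>es. f (lst x es)) = (\<Sum>\<omega>\<in>Om. p \<omega> * (\<Sum>y\<in>V. K \<omega> x y * (\<Sum>z\<in>V. Pn k y z * f z)))"
    using Suc.IH by simp
  also have "\<dots> = (\<Sum>y\<in>V. P x y * (\<Sum>z\<in>V. Pn k y z * f z))" by (rule step_swap)
  also have "\<dots> = (\<Sum>y\<in>V. \<Sum>z\<in>V. P x y * Pn k y z * f z)" by (simp add: sum_distrib_left mult.assoc)
  also have "\<dots> = (\<Sum>z\<in>V. \<Sum>y\<in>V. P x y * Pn k y z * f z)" by (rule sum.swap)
  also have "\<dots> = (\<Sum>z\<in>V. Pn (Suc k) x z * f z)" by (simp add: sum_distrib_right)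
  finally show ?case .
qed

text \<open>A nonnegative function of mean zero vanishes almost surely. This disposes of endpoints
  of probability 0, where the logarithms of the entropy argument degenerate.\<close>

lemma pathE_zero_mult:
  assumes "x \<in> V" "\<And>es. lst x es \<in> V \<Longrightarrow> 0 \<le> G es" "pathE k x G = 0"
  shows "pathE k x (\<lambda>es. G es * H es) = 0"
  using assms
proof (induction k arbitrary: x G H)
  case (Suc k)
  have nn: "0 \<le> pathE k y (\<lambda>es. G ((\<omega>, x, y) # es))" if "y \<in> V" for y \<omega>
    using that Suc.prems by (intro pathE_nonneg) auto
  have z1: "p \<omega> * (\<Sum>y\<in>V. K \<omega> x y * pathE k y (\<lambda>es. G ((\<omega>, x, y) # es))) = 0" if "\<omega> \<in> Om" for \<omega>
    using Suc.prems(3) that finOm Suc.prems(1)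
    by (simp, subst (asm) sum_nonneg_eq_0_iff) (auto intro!: mult_nonneg_nonneg sum_nonneg p0 K0 nn)
  have "p \<omega> * (\<Sum>y\<in>V. K \<omega> x y * pathE k y (\<lambda>es. G ((\<omega>, x, y) # es) * H ((\<omega>, x, y) # es))) = 0" if w: "\<omega> \<in> Om" for \<omega>
  proof (cases "p \<omega> = 0")
    case False
    then have "(\<Sum>y\<in>V. K \<omega> x y * pathE k y (\<lambda>es. G ((\<omega>, x, y) # es))) = 0" using z1[OF w] by simp
    then have "K \<omega> x y * pathE k y (\<lambda>es. G ((\<omega>, x, y) # es)) = 0" if "y \<in> V" for y
      using that fin Suc.prems(1) w by (subst (asm) sum_nonneg_eq_0_iff) (auto intro!: mult_nonneg_nonneg K0 nn)
    then have "K \<omega> x y * pathE k y (\<lambda>es. G ((\<omega>, x, y) # es) * H ((\<omega>, x, y) # es)) = 0" if "y \<in> V" for y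
      using that Suc.IH[of y "\<lambda>es. G ((\<omega>, x, y) # es)" "\<lambda>es. H ((\<omega>, x, y) # es)"] Suc.prems(2)
      by (cases "K \<omega> x y = 0") auto
    then show ?thesis by (intro mult_eq_0_iff[THEN iffD2] disjI2 sum.neutral) auto
  qed simp
  then show ?case unfolding pathE.simps by (intro sum.neutral ballI)
qed simp

text \<open>The exponentials of the partial sums form a supermartingale.\<close>

lemma pathE_exp_le_1:
  assumes "\<And>x. x \<in> V \<Longrightarrow> (\<Sum>\<omega>\<in>Om. p \<omega> * (\<Sum>y\<in>V. K \<omega> x y * exp (g (\<omega>, x, y)))) \<le> 1" and "x \<in> V"
  shows "pathE k x (\<lambda>es. exp (sum_list (map g es))) \<le> 1"
  using assms(2)
proof (induction k arbitrary: x)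
  case (Suc k)
  have "pathE (Suc k) x (\<lambda>es. exp (sum_list (map g es))) =
     (\<Sum>\<omega>\<in>Om. p \<omega> * (\<Sum>y\<in>V. K \<omega> x y * (exp (g (\<omega>, x, y)) * pathE k y (\<lambda>es. exp (sum_list (map g es))))))"
    by (simp add: exp_add pathE_scale)
  also have "\<dots> \<le> (\<Sum>\<omega>\<in>Om. p \<omega> * (\<Sum>y\<in>V. K \<omega> x y * (exp (g (\<omega>, x, y)) * 1)))"
    using Suc by (intro sum_mono mult_left_mono p0 K0) auto
  also have "\<dots> \<le> 1" using assms(1)[OF Suc.prems] by simp
  finally show ?case .
qed simp

text \<open>Splits the sum by the time \<open>l\<close> of the recorded step: \<open>l\<close> steps
  lead to it, and after it come the \<open>k - 1 - l\<close> remaining steps of the path and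
  \<open>M\<close> further ones to reach \<open>z\<close>.\<close>

lemma pathE_additive:
  assumes "x \<in> V"
  shows "pathE k x (\<lambda>es. \<Sum>z\<in>V. Pn M (lst x es) z * sum_list (map (\<lambda>e. g e z) es)) =
    (\<Sum>l<k. \<Sum>x'\<in>V. Pn l x x' * (\<Sum>\<omega>\<in>Om. p \<omega> * (\<Sum>y\<in>V. K \<omega> x' y * (\<Sum>z\<in>V. Pn (k - 1 - l + M) y z * g (\<omega>, x', y) z))))"
  using assms
proof (induction k arbitrary: x)
  case (Suc k)
  define R where "R j x' = (\<Sum>\<omega>\<in>Om. p \<omega> * (\<Sum>y\<in>V. K \<omega> x' y * (\<Sum>z\<in>V. Pn j y z * g (\<omega>, x', y) z)))" for j x'
  have first: "pathE k y (\<lambda>es. \<Sum>z\<in>V. Pn M (lst y es) z * c z) = (\<Sum>z\<in>V. Pn (k + M) y z * c z)" if "y \<in> V" for y c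
    using pathE_lst[OF that, of k "\<lambda>w. \<Sum>z\<in>V. Pn M w z * c z"] that
    by (simp add: Pn_add sum_distrib_left sum_distrib_right mult.assoc) (rule sum.swap)
  have "pathE (Suc k) x (\<lambda>es. \<Sum>z\<in>V. Pn M (lst x es) z * sum_list (map (\<lambda>e. g e z) es)) =
     (\<Sum>\<omega>\<in>Om. p \<omega> * (\<Sum>y\<in>V. K \<omega> x y * ((\<Sum>z\<in>V. Pn (k + M) y z * g (\<omega>, x, y) z) + (\<Sum>l<k. \<Sum>x'\<in>V. Pn l y x' * R (k - 1 - l + M) x'))))"
    using Suc.IH by (simp add: distrib_left sum.distrib pathE_add first R_def)
  also have "\<dots> = R (k + M) x + (\<Sum>\<omega>\<in>Om. p \<omega> * (\<Sum>y\<in>V. K \<omega> x y * (\<Sum>l<k. \<Sum>x'\<in>V. Pn l y x' * R (k - 1 - l + M) x')))"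
    by (simp add: R_def distrib_left sum.distrib)
  also have "(\<Sum>\<omega>\<in>Om. p \<omega> * (\<Sum>y\<in>V. K \<omega> x y * (\<Sum>l<k. \<Sum>x'\<in>V. Pn l y x' * R (k - 1 - l + M) x'))) =
      (\<Sum>y\<in>V. P x y * (\<Sum>l<k. \<Sum>x'\<in>V. Pn l y x' * R (k - 1 - l + M) x'))"
    by (rule step_swap)
  also have "\<dots> = (\<Sum>y\<in>V. \<Sum>l<k. P x y * (\<Sum>x'\<in>V. Pn l y x' * R (k - 1 - l + M) x'))"
    by (simp add: sum_distrib_left)
  also have "\<dots> = (\<Sum>l<k. \<Sum>y\<in>V. P x y * (\<Sum>x'\<in>V. Pn l y x' * R (k - 1 - l + M) x'))" by (rule sum.swap)
  also have "\<dots> = (\<Sum>l<k. \<Sum>x'\<in>V. Pn (Suc l) x x' * R (k - 1 - l + M) x')"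
  proof (rule sum.cong[OF refl])
    fix l
    have "(\<Sum>y\<in>V. P x y * (\<Sum>x'\<in>V. Pn l y x' * R (k - 1 - l + M) x')) = (\<Sum>y\<in>V. \<Sum>x'\<in>V. P x y * Pn l y x' * R (k - 1 - l + M) x')"
      by (simp add: sum_distrib_left mult.assoc)
    also have "\<dots> = (\<Sum>x'\<in>V. \<Sum>y\<in>V. P x y * Pn l y x' * R (k - 1 - l + M) x')" by (rule sum.swap)
    finally show "(\<Sum>y\<in>V. P x y * (\<Sum>x'\<in>V. Pn l y x' * R (k - 1 - l + M) x')) = (\<Sum>x'\<in>V. Pn (Suc l) x x' * R (k - 1 - l + M) x')"
      by (simp add: sum_distrib_right)
  qed
  also have "R (k + M) x = (\<Sum>x'\<in>V. Pn 0 x x' * R (k + M) x')"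
  proof -
    have "(\<Sum>x'\<in>V. Pn 0 x x' * R (k + M) x') = (\<Sum>x'\<in>V. if x' = x then R (k + M) x' else 0)" by (intro sum.cong) auto
    then show ?thesis using Suc.prems fin by simp
  qed
  also have "\<dots> + (\<Sum>l<k. \<Sum>x'\<in>V. Pn (Suc l) x x' * R (k - 1 - l + M) x') = (\<Sum>l<Suc k. \<Sum>x'\<in>V. Pn l x x' * R (Suc k - 1 - l + M) x')"
    by (simp only: sum.lessThan_Suc_shift[of _ k]) simp
  finally show ?case by (simp add: R_def)
qed simp

definition msd :: "('a \<Rightarrow> real) \<Rightarrow> nat \<Rightarrow> real" where
  "msd f k = (\<Sum>x\<in>V. \<pi> x * (\<Sum>z\<in>V. Pn k x z * (f x - f z)\<^sup>2))"

definition Pop :: "('a \<Rightarrow> real) \<Rightarrow> 'a \<Rightarrow> real" where "Pop f x = (\<Sum>z\<in>V. P x z * f z)"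

lemma Pop_pow: "x \<in> V \<Longrightarrow> (Pop ^^ k) f x = (\<Sum>z\<in>V. Pn k x z * f z)"
proof (induction k arbitrary: x)
  case 0
  have "(\<Sum>z\<in>V. Pn 0 x z * f z) = (\<Sum>y\<in>V. if y = x then f y else 0)" by (intro sum.cong) auto
  then show ?case using 0 fin by simp
next
  case (Suc k)
  have "(Pop ^^ Suc k) f x = Pop ((Pop ^^ k) f) x" by simp
  also have "\<dots> = (\<Sum>y\<in>V. P x y * (\<Sum>z\<in>V. Pn k y z * f z))"
    unfolding Pop_def[of "(Pop ^^ k) f"] using Suc.IH by (intro sum.cong) auto
  also have "\<dots> = (\<Sum>y\<in>V. \<Sum>z\<in>V. P x y * Pn k y z * f z)" by (simp add: sum_distrib_left mult.assoc)
  also have "\<dots> = (\<Sum>z\<in>V. \<Sum>y\<in>V. P x y * Pn k y z * f z)" by (rule sum.swap)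
  finally show ?case by (simp add: sum_distrib_right)
qed

lemma ip_Pop_swap: "ip (Pop f) g = ip f (Pop g)"
proof -
  have "ip (Pop f) g = (\<Sum>x\<in>V. \<Sum>z\<in>V. (\<pi> x * P x z) * f z * g x)"
    by (simp add: ip_def Pop_def sum_distrib_left sum_distrib_right mult_ac)
  also have "\<dots> = (\<Sum>x\<in>V. \<Sum>z\<in>V. (\<pi> z * P z x) * f z * g x)" using Prev by (intro sum.cong) auto
  also have "\<dots> = (\<Sum>z\<in>V. \<Sum>x\<in>V. (\<pi> z * P z x) * f z * g x)" by (rule sum.swap)
  also have "\<dots> = ip f (Pop g)" by (simp add: ip_def Pop_def sum_distrib_left sum_distrib_right mult_ac)
  finally show ?thesis .
qed

lemma msd_eq: "msd f k = 2 * (ip f f - ip f ((Pop ^^ k) f))"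
proof -
  have 1: "(\<Sum>z\<in>V. Pn k x z * (f x - f z)\<^sup>2) = (f x)\<^sup>2 - 2 * f x * (Pop ^^ k) f x + (\<Sum>z\<in>V. Pn k x z * (f z)\<^sup>2)" if "x \<in> V" for x
  proof -
    have "(\<Sum>z\<in>V. Pn k x z * (f x - f z)\<^sup>2) = (\<Sum>z\<in>V. Pn k x z * (f x)\<^sup>2 - 2 * f x * (Pn k x z * f z) + Pn k x z * (f z)\<^sup>2)"
      by (intro sum.cong refl) (simp add: power2_eq_square algebra_simps)
    also have "\<dots> = (\<Sum>z\<in>V. Pn k x z) * (f x)\<^sup>2 - 2 * f x * (\<Sum>z\<in>V. Pn k x z * f z) + (\<Sum>z\<in>V. Pn k x z * (f z)\<^sup>2)"
      by (simp only: sum.distrib sum_subtractf sum_distrib_left[symmetric] sum_distrib_right[symmetric])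
    finally show ?thesis using Pn1[OF that, of k] Pop_pow[OF that, of k f] by simp
  qed
  have "msd f k = (\<Sum>x\<in>V. \<pi> x * (f x)\<^sup>2 - 2 * (\<pi> x * f x * (Pop ^^ k) f x) + \<pi> x * (\<Sum>z\<in>V. Pn k x z * (f z)\<^sup>2))"
    unfolding msd_def by (intro sum.cong refl) (simp add: 1 algebra_simps)
  also have "\<dots> = ip f f - 2 * ip f ((Pop ^^ k) f) + ip f f"
    by (simp only: sum.distrib sum_subtractf sum_distrib_left[symmetric] stationary_sum)
       (simp add: ip_def power2_eq_square mult.assoc)
  finally show ?thesis by simp
qed

lemma ip_Pop_le: "ip w (Pop w) \<le> ip w w" "- ip w w \<le> ip w (Pop w)"
proof -
  have "0 \<le> msd w 1" unfolding msd_def 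
    by (intro sum_nonneg mult_nonneg_nonneg Pn0 zero_le_power2 less_imp_le[OF pos])
  then show "ip w (Pop w) \<le> ip w w" using msd_eq[of w 1] by simp
  have 1: "(\<Sum>z\<in>V. Pn 1 x z * (w x + w z)\<^sup>2) = (w x)\<^sup>2 + 2 * w x * (Pop ^^ 1) w x + (\<Sum>z\<in>V. Pn 1 x z * (w z)\<^sup>2)" if "x \<in> V" for x
  proof -
    have "(\<Sum>z\<in>V. Pn 1 x z * (w x + w z)\<^sup>2) = (\<Sum>z\<in>V. Pn 1 x z * (w x)\<^sup>2 + 2 * w x * (Pn 1 x z * w z) + Pn 1 x z * (w z)\<^sup>2)"
      by (intro sum.cong refl) (simp add: power2_eq_square algebra_simps)
    also have "\<dots> = (\<Sum>z\<in>V. Pn 1 x z) * (w x)\<^sup>2 + 2 * w x * (\<Sum>z\<in>V. Pn 1 x z * w z) + (\<Sum>z\<in>V. Pn 1 x z * (w z)\<^sup>2)"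
      by (simp only: sum.distrib sum_distrib_left[symmetric] sum_distrib_right[symmetric])
    finally show ?thesis using Pn1[OF that, of 1] Pop_pow[OF that, of 1 w] by simp
  qed
  have "0 \<le> (\<Sum>x\<in>V. \<pi> x * (\<Sum>z\<in>V. Pn 1 x z * (w x + w z)\<^sup>2))" 
    by (intro sum_nonneg mult_nonneg_nonneg Pn0 zero_le_power2 less_imp_le[OF pos])
  also have "\<dots> = (\<Sum>x\<in>V. \<pi> x * (w x)\<^sup>2 + 2 * (\<pi> x * w x * (Pop ^^ 1) w x) + \<pi> x * (\<Sum>z\<in>V. Pn 1 x z * (w z)\<^sup>2))"
    by (intro sum.cong refl) (simp only: 1, simp add: algebra_simps)
  also have "\<dots> = ip w w + 2 * ip w ((Pop ^^ 1) w) + ip w w"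
    by (simp only: sum.distrib sum_distrib_left[symmetric] stationary_sum)
       (simp add: ip_def power2_eq_square mult.assoc)
  finally show "- ip w w \<le> ip w (Pop w)" by simp
qed

text \<open>The triangle inequality would only give growth quadratic in \<open>k\<close>.
  Reversibility gives linear growth, which is the Markov type 2 property of Hilbert space found by
  Ball: the displacement is twice a difference of correlations \<open>a 0 - a k\<close>, and every
  decrement of \<open>a\<close> is at most the Dirichlet form of \<open>f\<close>, which
  \<open>Pop\<close> does not increase.\<close>

lemma msd_le: "msd f k \<le> real k * msd f 1"
proof -
  define a where "a k = ip f ((Pop ^^ k) f)" for k
  define En where "En g = ip g g - ip g (Pop g)" for g
  have cg: "Pop (\<lambda>i. g i - h i) = (\<lambda>i. Pop g i - Pop h i)" for g h
    by (simp add: fun_eq_iff Pop_def sum_subtractf algebra_simps)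
  have En_diff: "0 \<le> En g + En h - 2 * (ip g h - ip g (Pop h))" for g h
  proof -
    have "0 \<le> En (\<lambda>i. g i - h i)" using ip_Pop_le(1) by (simp add: En_def)
    also have "\<dots> = En g + En h - 2 * (ip g h - ip g (Pop h))"
      using ip_Pop_swap[of g h] by (simp add: En_def cg ip_simps ip_commute[of h g] ip_commute[of h "Pop g"])
    finally show ?thesis .
  qed
  have En_Pop: "En (Pop g) \<le> En g" for g
  proof -
    \<comment> \<open>The two Dirichlet forms differ by the quadratic form of identity plus
      \<open>Pop\<close> at this function, and that is nonnegative since the spectrum of
      \<open>Pop\<close> is at least -1.\<close>
    define w where "w = (\<lambda>i. g i - Pop g i)"
    have "0 \<le> ip w w + ip w (Pop w)" using ip_Pop_le(2)[of w] by simp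
    also have "\<dots> = En g - En (Pop g)"
      unfolding w_def En_def cg ip_simps
      using ip_Pop_swap[of g "Pop g"] ip_Pop_swap[of "Pop g" "Pop g"] ip_Pop_swap[of g "Pop (Pop g)"] ip_commute[of "Pop g" g] 
        ip_commute[of "Pop g" "Pop (Pop g)"]
      by simp
    finally show ?thesis by simp
  qed
  have En_pow: "En ((Pop ^^ j) f) \<le> En f" for j
    by (induction j) (auto intro: order_trans[OF En_Pop])
  have step: "a j - a (Suc j) \<le> En f" for j
    using En_diff[of f "(Pop ^^ j) f"] En_pow[of j] by (simp add: a_def)
  have "a 0 - a k \<le> real k * En f"
  proof (induction k)
    case (Suc k) then show ?case using step[of k] by (simp add: algebra_simps)
  qed simp
  moreover have "msd f k = 2 * (a 0 - a k)" "msd f 1 = 2 * En f" by (auto simp: msd_eq a_def En_def)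
  ultimately show ?thesis by simp
qed

end


section \<open>Entropy of the walk and its growth under doubling of time\<close>

lemma gibbs_pointwise:
  fixes p q s :: real
  assumes "0 \<le> p" "0 < q"
  shows "p - q * exp s \<le> p * (ln p - ln q - s)"
proof (cases "p = 0")
  case True then show ?thesis using assms by simp
next
  case False
  then have p: "0 < p" using assms by simp
  \<comment> \<open>The bound of ln by its tangent at 1 is the pointwise form of the
    Donsker-Varadhan inequality: once summed, with an exponential moment of at most one, it bounds
    the mean of \<open>s\<close> by a relative entropy.\<close>
  have "ln (q * exp s / p) \<le> q * exp s / p - 1" using p assms by (intro ln_le_minus_one) simp
  then have "ln q + s - ln p \<le> q * exp s / p - 1" using p assms by (simp add: ln_div ln_mult)
  then have "p * (ln q + s - ln p) \<le> p * (q * exp s / p - 1)" using p by (intro mult_left_mono) auto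
  then show ?thesis using p by (simp add: algebra_simps)
qed

context mixed_walk begin

text \<open>The conditional entropy of the position at time \<open>k\<close> given a stationary
  start.\<close>

definition walk_entropy :: "nat \<Rightarrow> real" where
  "walk_entropy k = - (\<Sum>x\<in>V. \<pi> x * (\<Sum>z\<in>V. Pn k x z * ln (Pn k x z)))"

lemma Pn_le_1: "x \<in> V \<Longrightarrow> y \<in> V \<Longrightarrow> Pn k x y \<le> 1"
  using Pn1[of x k] member_le_sum[of y V "Pn k x"] Pn0 fin by auto

lemma walk_entropy_nonneg: "0 \<le> walk_entropy k"
proof -
  have h: "Pn k x z * ln (Pn k x z) \<le> 0" if "x \<in> V" "z \<in> V" for x z
    using Pn0[OF that, of k] Pn_le_1[OF that, of k]
    by (cases "Pn k x z = 0") (auto intro!: mult_nonneg_nonpos simp: ln_le_zero_iff)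
  then have "(\<Sum>x\<in>V. \<pi> x * (\<Sum>z\<in>V. Pn k x z * ln (Pn k x z))) \<le> 0"
    by (intro sum_nonpos[of V] mult_nonneg_nonpos[OF less_imp_le[OF pos] sum_nonpos[OF h]])
  then show ?thesis by (simp add: walk_entropy_def)
qed

lemma walk_entropy_le: assumes "V \<noteq> {}" shows "walk_entropy k \<le> ln (real (card V))"
proof -
  define N where "N = real (card V)"
  have N: "0 < N" using assms fin by (auto simp: N_def card_gt_0_iff)
  have "- (\<Sum>z\<in>V. Pn k x z * ln (Pn k x z)) \<le> ln N" if x: "x \<in> V" for x
  proof -
    have "(\<Sum>z\<in>V. Pn k x z - 1 / N) \<le> (\<Sum>z\<in>V. Pn k x z * (ln (Pn k x z) + ln N))"
    proof (rule sum_mono)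
      fix z assume z: "z \<in> V"
      show "Pn k x z - 1 / N \<le> Pn k x z * (ln (Pn k x z) + ln N)"
        using gibbs_pointwise[OF Pn0[OF x z], of "1 / N" k 0] N by (simp add: ln_div)
    qed
    moreover have "(\<Sum>z\<in>V. Pn k x z - 1 / N) = 0"
      using Pn1[OF x, of k] N by (simp add: sum_subtractf N_def)
    moreover have "(\<Sum>z\<in>V. Pn k x z * (ln (Pn k x z) + ln N)) = (\<Sum>z\<in>V. Pn k x z * ln (Pn k x z)) + ln N"
      using Pn1[OF x, of k] by (simp add: distrib_left sum.distrib sum_distrib_right[symmetric])
    ultimately show ?thesis by simp
  qed
  then have "(\<Sum>x\<in>V. \<pi> x * - (\<Sum>z\<in>V. Pn k x z * ln (Pn k x z))) \<le> (\<Sum>x\<in>V. \<pi> x * ln N)"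
    by (intro sum_mono mult_left_mono less_imp_le[OF pos])
  then show ?thesis using pi1 by (simp add: walk_entropy_def N_def sum_negf sum_distrib_right[symmetric])
qed

text \<open>The Gibbs variational inequality along the first half of the path: a test function \<open>F\<close> whose
  exponential moment is at most one bounds the entropy gained by the second half from below.\<close>

lemma entropy_gain:
  fixes F :: "'a \<Rightarrow> 'a \<Rightarrow> 'w \<times> 'a \<times> 'a \<Rightarrow> real"
  assumes F: "\<And>x0 z x. x0 \<in> V \<Longrightarrow> z \<in> V \<Longrightarrow> x \<in> V \<Longrightarrow>
      (\<Sum>\<omega>\<in>Om. p \<omega> * (\<Sum>y\<in>V. K \<omega> x y * exp (F x0 z (\<omega>, x, y)))) \<le> 1"
  shows "(\<Sum>x\<in>V. \<pi> x * pathE k x (\<lambda>es. \<Sum>z\<in>V. Pn k (lst x es) z * sum_list (map (F x z) es))) \<le> walk_entropy (2 * k) - walk_entropy k"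
proof -
  have Q: "pathE k x (\<lambda>es. Pn k (lst x es) z) = Pn (2 * k) x z" if "x \<in> V" for x z
    using pathE_lst[OF that, of k "\<lambda>y. Pn k y z"] Pn_add[OF that, of k k z] by (simp add: mult_2)
  \<comment> \<open>Given the start \<open>x\<close> and the end \<open>z\<close>, the first half of
    the path has density \<open>Pn k (lst x es) z / Pn (2 * k) x z\<close> relative to its
    unconditioned law. The averaged logarithm of this density is the information that the first half
    carries about the end, which equals the difference of the two entropies.\<close>
  have main: "pathE k x (\<lambda>es. Pn k (lst x es) z * sum_list (map (F x z) es))
      \<le> pathE k x (\<lambda>es. Pn k (lst x es) z * ln (Pn k (lst x es) z)) - Pn (2 * k) x z * ln (Pn (2 * k) x z)"
    if x: "x \<in> V" and z: "z \<in> V" for x z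
  proof (cases "Pn (2 * k) x z = 0")
    case True
    have zz: "pathE k x (\<lambda>es. Pn k (lst x es) z * H es) = 0" for H
      by (rule pathE_zero_mult[OF x]) (use True Q[OF x, of z] z in \<open>auto intro: Pn0\<close>)
    show ?thesis unfolding zz True by simp
  next
    case False
    let ?q = "Pn (2 * k) x z"
    have q: "0 < ?q" using False Pn0[OF x z, of "2 * k"] by simp
    have "0 \<le> ?q - ?q * pathE k x (\<lambda>es. exp (sum_list (map (F x z) es)))"
      using pathE_exp_le_1[of "F x z" x k] F[OF x z] x q by (simp add: mult_le_cancel_left1)
    also have "\<dots> = pathE k x (\<lambda>es. Pn k (lst x es) z - ?q * exp (sum_list (map (F x z) es)))"
      by (simp add: pathE_diff pathE_scale Q[OF x])
    also have "\<dots> \<le> pathE k x (\<lambda>es. Pn k (lst x es) z * (ln (Pn k (lst x es) z) - ln ?q - sum_list (map (F x z) es)))"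
      by (intro pathE_mono x gibbs_pointwise q Pn0 z)
    also have "\<dots> = pathE k x (\<lambda>es. (Pn k (lst x es) z * ln (Pn k (lst x es) z) - ln ?q * Pn k (lst x es) z) - Pn k (lst x es) z * sum_list (map (F x z) es))"
      by (simp add: algebra_simps)
    also have "\<dots> = pathE k x (\<lambda>es. Pn k (lst x es) z * ln (Pn k (lst x es) z)) - ln ?q * ?q - pathE k x (\<lambda>es. Pn k (lst x es) z * sum_list (map (F x z) es))"
      by (simp only: pathE_diff pathE_scale Q[OF x])
    finally show ?thesis by (simp add: mult.commute)
  qed
  have "(\<Sum>x\<in>V. \<pi> x * pathE k x (\<lambda>es. \<Sum>z\<in>V. Pn k (lst x es) z * sum_list (map (F x z) es)))
     \<le> (\<Sum>x\<in>V. \<pi> x * (pathE k x (\<lambda>es. \<Sum>z\<in>V. Pn k (lst x es) z * ln (Pn k (lst x es) z)) - (\<Sum>z\<in>V. Pn (2 * k) x z * ln (Pn (2 * k) x z))))"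
    unfolding pathE_sum[OF fin] sum_subtractf[symmetric]
    by (intro sum_mono mult_left_mono main less_imp_le[OF pos])
  also have "\<dots> = (\<Sum>x\<in>V. \<pi> x * (\<Sum>y\<in>V. Pn k x y * (\<Sum>z\<in>V. Pn k y z * ln (Pn k y z)))) - (\<Sum>x\<in>V. \<pi> x * (\<Sum>z\<in>V. Pn (2 * k) x z * ln (Pn (2 * k) x z)))"
    unfolding right_diff_distrib sum_subtractf
    using pathE_lst[of _ k "\<lambda>y. \<Sum>z\<in>V. Pn k y z * ln (Pn k y z)"] by simp
  also have "\<dots> = walk_entropy (2 * k) - walk_entropy k" by (simp add: stationary_sum walk_entropy_def)
  finally show ?thesis .
qed

text \<open>Isolates one step of a stationary path together with its past and its future. The lemmas
  that follow evaluate it on functions that see only a part of this window.\<close>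

definition EE :: "nat \<Rightarrow> nat \<Rightarrow> ('a \<Rightarrow> 'w \<Rightarrow> 'a \<Rightarrow> 'a \<Rightarrow> 'a \<Rightarrow> real) \<Rightarrow> real" where
  "EE l k \<Phi> = (\<Sum>x0\<in>V. \<pi> x0 * (\<Sum>x\<in>V. Pn l x0 x * (\<Sum>\<omega>\<in>Om. p \<omega> * (\<Sum>y\<in>V. K \<omega> x y * (\<Sum>z\<in>V. Pn k y z * \<Phi> x0 \<omega> x y z)))))"

lemma EE_mono:
  "(\<And>x0 \<omega> x y z. x0 \<in> V \<Longrightarrow> \<omega> \<in> Om \<Longrightarrow> x \<in> V \<Longrightarrow> y \<in> V \<Longrightarrow> z \<in> V \<Longrightarrow> \<Phi> x0 \<omega> x y z \<le> \<Psi> x0 \<omega> x y z) \<Longrightarrow> EE l k \<Phi> \<le> EE l k \<Psi>"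
  unfolding EE_def by (intro sum_mono mult_left_mono less_imp_le[OF pos] Pn0 p0 K0)

lemma EE_diff: "EE l k (\<lambda>x0 \<omega> x y z. \<Phi> x0 \<omega> x y z - \<Psi> x0 \<omega> x y z) = EE l k \<Phi> - EE l k \<Psi>"
  unfolding EE_def by (simp add: right_diff_distrib sum_subtractf)

lemma EE_scale: "EE l k (\<lambda>x0 \<omega> x y z. c * \<Phi> x0 \<omega> x y z) = c * EE l k \<Phi>"
  unfolding EE_def by (simp add: sum_distrib_left mult_ac)

lemma EE_no_z: "EE l k (\<lambda>x0 \<omega> x y z. \<Phi> x0 \<omega> x y) = (\<Sum>x0\<in>V. \<pi> x0 * (\<Sum>x\<in>V. Pn l x0 x * (\<Sum>\<omega>\<in>Om. p \<omega> * (\<Sum>y\<in>V. K \<omega> x y * \<Phi> x0 \<omega> x y))))"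
  unfolding EE_def by (simp add: sum_distrib_right[symmetric] Pn1 cong: sum.cong)

lemma EE_const: "EE l k (\<lambda>x0 \<omega> x y z. c) = c"
  by (simp add: EE_no_z sum_distrib_right[symmetric] K1 p1 Pn1 pi1 cong: sum.cong)

lemma EE_step: "EE l k (\<lambda>x0 \<omega> x y z. \<Phi> \<omega> x y) = (\<Sum>x\<in>V. \<pi> x * (\<Sum>\<omega>\<in>Om. p \<omega> * (\<Sum>y\<in>V. K \<omega> x y * \<Phi> \<omega> x y)))"
  unfolding EE_no_z by (rule stationary_sum)

lemma EE_past: "EE l k (\<lambda>x0 \<omega> x y z. \<Phi> x0 \<omega> x) = (\<Sum>x0\<in>V. \<pi> x0 * (\<Sum>x\<in>V. Pn l x0 x * (\<Sum>\<omega>\<in>Om. p \<omega> * \<Phi> x0 \<omega> x)))"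
  by (simp add: EE_no_z sum_distrib_right[symmetric] K1 cong: sum.cong)

text \<open>Every single kernel preserves \<pi>, not only their mixture. Hence \<open>y\<close> is
  stationary and independent of \<omega>, so that \<omega> can be averaged for fixed
  \<open>y\<close> and \<open>z\<close>. This is where reversibility of the individual kernels
  enters.\<close>

lemma EE_future: "EE l k (\<lambda>x0 \<omega> x y z. \<Phi> \<omega> y z) = (\<Sum>y\<in>V. \<pi> y * (\<Sum>z\<in>V. Pn k y z * (\<Sum>\<omega>\<in>Om. p \<omega> * \<Phi> \<omega> y z)))"
proof -
  have "EE l k (\<lambda>x0 \<omega> x y z. \<Phi> \<omega> y z) = (\<Sum>x\<in>V. \<pi> x * (\<Sum>\<omega>\<in>Om. p \<omega> * (\<Sum>y\<in>V. K \<omega> x y * (\<Sum>z\<in>V. Pn k y z * \<Phi> \<omega> y z))))"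
    unfolding EE_def by (rule stationary_sum)
  also have "\<dots> = (\<Sum>x\<in>V. \<Sum>\<omega>\<in>Om. p \<omega> * (\<pi> x * (\<Sum>y\<in>V. K \<omega> x y * (\<Sum>z\<in>V. Pn k y z * \<Phi> \<omega> y z))))"
    by (simp add: sum_distrib_left mult_ac)
  also have "\<dots> = (\<Sum>\<omega>\<in>Om. p \<omega> * (\<Sum>x\<in>V. \<pi> x * (\<Sum>y\<in>V. K \<omega> x y * (\<Sum>z\<in>V. Pn k y z * \<Phi> \<omega> y z))))"
    by (subst sum.swap) (simp add: sum_distrib_left)
  also have "\<dots> = (\<Sum>\<omega>\<in>Om. p \<omega> * (\<Sum>y\<in>V. \<pi> y * (\<Sum>z\<in>V. Pn k y z * \<Phi> \<omega> y z)))"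
    by (intro sum.cong refl arg_cong2[where f="(*)"] K_stationary_sum)
  also have "\<dots> = (\<Sum>\<omega>\<in>Om. \<Sum>y\<in>V. \<pi> y * (\<Sum>z\<in>V. Pn k y z * (p \<omega> * \<Phi> \<omega> y z)))"
    by (simp add: sum_distrib_left mult_ac)
  also have "\<dots> = (\<Sum>y\<in>V. \<pi> y * (\<Sum>\<omega>\<in>Om. \<Sum>z\<in>V. Pn k y z * (p \<omega> * \<Phi> \<omega> y z)))"
    by (subst sum.swap) (simp add: sum_distrib_left)
  also have "\<dots> = (\<Sum>y\<in>V. \<pi> y * (\<Sum>z\<in>V. Pn k y z * (\<Sum>\<omega>\<in>Om. p \<omega> * \<Phi> \<omega> y z)))"
    by (subst sum.swap) (simp add: sum_distrib_left)
  finally show ?thesis .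
qed

lemma EE_ends: "EE l k (\<lambda>x0 \<omega> x y z. \<Phi> x0 z) = (\<Sum>x0\<in>V. \<pi> x0 * (\<Sum>z\<in>V. Pn (l + Suc k) x0 z * \<Phi> x0 z))"
  unfolding EE_def
proof (rule sum.cong[OF refl], rule arg_cong2[where f="(*)", OF refl])
  fix x0 assume x0: "x0 \<in> V"
  have "(\<Sum>x\<in>V. Pn l x0 x * (\<Sum>\<omega>\<in>Om. p \<omega> * (\<Sum>y\<in>V. K \<omega> x y * (\<Sum>z\<in>V. Pn k y z * \<Phi> x0 z))))
    = (\<Sum>x\<in>V. Pn l x0 x * (\<Sum>z\<in>V. Pn (Suc k) x z * \<Phi> x0 z))"
  proof (rule sum.cong[OF refl], rule arg_cong2[where f="(*)", OF refl])
    fix x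
    have "(\<Sum>\<omega>\<in>Om. p \<omega> * (\<Sum>y\<in>V. K \<omega> x y * (\<Sum>z\<in>V. Pn k y z * \<Phi> x0 z))) = (\<Sum>y\<in>V. P x y * (\<Sum>z\<in>V. Pn k y z * \<Phi> x0 z))"
      by (rule step_swap)
    also have "\<dots> = (\<Sum>y\<in>V. \<Sum>z\<in>V. P x y * Pn k y z * \<Phi> x0 z)" by (simp add: sum_distrib_left mult.assoc)
    also have "\<dots> = (\<Sum>z\<in>V. \<Sum>y\<in>V. P x y * Pn k y z * \<Phi> x0 z)" by (rule sum.swap)
    finally show "(\<Sum>\<omega>\<in>Om. p \<omega> * (\<Sum>y\<in>V. K \<omega> x y * (\<Sum>z\<in>V. Pn k y z * \<Phi> x0 z))) = (\<Sum>z\<in>V. Pn (Suc k) x z * \<Phi> x0 z)"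
      by (simp add: sum_distrib_right)
  qed
  also have "\<dots> = (\<Sum>x\<in>V. \<Sum>z\<in>V. Pn l x0 x * Pn (Suc k) x z * \<Phi> x0 z)"
    by (simp only: sum_distrib_left mult.assoc)
  also have "\<dots> = (\<Sum>z\<in>V. \<Sum>x\<in>V. Pn l x0 x * Pn (Suc k) x z * \<Phi> x0 z)" by (rule sum.swap)
  also have "\<dots> = (\<Sum>z\<in>V. Pn (l + Suc k) x0 z * \<Phi> x0 z)"
    by (simp only: Pn_add[OF x0] sum_distrib_right)
  finally show "(\<Sum>x\<in>V. Pn l x0 x * (\<Sum>\<omega>\<in>Om. p \<omega> * (\<Sum>y\<in>V. K \<omega> x y * (\<Sum>z\<in>V. Pn k y z * \<Phi> x0 z)))) = (\<Sum>z\<in>V. Pn (l + Suc k) x0 z * \<Phi> x0 z)" .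
qed

end

text \<open>The index \<omega> that selects the kernel also carries a projection
  \<open>u \<omega>\<close> of the vectors \<open>v\<close>, subgaussian relative to their
  distances. In the application both come from the same coins: the kernel follows a matching that
  answers a cut of this very projection.\<close>

locale projected_walk = mixed_walk V \<pi> Om p K
  for V :: "'a set" and \<pi> :: "'a \<Rightarrow> real" and Om :: "'w set" and p :: "'w \<Rightarrow> real" and K :: "'w \<Rightarrow> 'a \<Rightarrow> 'a \<Rightarrow> real" +
  fixes I :: "'c set" and v :: "'a \<Rightarrow> 'c \<Rightarrow> real" and u :: "'w \<Rightarrow> 'a \<Rightarrow> real"
  assumes finI: "finite I"
    and mgf: "\<And>t x y. x \<in> V \<Longrightarrow> y \<in> V \<Longrightarrow>
       (\<Sum>\<omega>\<in>Om. p \<omega> * exp (t * (u \<omega> x - u \<omega> y))) \<le> exp (t\<^sup>2 / 2 * (\<Sum>c\<in>I. (v x c - v y c)\<^sup>2))"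
    and var: "\<And>x y. x \<in> V \<Longrightarrow> y \<in> V \<Longrightarrow>
       (\<Sum>\<omega>\<in>Om. p \<omega> * (u \<omega> x - u \<omega> y)\<^sup>2) \<le> (\<Sum>c\<in>I. (v x c - v y c)\<^sup>2)"
begin

definition N :: "'a \<Rightarrow> 'a \<Rightarrow> real" where "N x y = (\<Sum>c\<in>I. (v x c - v y c)\<^sup>2)"

definition W :: "nat \<Rightarrow> real" where "W k = (\<Sum>x\<in>V. \<pi> x * (\<Sum>z\<in>V. Pn k x z * N x z))"

lemma W_msd: "W k = (\<Sum>c\<in>I. msd (\<lambda>x. v x c) k)"
proof -
  have "W k = (\<Sum>x\<in>V. \<Sum>z\<in>V. \<Sum>c\<in>I. \<pi> x * (Pn k x z * (v x c - v z c)\<^sup>2))"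
    by (simp add: W_def N_def sum_distrib_left)
  also have "\<dots> = (\<Sum>x\<in>V. \<Sum>c\<in>I. \<Sum>z\<in>V. \<pi> x * (Pn k x z * (v x c - v z c)\<^sup>2))"
    by (intro sum.cong refl sum.swap)
  also have "\<dots> = (\<Sum>c\<in>I. \<Sum>x\<in>V. \<Sum>z\<in>V. \<pi> x * (Pn k x z * (v x c - v z c)\<^sup>2))" by (rule sum.swap)
  finally show ?thesis by (simp add: msd_def sum_distrib_left)
qed

lemma W_le: "W k \<le> real k * W 1"
  unfolding W_msd sum_distrib_left by (intro sum_mono msd_le)

definition avg_move :: real where
  "avg_move = (\<Sum>x\<in>V. \<pi> x * (\<Sum>\<omega>\<in>Om. p \<omega> * (\<Sum>y\<in>V. K \<omega> x y * \<bar>u \<omega> y - u \<omega> x\<bar>)))"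

text \<open>The test function correlates the direction of one step with the displacement of the
  whole path, both seen through the projection of that step. The step itself contributes its
  modulus, on average at least \<open>A\<close>. Past and future are independent of \<omega>, and by
  \<open>W_le\<close> their variances add up to at most \<open>2 * real k * B\<close>, too little to
  cancel it for \<open>k\<close> in the stated range.\<close>

lemma entropy_doubling:
  assumes A: "0 < A" "A \<le> avg_move" and V: "W 1 \<le> B" "0 < B" and k: "1 \<le> k" "real k \<le> A\<^sup>2 / (32 * B)"
  shows "A\<^sup>2 / (32 * B) \<le> walk_entropy (2 * k) - walk_entropy k"
proof -
  \<comment> \<open>Maximizes \<open>t * (A / 2) - t\<^sup>2 * real k * B\<close>.\<close>
  define t where "t = A / (4 * real k * B)"
  define d where "d = A\<^sup>2 / (32 * B)"
  \<comment> \<open>Weight for converting absolute values into squares. With this choice past and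
    future cost at most 3/8 of \<open>A\<close> altogether, less than the half that is given
    away.\<close>
  define c where "c = A / 4"
  have k0: "0 < real k" using k by simp
  have t: "0 < t" using A V k by (simp add: t_def)
  have c: "0 < c" using A by (simp add: c_def)
  \<comment> \<open>The term in \<open>N\<close> normalizes the exponential moment of the
    projection. The sign varies with \<omega> and is dominated by the sum over both signs; the
    factor 2 lost there is what \<open>ln 2\<close> removes.\<close>
  define F where "F x0 z e = (case e of (\<omega>, x, y) \<Rightarrow> t * (sgn (u \<omega> y - u \<omega> x) * (u \<omega> z - u \<omega> x0)) - t\<^sup>2 / 2 * N z x0 - ln 2)" for x0 z e
  have Fexp: "(\<Sum>\<omega>\<in>Om. p \<omega> * (\<Sum>y\<in>V. K \<omega> x y * exp (F x0 z (\<omega>, x, y)))) \<le> 1"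
    if x0: "x0 \<in> V" and z: "z \<in> V" and x: "x \<in> V" for x0 z x
  proof -
    define b where "b = exp (- (t\<^sup>2 / 2 * N z x0)) / 2"
    have pt: "exp (F x0 z (\<omega>, x, y)) \<le> b * (exp (t * (u \<omega> z - u \<omega> x0)) + exp ((- t) * (u \<omega> z - u \<omega> x0)))" for \<omega> y
    proof -
      let ?w = "t * (u \<omega> z - u \<omega> x0)" and ?s = "sgn (u \<omega> y - u \<omega> x)"
      have "?s = 1 \<or> ?s = -1 \<or> ?s = 0" by (simp add: sgn_if)
      moreover have "1 \<le> exp ?w + exp (- ?w)"
        by (smt (verit) exp_ge_zero one_le_exp_iff)
      ultimately have "exp (?s * ?w) \<le> exp ?w + exp (- ?w)"
        by (elim disjE) simp_all
      moreover have "F x0 z (\<omega>, x, y) = - (t\<^sup>2 / 2 * N z x0) + ?s * ?w - ln 2"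
        by (simp add: F_def algebra_simps)
      then have "exp (F x0 z (\<omega>, x, y)) = b * exp (?s * ?w)"
        by (simp only: exp_diff exp_add b_def exp_ln zero_less_numeral)
      ultimately show ?thesis by (simp add: b_def)
    qed
    have "(\<Sum>\<omega>\<in>Om. p \<omega> * (\<Sum>y\<in>V. K \<omega> x y * exp (F x0 z (\<omega>, x, y))))
       \<le> (\<Sum>\<omega>\<in>Om. p \<omega> * (\<Sum>y\<in>V. K \<omega> x y * (b * (exp (t * (u \<omega> z - u \<omega> x0)) + exp ((- t) * (u \<omega> z - u \<omega> x0))))))"
      by (intro sum_mono mult_left_mono p0 K0 x pt)
    also have "\<dots> = b * ((\<Sum>\<omega>\<in>Om. p \<omega> * exp (t * (u \<omega> z - u \<omega> x0))) + (\<Sum>\<omega>\<in>Om. p \<omega> * exp ((- t) * (u \<omega> z - u \<omega> x0))))"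
    proof -
      have "(\<Sum>y\<in>V. K \<omega> x y * a) = a" if "\<omega> \<in> Om" for \<omega> a
        using K1[OF that x] by (simp add: sum_distrib_right[symmetric])
      then have "(\<Sum>\<omega>\<in>Om. p \<omega> * (\<Sum>y\<in>V. K \<omega> x y * (b * (exp (t * (u \<omega> z - u \<omega> x0)) + exp ((- t) * (u \<omega> z - u \<omega> x0))))))
        = (\<Sum>\<omega>\<in>Om. p \<omega> * (b * (exp (t * (u \<omega> z - u \<omega> x0)) + exp ((- t) * (u \<omega> z - u \<omega> x0)))))"
        by (intro sum.cong[OF refl] arg_cong2[where f="(*)", OF refl])
      then show ?thesis by (simp add: sum_distrib_left sum.distrib distrib_left mult.left_commute)
    qed
    also have "\<dots> \<le> b * (exp (t\<^sup>2 / 2 * N z x0) + exp ((- t)\<^sup>2 / 2 * N z x0))"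
      unfolding N_def using mgf[OF z x0, of t] mgf[OF z x0, of "- t"]
      by (intro mult_left_mono add_mono) (auto simp: b_def)
    also have "\<dots> = 1" by (simp add: b_def exp_minus field_simps)
    finally show ?thesis .
  qed
  have low: "t * (A / 2) - t\<^sup>2 * real k * B - ln 2 \<le> EE l (k - 1 - l + k) (\<lambda>x0 \<omega> x y z. F x0 z (\<omega>, x, y))" if l: "l < k" for l
  proof -
    let ?j = "k - 1 - l + k"
    have "EE l ?j (\<lambda>x0 \<omega> x y z. (t * \<bar>u \<omega> y - u \<omega> x\<bar> - t * c) - t / (2 * c) * (u \<omega> z - u \<omega> y)\<^sup>2 - t / (2 * c) * (u \<omega> x - u \<omega> x0)\<^sup>2 - t\<^sup>2 / 2 * N z x0 - ln 2)
      \<le> EE l ?j (\<lambda>x0 \<omega> x y z. F x0 z (\<omega>, x, y))"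
    proof (rule EE_mono)
      fix x0 \<omega> x y z
      have am: "\<bar>g\<bar> \<le> c / 2 + g\<^sup>2 / (2 * c)" for g
      proof -
        have "0 \<le> (\<bar>g\<bar> - c)\<^sup>2" by simp
        then have "2 * c * \<bar>g\<bar> \<le> c * c + g\<^sup>2" by (simp add: power2_diff power2_eq_square algebra_simps)
        then show ?thesis using c by (simp add: field_simps power2_eq_square)
      qed
      let ?s = "sgn (u \<omega> y - u \<omega> x)"
      have "?s * (u \<omega> z - u \<omega> x0) = ?s * (u \<omega> y - u \<omega> x) + ?s * (u \<omega> z - u \<omega> y) + ?s * (u \<omega> x - u \<omega> x0)"
        by (simp add: algebra_simps)
      moreover have "?s * (u \<omega> y - u \<omega> x) = \<bar>u \<omega> y - u \<omega> x\<bar>" by (simp add: abs_sgn mult.commute)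
      moreover have "- \<bar>g\<bar> \<le> ?s * g" for g by (auto simp: sgn_if)
      ultimately have "\<bar>u \<omega> y - u \<omega> x\<bar> - c - (u \<omega> z - u \<omega> y)\<^sup>2 / (2 * c) - (u \<omega> x - u \<omega> x0)\<^sup>2 / (2 * c) \<le> ?s * (u \<omega> z - u \<omega> x0)"
        using am[of "u \<omega> z - u \<omega> y"] am[of "u \<omega> x - u \<omega> x0"] by (smt (verit) field_sum_of_halves)
      then have "t * (\<bar>u \<omega> y - u \<omega> x\<bar> - c - (u \<omega> z - u \<omega> y)\<^sup>2 / (2 * c) - (u \<omega> x - u \<omega> x0)\<^sup>2 / (2 * c)) \<le> t * (?s * (u \<omega> z - u \<omega> x0))"
        using t by (intro mult_left_mono) auto
      then show "(t * \<bar>u \<omega> y - u \<omega> x\<bar> - t * c) - t / (2 * c) * (u \<omega> z - u \<omega> y)\<^sup>2 - t / (2 * c) * (u \<omega> x - u \<omega> x0)\<^sup>2 - t\<^sup>2 / 2 * N z x0 - ln 2 \<le> F x0 z (\<omega>, x, y)"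
        by (simp add: F_def algebra_simps)
    qed
    also have "EE l ?j (\<lambda>x0 \<omega> x y z. (t * \<bar>u \<omega> y - u \<omega> x\<bar> - t * c) - t / (2 * c) * (u \<omega> z - u \<omega> y)\<^sup>2 - t / (2 * c) * (u \<omega> x - u \<omega> x0)\<^sup>2 - t\<^sup>2 / 2 * N z x0 - ln 2)
      = (t * EE l ?j (\<lambda>x0 \<omega> x y z. \<bar>u \<omega> y - u \<omega> x\<bar>) - t * c) - t / (2 * c) * EE l ?j (\<lambda>x0 \<omega> x y z. (u \<omega> z - u \<omega> y)\<^sup>2)
        - t / (2 * c) * EE l ?j (\<lambda>x0 \<omega> x y z. (u \<omega> x - u \<omega> x0)\<^sup>2) - t\<^sup>2 / 2 * EE l ?j (\<lambda>x0 \<omega> x y z. N z x0) - ln 2"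
      by (simp only: EE_diff EE_scale EE_const)
    also have "EE l ?j (\<lambda>x0 \<omega> x y z. \<bar>u \<omega> y - u \<omega> x\<bar>) = avg_move"
      unfolding avg_move_def by (rule EE_step)
    finally have 1: "(t * avg_move - t * c) - t / (2 * c) * EE l ?j (\<lambda>x0 \<omega> x y z. (u \<omega> z - u \<omega> y)\<^sup>2)
        - t / (2 * c) * EE l ?j (\<lambda>x0 \<omega> x y z. (u \<omega> x - u \<omega> x0)\<^sup>2) - t\<^sup>2 / 2 * EE l ?j (\<lambda>x0 \<omega> x y z. N z x0) - ln 2
        \<le> EE l ?j (\<lambda>x0 \<omega> x y z. F x0 z (\<omega>, x, y))" .
    have Wb: "W j \<le> real j * B" for j using W_le[of j] V by (smt (verit) mult_left_mono of_nat_0_le_iff)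
    have Nsym: "N x y = N y x" for x y by (simp add: N_def power2_commute)
    have e2: "EE l ?j (\<lambda>x0 \<omega> x y z. (u \<omega> z - u \<omega> y)\<^sup>2) \<le> real ?j * B"
    proof -
      have "EE l ?j (\<lambda>x0 \<omega> x y z. (u \<omega> z - u \<omega> y)\<^sup>2) \<le> W ?j"
        unfolding EE_future W_def N_def using var
        by (intro sum_mono mult_left_mono less_imp_le[OF pos] Pn0) (auto simp: power2_commute)
      then show ?thesis using Wb[of ?j] by simp
    qed
    have e3: "EE l ?j (\<lambda>x0 \<omega> x y z. (u \<omega> x - u \<omega> x0)\<^sup>2) \<le> real l * B"
    proof -
      have "EE l ?j (\<lambda>x0 \<omega> x y z. (u \<omega> x - u \<omega> x0)\<^sup>2) \<le> W l"
        unfolding EE_past W_def N_def using var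
        by (intro sum_mono mult_left_mono less_imp_le[OF pos] Pn0) (auto simp: power2_commute)
      then show ?thesis using Wb[of l] by simp
    qed
    have e4: "EE l ?j (\<lambda>x0 \<omega> x y z. N z x0) \<le> real (2 * k) * B"
    proof -
      have "l + Suc ?j = 2 * k" using l by simp
      then have "EE l ?j (\<lambda>x0 \<omega> x y z. N z x0) = W (2 * k)"
        unfolding EE_ends W_def by (simp only: Nsym)
      then show ?thesis using Wb[of "2 * k"] by simp
    qed
    have tc: "0 \<le> t / (2 * c)" using t c by simp
    have "real ?j * B + real l * B \<le> 2 * real k * B"
    proof -
      have "real ?j + real l \<le> 2 * real k" using l by simp
      then have "(real ?j + real l) * B \<le> (2 * real k) * B" using V by (intro mult_right_mono) auto
      then show ?thesis by (simp add: algebra_simps)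
    qed
    then have "EE l ?j (\<lambda>x0 \<omega> x y z. (u \<omega> z - u \<omega> y)\<^sup>2) + EE l ?j (\<lambda>x0 \<omega> x y z. (u \<omega> x - u \<omega> x0)\<^sup>2) \<le> 2 * real k * B"
      using e2 e3 by linarith
    from mult_left_mono[OF this tc]
    have 2: "t / (2 * c) * EE l ?j (\<lambda>x0 \<omega> x y z. (u \<omega> z - u \<omega> y)\<^sup>2) + t / (2 * c) * EE l ?j (\<lambda>x0 \<omega> x y z. (u \<omega> x - u \<omega> x0)\<^sup>2) \<le> t * (real k * B / c)"
      using c by (simp add: distrib_left)
    have 3: "t\<^sup>2 / 2 * EE l ?j (\<lambda>x0 \<omega> x y z. N z x0) \<le> t\<^sup>2 * real k * B"
      using mult_left_mono[OF e4, of "t\<^sup>2 / 2"] by simp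
    have "real k * B / c \<le> A / 8"
    proof -
      have "real k * (32 * B) \<le> A\<^sup>2" using k V by (simp add: pos_le_divide_eq)
      then show ?thesis using A by (simp add: c_def divide_le_eq power2_eq_square)
    qed
    then have "t * (real k * B / c) \<le> t * (A / 8)" using t by (intro mult_left_mono) auto
    moreover have "t * A \<le> t * avg_move" using A t by (intro mult_left_mono) auto
    moreover have "t * c = t * (A / 4)" by (simp add: c_def)
    moreover have "0 \<le> t * A" using t A by simp
    moreover have "t * (A / 8) = t * A / 8" "t * (A / 4) = t * A / 4" "t * (A / 2) = t * A / 2" by simp_all
    ultimately have 4: "t * (A / 2) \<le> (t * avg_move - t * c) - t * (real k * B / c)" by linarith
    show ?thesis using 1 2 3 4 by linarith
  qed
  have td: "t * (A / 2) - t\<^sup>2 * real k * B = 2 * d / real k"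
    using A V k by (simp add: t_def d_def field_simps power2_eq_square)
  \<comment> \<open>Over all \<open>k\<close> steps the gain is \<open>2 * d\<close>, and the copies
    of \<open>ln 2\<close> cost at most \<open>k\<close>, hence at most \<open>d\<close>.\<close>
  have "d \<le> real k * (2 * d / real k - ln 2)"
  proof -
    have "ln 2 \<le> (1::real)" using ln_2_less_1 by simp
    then have "real k * ln 2 \<le> real k * 1" by (intro mult_left_mono) auto
    then have "real k * ln 2 \<le> d" using k unfolding d_def by linarith
    then show ?thesis using k0 by (simp add: right_diff_distrib)
  qed
  also have "\<dots> = (\<Sum>l<k. t * (A / 2) - t\<^sup>2 * real k * B - ln 2)"
    by (simp only: td sum_constant card_lessThan)
  also have "\<dots> \<le> (\<Sum>l<k. EE l (k - 1 - l + k) (\<lambda>x0 \<omega> x y z. F x0 z (\<omega>, x, y)))"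
    using low by (intro sum_mono) auto
  also have "\<dots> = (\<Sum>x\<in>V. \<pi> x * pathE k x (\<lambda>es. \<Sum>z\<in>V. Pn k (lst x es) z * sum_list (map (F x z) es)))"
    unfolding EE_def
    by (subst sum.swap) (simp add: pathE_additive[where g = "\<lambda>e z. F x z e" for x] sum_distrib_left)
  also have "\<dots> \<le> walk_entropy (2 * k) - walk_entropy k" by (rule entropy_gain[OF Fexp])
  finally show ?thesis by (simp add: d_def)
qed

text \<open>Doubling from time 1 stays within the range of \<open>entropy_doubling\<close> at least
  \<open>S + 1\<close> times, and every doubling earns the same amount. The factor
  \<open>S + 1\<close> is what later outweighs constants depending on \<delta>.\<close>

lemma entropy_bound:
  assumes A: "0 < A" "A \<le> avg_move" and V: "W 1 \<le> B" "0 < B" and S: "2 ^ S \<le> A\<^sup>2 / (32 * B)" and ne: "V \<noteq> {}"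
  shows "real (S + 1) * (A\<^sup>2 / (32 * B)) \<le> ln (real (card V))"
proof -
  have "real (s + 1) * (A\<^sup>2 / (32 * B)) \<le> walk_entropy (2 ^ (s + 1))" if "s \<le> S" for s
    using that
  proof (induction s)
    case 0
    have "(1::real) \<le> 2 ^ S" by simp
    then have "real 1 \<le> A\<^sup>2 / (32 * B)" using S by linarith
    then have "A\<^sup>2 / (32 * B) \<le> walk_entropy (2 * 1) - walk_entropy 1" by (intro entropy_doubling A V) auto
    then show ?case using walk_entropy_nonneg[of 1] by simp
  next
    case (Suc s)
    have "(2::real) ^ (s + 1) \<le> 2 ^ S" using Suc.prems by (intro power_increasing) auto
    then have "real (2 ^ (s + 1)) \<le> A\<^sup>2 / (32 * B)" using S by simp
    then have g: "A\<^sup>2 / (32 * B) \<le> walk_entropy (2 * 2 ^ (s + 1)) - walk_entropy (2 ^ (s + 1))" by (intro entropy_doubling A V) auto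
    have e: "real (Suc s + 1) * X = real (s + 1) * X + X" "(2::nat) ^ (Suc s + 1) = 2 * 2 ^ (s + 1)" for X
      by (simp_all add: algebra_simps)
    show ?case unfolding e using g Suc.IH[OF Suc_leD[OF Suc.prems]] by linarith
  qed
  from this[of S] walk_entropy_le[OF ne, of "2 ^ (S + 1)"] show ?thesis by simp
qed

end


section \<open>Random signs\<close>

definition coin_avg :: "nat \<Rightarrow> (bool list \<Rightarrow> real) \<Rightarrow> real" where
  "coin_avg F f = (\<Sum>bs | length bs = F. f bs) / 2 ^ F"

definition sg :: "bool \<Rightarrow> real" where "sg b = (if b then 1 else -1)"

definition rsum :: "nat \<Rightarrow> (nat \<Rightarrow> real) \<Rightarrow> bool list \<Rightarrow> real" where
  "rsum n w bs = (\<Sum>l<n. w l * sg (bs ! l))"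

definition blk :: "nat \<Rightarrow> nat \<Rightarrow> 'b list \<Rightarrow> 'b list" where
  "blk n k bs = take n (drop (k * n) bs)"

lemma finite_len: "finite {bs :: bool list. length bs = F}"
  using finite_lists_length_eq[of "UNIV :: bool set" F] by simp

lemma card_len: "card {bs :: bool list. length bs = F} = 2 ^ F"
  using card_lists_length_eq[of "UNIV :: bool set" F] by simp

lemma coin_avg_0 [simp]: "coin_avg 0 f = f []"
  by (simp add: coin_avg_def)

lemma coin_avg_Suc: "coin_avg (Suc F) f = (coin_avg F (\<lambda>x. f (False # x)) + coin_avg F (\<lambda>x. f (True # x))) / 2"
proof -
  have "{bs :: bool list. length bs = Suc F} = (#) False ` {bs. length bs = F} \<union> (#) True ` {bs. length bs = F}"
    by (force simp: length_Suc_conv)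
  then have "(\<Sum>bs | length bs = Suc F. f bs) = (\<Sum>bs\<in>(#) False ` {bs. length bs = F}. f bs) + (\<Sum>bs\<in>(#) True ` {bs. length bs = F}. f bs)"
    by (simp only:) (rule sum.union_disjoint, auto simp: finite_len)
  also have "\<dots> = (\<Sum>bs | length bs = F. f (False # bs)) + (\<Sum>bs | length bs = F. f (True # bs))"
    by (simp add: sum.reindex)
  finally show ?thesis by (simp add: coin_avg_def add_divide_distrib)
qed

lemma coin_avg_append: "coin_avg (a + b) f = coin_avg a (\<lambda>x. coin_avg b (\<lambda>y. f (x @ y)))"
  by (induction a arbitrary: f) (auto simp: coin_avg_Suc)

lemma coin_avg_mono: "(\<And>bs. length bs = F \<Longrightarrow> f bs \<le> g bs) \<Longrightarrow> coin_avg F f \<le> coin_avg F g"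
  by (auto simp: coin_avg_def intro!: divide_right_mono sum_mono)

lemma coin_avg_cong: "(\<And>bs. length bs = F \<Longrightarrow> f bs = g bs) \<Longrightarrow> coin_avg F f = coin_avg F g"
  by (auto simp: coin_avg_def intro!: arg_cong2[where f="(/)"] sum.cong)

lemma coin_avg_add: "coin_avg F (\<lambda>x. f x + g x) = coin_avg F f + coin_avg F g"
  by (simp add: coin_avg_def sum.distrib add_divide_distrib)

lemma coin_avg_diff: "coin_avg F (\<lambda>x. f x - g x) = coin_avg F f - coin_avg F g"
  by (simp add: coin_avg_def sum_subtractf diff_divide_distrib)

lemma coin_avg_scale: "coin_avg F (\<lambda>x. c * f x) = c * coin_avg F f"
  by (simp add: coin_avg_def sum_distrib_left)

lemma coin_avg_divide: "coin_avg F (\<lambda>x. f x / c) = coin_avg F f / c"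
  using coin_avg_scale[of F "1 / c" f] by simp

lemma coin_avg_const [simp]: "coin_avg F (\<lambda>_. c) = c"
  by (simp add: coin_avg_def card_len)

lemma coin_avg_sum: "coin_avg F (\<lambda>x. \<Sum>i\<in>S. f i x) = (\<Sum>i\<in>S. coin_avg F (f i))"
  unfolding coin_avg_def by (subst sum.swap) (simp add: sum_divide_distrib)

lemma coin_avg_nonneg: "(\<And>bs. length bs = F \<Longrightarrow> 0 \<le> f bs) \<Longrightarrow> 0 \<le> coin_avg F f"
  using coin_avg_mono[of F "\<lambda>_. 0" f] by simp

lemma blk_append:
  assumes "length x = K * n" "length y = n"
  shows "k < K \<Longrightarrow> blk n k (x @ y) = blk n k x" "blk n K (x @ y) = y"
proof -
  assume "k < K"
  then have "(k + 1) * n \<le> K * n" by (intro mult_right_mono) auto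
  then show "blk n k (x @ y) = blk n k x" using assms by (simp add: blk_def)
qed (use assms in \<open>simp add: blk_def\<close>)

text \<open>Independence of the disjoint blocks of one string of coins.\<close>

lemma coin_avg_prod_blk: "coin_avg (K * n) (\<lambda>bs. \<Prod>k<K. g (blk n k bs)) = (coin_avg n g) ^ K"
proof (induction K)
  case (Suc K)
  have "coin_avg (Suc K * n) (\<lambda>bs. \<Prod>k<Suc K. g (blk n k bs)) = coin_avg (K * n) (\<lambda>x. coin_avg n (\<lambda>y. \<Prod>k<Suc K. g (blk n k (x @ y))))"
    using coin_avg_append[of "K * n" n] by (simp add: add.commute)
  also have "\<dots> = coin_avg (K * n) (\<lambda>x. coin_avg n (\<lambda>y. (\<Prod>k<K. g (blk n k x)) * g y))"
  proof (intro coin_avg_cong)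
    fix x y :: "bool list" assume xy: "length x = K * n" "length y = n"
    then have "(\<Prod>k<K. g (blk n k (x @ y))) = (\<Prod>k<K. g (blk n k x))"
      by (intro prod.cong refl arg_cong[where f = g] blk_append(1)) auto
    then show "(\<Prod>k<Suc K. g (blk n k (x @ y))) = (\<Prod>k<K. g (blk n k x)) * g y"
      using xy by (simp add: blk_append)
  qed
  also have "\<dots> = coin_avg (K * n) (\<lambda>x. coin_avg n g * (\<Prod>k<K. g (blk n k x)))"
  proof (intro coin_avg_cong)
    fix x :: "bool list"
    show "coin_avg n (\<lambda>y. (\<Prod>k<K. g (blk n k x)) * g y) = coin_avg n g * (\<Prod>k<K. g (blk n k x))"
      by (subst coin_avg_scale) (rule mult.commute)
  qed
  also have "\<dots> = coin_avg n g ^ Suc K" by (simp add: coin_avg_scale Suc)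
  finally show ?case .
qed simp

lemma coin_avg_last_blk: "0 < K \<Longrightarrow> coin_avg (K * n) (\<lambda>bs. g (blk n (K - 1) bs)) = coin_avg n g"
proof -
  assume "0 < K"
  then obtain J where K: "K = Suc J" by (cases K) auto
  have "coin_avg (Suc J * n) (\<lambda>bs. g (blk n J bs)) = coin_avg (J * n) (\<lambda>x. coin_avg n (\<lambda>y. g (blk n J (x @ y))))"
    using coin_avg_append[of "J * n" n] by (simp add: add.commute)
  also have "\<dots> = coin_avg (J * n) (\<lambda>x. coin_avg n g)" by (intro coin_avg_cong) (simp add: blk_append)
  finally show ?thesis by (simp add: K)
qed

lemma rsum_Cons: "rsum (Suc n) w (b # bs) = w 0 * sg b + rsum n (\<lambda>l. w (Suc l)) bs"
  by (simp add: rsum_def sum.lessThan_Suc_shift del: sum.lessThan_Suc)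

lemma cosh_le_exp_half_square: "cosh (x::real) \<le> exp (x\<^sup>2 / 2)"
proof -
  have "cosh y \<le> exp (y\<^sup>2 / 2)" if "0 \<le> y" for y :: real
  proof -
    \<comment> \<open>The analytic part of Hoeffding's lemma for a fair coin on an interval of
      length \<open>2 * y\<close>.\<close>
    have "- (2 * y) * (1 / 2) + ln (1 + (1 / 2) * (exp (2 * y) - 1)) \<le> (2 * y)\<^sup>2 / 8"
      using that by (intro Hoeffdings_lemma_aux) auto
    then have "ln ((1 + exp (2 * y)) / 2) \<le> y + y\<^sup>2 / 2" by (simp add: power2_eq_square field_simps)
    then have "exp (ln ((1 + exp (2 * y)) / 2)) \<le> exp (y + y\<^sup>2 / 2)" by simp
    moreover have "exp (ln ((1 + exp (2 * y)) / 2)) = (1 + exp (2 * y)) / 2" by (intro exp_ln) (simp add: add_pos_pos)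
    ultimately have "(1 + exp (2 * y)) / 2 \<le> exp (y + y\<^sup>2 / 2)" by simp
    then have "(1 + exp (2 * y)) / 2 * exp (- y) \<le> exp (y + y\<^sup>2 / 2) * exp (- y)" by (intro mult_right_mono) auto
    moreover have "(1 + exp (2 * y)) / 2 * exp (- y) = cosh y"
      by (simp add: cosh_def field_simps exp_minus exp_add[symmetric] mult_2 exp_double power2_eq_square)
    ultimately show ?thesis by (simp add: exp_add[symmetric])
  qed
  from this[of "\<bar>x\<bar>"] show ?thesis by (simp add: cosh_real_abs)
qed

lemma sign_mgf: "coin_avg n (\<lambda>bs. exp (t * rsum n w bs)) \<le> exp (t\<^sup>2 / 2 * (\<Sum>l<n. (w l)\<^sup>2))"
proof (induction n arbitrary: w)
  case 0 then show ?case by (simp add: rsum_def)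
next
  case (Suc n)
  let ?w = "\<lambda>l. w (Suc l)"
  have "coin_avg (Suc n) (\<lambda>bs. exp (t * rsum (Suc n) w bs)) = cosh (t * w 0) * coin_avg n (\<lambda>bs. exp (t * rsum n ?w bs))"
  proof -
    have c: "coin_avg n (\<lambda>x. exp (t * (w 0 * sg b + rsum n ?w x))) = exp (t * (w 0 * sg b)) * coin_avg n (\<lambda>bs. exp (t * rsum n ?w bs))" for b
      by (simp add: distrib_left exp_add coin_avg_scale)
    show ?thesis unfolding coin_avg_Suc rsum_Cons c by (simp add: sg_def cosh_def algebra_simps)
  qed
  also have "\<dots> \<le> exp ((t * w 0)\<^sup>2 / 2) * exp (t\<^sup>2 / 2 * (\<Sum>l<n. (?w l)\<^sup>2))"
    by (intro mult_mono Suc cosh_le_exp_half_square coin_avg_nonneg) auto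
  also have "\<dots> = exp (t\<^sup>2 / 2 * (\<Sum>l<Suc n. (w l)\<^sup>2))"
    unfolding sum.lessThan_Suc_shift exp_add[symmetric] by (simp add: power_mult_distrib distrib_left)
  finally show ?case .
qed

lemma sign_mean: "coin_avg n (rsum n w) = 0"
proof (induction n arbitrary: w)
  case (Suc n)
  then show ?case by (simp add: coin_avg_Suc rsum_Cons sg_def coin_avg_add coin_avg_diff)
qed (simp add: rsum_def)

lemma sign_second: "coin_avg n (\<lambda>bs. (rsum n w bs)\<^sup>2) = (\<Sum>l<n. (w l)\<^sup>2)"
proof (induction n arbitrary: w)
  case 0 then show ?case by (simp add: rsum_def)
next
  case (Suc n)
  let ?w = "\<lambda>l. w (Suc l)"
  have "coin_avg n (\<lambda>bs. (c + rsum n ?w bs)\<^sup>2) = c\<^sup>2 + (\<Sum>l<n. (?w l)\<^sup>2)" for c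
    using Suc[of ?w] sign_mean[of n ?w] by (simp add: power2_sum coin_avg_add coin_avg_scale mult.assoc)
  from this[of "w 0"] this[of "- w 0"] show ?case
    unfolding sum.lessThan_Suc_shift by (simp add: coin_avg_Suc rsum_Cons sg_def)
qed

lemma power_le_fact_cosh: "(x::real) ^ (2 * p) \<le> fact (2 * p) * cosh x"
proof -
  have s: "(\<lambda>n. if even n then x ^ n /\<^sub>R fact n else 0) sums cosh x" by (rule cosh_converges)
  have "(if even (2 * p) then x ^ (2 * p) /\<^sub>R fact (2 * p) else 0) \<le> cosh x"
    using sum_le_suminf[OF sums_summable[OF s], of "{2 * p}"] sums_unique[OF s]
    by (auto simp: zero_le_even_power)
  then show ?thesis by (simp add: field_simps)
qed

text \<open>A single term of the power series of cosh bounds the moment by the exponential moment at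
  \<open>t\<close>. The bound is best at \<open>t\<^sup>2 = 2 * real p / s\<close>, which produces
  \<open>exp (real p)\<close>.\<close>

lemma sign_even_moment:
  assumes s: "(\<Sum>l<n. (w l)\<^sup>2) = s" "0 < s" and p: "1 \<le> p"
  shows "coin_avg n (\<lambda>bs. (rsum n w bs) ^ (2 * p)) \<le> fact (2 * p) * exp (real p) * (s / (2 * real p)) ^ p"
proof -
  define t where "t = sqrt (2 * real p / s)"
  have t2: "t\<^sup>2 = 2 * real p / s" and t0: "0 < t" using s p by (auto simp: t_def)
  have tp: "t ^ (2 * p) = (2 * real p / s) ^ p" by (simp add: power_mult t2)
  have tt: "(s / (2 * real p)) ^ p * t ^ (2 * p) = 1"
    unfolding tp power_mult_distrib[symmetric] using s p by simp
  have "(rsum n w bs) ^ (2 * p) \<le> (s / (2 * real p)) ^ p * (fact (2 * p) * ((exp (t * rsum n w bs) + exp ((- t) * rsum n w bs)) / 2))" for bs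
  proof -
    have "(rsum n w bs) ^ (2 * p) = (s / (2 * real p)) ^ p * (t * rsum n w bs) ^ (2 * p)"
      using tt by (simp add: power_mult_distrib)
    also have "\<dots> \<le> (s / (2 * real p)) ^ p * (fact (2 * p) * cosh (t * rsum n w bs))"
      using s by (intro mult_left_mono power_le_fact_cosh) auto
    finally show ?thesis by (simp add: cosh_def)
  qed
  then have "coin_avg n (\<lambda>bs. (rsum n w bs) ^ (2 * p)) \<le> coin_avg n (\<lambda>bs. (s / (2 * real p)) ^ p * (fact (2 * p) * ((exp (t * rsum n w bs) + exp ((- t) * rsum n w bs)) / 2)))"
    by (intro coin_avg_mono)
  also have "\<dots> = (s / (2 * real p)) ^ p * (fact (2 * p) * ((coin_avg n (\<lambda>bs. exp (t * rsum n w bs)) + coin_avg n (\<lambda>bs. exp ((- t) * rsum n w bs))) / 2))"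
    by (simp only: coin_avg_scale coin_avg_divide coin_avg_add)
  also have "\<dots> \<le> (s / (2 * real p)) ^ p * (fact (2 * p) * ((exp (t\<^sup>2 / 2 * s) + exp ((- t)\<^sup>2 / 2 * s)) / 2))"
    using sign_mgf[where t = t and w = w and n = n] sign_mgf[where t = "- t" and w = w and n = n] s
    by (intro mult_left_mono divide_right_mono add_mono) auto
  also have "\<dots> = (s / (2 * real p)) ^ p * (fact (2 * p) * exp (real p))"
    using s by (simp add: t2)
  finally show ?thesis by (simp add: mult_ac)
qed

text \<open>Expanding the fourth power would give the constant 3; the general moment bound gives 24
  e^2 / 16, which is at most 12.\<close>

lemma sign_fourth: "coin_avg n (\<lambda>bs. (rsum n w bs) ^ 4) \<le> 12 * (\<Sum>l<n. (w l)\<^sup>2)\<^sup>2"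
proof (cases "(\<Sum>l<n. (w l)\<^sup>2) = 0")
  case True
  then have "\<forall>l\<in>{..<n}. (w l)\<^sup>2 = 0" by (subst sum_nonneg_eq_0_iff[symmetric]) auto
  then have "rsum n w bs = 0" for bs by (simp add: rsum_def)
  then show ?thesis by simp
next
  case False
  then have s: "0 < (\<Sum>l<n. (w l)\<^sup>2)" by (simp add: less_le sum_nonneg)
  have e: "exp (2::real) \<le> 8"
  proof -
    have "exp (2::real) = exp 1 * exp 1" by (simp add: exp_add[symmetric])
    also have "\<dots> \<le> (2.8::real) * 2.8" using e_less_272 by (intro mult_mono) auto
    finally show ?thesis by simp
  qed
  have "coin_avg n (\<lambda>bs. (rsum n w bs) ^ 4) \<le> fact 4 * exp 2 * ((\<Sum>l<n. (w l)\<^sup>2) / 4)\<^sup>2"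
    using sign_even_moment[OF refl s, of 2] by simp
  also have "\<dots> = (24 / 16) * exp 2 * (\<Sum>l<n. (w l)\<^sup>2)\<^sup>2" by (simp add: fact_numeral power_divide)
  also have "\<dots> \<le> (24 / 16) * 8 * (\<Sum>l<n. (w l)\<^sup>2)\<^sup>2" using e by (intro mult_right_mono mult_left_mono) auto
  finally show ?thesis by simp
qed

lemma fact_double_le: "(fact (2 * p) :: real) \<le> fact p * (2 * real p) ^ p"
proof -
  have "(fact (p + j) :: real) \<le> fact p * real (p + j) ^ j" for j
  proof (induction j)
    case (Suc j)
    have "(fact (p + Suc j) :: real) = real (p + Suc j) * fact (p + j)" by simp
    also have "\<dots> \<le> real (p + Suc j) * (fact p * real (p + j) ^ j)" by (intro mult_left_mono Suc) auto
    also have "\<dots> \<le> real (p + Suc j) * (fact p * real (p + Suc j) ^ j)"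
      by (intro mult_left_mono power_mono) auto
    finally show ?case by (simp add: mult_ac)
  qed simp
  from this[of p] show ?thesis by (simp only: mult_2[symmetric] of_nat_mult of_nat_numeral)
qed

text \<open>By \<open>fact_double_le\<close> the \<open>p\<close>-th term of the exponential series
  has mean at most \<open>(exp 1 / 8) ^ p\<close>. The 8 is large enough for the geometric series to
  sum to less than \<open>exp (1 / 2)\<close>.\<close>

lemma sign_exp_square:
  assumes s: "(\<Sum>l<n. (w l)\<^sup>2) = s" "0 < s"
  shows "coin_avg n (\<lambda>bs. exp ((rsum n w bs)\<^sup>2 / (8 * s))) \<le> exp (1 / 2)"
proof -
  define f where "f p bs = ((rsum n w bs)\<^sup>2 / (8 * s)) ^ p / fact p" for p bs
  have e1: "exp 1 / 8 < (0.34 :: real)" using e_less_272 by simp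
  have fs: "(\<lambda>p. f p bs) sums exp ((rsum n w bs)\<^sup>2 / (8 * s))" for bs
  proof -
    have c: "z ^ p / fact p = z ^ p /\<^sub>R fact p" for z :: real and p
      by (simp add: divide_inverse mult.commute)
    show ?thesis unfolding f_def c by (rule exp_converges)
  qed
  have "(\<lambda>p. coin_avg n (f p)) sums coin_avg n (\<lambda>bs. exp ((rsum n w bs)\<^sup>2 / (8 * s)))"
    unfolding coin_avg_def by (intro sums_divide sums_sum fs)
  moreover have gs: "(\<lambda>p. (exp 1 / 8 :: real) ^ p) sums (1 / (1 - exp 1 / 8))"
    using e1 by (intro geometric_sums) auto
  moreover have "coin_avg n (f p) \<le> (exp 1 / 8) ^ p" for p
  proof (cases "p = 0")
    case True
    have "f 0 = (\<lambda>_. 1)" by (simp add: f_def fun_eq_iff)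
    then show ?thesis using True by simp
  next
    case False
    then have p: "1 \<le> p" by simp
    have "coin_avg n (f p) = coin_avg n (\<lambda>bs. (rsum n w bs) ^ (2 * p)) / ((8 * s) ^ p * fact p)"
    proof -
      have "f p = (\<lambda>bs. (rsum n w bs) ^ (2 * p) / ((8 * s) ^ p * fact p))"
        by (simp add: f_def fun_eq_iff power_divide power_mult power_mult_distrib)
      then show ?thesis by (simp only: coin_avg_divide)
    qed
    also have "\<dots> \<le> (fact (2 * p) * exp (real p) * (s / (2 * real p)) ^ p) / ((8 * s) ^ p * fact p)"
      using s by (intro divide_right_mono sign_even_moment p) auto
    also have "\<dots> \<le> (fact p * (2 * real p) ^ p * exp (real p) * (s / (2 * real p)) ^ p) / ((8 * s) ^ p * fact p)"
      using s by (intro divide_right_mono mult_right_mono fact_double_le) auto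
    also have "\<dots> = (exp 1 / 8) ^ p"
      using s p by (simp add: power_divide power_mult_distrib exp_of_nat_mult[symmetric] field_simps)
    finally show ?thesis .
  qed
  ultimately have "coin_avg n (\<lambda>bs. exp ((rsum n w bs)\<^sup>2 / (8 * s))) \<le> 1 / (1 - exp 1 / 8)"
    by (rule sums_le[rotated]) 
  also have "\<dots> \<le> 1 / (0.66::real)" using e1 by (intro divide_left_mono) auto
  also have "\<dots> \<le> 1 + 1 / 2 + (1 / 2)\<^sup>2 / 2" by (simp add: power2_eq_square)
  also have "\<dots> \<le> exp (1 / 2 :: real)" by (rule exp_lower_Taylor_quadratic) simp
  finally show ?thesis .
qed

lemma exp_minus_le_quadratic: "0 \<le> y \<Longrightarrow> exp (- y) \<le> 1 - y + y\<^sup>2 / (2::real)"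
proof -
  assume y: "0 \<le> y"
  have "1 + y + y\<^sup>2 / 2 \<le> exp y" by (rule exp_lower_Taylor_quadratic[OF y])
  moreover have "1 \<le> (1 - y + y\<^sup>2 / 2) * (1 + y + y\<^sup>2 / 2)"
  proof -
    have "(1 - y + y\<^sup>2 / 2) * (1 + y + y\<^sup>2 / 2) = 1 + (y\<^sup>2)\<^sup>2 / 4"
      by (simp add: field_simps power2_eq_square)
    then show ?thesis by simp
  qed
  moreover have "0 < 1 - y + y\<^sup>2 / 2"
    using sum_power2_gt_zero_iff[of "1 - y" 1] by (simp add: power2_eq_square algebra_simps)
  ultimately have "1 \<le> (1 - y + y\<^sup>2 / 2) * exp y"
    by (meson less_imp_le mult_left_mono order_trans)
  then have "1 * exp (- y) \<le> (1 - y + y\<^sup>2 / 2) * exp y * exp (- y)" by (intro mult_right_mono) auto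
  then show ?thesis by (simp add: mult.assoc exp_add[symmetric])
qed

text \<open>With x in place of 1/12, second and fourth moment give the bound 1 - x + 6 x^2, the 6
  being half the constant of \<open>sign_fourth\<close>; its minimum is at x = 1/12.\<close>

lemma sign_exp_minus_square:
  assumes s: "(\<Sum>l<n. (w l)\<^sup>2) = s" "0 < s"
  shows "coin_avg n (\<lambda>bs. exp (- ((rsum n w bs)\<^sup>2 / (12 * s)))) \<le> exp (- (1 / 24))"
proof -
  have "coin_avg n (\<lambda>bs. exp (- ((rsum n w bs)\<^sup>2 / (12 * s)))) \<le> coin_avg n (\<lambda>bs. 1 - (rsum n w bs)\<^sup>2 / (12 * s) + (rsum n w bs) ^ 4 / (288 * s\<^sup>2))"
  proof (rule coin_avg_mono)
    fix bs
    have "exp (- ((rsum n w bs)\<^sup>2 / (12 * s))) \<le> 1 - (rsum n w bs)\<^sup>2 / (12 * s) + ((rsum n w bs)\<^sup>2 / (12 * s))\<^sup>2 / 2"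
      using s by (intro exp_minus_le_quadratic) auto
    then show "exp (- ((rsum n w bs)\<^sup>2 / (12 * s))) \<le> 1 - (rsum n w bs)\<^sup>2 / (12 * s) + (rsum n w bs) ^ 4 / (288 * s\<^sup>2)"
      by (simp add: power_divide power_mult_distrib)
  qed
  also have "\<dots> = 1 - s / (12 * s) + coin_avg n (\<lambda>bs. (rsum n w bs) ^ 4) / (288 * s\<^sup>2)"
    using s by (simp only: coin_avg_add coin_avg_diff coin_avg_divide coin_avg_const sign_second)
  also have "\<dots> \<le> 1 - s / (12 * s) + 12 * s\<^sup>2 / (288 * s\<^sup>2)"
    using sign_fourth[of n w] s by (intro add_left_mono divide_right_mono) auto
  also have "\<dots> = 1 + (- (1 / 24))" using s by simp
  also have "\<dots> \<le> exp (- (1 / 24))" by (rule exp_ge_add_one_self)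
  finally show ?thesis .
qed

text \<open>Khintchine's lower bound from second and fourth moments alone: the modulus dominates a
  combination of the square and the fourth power. The inequality
  \<open>t \<le> 1 + (4 / 27) * t ^ 3\<close> behind it is tangent at t = 3/2.\<close>

lemma sign_abs_ge:
  "sqrt (\<Sum>l<n. (w l)\<^sup>2) / 4 \<le> coin_avg n (\<lambda>bs. \<bar>rsum n w bs\<bar>)"
proof (cases "(\<Sum>l<n. (w l)\<^sup>2) = 0")
  case True then show ?thesis by (simp add: coin_avg_nonneg)
next
  case False
  define r where "r = sqrt (\<Sum>l<n. (w l)\<^sup>2)"
  have r: "0 < r" "r\<^sup>2 = (\<Sum>l<n. (w l)\<^sup>2)" using False by (auto simp: r_def less_le sum_nonneg)
  have pt: "x\<^sup>2 / (2 * r) - (4 / 27) * (x ^ 4 / (8 * r ^ 3)) \<le> \<bar>x\<bar>" for x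
  proof -
    define t where "t = \<bar>x\<bar> / (2 * r)"
    have t: "0 \<le> t" "\<bar>x\<bar> = t * (2 * r)" using r by (auto simp: t_def)
    have "0 \<le> (2 * t - 3)\<^sup>2 * (t + 3)" using t by simp
    then have "t \<le> 1 + (4 / 27) * t ^ 3" by (simp add: power2_eq_square power3_eq_cube algebra_simps)
    then have "t * (2 * r) * t \<le> t * (2 * r) * (1 + (4 / 27) * t ^ 3)" using t r by (intro mult_left_mono) auto
    moreover have "x\<^sup>2 / (2 * r) = t * (2 * r) * t"
      using r t(2) by (metis (no_types, lifting) t_def power2_abs power2_eq_square times_divide_eq_right mult.assoc)
    moreover have "x ^ 4 / (8 * r ^ 3) = t * (2 * r) * t ^ 3"
    proof -
      have "x ^ 4 = \<bar>x\<bar> ^ 4" by simp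
      also have "\<dots> = (t * (2 * r)) ^ 4" using t(2) by simp
      finally show ?thesis using r by (simp add: power_mult_distrib field_simps power4_eq_xxxx power3_eq_cube)
    qed
    ultimately show ?thesis using t(2) by (simp add: algebra_simps)
  qed
  have "r / 4 \<le> r\<^sup>2 / (2 * r) - (4 / 27) * (12 * (r\<^sup>2)\<^sup>2 / (8 * r ^ 3))"
    using r(1) by (simp add: field_simps power2_eq_square power3_eq_cube)
  also have "\<dots> \<le> r\<^sup>2 / (2 * r) - (4 / 27) * (coin_avg n (\<lambda>bs. (rsum n w bs) ^ 4) / (8 * r ^ 3))"
    using sign_fourth[of n w] r by (intro diff_left_mono mult_left_mono divide_right_mono) auto
  also have "\<dots> = coin_avg n (\<lambda>bs. (rsum n w bs)\<^sup>2 / (2 * r) - (4 / 27) * ((rsum n w bs) ^ 4 / (8 * r ^ 3)))"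
    by (simp only: coin_avg_diff coin_avg_divide coin_avg_scale sign_second r)
  also have "\<dots> \<le> coin_avg n (\<lambda>bs. \<bar>rsum n w bs\<bar>)" by (intro coin_avg_mono pt)
  finally show ?thesis by (simp add: r_def)
qed

definition sq_sum :: "nat \<Rightarrow> nat \<Rightarrow> (nat \<Rightarrow> real) \<Rightarrow> bool list \<Rightarrow> real" where
  "sq_sum n K w bs = (\<Sum>k<K. (rsum n w (blk n k bs))\<^sup>2)"

text \<open>Chernoff bounds from the two exponential moments. Estimating squared norms within a
  constant factor is accurate enough, as the levels of the norm cuts are powers of two.\<close>

lemma sq_sum_concentrated:
  assumes s: "(\<Sum>l<n. (w l)\<^sup>2) = s"
  shows "coin_avg (K * n) (\<lambda>bs. of_bool (\<not> (real K * s / 4 \<le> sq_sum n K w bs \<and> sq_sum n K w bs \<le> 8 * real K * s))) \<le> 2 * exp (- (real K / 48))"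
proof (cases "s = 0")
  case True
  then have "\<forall>l\<in>{..<n}. (w l)\<^sup>2 = 0" using s by (subst sum_nonneg_eq_0_iff[symmetric]) auto
  then have "rsum n w bs = 0" for bs by (simp add: rsum_def)
  then show ?thesis using True by (simp add: sq_sum_def)
next
  case False
  then have s0: "0 < s" using s by (auto simp: less_le intro!: sum_nonneg)
  let ?N = "sq_sum n K w"
  have up: "coin_avg (K * n) (\<lambda>bs. exp (?N bs / (8 * s))) \<le> exp (1 / 2) ^ K"
  proof -
    have "coin_avg (K * n) (\<lambda>bs. exp (?N bs / (8 * s))) = coin_avg (K * n) (\<lambda>bs. \<Prod>k<K. exp ((rsum n w (blk n k bs))\<^sup>2 / (8 * s)))"
      by (intro coin_avg_cong) (simp add: sq_sum_def sum_divide_distrib exp_sum)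
    also have "\<dots> = (coin_avg n (\<lambda>bs. exp ((rsum n w bs)\<^sup>2 / (8 * s)))) ^ K" by (rule coin_avg_prod_blk)
    also have "\<dots> \<le> exp (1 / 2) ^ K" by (intro power_mono sign_exp_square s s0 coin_avg_nonneg) auto
    finally show ?thesis .
  qed
  have dn: "coin_avg (K * n) (\<lambda>bs. exp (- (?N bs / (12 * s)))) \<le> exp (- (1 / 24)) ^ K"
  proof -
    have "coin_avg (K * n) (\<lambda>bs. exp (- (?N bs / (12 * s)))) = coin_avg (K * n) (\<lambda>bs. \<Prod>k<K. exp (- ((rsum n w (blk n k bs))\<^sup>2 / (12 * s))))"
      by (intro coin_avg_cong) (simp add: sq_sum_def sum_divide_distrib exp_sum[symmetric] sum_negf)
    also have "\<dots> = (coin_avg n (\<lambda>bs. exp (- ((rsum n w bs)\<^sup>2 / (12 * s))))) ^ K" by (rule coin_avg_prod_blk)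
    also have "\<dots> \<le> exp (- (1 / 24)) ^ K" by (intro power_mono sign_exp_minus_square s s0 coin_avg_nonneg) auto
    finally show ?thesis .
  qed
  have "coin_avg (K * n) (\<lambda>bs. of_bool (\<not> (real K * s / 4 \<le> ?N bs \<and> ?N bs \<le> 8 * real K * s)))
     \<le> coin_avg (K * n) (\<lambda>bs. exp (real K / 48) * exp (- (?N bs / (12 * s))) + exp (- real K) * exp (?N bs / (8 * s)))"
  proof (rule coin_avg_mono)
    fix bs
    have "1 \<le> exp (real K / 48) * exp (- (?N bs / (12 * s)))" if "?N bs < real K * s / 4"
    proof -
      have "?N bs / (12 * s) \<le> (real K * s / 4) / (12 * s)" using that s0 by (intro divide_right_mono) auto
      then have "0 \<le> real K / 48 - ?N bs / (12 * s)" using s0 by simp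
      then show ?thesis by (simp add: exp_add[symmetric])
    qed
    moreover have "1 \<le> exp (- real K) * exp (?N bs / (8 * s))" if "8 * real K * s < ?N bs"
    proof -
      have "(8 * real K * s) / (8 * s) \<le> ?N bs / (8 * s)" using that s0 by (intro divide_right_mono) auto
      then have "0 \<le> - real K + ?N bs / (8 * s)" using s0 by simp
      then show ?thesis by (simp add: exp_add[symmetric])
    qed
    ultimately show "of_bool (\<not> (real K * s / 4 \<le> ?N bs \<and> ?N bs \<le> 8 * real K * s)) \<le> exp (real K / 48) * exp (- (?N bs / (12 * s))) + exp (- real K) * exp (?N bs / (8 * s))"
      by (auto simp: not_le intro: add_increasing add_increasing2)
  qed
  also have "\<dots> = exp (real K / 48) * coin_avg (K * n) (\<lambda>bs. exp (- (?N bs / (12 * s)))) + exp (- real K) * coin_avg (K * n) (\<lambda>bs. exp (?N bs / (8 * s)))"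
    by (simp only: coin_avg_add coin_avg_scale)
  also have "\<dots> \<le> exp (real K / 48) * exp (- (1 / 24)) ^ K + exp (- real K) * exp (1 / 2) ^ K"
    using up dn by (intro add_mono mult_left_mono) auto
  also have "\<dots> = exp (- (real K / 48)) + exp (- (real K / 2))"
    by (simp add: exp_of_nat_mult[symmetric] exp_add[symmetric])
  also have "\<dots> \<le> 2 * exp (- (real K / 48))" by simp
  finally show ?thesis .
qed


section \<open>Matching actions and threshold cuts\<close>

text \<open>Both sides of the cut have total demand \<open>vol \<mu> S\<close>, and an approximate
  action loses at most a fraction \<epsilon> of it. On the far side the demand per unit of weight is
  constant, so a bad set absorbs at most its proportion.\<close>

lemma matching_flow:
  assumes fin: "finite V" and pos: "\<And>i. i \<in> V \<Longrightarrow> 0 < \<mu> i" and S: "valid_cut V \<mu> S"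
    and D: "matching_action V \<mu> \<epsilon> S D" and X: "X = S \<or> X = V - S" and Bd: "Bd \<subseteq> V - X"
  shows "vol \<mu> S * ((1 - \<epsilon>) - vol \<mu> Bd / vol \<mu> (V - X)) \<le> (\<Sum>i\<in>X. \<Sum>j\<in>V - X - Bd. D i j)"
proof -
  define \<sigma> where "\<sigma> = vol \<mu> S"
  have SV: "S \<subset> V" "S \<noteq> {}" and half: "vol \<mu> S \<le> vol \<mu> V / 2" using S by (auto simp: valid_cut_def)
  have finS: "finite S" using SV fin finite_subset by blast
  have volV: "vol \<mu> V = vol \<mu> S + vol \<mu> (V - S)"
    unfolding vol_def using SV fin by (subst sum.subset_diff[of S V]) auto
  have pS: "0 < real (\<mu> i)" if "i \<in> S" for i using pos[of i] that SV by auto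
  have pC: "0 < real (\<mu> i)" if "i \<in> V - S" for i using pos[of i] that by auto
  have s0: "0 < \<sigma>" unfolding \<sigma>_def vol_def by (intro sum_pos finS SV pS)
  have c0: "0 < vol \<mu> (V - S)" unfolding vol_def by (intro sum_pos pC) (use SV fin in auto)
  have sym: "\<And>i j. D i j = D j i" and nn: "\<And>i j. 0 \<le> D i j" and bip: "\<And>i j. D i j \<noteq> 0 \<Longrightarrow> i \<in> S \<longleftrightarrow> j \<notin> S"
    and deg: "\<And>i. i \<in> V \<Longrightarrow> wdegree V D i \<le> real (\<mu> i) * \<bar>seed V \<mu> S i\<bar>"
    and def: "(\<Sum>i\<in>V. \<bar>wdegree V D i - real (\<mu> i) * \<bar>seed V \<mu> S i\<bar>\<bar>) \<le> \<epsilon> * (\<Sum>i\<in>V. \<bar>real (\<mu> i) * \<bar>seed V \<mu> S i\<bar>\<bar>)"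
    using D by (auto simp: matching_action_def weighted_graph_def)
  have seedS: "\<bar>seed V \<mu> S i\<bar> = 1" if "i \<in> S" for i using that SV by (simp add: seed_def)
  have seedC: "\<bar>seed V \<mu> S i\<bar> = \<sigma> / vol \<mu> (V - S)" if "i \<in> V - S" for i
    using that s0 c0 by (simp add: seed_def \<sigma>_def)
  have split: "(\<Sum>i\<in>V. f i) = (\<Sum>i\<in>S. f i) + (\<Sum>i\<in>V - S. f i)" for f :: "'a \<Rightarrow> real"
    using SV fin by (subst sum.subset_diff[of S V]) auto
  have tot: "(\<Sum>i\<in>V. real (\<mu> i) * \<bar>seed V \<mu> S i\<bar>) = 2 * \<sigma>"
  proof -
    have "(\<Sum>i\<in>V - S. real (\<mu> i) * \<bar>seed V \<mu> S i\<bar>) = vol \<mu> (V - S) * (\<sigma> / vol \<mu> (V - S))"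
      using seedC by (simp add: vol_def sum_distrib_right sum_divide_distrib)
    moreover have "(\<Sum>i\<in>S. real (\<mu> i) * \<bar>seed V \<mu> S i\<bar>) = \<sigma>"
      using seedS by (simp add: vol_def \<sigma>_def)
    ultimately show ?thesis using c0 by (simp add: split)
  qed
  have dS: "wdegree V D i = (\<Sum>j\<in>V - S. D i j)" if "i \<in> S" for i
  proof -
    have "(\<Sum>j\<in>S. D i j) = 0" using bip that by (intro sum.neutral) blast
    then show ?thesis by (simp add: wdegree_def split)
  qed
  have dC: "wdegree V D i = (\<Sum>j\<in>S. D i j)" if "i \<in> V - S" for i
  proof -
    have "(\<Sum>j\<in>V - S. D i j) = 0" using bip that by (intro sum.neutral) blast
    then show ?thesis by (simp add: wdegree_def split)
  qed
  have cross: "(\<Sum>i\<in>V - S. wdegree V D i) = (\<Sum>i\<in>S. wdegree V D i)"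
  proof -
    have "(\<Sum>i\<in>V - S. wdegree V D i) = (\<Sum>i\<in>V - S. \<Sum>j\<in>S. D i j)" by (simp add: dC)
    also have "\<dots> = (\<Sum>j\<in>S. \<Sum>i\<in>V - S. D i j)" by (rule sum.swap)
    also have "\<dots> = (\<Sum>j\<in>S. wdegree V D j)" by (intro sum.cong refl) (simp add: dS sym)
    finally show ?thesis .
  qed
  \<comment> \<open>Degrees never exceed the demand, so the distance in the 1-norm is a difference
    of totals; by \<open>cross\<close> the two sides contribute equally to the total degree.\<close>
  have "(\<Sum>i\<in>V. \<bar>wdegree V D i - real (\<mu> i) * \<bar>seed V \<mu> S i\<bar>\<bar>) = (\<Sum>i\<in>V. real (\<mu> i) * \<bar>seed V \<mu> S i\<bar> - wdegree V D i)"
  proof (intro sum.cong refl)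
    fix i assume "i \<in> V"
    from deg[OF this] show "\<bar>wdegree V D i - real (\<mu> i) * \<bar>seed V \<mu> S i\<bar>\<bar> = real (\<mu> i) * \<bar>seed V \<mu> S i\<bar> - wdegree V D i"
      by linarith
  qed
  also have "\<dots> = 2 * \<sigma> - 2 * (\<Sum>i\<in>S. wdegree V D i)"
    by (simp add: sum_subtractf tot) (simp add: split cross)
  finally have fl: "(1 - \<epsilon>) * \<sigma> \<le> (\<Sum>i\<in>S. wdegree V D i)"
    using def tot by (simp add: abs_mult algebra_simps)
  have flX: "(1 - \<epsilon>) * \<sigma> \<le> (\<Sum>i\<in>X. \<Sum>j\<in>V - X. D i j)"
  proof (cases "X = S")
    case True then show ?thesis using fl by (simp add: dS)
  next
    case False
    then have "X = V - S" "V - X = S" using X SV by auto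
    then show ?thesis using fl cross by (simp add: dC)
  qed
  have YV: "V - X \<subseteq> V" by auto
  have degY: "wdegree V D j \<le> real (\<mu> j) * (\<sigma> / vol \<mu> (V - X))" if "j \<in> V - X" for j
  proof (cases "X = S")
    case True then show ?thesis using deg[of j] seedC[of j] that by simp
  next
    case False
    then have "V - X = S" using X SV by auto
    then show ?thesis using deg[of j] seedS[of j] that SV s0 by (auto simp: \<sigma>_def)
  qed
  have finB: "finite Bd" "finite X" "finite (V - X)" using Bd fin X finS finite_subset by (auto intro: finite_subset)
  have XV: "X \<subseteq> V" using X SV by auto
  have "(\<Sum>i\<in>X. \<Sum>j\<in>Bd. D i j) = (\<Sum>j\<in>Bd. \<Sum>i\<in>X. D i j)" by (rule sum.swap)
  also have "\<dots> \<le> (\<Sum>j\<in>Bd. wdegree V D j)"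
    unfolding wdegree_def using XV fin nn by (intro sum_mono) (simp add: sym sum_mono2)
  also have "\<dots> \<le> (\<Sum>j\<in>Bd. real (\<mu> j) * (\<sigma> / vol \<mu> (V - X)))" using degY Bd by (intro sum_mono) auto
  also have "\<dots> = \<sigma> * (vol \<mu> Bd / vol \<mu> (V - X))" by (simp add: vol_def sum_distrib_left sum_distrib_right sum_divide_distrib mult_ac)
  finally have b: "(\<Sum>i\<in>X. \<Sum>j\<in>Bd. D i j) \<le> \<sigma> * (vol \<mu> Bd / vol \<mu> (V - X))" .
  have "(\<Sum>i\<in>X. \<Sum>j\<in>V - X. D i j) = (\<Sum>i\<in>X. (\<Sum>j\<in>V - X - Bd. D i j) + (\<Sum>j\<in>Bd. D i j))"
    using Bd finB by (intro sum.cong refl sum.subset_diff) auto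
  then have "(\<Sum>i\<in>X. \<Sum>j\<in>V - X. D i j) = (\<Sum>i\<in>X. \<Sum>j\<in>V - X - Bd. D i j) + (\<Sum>i\<in>X. \<Sum>j\<in>Bd. D i j)"
    by (simp add: sum.distrib)
  then show ?thesis using flX b by (simp add: \<sigma>_def[symmetric] algebra_simps)
qed

text \<open>Every unit of flow out of \<open>X\<close> that avoids \<open>Bd\<close> pays at least
  \<open>a\<close>. The sum over ordered pairs counts each edge twice, hence the 2.\<close>

lemma matching_energy_ge:
  assumes fin: "finite V" and pos: "\<And>i. i \<in> V \<Longrightarrow> 0 < \<mu> i" and S: "valid_cut V \<mu> S"
    and D: "matching_action V \<mu> \<epsilon> S D" and X: "X = S \<or> X = V - S" and Bd: "Bd \<subseteq> V - X"
    and \<phi>: "\<And>i j. 0 \<le> \<phi> i j" "\<And>i j. \<phi> i j = \<phi> j i" "0 \<le> a"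
      "\<And>i j. i \<in> X \<Longrightarrow> j \<in> V - X - Bd \<Longrightarrow> a \<le> \<phi> i j"
  shows "2 * a * (vol \<mu> S * ((1 - \<epsilon>) - vol \<mu> Bd / vol \<mu> (V - X))) \<le> (\<Sum>i\<in>V. \<Sum>j\<in>V. D i j * \<phi> i j)"
proof -
  have sym: "\<And>i j. D i j = D j i" and nn: "\<And>i j. 0 \<le> D i j" 
    using D by (auto simp: matching_action_def weighted_graph_def)
  have SV: "S \<subset> V" using S by (auto simp: valid_cut_def)
  let ?Z = "V - X - Bd"
  have XV: "X \<subseteq> V" using X SV by auto
  have fX: "finite X" "finite ?Z" using XV fin finite_subset by auto
  have "a * (vol \<mu> S * ((1 - \<epsilon>) - vol \<mu> Bd / vol \<mu> (V - X))) \<le> a * (\<Sum>i\<in>X. \<Sum>j\<in>?Z. D i j)"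
    using \<phi>(3) by (intro mult_left_mono matching_flow[OF fin pos S D X Bd])
  also have "\<dots> \<le> (\<Sum>i\<in>X. \<Sum>j\<in>?Z. D i j * \<phi> i j)"
    unfolding sum_distrib_left using \<phi>(4) nn
    by (intro sum_mono) (metis mult.commute mult_left_mono)
  finally have 1: "a * (vol \<mu> S * ((1 - \<epsilon>) - vol \<mu> Bd / vol \<mu> (V - X))) \<le> (\<Sum>i\<in>X. \<Sum>j\<in>?Z. D i j * \<phi> i j)" .
  have 2: "(\<Sum>i\<in>?Z. \<Sum>j\<in>X. D i j * \<phi> i j) = (\<Sum>i\<in>X. \<Sum>j\<in>?Z. D i j * \<phi> i j)"
    by (subst sum.swap) (simp add: sym \<phi>(2))
  have nnp: "0 \<le> D i j * \<phi> i j" for i j using nn \<phi>(1) by simp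
  have "(\<Sum>i\<in>X. \<Sum>j\<in>?Z. D i j * \<phi> i j) + (\<Sum>i\<in>?Z. \<Sum>j\<in>X. D i j * \<phi> i j)
    \<le> (\<Sum>i\<in>X. \<Sum>j\<in>V. D i j * \<phi> i j) + (\<Sum>i\<in>?Z. \<Sum>j\<in>V. D i j * \<phi> i j)"
    using XV fin nnp by (intro add_mono sum_mono sum_mono2) auto
  also have "\<dots> = (\<Sum>i\<in>X \<union> ?Z. \<Sum>j\<in>V. D i j * \<phi> i j)"
    using fX by (intro sum.union_disjoint[symmetric]) auto
  also have "\<dots> \<le> (\<Sum>i\<in>V. \<Sum>j\<in>V. D i j * \<phi> i j)"
    using XV fin nnp by (intro sum_mono2 sum_nonneg) auto
  finally show ?thesis using 1 2 by simp
qed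

section \<open>Threshold cuts and their repair\<close>

primrec amin :: "(nat \<Rightarrow> nat) \<Rightarrow> nat \<Rightarrow> nat" where
  "amin \<mu> 0 = 0"
| "amin \<mu> (Suc i) = (if \<mu> i < \<mu> (amin \<mu> i) then i else amin \<mu> i)"

text \<open>Cutting relative to the mean modulus makes the cut invariant under scaling, so vectors
  never have to be normalized. The negated strict comparison is the one that the program
  evaluates.\<close>

definition thr_cut :: "nat \<Rightarrow> (nat \<Rightarrow> nat) \<Rightarrow> real \<Rightarrow> (nat \<Rightarrow> real) \<Rightarrow> nat set" where
  "thr_cut n \<mu> c sc = {i. i < n \<and> \<not> sc i < c * (\<Sum>j<n. real (\<mu> j) * \<bar>sc j\<bar>) / vol \<mu> {..<n}}"

text \<open>Makes every vertex set a legal cut. The substitute for the empty set is a lightest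
  vertex, because among at least two vertices it carries at most half of the weight.\<close>

definition fix_cut :: "nat \<Rightarrow> (nat \<Rightarrow> nat) \<Rightarrow> nat set \<Rightarrow> nat set" where
  "fix_cut n \<mu> S = (let S' = (if vol \<mu> {..<n} < vol \<mu> S + vol \<mu> S then {..<n} - S else S)
     in if S' = {} then {amin \<mu> n} else S')"

lemma amin_le: "i < n \<Longrightarrow> \<mu> (amin \<mu> n) \<le> \<mu> i"
  by (induction n) (auto simp: less_Suc_eq intro: less_imp_le order_trans[rotated] le_less_trans)

lemma amin_less: "0 < n \<Longrightarrow> amin \<mu> n < n"
proof (induction n)
  case (Suc n) then show ?case by (cases "n = 0") (auto simp: less_Suc_eq)
qed simp

lemma vol_compl: fixes n :: nat shows "S \<subseteq> {..<n} \<Longrightarrow> vol \<mu> {..<n} = vol \<mu> S + vol \<mu> ({..<n} - S)"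
  unfolding vol_def by (subst sum.subset_diff[of S "{..<n}"]) auto

lemma valid_fix_cut:
  assumes n: "2 \<le> n" and pos: "\<And>i. i < n \<Longrightarrow> 0 < \<mu> i" and S: "S \<subseteq> {..<n}"
  shows "valid_cut {..<n} \<mu> (fix_cut n \<mu> S)"
proof -
  define S' where "S' = (if vol \<mu> {..<n} < vol \<mu> S + vol \<mu> S then {..<n} - S else S)"
  have F: "fix_cut n \<mu> S = (if S' = {} then {amin \<mu> n} else S')" by (simp add: fix_cut_def S'_def Let_def)
  have h: "vol \<mu> S' \<le> vol \<mu> {..<n} / 2" using vol_compl[OF S, of \<mu>] by (auto simp: S'_def)
  have S'V: "S' \<subseteq> {..<n}" using S by (auto simp: S'_def)
  have vp: "0 < vol \<mu> {..<n}" unfolding vol_def using n pos by (intro sum_pos) (auto simp: lessThan_empty_iff)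
  show ?thesis
  proof (cases "S' = {}")
    case True
    let ?a = "amin \<mu> n"
    have a: "?a < n" using n by (intro amin_less) auto
    define b where "b = (if ?a = 0 then 1 else 0 :: nat)"
    have b: "b < n" "b \<noteq> ?a" using n by (auto simp: b_def)
    have "vol \<mu> {?a, b} \<le> vol \<mu> {..<n}" unfolding vol_def using a b by (intro sum_mono2) auto
    moreover have "vol \<mu> {?a, b} = real (\<mu> ?a) + real (\<mu> b)" using b by (simp add: vol_def)
    moreover have "real (\<mu> ?a) \<le> real (\<mu> b)" using amin_le[OF b(1)] by simp
    ultimately have "vol \<mu> {?a} \<le> vol \<mu> {..<n} / 2" by (simp add: vol_def)
    then show ?thesis using True F a b by (auto simp: valid_cut_def)
  next
    case False
    then have "S' \<noteq> {..<n}" using h vp by auto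
    then show ?thesis using False F h S'V by (auto simp: valid_cut_def)
  qed
qed

lemma thr_cut_scale: "0 < a \<Longrightarrow> thr_cut n \<mu> c (\<lambda>i. a * sc i) = thr_cut n \<mu> c sc"
proof -
  assume a: "0 < a"
  have e: "(\<Sum>j<n. real (\<mu> j) * \<bar>a * sc j\<bar>) = a * (\<Sum>j<n. real (\<mu> j) * \<bar>sc j\<bar>)"
    unfolding sum_distrib_left using a by (intro sum.cong) (auto simp: abs_mult)
  have "c * (a * (\<Sum>j<n. real (\<mu> j) * \<bar>sc j\<bar>)) / vol \<mu> {..<n} = a * (c * (\<Sum>j<n. real (\<mu> j) * \<bar>sc j\<bar>) / vol \<mu> {..<n})"
    by simp
  then show ?thesis unfolding thr_cut_def e using a by (simp only: mult_less_cancel_left_pos)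
qed


text \<open>The first \<open>Lv\<close> levels threshold one random projection at a fraction of its average modulus, the
  others threshold an estimate of the squared norms at a power of two: they handle vectors of
  bounded norm and vectors whose norms are spread over many scales, respectively.\<close>

definition round_cut :: "nat \<Rightarrow> (nat \<Rightarrow> nat) \<Rightarrow> nat \<Rightarrow> nat \<Rightarrow> (nat \<Rightarrow> nat \<Rightarrow> real) \<Rightarrow> nat \<Rightarrow> bool list \<Rightarrow> nat set" where
  "round_cut n \<mu> Lv K w l bs = fix_cut n \<mu>
     (if l < Lv then thr_cut n \<mu> (real l / real Lv) (\<lambda>i. rsum n (w i) (blk n (K - 1) bs))
      else thr_cut n \<mu> (2 ^ (l - Lv + 1)) (\<lambda>i. sq_sum n K (w i) bs))"

definition norm_sq :: "nat \<Rightarrow> (nat \<Rightarrow> real) \<Rightarrow> real" where "norm_sq n w = (\<Sum>l<n. (w l)\<^sup>2)"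

definition dist_sq :: "nat \<Rightarrow> (nat \<Rightarrow> nat \<Rightarrow> real) \<Rightarrow> nat \<Rightarrow> nat \<Rightarrow> real" where
  "dist_sq n v i j = (\<Sum>l<n. (v i l - v j l)\<^sup>2)"

lemma dist_sq_ge: "norm_sq n (v i) / 2 - norm_sq n (v j) \<le> dist_sq n v i j"
proof -
  have "(x::real)\<^sup>2 / 2 - y\<^sup>2 \<le> (x - y)\<^sup>2" for x y
    using zero_le_power2[of "x / 2 - y"] zero_le_power2[of "x - 2 * y"] by (simp add: power2_eq_square algebra_simps)
  then show ?thesis unfolding norm_sq_def dist_sq_def sum_divide_distrib sum_subtractf[symmetric] by (intro sum_mono)
qed

lemma dist_sq_props: "0 \<le> dist_sq n v i j" "dist_sq n v i j = dist_sq n v j i"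
  by (auto simp: dist_sq_def power2_commute intro: sum_nonneg)

lemma vol_mono: "finite B \<Longrightarrow> A \<subseteq> B \<Longrightarrow> vol \<mu> A \<le> vol \<mu> B"
  unfolding vol_def by (intro sum_mono2) auto

lemma markov_vol:
  assumes fin: "finite V" and f: "\<And>i. i \<in> V \<Longrightarrow> 0 \<le> f i" and B: "B \<subseteq> V" "\<And>i. i \<in> B \<Longrightarrow> c \<le> f i"
  shows "c * vol \<mu> B \<le> (\<Sum>i\<in>V. real (\<mu> i) * f i)"
proof -
  have "c * vol \<mu> B \<le> (\<Sum>i\<in>B. real (\<mu> i) * f i)"
    unfolding vol_def sum_distrib_left
  proof (rule sum_mono)
    fix i assume "i \<in> B"
    from mult_left_mono[OF B(2)[OF this], of "real (\<mu> i)"] show "c * real (\<mu> i) \<le> real (\<mu> i) * f i"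
      by (simp add: mult.commute)
  qed
  also have "\<dots> \<le> (\<Sum>i\<in>V. real (\<mu> i) * f i)" using fin f B by (intro sum_mono2) auto
  finally show ?thesis .
qed

text \<open>Markov's inequality is used twice. The threshold is at least twice the average, so the
  cut side has at most half of the weight and is not complemented. Outside, the vertices of squared
  norm above \<open>2 ^ l / 64\<close> weigh so little that they absorb at most half of the
  guaranteed flow. All other pairs differ by a factor 4 in squared norm and are therefore far
  apart.\<close>

lemma norm_cut_energy:
  assumes n: "2 \<le> n" and pos: "\<And>i. i < n \<Longrightarrow> 0 < \<mu> i" and d: "0 < \<delta>"
    and K: "1 \<le> K" and tot: "(\<Sum>i<n. real (\<mu> i) * norm_sq n (v i)) = vol \<mu> {..<n}"
    and good: "\<And>i. i < n \<Longrightarrow> real K * norm_sq n (v i) / 4 \<le> N i \<and> N i \<le> 8 * real K * norm_sq n (v i)"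
    and l: "256 / \<delta> \<le> 2 ^ l"
    and D: "matching_action {..<n} \<mu> (1 - \<delta>) (fix_cut n \<mu> (thr_cut n \<mu> (2 ^ (l + 1)) N)) D"
  shows "\<delta> / 4096 * (2 ^ (l + 6) * vol \<mu> {i. i < n \<and> 2 ^ (l + 6) \<le> norm_sq n (v i)}) \<le> (\<Sum>i<n. \<Sum>j<n. D i j * dist_sq n v i j)"
proof -
  define T where "T = vol \<mu> {..<n}"
  define S0 where "S0 = thr_cut n \<mu> (2 ^ (l + 1)) N"
  define H where "H = {i. i < n \<and> 2 ^ (l + 6) \<le> norm_sq n (v i)}"
  define av where "av = (\<Sum>j<n. real (\<mu> j) * N j) / T"
  have T0: "0 < T" unfolding T_def vol_def using n pos by (intro sum_pos) (auto simp: lessThan_empty_iff)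
  have nv0: "0 \<le> norm_sq n w" for w by (simp add: norm_sq_def sum_nonneg)
  have N0: "0 \<le> N i" if "i < n" for i using good[OF that] nv0[of "v i"] by (smt (verit) divide_nonneg_nonneg mult_nonneg_nonneg of_nat_0_le_iff)
  have S0_def': "S0 = {i. i < n \<and> \<not> N i < 2 ^ (l + 1) * av}"
    unfolding S0_def thr_cut_def av_def T_def using N0 by simp
  have av1: "real K / 4 \<le> av"
  proof -
    have "(\<Sum>j<n. real (\<mu> j) * (real K / 4 * norm_sq n (v j))) \<le> (\<Sum>j<n. real (\<mu> j) * N j)"
      using good by (intro sum_mono mult_left_mono) auto
    also have "(\<Sum>j<n. real (\<mu> j) * (real K / 4 * norm_sq n (v j))) = real K / 4 * T"
      unfolding T_def tot[symmetric] by (simp add: sum_distrib_left mult_ac)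
    finally show ?thesis using T0 by (simp add: av_def pos_le_divide_eq)
  qed
  have av2: "av \<le> 8 * real K"
  proof -
    have "(\<Sum>j<n. real (\<mu> j) * N j) \<le> (\<Sum>j<n. real (\<mu> j) * (8 * real K * norm_sq n (v j)))"
      using good by (intro sum_mono mult_left_mono) auto
    also have "\<dots> = 8 * real K * T"
      unfolding T_def tot[symmetric] by (simp add: sum_distrib_left mult_ac)
    finally show ?thesis using T0 by (simp add: av_def pos_divide_le_eq)
  qed
  have K0: "0 < real K" using K by simp
  \<comment> \<open>The offset 6: the estimate may be low by a factor 4, the average high by a
    factor 8, and the threshold has one more factor 2.\<close>
  have HS: "H \<subseteq> S0"
  proof
    fix i assume i: "i \<in> H"
    then have "real K * 2 ^ (l + 6) / 4 \<le> real K * norm_sq n (v i) / 4"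
      by (intro divide_right_mono mult_left_mono) (auto simp: H_def)
    also have "\<dots> \<le> N i" using good i by (auto simp: H_def)
    finally have "2 ^ (l + 1) * (8 * real K) \<le> N i" by (simp add: power_add mult_ac)
    moreover have "2 ^ (l + 1) * av \<le> 2 ^ (l + 1) * (8 * real K)" using av2 by (intro mult_left_mono) auto
    ultimately have "\<not> N i < 2 ^ (l + 1) * av" by linarith
    then show "i \<in> S0" using i by (simp only: S0_def' H_def mem_Collect_eq) simp
  qed
  have low: "2 ^ l / 16 \<le> norm_sq n (v i)" if "i \<in> S0" for i
  proof -
    have "2 ^ (l + 1) * (real K / 4) \<le> 2 ^ (l + 1) * av" using av1 by (intro mult_left_mono) auto
    also have "\<dots> \<le> N i" using that by (auto simp: S0_def')
    also have "\<dots> \<le> 8 * real K * norm_sq n (v i)" using good that by (auto simp: S0_def')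
    finally show ?thesis using K0 by (simp add: field_simps)
  qed
  have "2 ^ (l + 1) * av * vol \<mu> S0 \<le> (\<Sum>i<n. real (\<mu> i) * N i)"
    using N0 by (intro markov_vol) (auto simp: S0_def')
  also have "\<dots> = av * T" using T0 by (simp add: av_def)
  finally have "av * (2 ^ (l + 1) * vol \<mu> S0) \<le> av * T" by (simp add: mult_ac)
  moreover have "0 < av" using av1 K0 by linarith
  ultimately have "2 ^ (l + 1) * vol \<mu> S0 \<le> T" by simp
  moreover have "2 * vol \<mu> S0 \<le> 2 ^ (l + 1) * vol \<mu> S0"
    by (intro mult_right_mono) (auto simp: vol_def sum_nonneg)
  ultimately have half: "vol \<mu> S0 \<le> T / 2" by simp
  have Dnn: "0 \<le> D i j" for i j using D by (auto simp: matching_action_def weighted_graph_def)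
  show ?thesis
  proof (cases "H = {}")
    case True
    then show ?thesis using Dnn dist_sq_props by (auto simp: H_def[symmetric] vol_def intro!: sum_nonneg mult_nonneg_nonneg)
  next
    case False
    then have ne: "S0 \<noteq> {}" using HS by auto
    have S0V: "S0 \<subseteq> {..<n}" by (auto simp: S0_def')
    have fx: "fix_cut n \<mu> S0 = S0" using half ne by (simp add: fix_cut_def T_def Let_def)
    have vc: "valid_cut {..<n} \<mu> S0" using valid_fix_cut[where \<mu> = \<mu>, OF n pos S0V] fx by simp
    define Bd where "Bd = {j. j < n \<and> j \<notin> S0 \<and> 2 ^ l / 64 < norm_sq n (v j)}"
    have "(2 ^ l / 64) * vol \<mu> Bd \<le> (\<Sum>i<n. real (\<mu> i) * norm_sq n (v i))"
      using nv0 by (intro markov_vol) (auto simp: Bd_def)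
    then have "(2 ^ l / 64) * vol \<mu> Bd \<le> T" by (simp add: T_def tot)
    then have b1: "vol \<mu> Bd \<le> 64 * T / 2 ^ l" by (simp add: field_simps)
    have c2: "T / 2 \<le> vol \<mu> ({..<n} - S0)" using vol_compl[OF S0V, of \<mu>] half by (simp add: T_def)
    have "vol \<mu> Bd / vol \<mu> ({..<n} - S0) \<le> (64 * T / 2 ^ l) / (T / 2)"
      using b1 c2 T0 by (intro frac_le) auto
    also have "\<dots> = 128 / 2 ^ l" using T0 by simp
    also have "\<dots> \<le> \<delta> / 2" using l d by (simp add: field_simps)
    finally have ratio: "vol \<mu> Bd / vol \<mu> ({..<n} - S0) \<le> \<delta> / 2" .
    have "2 * (2 ^ l / 64) * (vol \<mu> S0 * ((1 - (1 - \<delta>)) - vol \<mu> Bd / vol \<mu> ({..<n} - S0))) \<le> (\<Sum>i<n. \<Sum>j<n. D i j * dist_sq n v i j)"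
    proof (rule matching_energy_ge[where S = S0 and X = S0 and D = D, OF _ _ vc])
      show "matching_action {..<n} \<mu> (1 - \<delta>) S0 D" using D fx by (simp add: S0_def)
      fix i j assume "i \<in> S0" "j \<in> {..<n} - S0 - Bd"
      then show "2 ^ l / 64 \<le> dist_sq n v i j" using low[of i] dist_sq_ge[of n v i j] by (auto simp: Bd_def)
    qed (use pos dist_sq_props in \<open>auto simp: Bd_def\<close>)
    moreover have "2 * (2 ^ l / 64) * (vol \<mu> H * (\<delta> / 2)) \<le> 2 * (2 ^ l / 64) * (vol \<mu> S0 * ((1 - (1 - \<delta>)) - vol \<mu> Bd / vol \<mu> ({..<n} - S0)))"
      using ratio HS S0V d finite_subset[OF S0V] by (intro mult_left_mono mult_mono vol_mono) (auto simp: vol_def sum_nonneg)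
    moreover have "2 * (2 ^ l / 64) * (vol \<mu> H * (\<delta> / 2)) = \<delta> / 4096 * (2 ^ (l + 6) * vol \<mu> H)"
      by (simp add: power_add)
    ultimately show ?thesis unfolding H_def[symmetric] by linarith
  qed
qed

lemma ex_pow2_between: "(1::real) \<le> x \<Longrightarrow> \<exists>l. 2 ^ l \<le> x \<and> x < 2 ^ Suc l"
proof -
  assume x: "1 \<le> x"
  define m where "m = (LEAST m. x < 2 ^ m)"
  have "\<exists>m. x < 2 ^ m" by (rule real_arch_pow) simp
  then have m: "x < 2 ^ m" unfolding m_def by (rule LeastI_ex)
  have "m \<noteq> 0" using m x by (auto intro: ccontr)
  then obtain l where l: "m = Suc l" by (cases m) auto
  have "\<not> x < 2 ^ l" using not_less_Least[of l "\<lambda>m. x < 2 ^ m"] l by (simp add: m_def[symmetric])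
  then show ?thesis using m l by (intro exI[of _ l]) auto
qed

text \<open>A layer-cake estimate: a value above the cutoff is counted at its own level, where
  \<open>2 ^ (l + 6)\<close> exceeds half of it. The cutoff is 64 times 512 / \<delta>, so that this
  level meets the condition on \<open>2 ^ l\<close>.\<close>

lemma dyadic_energy:
  fixes n :: nat
  assumes d: "0 < \<delta>" "\<delta> \<le> 1" and nv: "\<And>i. i < n \<Longrightarrow> f i \<le> 2 ^ Lv"
  shows "(\<Sum>i | i < n \<and> 2 ^ 15 / \<delta> \<le> f i. real (\<mu> i) * f i) / 2 \<le> (\<Sum>l | l < Lv \<and> 256 / \<delta> \<le> 2 ^ l. 2 ^ (l + 6) * vol \<mu> {i. i < n \<and> 2 ^ (l + 6) \<le> (f i :: real)})"
proof -
  let ?L = "{l. l < Lv \<and> 256 / \<delta> \<le> (2::real) ^ l}" and ?H = "{i. i < n \<and> 2 ^ 15 / \<delta> \<le> f i}"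
  have "(\<Sum>i\<in>?H. real (\<mu> i) * f i) / 2 = (\<Sum>i\<in>?H. real (\<mu> i) * (f i / 2))" by (simp add: sum_divide_distrib)
  also have "\<dots> \<le> (\<Sum>i\<in>?H. real (\<mu> i) * (\<Sum>l\<in>?L. 2 ^ (l + 6) * of_bool (2 ^ (l + 6) \<le> f i)))"
  proof (intro sum_mono mult_left_mono)
    fix i assume i: "i \<in> ?H"
    have "512 \<le> 512 / \<delta>" using d by (simp add: field_simps)
    moreover have big: "512 / \<delta> \<le> f i / 64" using i by simp
    ultimately have "1 \<le> f i / 64" by linarith
    then obtain l where l: "2 ^ l \<le> f i / 64" "f i / 64 < 2 ^ Suc l" using ex_pow2_between by blast
    have "256 / \<delta> \<le> 2 ^ l" using l(2) big by simp
    moreover have "0 < (2::real) ^ l" by simp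
    moreover have "f i \<le> 2 ^ Lv" using nv[of i] i by auto
    ultimately have "(2::real) ^ l < 2 ^ Lv" using l(1) by linarith
    then have "l < Lv" by simp
    with \<open>256 / \<delta> \<le> 2 ^ l\<close> have lL: "l \<in> ?L" by simp
    have "f i / 2 \<le> 2 ^ (l + 6) * of_bool (2 ^ (l + 6) \<le> f i)" using l by (simp add: power_add)
    also have "\<dots> \<le> (\<Sum>l\<in>?L. 2 ^ (l + 6) * of_bool (2 ^ (l + 6) \<le> f i))" by (rule member_le_sum[OF lL]) auto
    finally show "f i / 2 \<le> (\<Sum>l\<in>?L. 2 ^ (l + 6) * of_bool (2 ^ (l + 6) \<le> f i))" .
  qed auto
  also have "\<dots> \<le> (\<Sum>i<n. real (\<mu> i) * (\<Sum>l\<in>?L. 2 ^ (l + 6) * of_bool (2 ^ (l + 6) \<le> f i)))"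
    by (intro sum_mono2) (auto intro!: mult_nonneg_nonneg sum_nonneg)
  also have "\<dots> = (\<Sum>i<n. \<Sum>l\<in>?L. 2 ^ (l + 6) * (real (\<mu> i) * of_bool (2 ^ (l + 6) \<le> f i)))"
    unfolding sum_distrib_left by (simp only: mult.left_commute)
  also have "\<dots> = (\<Sum>l\<in>?L. \<Sum>i<n. 2 ^ (l + 6) * (real (\<mu> i) * of_bool (2 ^ (l + 6) \<le> f i)))" by (rule sum.swap)
  also have "\<dots> = (\<Sum>l\<in>?L. 2 ^ (l + 6) * vol \<mu> {i. i < n \<and> 2 ^ (l + 6) \<le> f i})"
  proof (intro sum.cong refl)
    fix l
    have "vol \<mu> {i. i < n \<and> 2 ^ (l + 6) \<le> f i} = (\<Sum>i<n. real (\<mu> i) * of_bool (2 ^ (l + 6) \<le> f i))"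
      unfolding vol_def by (intro sum.mono_neutral_cong_left) auto
    then show "(\<Sum>i<n. 2 ^ (l + 6) * (real (\<mu> i) * of_bool (2 ^ (l + 6) \<le> f i))) = 2 ^ (l + 6) * vol \<mu> {i. i < n \<and> 2 ^ (l + 6) \<le> f i}"
      by (simp only: sum_distrib_left)
  qed
  finally show ?thesis .
qed

text \<open>A Paley-Zygmund argument. Since the mean is zero, the positive part has half of the
  first absolute moment; values below \<open>r1 / 4\<close> account for at most half of that, and
  Cauchy-Schwarz turns the rest into weight.\<close>

lemma mass_tail:
  fixes n :: nat
  assumes T: "T = vol \<mu> {..<n}" "0 < T" and mean: "(\<Sum>i<n. real (\<mu> i) * u i) = 0"
    and r1: "(\<Sum>i<n. real (\<mu> i) * \<bar>u i\<bar>) = r1 * T" and r2: "(\<Sum>i<n. real (\<mu> i) * (u i)\<^sup>2) = r2 * T" and p: "0 < r1"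
  shows "T * (r1\<^sup>2 / (16 * r2)) \<le> vol \<mu> {i. i < n \<and> r1 / 4 \<le> u i}" "0 < r2"
proof -
  let ?P = "{i. i < n \<and> r1 / 4 \<le> u i}"
  show r20: "0 < r2"
  proof (rule ccontr)
    assume "\<not> 0 < r2"
    then have "r2 * T \<le> 0" using T by (simp add: mult_nonpos_nonneg)
    moreover have "0 \<le> (\<Sum>i<n. real (\<mu> i) * (u i)\<^sup>2)" by (intro sum_nonneg) auto
    ultimately have "(\<Sum>i<n. real (\<mu> i) * (u i)\<^sup>2) = 0" using r2 by linarith
    then have "\<forall>i\<in>{..<n}. real (\<mu> i) * (u i)\<^sup>2 = 0" by (subst sum_nonneg_eq_0_iff[symmetric]) auto
    then have "(\<Sum>i<n. real (\<mu> i) * \<bar>u i\<bar>) = 0" by (intro sum.neutral) auto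
    then show False using r1 p T by simp
  qed
  have "T * (r1 / 4) = (\<Sum>i<n. real (\<mu> i) * ((\<bar>u i\<bar> + u i) / 2 - r1 / 4))"
  proof -
    have "(\<Sum>i<n. real (\<mu> i) * ((\<bar>u i\<bar> + u i) / 2 - r1 / 4)) = ((\<Sum>i<n. real (\<mu> i) * \<bar>u i\<bar>) + (\<Sum>i<n. real (\<mu> i) * u i)) / 2 - (\<Sum>i<n. real (\<mu> i)) * (r1 / 4)"
      by (simp add: right_diff_distrib distrib_left sum_subtractf sum.distrib sum_divide_distrib add_divide_distrib sum_distrib_right)
    also have "\<dots> = r1 * T / 2 - T * (r1 / 4)" by (simp add: r1 mean T(1) vol_def)
    finally show ?thesis by simp
  qed
  also have "\<dots> \<le> (\<Sum>i<n. if i \<in> ?P then real (\<mu> i) * u i else 0)"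
  proof (rule sum_mono)
    fix i assume i: "i \<in> {..<n}"
    have "(\<bar>u i\<bar> + u i) / 2 - r1 / 4 \<le> (if i \<in> ?P then u i else 0)" using i p by (auto simp: abs_if)
    then have "real (\<mu> i) * ((\<bar>u i\<bar> + u i) / 2 - r1 / 4) \<le> real (\<mu> i) * (if i \<in> ?P then u i else 0)" by (intro mult_left_mono) auto
    then show "real (\<mu> i) * ((\<bar>u i\<bar> + u i) / 2 - r1 / 4) \<le> (if i \<in> ?P then real (\<mu> i) * u i else 0)"
      by (cases "i \<in> ?P") (simp_all only: if_True if_False mult_zero_right)
  qed
  also have "\<dots> = (\<Sum>i\<in>?P. sqrt (real (\<mu> i)) * (sqrt (real (\<mu> i)) * u i))"
    by (intro sum.mono_neutral_cong_right) auto
  finally have 1: "T * (r1 / 4) \<le> (\<Sum>i\<in>?P. sqrt (real (\<mu> i)) * (sqrt (real (\<mu> i)) * u i))" .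
  have "(T * (r1 / 4))\<^sup>2 \<le> (\<Sum>i\<in>?P. sqrt (real (\<mu> i)) * (sqrt (real (\<mu> i)) * u i))\<^sup>2"
    using 1 T p by (intro power_mono) auto
  also have "\<dots> \<le> (\<Sum>i\<in>?P. (sqrt (real (\<mu> i)))\<^sup>2) * (\<Sum>i\<in>?P. (sqrt (real (\<mu> i)) * u i)\<^sup>2)"
    by (rule Cauchy_Schwarz_ineq_sum)
  also have "\<dots> = vol \<mu> ?P * (\<Sum>i\<in>?P. real (\<mu> i) * (u i)\<^sup>2)" by (simp add: vol_def power_mult_distrib)
  also have "\<dots> \<le> vol \<mu> ?P * (\<Sum>i<n. real (\<mu> i) * (u i)\<^sup>2)"
    by (intro mult_left_mono sum_mono2) (auto simp: vol_def sum_nonneg)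
  finally have "(T * (r1 / 4))\<^sup>2 \<le> vol \<mu> ?P * (r2 * T)" unfolding r2 .
  then have "T * (T * (r1\<^sup>2 / 16)) \<le> T * (vol \<mu> ?P * r2)" by (simp add: power2_eq_square mult_ac)
  then have "T * (r1\<^sup>2 / 16) \<le> vol \<mu> ?P * r2" using T by simp
  then have "T * (r1\<^sup>2 / 16) / r2 \<le> vol \<mu> ?P" using r20 by (simp add: pos_divide_le_eq)
  then show "T * (r1\<^sup>2 / (16 * r2)) \<le> vol \<mu> ?P" by (simp add: field_simps)
qed

lemma card_open_interval_le: "finite {l::nat. x < real l \<and> real l < x + real J} \<and> card {l::nat. x < real l \<and> real l < x + real J} \<le> J"
proof -
  have "{l::nat. x < real l \<and> real l < x + real J} \<subseteq> nat ` {\<lfloor>x\<rfloor> + 1..\<lfloor>x\<rfloor> + int J}"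
  proof
    fix l assume l: "l \<in> {l::nat. x < real l \<and> real l < x + real J}"
    have "\<lfloor>x\<rfloor> < int l" using l by (simp add: floor_less_iff)
    moreover have "real_of_int (int l) \<le> x + real J" using l by simp
    then have "int l \<le> \<lfloor>x + real J\<rfloor>" by (simp only: le_floor_iff)
    moreover have "\<lfloor>x + real J\<rfloor> = \<lfloor>x\<rfloor> + int J" using floor_add_int[of x "int J"] by simp
    ultimately show "l \<in> nat ` {\<lfloor>x\<rfloor> + 1..\<lfloor>x\<rfloor> + int J}" by (intro image_eqI[of _ _ "int l"]) auto
  qed
  moreover have "card (nat ` {\<lfloor>x\<rfloor> + 1..\<lfloor>x\<rfloor> + int J}) \<le> J"
    by (rule order_trans[OF card_image_le]) auto
  ultimately show ?thesis by (meson card_mono finite_atLeastAtMost_int finite_imageI finite_subset order_trans)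
qed


text \<open>For levels below a quarter of \<open>Lv\<close> both sides of the cut have a share
  \<open>p3\<close> of the weight by \<open>mass_tail\<close>. An edge across the cut is short only
  if its lower end lies within \<open>a\<close> below the threshold, and this happens to a vertex
  for at most \<open>J\<close> levels. Summed over the levels, such vertices absorb at most half of
  the flow.\<close>

lemma bulk_move:
  fixes n :: nat and \<mu> :: "nat \<Rightarrow> nat"
  assumes n: "2 \<le> n" and pos: "\<And>i. i < n \<Longrightarrow> 0 < \<mu> i" and d: "0 < \<delta>" "\<delta> \<le> 1"
    and T: "T = vol \<mu> {..<n}" and mean: "(\<Sum>i<n. real (\<mu> i) * u i) = 0"
    and r1: "(\<Sum>i<n. real (\<mu> i) * \<bar>u i\<bar>) = r1 * T" and r2: "(\<Sum>i<n. real (\<mu> i) * (u i)\<^sup>2) = r2 * T"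
    and al: "0 < \<alpha>" "\<alpha> \<le> r1" "r2 \<le> \<beta>" and p3: "p3 = \<alpha>\<^sup>2 / (16 * \<beta>)"
    and Lv: "16 / (\<delta> * p3) \<le> real Lv" "0 < Lv"
    and D: "\<And>l. 4 * l < Lv \<Longrightarrow> matching_action {..<n} \<mu> (1 - \<delta>) (fix_cut n \<mu> (thr_cut n \<mu> (real l / real Lv) u)) (D l)"
  shows "\<alpha> * (\<delta> * p3)\<^sup>2 * real Lv * T / 64 \<le> (\<Sum>l | 4 * l < Lv. \<Sum>i<n. \<Sum>j<n. D l i j * \<bar>u i - u j\<bar>)"
proof -
  let ?V = "{..<n}" and ?L = "{l. 4 * l < Lv}"
  have T0: "0 < T" unfolding T vol_def using n pos by (intro sum_pos) (auto simp: lessThan_empty_iff)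
  have r10: "0 < r1" using al by simp
  have r20: "0 < r2" using mass_tail(2)[OF T T0 mean r1 r2 r10] .
  have p30: "0 < p3" using al r20 by (simp add: p3)
  have pr: "p3 \<le> r1\<^sup>2 / (16 * r2)" unfolding p3 using al r20 by (intro frac_le power_mono) auto
  have m1: "T * p3 \<le> vol \<mu> {i. i < n \<and> r1 / 4 \<le> u i}"
    using mass_tail(1)[OF T T0 mean r1 r2 r10] mult_left_mono[OF pr, of T] T0 by simp
  have m2: "T * p3 \<le> vol \<mu> {i. i < n \<and> r1 / 4 \<le> - u i}"
    using mass_tail(1)[OF T T0, of "\<lambda>i. - u i" r1 r2] mult_left_mono[OF pr, of T] T0 mean r1 r2 r10
    by (simp add: sum_negf)
  \<comment> \<open>The hypothesis on \<open>Lv\<close> makes the argument of the floor at least 2,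
    so rounding loses at most half.\<close>
  define J where "J = nat \<lfloor>\<delta> * p3 * real Lv / 8\<rfloor>"
  have x2: "2 \<le> \<delta> * p3 * real Lv / 8"
    using Lv d p30 by (simp add: field_simps)
  have Jr: "real J = real_of_int \<lfloor>\<delta> * p3 * real Lv / 8\<rfloor>" unfolding J_def using x2 by (intro of_nat_nat) simp
  have J1: "real J \<le> \<delta> * p3 * real Lv / 8" unfolding Jr by (rule of_int_floor_le)
  have J2: "\<delta> * p3 * real Lv / 16 \<le> real J" unfolding Jr using x2 by linarith
  define s where "s = r1 / real Lv"
  have s0: "0 < s" using r10 Lv by (simp add: s_def)
  define a where "a = real J * s"
  have a0: "0 \<le> a" using s0 by (simp add: a_def)
  define S0 where "S0 l = {i. i < n \<and> real l * s \<le> u i}" for l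
  have thr: "thr_cut n \<mu> (real l / real Lv) u = S0 l" for l
  proof -
    have "real l / real Lv * (\<Sum>i<n. real (\<mu> i) * \<bar>u i\<bar>) / vol \<mu> {..<n} = real l * s"
      unfolding r1 T[symmetric] using T0 by (simp add: s_def)
    then show ?thesis unfolding thr_cut_def S0_def by (simp only: not_less)
  qed
  define Bd where "Bd l = {j. j < n \<and> j \<notin> S0 l \<and> real l * s - a < u j}" for l
  have finL: "finite ?L" by (rule finite_subset[of _ "{..Lv}"]) auto
  have each: "2 * a * (T * p3 * \<delta> - vol \<mu> (Bd l)) \<le> (\<Sum>i<n. \<Sum>j<n. D l i j * \<bar>u i - u j\<bar>)" if l: "4 * l < Lv" for l
  proof -
    have th: "real l * s \<le> r1 / 4"
    proof -
      have "real (4 * l) \<le> real Lv" using l by simp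
      then have "real l * 4 * r1 \<le> real Lv * r1" using r10 by (intro mult_right_mono) auto
      then show ?thesis using Lv by (simp add: s_def field_simps)
    qed
    have sub1: "{i. i < n \<and> r1 / 4 \<le> u i} \<subseteq> S0 l" using th by (auto simp: S0_def)
    have sub2: "{i. i < n \<and> r1 / 4 \<le> - u i} \<subseteq> ?V - S0 l"
    proof -
      have "0 \<le> real l * s" using s0 by simp
      then show ?thesis using r10 by (auto simp: S0_def)
    qed
    have S0V: "S0 l \<subseteq> ?V" by (auto simp: S0_def)
    have v1: "T * p3 \<le> vol \<mu> (S0 l)" using m1 vol_mono[OF finite_subset[OF S0V] sub1, of \<mu>] by simp
    have v2: "T * p3 \<le> vol \<mu> (?V - S0 l)" using m2 vol_mono[OF _ sub2, of \<mu>] by simp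
    have Tp: "0 < T * p3" using T0 p30 by simp
    have ne: "X \<noteq> {}" if "T * p3 \<le> vol \<mu> X" for X
    proof
      assume "X = {}"
      then show False using that Tp by (simp add: vol_def)
    qed
    note ne = ne[OF v1] ne[OF v2]
    let ?S = "fix_cut n \<mu> (S0 l)"
    have F: "?S = S0 l \<or> ?S = ?V - S0 l" using ne by (auto simp: fix_cut_def Let_def)
    \<comment> \<open>\<open>fix_cut\<close> may have complemented the set; the energy bound accepts
      either side as \<open>X\<close>, so \<open>S0 l\<close> remains the upper side.\<close>
    have X: "S0 l = ?S \<or> S0 l = ?V - ?S" using F S0V by auto
    have vS: "T * p3 \<le> vol \<mu> ?S" using F by (rule disjE) (simp_all only: v1 v2)
    have Dl: "matching_action ?V \<mu> (1 - \<delta>) ?S (D l)" using D[OF l] by (simp add: thr)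
    have vc: "valid_cut ?V \<mu> ?S" by (rule valid_fix_cut[OF n pos S0V])
    have "2 * a * (vol \<mu> ?S * ((1 - (1 - \<delta>)) - vol \<mu> (Bd l) / vol \<mu> (?V - S0 l))) \<le> (\<Sum>i<n. \<Sum>j<n. D l i j * \<bar>u i - u j\<bar>)"
    proof (rule matching_energy_ge[OF _ _ vc Dl X])
      fix i j assume "i \<in> S0 l" "j \<in> ?V - S0 l - Bd l"
      then show "a \<le> \<bar>u i - u j\<bar>" by (auto simp: S0_def Bd_def)
    qed (use pos a0 in \<open>auto simp: Bd_def\<close>)
    moreover have "T * p3 * \<delta> - vol \<mu> (Bd l) \<le> vol \<mu> ?S * (\<delta> - vol \<mu> (Bd l) / vol \<mu> (?V - S0 l))"
      if h: "0 \<le> \<delta> - vol \<mu> (Bd l) / vol \<mu> (?V - S0 l)"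
    proof -
      have b0: "0 \<le> vol \<mu> (Bd l)" by (simp add: vol_def sum_nonneg)
      have "vol \<mu> (Bd l) / vol \<mu> (?V - S0 l) \<le> vol \<mu> (Bd l) / (T * p3)"
        using v2 Tp b0 by (intro divide_left_mono) auto
      then have "T * p3 * (\<delta> - vol \<mu> (Bd l) / (T * p3)) \<le> T * p3 * (\<delta> - vol \<mu> (Bd l) / vol \<mu> (?V - S0 l))"
        using Tp by (intro mult_left_mono) auto
      also have "\<dots> \<le> vol \<mu> ?S * (\<delta> - vol \<mu> (Bd l) / vol \<mu> (?V - S0 l))"
        using vS h by (intro mult_right_mono) auto
      finally show ?thesis using T0 p30 by (simp add: right_diff_distrib)
    qed
    moreover have "T * p3 * \<delta> - vol \<mu> (Bd l) \<le> 0" if h: "\<not> 0 \<le> \<delta> - vol \<mu> (Bd l) / vol \<mu> (?V - S0 l)"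
    proof -
      have b0: "0 \<le> vol \<mu> (Bd l)" by (simp add: vol_def sum_nonneg)
      have "\<delta> \<le> vol \<mu> (Bd l) / vol \<mu> (?V - S0 l)" using h by simp
      also have "\<dots> \<le> vol \<mu> (Bd l) / (T * p3)" using v2 Tp b0 by (intro divide_left_mono) auto
      finally show ?thesis using Tp by (simp add: pos_le_divide_eq mult.commute)
    qed
    moreover have "0 \<le> (\<Sum>i<n. \<Sum>j<n. D l i j * \<bar>u i - u j\<bar>)"
      using Dl by (auto simp: matching_action_def weighted_graph_def intro!: sum_nonneg mult_nonneg_nonneg)
    ultimately show ?thesis
    proof (cases "0 \<le> \<delta> - vol \<mu> (Bd l) / vol \<mu> (?V - S0 l)")
      case True
      note t1 = \<open>0 \<le> \<delta> - vol \<mu> (Bd l) / vol \<mu> (?V - S0 l) \<Longrightarrow> T * p3 * \<delta> - vol \<mu> (Bd l) \<le> vol \<mu> ?S * (\<delta> - vol \<mu> (Bd l) / vol \<mu> (?V - S0 l))\<close>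
      have "2 * a * (T * p3 * \<delta> - vol \<mu> (Bd l)) \<le> 2 * a * (vol \<mu> ?S * (\<delta> - vol \<mu> (Bd l) / vol \<mu> (?V - S0 l)))"
        using a0 by (intro mult_left_mono t1 True) auto
      then show ?thesis
        using \<open>2 * a * (vol \<mu> ?S * ((1 - (1 - \<delta>)) - vol \<mu> (Bd l) / vol \<mu> (?V - S0 l))) \<le> _\<close> by simp
    next
      case False
      have "2 * a * (T * p3 * \<delta> - vol \<mu> (Bd l)) \<le> 0"
        using a0 \<open>\<not> 0 \<le> \<delta> - vol \<mu> (Bd l) / vol \<mu> (?V - S0 l) \<Longrightarrow> T * p3 * \<delta> - vol \<mu> (Bd l) \<le> 0\<close>[OF False]
        by (intro mult_nonneg_nonpos) auto
      then show ?thesis using \<open>0 \<le> (\<Sum>i<n. \<Sum>j<n. D l i j * \<bar>u i - u j\<bar>)\<close> by linarith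
    qed
  qed
  have Bsum: "(\<Sum>l\<in>?L. vol \<mu> (Bd l)) \<le> real J * T"
  proof -
    have "(\<Sum>l\<in>?L. vol \<mu> (Bd l)) = (\<Sum>l\<in>?L. \<Sum>i<n. real (\<mu> i) * of_bool (i \<in> Bd l))"
    proof (rule sum.cong[OF refl])
      fix l show "vol \<mu> (Bd l) = (\<Sum>i<n. real (\<mu> i) * of_bool (i \<in> Bd l))"
        unfolding vol_def by (intro sum.mono_neutral_cong_left) (auto simp: Bd_def)
    qed
    also have "\<dots> = (\<Sum>i<n. \<Sum>l\<in>?L. real (\<mu> i) * of_bool (i \<in> Bd l))" by (rule sum.swap)
    also have "\<dots> = (\<Sum>i<n. real (\<mu> i) * (\<Sum>l\<in>?L. of_bool (i \<in> Bd l)))" by (simp only: sum_distrib_left)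
    also have "\<dots> \<le> (\<Sum>i<n. real (\<mu> i) * real J)"
    proof (intro sum_mono mult_left_mono)
      fix i
      have "(\<Sum>l\<in>?L. of_bool (i \<in> Bd l)) = real (card (?L \<inter> {l. i \<in> Bd l}))" using finL by simp
      also have "card (?L \<inter> {l. i \<in> Bd l}) \<le> card {l::nat. u i / s < real l \<and> real l < u i / s + real J}"
      proof (rule card_mono)
        show "?L \<inter> {l. i \<in> Bd l} \<subseteq> {l::nat. u i / s < real l \<and> real l < u i / s + real J}"
          using s0 by (auto simp: Bd_def S0_def a_def field_simps)
      qed (use card_open_interval_le in blast)
      also have "\<dots> \<le> J" using card_open_interval_le by blast
      finally show "(\<Sum>l\<in>?L. of_bool (i \<in> Bd l)) \<le> real J" by simp
    qed auto
    also have "\<dots> = real J * T" by (simp add: T vol_def sum_distrib_left mult.commute)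
    finally show ?thesis .
  qed
  have card4: "real Lv / 4 \<le> real (card ?L)"
  proof -
    have "?L = {..<(Lv + 3) div 4}" by (rule set_eqI) (simp, presburger)
    then have "card ?L = (Lv + 3) div 4" by simp
    then have "Lv \<le> 4 * card ?L" by presburger
    then show ?thesis by linarith
  qed
  have "\<alpha> * (\<delta> * p3)\<^sup>2 * real Lv * T / 64 \<le> 2 * a * (T * p3 * \<delta> * real Lv / 8)"
  proof -
    have "\<delta> * p3 * real Lv / 16 * (r1 / real Lv) \<le> a"
      unfolding a_def s_def using J2 r10 by (intro mult_right_mono) auto
    then have "\<delta> * p3 * r1 / 16 \<le> a" using Lv by simp
    moreover have "\<delta> * p3 * \<alpha> / 16 \<le> \<delta> * p3 * r1 / 16" using al d p30 by simp
    ultimately have "\<delta> * p3 * \<alpha> / 16 \<le> a" by linarith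
    then have "2 * (\<delta> * p3 * \<alpha> / 16) * (T * p3 * \<delta> * real Lv / 8) \<le> 2 * a * (T * p3 * \<delta> * real Lv / 8)"
      using T0 p30 d by (intro mult_right_mono mult_left_mono) auto
    then show ?thesis by (simp add: power2_eq_square mult_ac)
  qed
  also have "\<dots> \<le> 2 * a * (real (card ?L) * (T * p3 * \<delta>) - (\<Sum>l\<in>?L. vol \<mu> (Bd l)))"
  proof (intro mult_left_mono)
    have "real Lv / 4 * (T * p3 * \<delta>) \<le> real (card ?L) * (T * p3 * \<delta>)"
      using card4 T0 p30 d by (intro mult_right_mono) auto
    moreover have "real J * T \<le> \<delta> * p3 * real Lv / 8 * T" using J1 T0 by (intro mult_right_mono) auto
    ultimately show "T * p3 * \<delta> * real Lv / 8 \<le> real (card ?L) * (T * p3 * \<delta>) - (\<Sum>l\<in>?L. vol \<mu> (Bd l))"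
      using Bsum by (simp add: algebra_simps)
  qed (use a0 in simp)
  also have "\<dots> = (\<Sum>l\<in>?L. 2 * a * (T * p3 * \<delta> - vol \<mu> (Bd l)))"
    by (simp add: sum_distrib_left[symmetric] sum_subtractf)
  also have "\<dots> \<le> (\<Sum>l\<in>?L. \<Sum>i<n. \<Sum>j<n. D l i j * \<bar>u i - u j\<bar>)" using each by (intro sum_mono) auto
  finally show ?thesis .
qed

text \<open>The mean modulus has expectation at least 2 \<alpha>, because vectors of norm at most
  \<open>R\<close> carry half of the total, and the mean square has expectation 1. The pointwise
  bound \<open>pt\<close> combines both without conditioning: outside the event the modulus is below
  \<alpha> or below \<alpha> / 2 times the mean square.\<close>

lemma bulk_prob:
  fixes n :: nat
  assumes T: "T = vol \<mu> {..<n}" "0 < T" and tot: "(\<Sum>i<n. real (\<mu> i) * norm_sq n (v i)) = T" and R: "0 < R"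
    and low: "T / 2 \<le> (\<Sum>i | i < n \<and> norm_sq n (v i) \<le> R\<^sup>2. real (\<mu> i) * norm_sq n (v i))"
    and al: "\<alpha> = 1 / (16 * R)"
  shows "\<alpha>\<^sup>2 / 4 \<le> coin_avg n (\<lambda>bs. of_bool (\<alpha> \<le> (\<Sum>i<n. real (\<mu> i) * \<bar>rsum n (v i) bs\<bar>) / T \<and> (\<Sum>i<n. real (\<mu> i) * (rsum n (v i) bs)\<^sup>2) / T \<le> 4 / \<alpha>\<^sup>2))"
proof -
  define r1 where "r1 bs = (\<Sum>i<n. real (\<mu> i) * \<bar>rsum n (v i) bs\<bar>) / T" for bs
  define r2 where "r2 bs = (\<Sum>i<n. real (\<mu> i) * (rsum n (v i) bs)\<^sup>2) / T" for bs
  have a0: "0 < \<alpha>" using R al by simp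
  have nv0: "0 \<le> norm_sq n w" for w by (simp add: norm_sq_def sum_nonneg)
  have Er2: "coin_avg n r2 = 1"
    unfolding r2_def[abs_def] using T(2) by (simp add: coin_avg_divide coin_avg_sum coin_avg_scale sign_second norm_sq_def[symmetric] tot)
  have Er1: "2 * \<alpha> \<le> coin_avg n r1"
  proof -
    have "T / 2 / R \<le> (\<Sum>i | i < n \<and> norm_sq n (v i) \<le> R\<^sup>2. real (\<mu> i) * norm_sq n (v i)) / R"
      using low R by (intro divide_right_mono) auto
    also have "\<dots> = (\<Sum>i | i < n \<and> norm_sq n (v i) \<le> R\<^sup>2. real (\<mu> i) * (norm_sq n (v i) / R))" by (simp add: sum_divide_distrib)
    also have "\<dots> \<le> (\<Sum>i | i < n \<and> norm_sq n (v i) \<le> R\<^sup>2. real (\<mu> i) * sqrt (norm_sq n (v i)))"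
    proof (intro sum_mono mult_left_mono)
      fix i assume "i \<in> {i. i < n \<and> norm_sq n (v i) \<le> R\<^sup>2}"
      then have "sqrt (norm_sq n (v i)) \<le> R" using R by (intro real_le_lsqrt) (auto simp: nv0)
      then have "sqrt (norm_sq n (v i)) * sqrt (norm_sq n (v i)) \<le> R * sqrt (norm_sq n (v i))" by (intro mult_right_mono) (auto simp: nv0)
      then show "norm_sq n (v i) / R \<le> sqrt (norm_sq n (v i))" using R nv0[of "v i"] by (simp add: divide_le_eq mult.commute)
    qed auto
    also have "\<dots> \<le> (\<Sum>i<n. real (\<mu> i) * sqrt (norm_sq n (v i)))" by (intro sum_mono2) (auto simp: nv0)
    also have "\<dots> \<le> (\<Sum>i<n. real (\<mu> i) * (4 * coin_avg n (\<lambda>bs. \<bar>rsum n (v i) bs\<bar>)))"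
      using sign_abs_ge[where n = n] by (intro sum_mono mult_left_mono) (auto simp: norm_sq_def field_simps)
    also have "\<dots> = 4 * T * coin_avg n r1"
    proof -
      have "coin_avg n r1 = (\<Sum>i<n. real (\<mu> i) * coin_avg n (\<lambda>bs. \<bar>rsum n (v i) bs\<bar>)) / T"
        unfolding r1_def[abs_def] by (simp add: coin_avg_divide coin_avg_sum coin_avg_scale)
      then have "4 * T * coin_avg n r1 = 4 * (\<Sum>i<n. real (\<mu> i) * coin_avg n (\<lambda>bs. \<bar>rsum n (v i) bs\<bar>))" using T(2) by simp
      then show ?thesis by (simp only: sum_distrib_left mult.left_commute)
    qed
    finally have "T * (1 / (2 * R)) \<le> T * (4 * coin_avg n r1)" by (simp add: mult_ac)
    then have "1 / (2 * R) \<le> 4 * coin_avg n r1" by (simp only: mult_le_cancel_left_pos[OF T(2)])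
    then show ?thesis by (simp add: al)
  qed
  have r1r2: "(r1 bs)\<^sup>2 \<le> r2 bs" for bs
  proof -
    have "(\<Sum>i<n. real (\<mu> i) * \<bar>rsum n (v i) bs\<bar>)\<^sup>2 = (\<Sum>i<n. sqrt (real (\<mu> i)) * (sqrt (real (\<mu> i)) * \<bar>rsum n (v i) bs\<bar>))\<^sup>2"
      by (simp add: mult.assoc[symmetric])
    also have "\<dots> \<le> (\<Sum>i<n. (sqrt (real (\<mu> i)))\<^sup>2) * (\<Sum>i<n. (sqrt (real (\<mu> i)) * \<bar>rsum n (v i) bs\<bar>)\<^sup>2)"
      by (rule Cauchy_Schwarz_ineq_sum)
    also have "\<dots> = T * (\<Sum>i<n. real (\<mu> i) * (rsum n (v i) bs)\<^sup>2)"
      by (simp add: power_mult_distrib T(1) vol_def)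
    finally show ?thesis using T(2) by (simp add: r1_def r2_def power_divide field_simps power2_eq_square)
  qed
  have r1n: "0 \<le> r1 bs" and r2n: "0 \<le> r2 bs" for bs using T(2) by (auto simp: r1_def r2_def intro!: divide_nonneg_nonneg sum_nonneg)
  let ?g = "\<lambda>bs. of_bool (\<alpha> \<le> r1 bs \<and> r2 bs \<le> 4 / \<alpha>\<^sup>2) :: real"
  have pt: "r1 bs \<le> \<alpha> + (2 / \<alpha>) * ?g bs + (\<alpha> / 2) * r2 bs" for bs
  proof -
    consider "r1 bs < \<alpha>" | "4 / \<alpha>\<^sup>2 < r2 bs" | "\<alpha> \<le> r1 bs" "r2 bs \<le> 4 / \<alpha>\<^sup>2" by linarith
    then show ?thesis
    proof cases
      case 1
      have "0 \<le> (2 / \<alpha>) * ?g bs + (\<alpha> / 2) * r2 bs" using a0 r2n[of bs] by (intro add_nonneg_nonneg mult_nonneg_nonneg) auto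
      then show ?thesis using 1 by linarith
    next
      case 2
      have "(r1 bs)\<^sup>2 \<le> ((\<alpha> / 2) * r2 bs)\<^sup>2"
      proof -
        have "4 \<le> \<alpha>\<^sup>2 * r2 bs" using 2 a0 by (simp add: field_simps)
        then have "4 * r2 bs \<le> \<alpha>\<^sup>2 * r2 bs * r2 bs" using r2n by (intro mult_right_mono) auto
        then have "4 * (r1 bs)\<^sup>2 \<le> \<alpha>\<^sup>2 * r2 bs * r2 bs" using r1r2[of bs] by linarith
        then show ?thesis by (simp add: power_mult_distrib power_divide power2_eq_square mult_ac)
      qed
      from power2_le_imp_le[OF this] have "r1 bs \<le> (\<alpha> / 2) * r2 bs" using a0 r2n[of bs] by simp
      moreover have "0 \<le> (2 / \<alpha>) * ?g bs" using a0 by (intro mult_nonneg_nonneg) auto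
      ultimately show ?thesis using a0 by linarith
    next
      case 3
      have "(r1 bs)\<^sup>2 \<le> (2 / \<alpha>)\<^sup>2" using r1r2[of bs] 3 by (simp add: power_divide)
      from power2_le_imp_le[OF this] have "r1 bs \<le> 2 / \<alpha>" using a0 by simp
      then have "r1 bs \<le> (2 / \<alpha>) * ?g bs" using 3 by simp
      moreover have "0 \<le> (\<alpha> / 2) * r2 bs" using a0 r2n[of bs] by (intro mult_nonneg_nonneg) auto
      ultimately show ?thesis using a0 by linarith
    qed
  qed
  have "2 * \<alpha> \<le> coin_avg n (\<lambda>bs. \<alpha> + (2 / \<alpha>) * ?g bs + (\<alpha> / 2) * r2 bs)"
    using Er1 coin_avg_mono[of n r1, OF pt] by linarith
  also have "\<dots> = \<alpha> + (2 / \<alpha>) * coin_avg n ?g + \<alpha> / 2" by (simp only: coin_avg_add coin_avg_scale coin_avg_const Er2)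
  finally have "\<alpha> / 2 \<le> (2 / \<alpha>) * coin_avg n ?g" by simp
  then have "\<alpha>\<^sup>2 / 4 \<le> coin_avg n ?g" using a0 by (simp add: field_simps power2_eq_square)
  then show ?thesis by (simp add: r1_def r2_def)
qed


text \<open>The seed is at most 1 in modulus because the cut side has at most half of the weight.
  Thus \<open>t\<close> rounds create degrees of at most \<open>t\<close> times the weight, which
  controls the Laplacian of the union.\<close>

lemma matching_degree_le:
  assumes fin: "finite V" and S: "valid_cut V \<mu> S" and pos: "\<And>i. i \<in> V \<Longrightarrow> 0 < \<mu> i"
    and D: "matching_action V \<mu> \<epsilon> S D" and i: "i \<in> V"
  shows "wdegree V D i \<le> real (\<mu> i)"
proof -
  have SV: "S \<subset> V" and half: "vol \<mu> S \<le> vol \<mu> V / 2" using S by (auto simp: valid_cut_def)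
  have volV: "vol \<mu> V = vol \<mu> S + vol \<mu> (V - S)"
    unfolding vol_def using SV fin by (subst sum.subset_diff[of S V]) auto
  have s0: "0 \<le> vol \<mu> S" by (simp add: vol_def sum_nonneg)
  have "\<bar>seed V \<mu> S i\<bar> \<le> 1"
  proof (cases "i \<in> S")
    case True then show ?thesis by (simp add: seed_def)
  next
    case False
    have "vol \<mu> S / vol \<mu> (V - S) \<le> 1" using volV half s0 by (cases "vol \<mu> (V - S) = 0") auto
    moreover have "0 \<le> vol \<mu> S / vol \<mu> (V - S)" using volV half s0 by simp
    ultimately show ?thesis using False i by (simp add: seed_def)
  qed
  then have "real (\<mu> i) * \<bar>seed V \<mu> S i\<bar> \<le> real (\<mu> i) * 1" by (intro mult_left_mono) auto
  moreover have "wdegree V D i \<le> real (\<mu> i) * \<bar>seed V \<mu> S i\<bar>" using D i by (auto simp: matching_action_def)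
  ultimately show ?thesis by simp
qed

text \<open>\<open>2 * Lv\<close> times the expected energy of a round, since each of the two types
  of cut has \<open>Lv\<close> equally likely levels. \<open>D l bs\<close> is the answer that the
  opponent would give to these coins.\<close>

definition Etot :: "nat \<Rightarrow> nat \<Rightarrow> nat \<Rightarrow> (nat \<Rightarrow> nat \<Rightarrow> real) \<Rightarrow> (nat \<Rightarrow> bool list \<Rightarrow> nat wgraph) \<Rightarrow> real" where
  "Etot n Lv K v D = (\<Sum>l<2 * Lv. coin_avg (K * n) (\<lambda>bs. \<Sum>i<n. \<Sum>j<n. D l bs i j * dist_sq n v i j))"

text \<open>The bound on \<open>K\<close> gives each of the \<open>n\<close> norm estimates a
  failure probability of at most 1 / (2 n), so with probability 1/2 all are good at once. Summing
  \<open>norm_cut_energy\<close> over the levels recovers the contribution of the long vectors, with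
  a loss linear in \<delta>.\<close>

lemma round_norm:
  fixes n :: nat and \<mu> :: "nat \<Rightarrow> nat"
  assumes n: "2 \<le> n" and pos: "\<And>i. i < n \<Longrightarrow> 0 < \<mu> i" and d: "0 < \<delta>" "\<delta> \<le> 1" and T: "T = vol \<mu> {..<n}"
    and K: "48 * ln (4 * real n) \<le> real K" and tot: "(\<Sum>i<n. real (\<mu> i) * norm_sq n (v i)) = T"
    and nv: "\<And>i. i < n \<Longrightarrow> norm_sq n (v i) \<le> 2 ^ Lv"
    and D: "\<And>l bs. l < 2 * Lv \<Longrightarrow> length bs = K * n \<Longrightarrow> matching_action {..<n} \<mu> (1 - \<delta>) (round_cut n \<mu> Lv K v l bs) (D l bs)"
    and high: "T / 2 \<le> (\<Sum>i | i < n \<and> 2 ^ 15 / \<delta> \<le> norm_sq n (v i). real (\<mu> i) * norm_sq n (v i))"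
  shows "\<delta> * T / 32768 \<le> Etot n Lv K v D"
proof -
  define good where "good bs = (\<forall>i<n. real K * norm_sq n (v i) / 4 \<le> sq_sum n K (v i) bs \<and> sq_sum n K (v i) bs \<le> 8 * real K * norm_sq n (v i))" for bs
  define c where "c l = \<delta> / 4096 * (2 ^ (l + 6) * vol \<mu> {i. i < n \<and> 2 ^ (l + 6) \<le> norm_sq n (v i)})" for l
  let ?L = "{l. l < Lv \<and> 256 / \<delta> \<le> (2::real) ^ l}"
  have "1 \<le> 4 * real n" using n by simp
  then have "0 \<le> ln (4 * real n)" by simp
  have K1: "1 \<le> K"
  proof -
    have "0 < ln (4 * real n)" using n by simp
    then show ?thesis using K by (cases K) auto
  qed
  have bad: "coin_avg (K * n) (\<lambda>bs. of_bool (\<not> good bs)) \<le> 1 / 2"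
  proof -
    have "coin_avg (K * n) (\<lambda>bs. of_bool (\<not> good bs)) \<le> coin_avg (K * n) (\<lambda>bs. \<Sum>i<n. of_bool (\<not> (real K * norm_sq n (v i) / 4 \<le> sq_sum n K (v i) bs \<and> sq_sum n K (v i) bs \<le> 8 * real K * norm_sq n (v i))))"
    proof (rule coin_avg_mono)
      fix bs
      let ?b = "\<lambda>i. of_bool (\<not> (real K * norm_sq n (v i) / 4 \<le> sq_sum n K (v i) bs \<and> sq_sum n K (v i) bs \<le> 8 * real K * norm_sq n (v i))) :: real"
      show "of_bool (\<not> good bs) \<le> (\<Sum>i<n. ?b i)"
      proof (cases "good bs")
        case True then show ?thesis by (simp add: sum_nonneg)
      next
        case False
        then obtain i where i: "i < n" "?b i = 1" by (auto simp: good_def)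
        have "?b i \<le> (\<Sum>i<n. ?b i)" using i(1) by (intro member_le_sum) auto
        then show ?thesis using i False by simp
      qed
    qed
    also have "\<dots> \<le> (\<Sum>i<n. 2 * exp (- (real K / 48)))"
      unfolding coin_avg_sum by (intro sum_mono sq_sum_concentrated) (simp add: norm_sq_def)
    also have "\<dots> \<le> (\<Sum>i<n. 2 * exp (- ln (4 * real n)))" using K by (intro sum_mono) simp
    also have "\<dots> = 1 / 2" using n by (simp add: exp_minus exp_ln)
    finally show ?thesis .
  qed
  have pg: "1 / 2 \<le> coin_avg (K * n) (\<lambda>bs. of_bool (good bs))"
  proof -
    have "coin_avg (K * n) (\<lambda>bs. of_bool (good bs)) = coin_avg (K * n) (\<lambda>bs. 1 - of_bool (\<not> good bs))" by (intro coin_avg_cong) simp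
    also have "\<dots> = 1 - coin_avg (K * n) (\<lambda>bs. of_bool (\<not> good bs))" by (simp only: coin_avg_diff coin_avg_const)
    finally show ?thesis using bad by simp
  qed
  have c0: "0 \<le> c l" for l using d by (simp add: c_def vol_def sum_nonneg)
  have nnE: "0 \<le> (\<Sum>i<n. \<Sum>j<n. D l bs i j * dist_sq n v i j)" if "l < 2 * Lv" "length bs = K * n" for l bs
    using D[OF that] dist_sq_props by (auto simp: matching_action_def weighted_graph_def intro!: sum_nonneg mult_nonneg_nonneg)
  have each: "c l / 2 \<le> coin_avg (K * n) (\<lambda>bs. \<Sum>i<n. \<Sum>j<n. D (Lv + l) bs i j * dist_sq n v i j)" if l: "l \<in> ?L" for l
  proof -
    have "c l / 2 \<le> c l * coin_avg (K * n) (\<lambda>bs. of_bool (good bs))" using mult_left_mono[OF pg c0[of l]] by simp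
    also have "\<dots> = coin_avg (K * n) (\<lambda>bs. c l * of_bool (good bs))" by (simp only: coin_avg_scale)
    also have "\<dots> \<le> coin_avg (K * n) (\<lambda>bs. \<Sum>i<n. \<Sum>j<n. D (Lv + l) bs i j * dist_sq n v i j)"
    proof (rule coin_avg_mono)
      fix bs :: "bool list" assume bs: "length bs = K * n"
      have l2: "Lv + l < 2 * Lv" using l by simp
      show "c l * of_bool (good bs) \<le> (\<Sum>i<n. \<Sum>j<n. D (Lv + l) bs i j * dist_sq n v i j)"
      proof (cases "good bs")
        case True
        have "c l \<le> (\<Sum>i<n. \<Sum>j<n. D (Lv + l) bs i j * dist_sq n v i j)"
          unfolding c_def
        proof (rule norm_cut_energy[OF n pos d(1) K1])
          show "matching_action {..<n} \<mu> (1 - \<delta>) (fix_cut n \<mu> (thr_cut n \<mu> (2 ^ (l + 1)) (\<lambda>i. sq_sum n K (v i) bs))) (D (Lv + l) bs)"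
            using D[OF l2 bs] by (simp add: round_cut_def)
        qed (use True l tot T in \<open>auto simp: good_def\<close>)
        then show ?thesis using True by simp
      next
        case False then show ?thesis using nnE[OF l2 bs] by simp
      qed
    qed
    finally show ?thesis .
  qed
  have fL: "finite ?L" by simp
  have "\<delta> * T / 32768 \<le> \<delta> / 4096 * (T / 2 / 2) / 2" using d by simp
  also have "\<dots> \<le> \<delta> / 4096 * (\<Sum>l\<in>?L. 2 ^ (l + 6) * vol \<mu> {i. i < n \<and> 2 ^ (l + 6) \<le> norm_sq n (v i)}) / 2"
  proof (intro divide_right_mono mult_left_mono)
    show "T / 2 / 2 \<le> (\<Sum>l\<in>?L. 2 ^ (l + 6) * vol \<mu> {i. i < n \<and> 2 ^ (l + 6) \<le> norm_sq n (v i)})"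
      using dyadic_energy[where n = n and f = "\<lambda>i. norm_sq n (v i)" and \<mu> = \<mu>, OF d nv] high by linarith
  qed (use d in auto)
  also have "\<dots> = (\<Sum>l\<in>?L. c l / 2)" by (simp add: c_def sum_distrib_left sum_divide_distrib)
  also have "\<dots> \<le> (\<Sum>l\<in>?L. coin_avg (K * n) (\<lambda>bs. \<Sum>i<n. \<Sum>j<n. D (Lv + l) bs i j * dist_sq n v i j))"
    by (intro sum_mono each)
  also have "\<dots> = (\<Sum>l\<in>(+) Lv ` ?L. coin_avg (K * n) (\<lambda>bs. \<Sum>i<n. \<Sum>j<n. D l bs i j * dist_sq n v i j))"
    by (simp add: sum.reindex)
  also have "\<dots> \<le> Etot n Lv K v D"
    unfolding Etot_def by (intro sum_mono2) (auto intro!: coin_avg_nonneg nnE)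
  finally show ?thesis .
qed

text \<open>Constants depending on \<delta> only: \<open>alph\<close> bounds the mean modulus of a
  projection of bounded vectors from below, \<open>mass3\<close> the share of weight in either tail,
  \<open>move1\<close> the expected move along a random matching. The 512 is 64 from
  \<open>bulk_move\<close>, 4 from \<open>bulk_prob\<close> and 2 for the two types of cut.\<close>

definition alph :: "real \<Rightarrow> real" where "alph \<delta> = 1 / (16 * sqrt (2 ^ 15 / \<delta>))"
definition mass3 :: "real \<Rightarrow> real" where "mass3 \<delta> = (alph \<delta>)\<^sup>2 / (16 * (4 / (alph \<delta>)\<^sup>2))"
definition move1 :: "real \<Rightarrow> real" where "move1 \<delta> = (alph \<delta>) ^ 3 * (\<delta> * mass3 \<delta>)\<^sup>2 / 512"

lemma move1_pos: "0 < \<delta> \<Longrightarrow> 0 < alph \<delta> \<and> 0 < mass3 \<delta> \<and> 0 < move1 \<delta>"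
  by (simp add: move1_def mass3_def alph_def)

lemma rsum_diff: "rsum n w bs - rsum n w' bs = rsum n (\<lambda>l. w l - w' l) bs"
  by (simp add: rsum_def sum_subtractf algebra_simps)

lemma rsum_mean:
  assumes "\<And>l. l < n \<Longrightarrow> (\<Sum>i<n. m i * v i l) = 0"
  shows "(\<Sum>i<n. m i * rsum n (v i) bs) = 0"
proof -
  have "(\<Sum>i<n. m i * rsum n (v i) bs) = (\<Sum>i<n. \<Sum>l<n. m i * v i l * sg (bs ! l))"
    by (simp add: rsum_def sum_distrib_left mult.assoc)
  also have "\<dots> = (\<Sum>l<n. (\<Sum>i<n. m i * v i l) * sg (bs ! l))"
    by (subst sum.swap) (simp add: sum_distrib_right)
  finally show ?thesis using assms by simp
qed

text \<open>The walk lives on one hypothetical round: every step draws level and coins afresh and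
  follows the answer that the opponent would give to them. Small energy makes the steps short, yet
  by \<open>bulk_move\<close> they move the projection by a constant on average;
  \<open>entropy_bound\<close> sets these two facts against each other.\<close>

lemma round_bulk:
  fixes n :: nat and \<mu> :: "nat \<Rightarrow> nat"
  assumes n: "2 \<le> n" and pos: "\<And>i. i < n \<Longrightarrow> 0 < \<mu> i" and d: "0 < \<delta>" "\<delta> \<le> 1" and T: "T = vol \<mu> {..<n}"
    and K: "1 \<le> K" and tot: "(\<Sum>i<n. real (\<mu> i) * norm_sq n (v i)) = T"
    and mean: "\<And>l. l < n \<Longrightarrow> (\<Sum>i<n. real (\<mu> i) * v i l) = 0"
    and Lv: "16 / (\<delta> * mass3 \<delta>) \<le> real Lv"
    and D: "\<And>l bs. l < 2 * Lv \<Longrightarrow> length bs = K * n \<Longrightarrow> matching_action {..<n} \<mu> (1 - \<delta>) (round_cut n \<mu> Lv K v l bs) (D l bs)"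
    and low: "\<not> T / 2 \<le> (\<Sum>i | i < n \<and> 2 ^ 15 / \<delta> \<le> norm_sq n (v i). real (\<mu> i) * norm_sq n (v i))"
    and B: "0 < B" "Etot n Lv K v D \<le> 2 * real Lv * B * T" and S: "2 ^ S \<le> (move1 \<delta>)\<^sup>2 / (32 * B)"
  shows "real (S + 1) * ((move1 \<delta>)\<^sup>2 / (32 * B)) \<le> ln (real n)"
proof -
  let ?V = "{..<n}"
  define R where "R = sqrt (2 ^ 15 / \<delta>)"
  define \<alpha> where "\<alpha> = alph \<delta>"
  have R0: "0 < R" "R\<^sup>2 = 2 ^ 15 / \<delta>" using d by (auto simp: R_def)
  have \<alpha>R: "\<alpha> = 1 / (16 * R)" by (simp add: \<alpha>_def alph_def R_def)
  have \<alpha>0: "0 < \<alpha>" and m0: "0 < mass3 \<delta>" and A0: "0 < move1 \<delta>" using move1_pos[OF d(1)] by (auto simp: \<alpha>_def)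
  have T0: "0 < T" unfolding T vol_def using n pos by (intro sum_pos) (auto simp: lessThan_empty_iff)
  have Lv0: "0 < Lv"
  proof -
    have "0 < 16 / (\<delta> * mass3 \<delta>)" using d m0 by simp
    then show ?thesis using Lv by (cases Lv) auto
  qed
  have nv0: "0 \<le> norm_sq n w" for w by (simp add: norm_sq_def sum_nonneg)
  have vc: "valid_cut ?V \<mu> (round_cut n \<mu> Lv K v l bs)" for l bs
    unfolding round_cut_def by (intro valid_fix_cut n pos) (auto simp: thr_cut_def)
  have lowT: "T / 2 \<le> (\<Sum>i | i < n \<and> norm_sq n (v i) \<le> R\<^sup>2. real (\<mu> i) * norm_sq n (v i))"
  proof -
    have "T = (\<Sum>i\<in>{i. i < n \<and> 2 ^ 15 / \<delta> \<le> norm_sq n (v i)} \<union> {i. i < n \<and> \<not> 2 ^ 15 / \<delta> \<le> norm_sq n (v i)}. real (\<mu> i) * norm_sq n (v i))"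
      unfolding tot[symmetric] by (intro sum.cong) auto
    also have "\<dots> = (\<Sum>i | i < n \<and> 2 ^ 15 / \<delta> \<le> norm_sq n (v i). real (\<mu> i) * norm_sq n (v i)) + (\<Sum>i | i < n \<and> \<not> 2 ^ 15 / \<delta> \<le> norm_sq n (v i). real (\<mu> i) * norm_sq n (v i))"
      by (intro sum.union_disjoint) auto
    finally have "T / 2 \<le> (\<Sum>i | i < n \<and> \<not> 2 ^ 15 / \<delta> \<le> norm_sq n (v i). real (\<mu> i) * norm_sq n (v i))" using low by linarith
    also have "\<dots> \<le> (\<Sum>i | i < n \<and> norm_sq n (v i) \<le> R\<^sup>2. real (\<mu> i) * norm_sq n (v i))"
      by (intro sum_mono2) (auto simp: R0(2) nv0)
    finally show ?thesis .
  qed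
  define Om where "Om = {..<2 * Lv} \<times> {bs :: bool list. length bs = K * n}"
  define p where "p = (\<lambda>\<omega>::nat \<times> bool list. 1 / (2 * real Lv * 2 ^ (K * n)))"
  define \<pi> where "\<pi> i = real (\<mu> i) / T" for i
  \<comment> \<open>Reads only the last block of coins, the one that the threshold cuts of a
    projection use.\<close>
  define u where "u \<omega> i = rsum n (v i) (blk n (K - 1) (snd \<omega>))" for \<omega> :: "nat \<times> bool list" and i
  define Dw where "Dw \<omega> = D (fst \<omega>) (snd \<omega>)" for \<omega>
  \<comment> \<open>An edge is taken with probability its weight over \<open>\<mu> x\<close>, and
    the unmatched remainder, nonnegative by \<open>matching_degree_le\<close>, stays put. Symmetry
    of the matching gives reversibility.\<close>
  define Kk where "Kk \<omega> x y = (if x = y then 1 - wdegree ?V (Dw \<omega>) x / real (\<mu> x) else 0) + Dw \<omega> x y / real (\<mu> x)" for \<omega> x y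
  have Dm: "matching_action ?V \<mu> (1 - \<delta>) (round_cut n \<mu> Lv K v (fst \<omega>) (snd \<omega>)) (Dw \<omega>)" if "\<omega> \<in> Om" for \<omega>
    using that D by (auto simp: Om_def Dw_def)
  have Dsym: "Dw \<omega> x y = Dw \<omega> y x" and Dnn: "0 \<le> Dw \<omega> x y" and Ddiag: "Dw \<omega> x x = 0" if "\<omega> \<in> Om" for \<omega> x y
    using Dm[OF that] by (auto simp: matching_action_def weighted_graph_def)
  have deg: "wdegree ?V (Dw \<omega>) x \<le> real (\<mu> x)" if "\<omega> \<in> Om" "x \<in> ?V" for \<omega> x
    by (rule matching_degree_le[OF _ vc _ Dm[OF that(1)] that(2)]) (use pos in auto)
  have sumOm: "(\<Sum>\<omega>\<in>Om. p \<omega> * f \<omega>) = (\<Sum>l<2 * Lv. coin_avg (K * n) (\<lambda>bs. f (l, bs))) / (2 * real Lv)" for f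
  proof -
    have "(\<Sum>\<omega>\<in>Om. p \<omega> * f \<omega>) = (\<Sum>l<2 * Lv. \<Sum>bs | length bs = K * n. p (l, bs) * f (l, bs))"
      unfolding Om_def sum.cartesian_product by (intro sum.cong) auto
    then show ?thesis by (simp add: p_def coin_avg_def sum_divide_distrib mult.commute)
  qed
  have sumOm_last: "(\<Sum>\<omega>\<in>Om. p \<omega> * g (blk n (K - 1) (snd \<omega>))) = coin_avg n g" for g
    unfolding sumOm using K Lv0 coin_avg_last_blk[of K n g] by simp
  note mupos = pos
  interpret projected_walk ?V \<pi> Om p Kk ?V v u
  proof
    show "finite ?V" by simp
    show "0 < \<pi> i" if "i \<in> ?V" for i using pos that T0 by (simp add: \<pi>_def)
    show "finite Om" using finite_len by (simp add: Om_def)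
    show "(\<Sum>x<n. \<pi> x) = 1" using T0 by (simp add: \<pi>_def sum_divide_distrib[symmetric] T vol_def)
    show "0 \<le> p \<omega>" for \<omega> by (simp add: p_def)
    show "(\<Sum>\<omega>\<in>Om. p \<omega>) = 1" using sumOm[of "\<lambda>_. 1"] Lv0 by simp
    show "0 \<le> Kk \<omega> x y" if "\<omega> \<in> Om" "x \<in> ?V" "y \<in> ?V" for \<omega> x y
    proof -
      have "wdegree ?V (Dw \<omega>) x / real (\<mu> x) \<le> 1"
        using deg[OF that(1,2)] pos[of x] that by (simp add: divide_le_eq_1_pos)
      moreover have "0 \<le> Dw \<omega> x y / real (\<mu> x)" using Dnn[OF that(1)] by simp
      ultimately show ?thesis unfolding Kk_def by (intro add_nonneg_nonneg) auto
    qed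
    show "(\<Sum>y\<in>?V. Kk \<omega> x y) = 1" if "\<omega> \<in> Om" "x \<in> ?V" for \<omega> x
      using that by (simp add: Kk_def sum.distrib sum_divide_distrib[symmetric] wdegree_def)
    show "\<pi> x * Kk \<omega> x y = \<pi> y * Kk \<omega> y x" if "\<omega> \<in> Om" "x \<in> ?V" "y \<in> ?V" for \<omega> x y
      using that pos[of x] pos[of y] Dsym[OF that(1), of x y] by (simp add: Kk_def \<pi>_def)
    show "(\<Sum>\<omega>\<in>Om. p \<omega> * exp (t * (u \<omega> x - u \<omega> y))) \<le> exp (t\<^sup>2 / 2 * (\<Sum>c<n. (v x c - v y c)\<^sup>2))" for t x y
      unfolding u_def rsum_diff sumOm_last[of "\<lambda>bs. exp (t * rsum n (\<lambda>l. v x l - v y l) bs)"] by (rule sign_mgf)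
    show "(\<Sum>\<omega>\<in>Om. p \<omega> * (u \<omega> x - u \<omega> y)\<^sup>2) \<le> (\<Sum>c<n. (v x c - v y c)\<^sup>2)" for x y
      unfolding u_def rsum_diff sumOm_last[of "\<lambda>bs. (rsum n (\<lambda>l. v x l - v y l) bs)\<^sup>2"] by (simp add: sign_second)
  qed
  \<comment> \<open>For functions vanishing on the diagonal the lazy part drops out, and
    \<open>\<pi> x / real (\<mu> x)\<close> is the constant 1 / \<open>T\<close>, so a stationary
    step is an average over the edges of all matchings.\<close>
  have trans: "(\<Sum>x<n. \<pi> x * (\<Sum>\<omega>\<in>Om. p \<omega> * (\<Sum>y<n. Kk \<omega> x y * f \<omega> x y))) = (\<Sum>l<2 * Lv. coin_avg (K * n) (\<lambda>bs. \<Sum>x<n. \<Sum>y<n. D l bs x y * f (l, bs) x y)) / (2 * real Lv) / T"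
    if f0: "\<And>\<omega> x. f \<omega> x x = 0" for f
  proof -
    have K1': "Kk \<omega> x y * f \<omega> x y = Dw \<omega> x y * f \<omega> x y / real (\<mu> x)" for \<omega> x y
      using f0 by (cases "x = y") (auto simp: Kk_def)
    have "(\<Sum>x<n. \<pi> x * (\<Sum>\<omega>\<in>Om. p \<omega> * (\<Sum>y<n. Kk \<omega> x y * f \<omega> x y))) = (\<Sum>x<n. \<Sum>\<omega>\<in>Om. p \<omega> * (\<Sum>y<n. Dw \<omega> x y * f \<omega> x y / T))"
    proof (rule sum.cong[OF refl])
      fix x assume "x \<in> ?V"
      then have mx: "real (\<mu> x) \<noteq> 0" using mupos[of x] by simp
      have c: "\<pi> x * (Dw \<omega> x y * f \<omega> x y / real (\<mu> x)) = Dw \<omega> x y * f \<omega> x y / T" for \<omega> y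
        using mx by (simp add: \<pi>_def)
      show "\<pi> x * (\<Sum>\<omega>\<in>Om. p \<omega> * (\<Sum>y<n. Kk \<omega> x y * f \<omega> x y)) = (\<Sum>\<omega>\<in>Om. p \<omega> * (\<Sum>y<n. Dw \<omega> x y * f \<omega> x y / T))"
        unfolding K1' c[symmetric] by (simp only: sum_distrib_left mult.left_commute)
    qed
    also have "\<dots> = (\<Sum>\<omega>\<in>Om. p \<omega> * (\<Sum>x<n. \<Sum>y<n. Dw \<omega> x y * f \<omega> x y / T))"
      by (subst sum.swap) (simp add: sum_distrib_left)
    also have "\<dots> = (\<Sum>\<omega>\<in>Om. p \<omega> * (\<Sum>x<n. \<Sum>y<n. Dw \<omega> x y * f \<omega> x y)) / T"
      by (simp only: sum_divide_distrib[symmetric] times_divide_eq_right)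
    finally show ?thesis unfolding sumOm by (simp add: Dw_def)
  qed
  have W1: "W 1 \<le> B"
  proof -
    have "W 1 = (\<Sum>x<n. \<pi> x * (\<Sum>\<omega>\<in>Om. p \<omega> * (\<Sum>y<n. Kk \<omega> x y * N x y)))"
      unfolding W_def using step_swap Pn_one by (intro sum.cong) simp_all
    also have "\<dots> = (\<Sum>l<2 * Lv. coin_avg (K * n) (\<lambda>bs. \<Sum>x<n. \<Sum>y<n. D l bs x y * N x y)) / (2 * real Lv) / T"
      by (rule trans) (simp add: N_def)
    also have "\<dots> = Etot n Lv K v D / (2 * real Lv) / T" by (simp add: Etot_def N_def dist_sq_def)
    also have "\<dots> \<le> B" using B T0 Lv0 by (simp add: field_simps)
    finally show ?thesis .
  qed
  have AM: "move1 \<delta> \<le> avg_move"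
  proof -
    define M where "M l bs = (\<Sum>x<n. \<Sum>y<n. D l bs x y * \<bar>u (l, bs) y - u (l, bs) x\<bar>)" for l bs
    define good where "good bs = (\<alpha> \<le> (\<Sum>i<n. real (\<mu> i) * \<bar>rsum n (v i) bs\<bar>) / T \<and> (\<Sum>i<n. real (\<mu> i) * (rsum n (v i) bs)\<^sup>2) / T \<le> 4 / \<alpha>\<^sup>2)" for bs
    define g where "g = \<alpha> * (\<delta> * mass3 \<delta>)\<^sup>2 * real Lv * T / 64"
    let ?L = "{l. 4 * l < Lv}"
    have M0: "0 \<le> M l bs" if "l < 2 * Lv" "length bs = K * n" for l bs
      using D[OF that] by (auto simp: M_def matching_action_def weighted_graph_def intro!: sum_nonneg mult_nonneg_nonneg)
    have finL: "finite ?L" by (rule finite_subset[of _ "{..Lv}"]) auto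
    have g0: "0 \<le> g" using \<alpha>0 T0 by (simp add: g_def)
    have pg: "\<alpha>\<^sup>2 / 4 \<le> coin_avg (K * n) (\<lambda>bs. of_bool (good (blk n (K - 1) bs)))"
      using bulk_prob[OF T T0 tot R0(1) lowT \<alpha>R] coin_avg_last_blk[of K n "\<lambda>bs. of_bool (good bs)"] K
      by (simp add: good_def)
    have "g * (\<alpha>\<^sup>2 / 4) \<le> g * coin_avg (K * n) (\<lambda>bs. of_bool (good (blk n (K - 1) bs)))" using pg g0 by (rule mult_left_mono)
    also have "\<dots> = coin_avg (K * n) (\<lambda>bs. g * of_bool (good (blk n (K - 1) bs)))" by (simp only: coin_avg_scale)
    also have "\<dots> \<le> coin_avg (K * n) (\<lambda>bs. \<Sum>l\<in>?L. M l bs)"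
    proof (rule coin_avg_mono)
      fix bs :: "bool list" assume bs: "length bs = K * n"
      let ?u = "\<lambda>i. rsum n (v i) (blk n (K - 1) bs)"
      show "g * of_bool (good (blk n (K - 1) bs)) \<le> (\<Sum>l\<in>?L. M l bs)"
      proof (cases "good (blk n (K - 1) bs)")
        case True
        have "\<alpha> * (\<delta> * mass3 \<delta>)\<^sup>2 * real Lv * T / 64 \<le> (\<Sum>l | 4 * l < Lv. \<Sum>i<n. \<Sum>j<n. D l bs i j * \<bar>?u i - ?u j\<bar>)"
        proof (rule bulk_move[OF n mupos d T _ _ _ \<alpha>0])
          show "(\<Sum>i<n. real (\<mu> i) * ?u i) = 0" by (rule rsum_mean[OF mean])
          show "(\<Sum>i<n. real (\<mu> i) * \<bar>?u i\<bar>) = (\<Sum>i<n. real (\<mu> i) * \<bar>?u i\<bar>) / T * T" using T0 by simp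
          show "(\<Sum>i<n. real (\<mu> i) * (?u i)\<^sup>2) = (\<Sum>i<n. real (\<mu> i) * (?u i)\<^sup>2) / T * T" using T0 by simp
          show "\<alpha> \<le> (\<Sum>i<n. real (\<mu> i) * \<bar>?u i\<bar>) / T" "(\<Sum>i<n. real (\<mu> i) * (?u i)\<^sup>2) / T \<le> 4 / \<alpha>\<^sup>2" using True by (auto simp: good_def)
          show "mass3 \<delta> = \<alpha>\<^sup>2 / (16 * (4 / \<alpha>\<^sup>2))" by (simp add: mass3_def \<alpha>_def)
          fix l assume "4 * l < Lv"
          then show "matching_action ?V \<mu> (1 - \<delta>) (fix_cut n \<mu> (thr_cut n \<mu> (real l / real Lv) ?u)) (D l bs)"
            using D[OF _ bs, of l] by (simp add: round_cut_def)
        qed (use Lv Lv0 in auto)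
        then show ?thesis using True by (simp add: g_def M_def u_def abs_minus_commute)
      next
        case False
        then show ?thesis using M0[OF _ bs] by (auto intro!: sum_nonneg)
      qed
    qed
    also have "\<dots> = (\<Sum>l\<in>?L. coin_avg (K * n) (M l))" by (rule coin_avg_sum)
    also have "\<dots> \<le> (\<Sum>l<2 * Lv. coin_avg (K * n) (M l))"
      using M0 by (intro sum_mono2) (auto intro!: coin_avg_nonneg)
    finally have 1: "g * (\<alpha>\<^sup>2 / 4) \<le> (\<Sum>l<2 * Lv. coin_avg (K * n) (M l))" .
    have "avg_move = (\<Sum>l<2 * Lv. coin_avg (K * n) (\<lambda>bs. M l bs)) / (2 * real Lv) / T"
      unfolding avg_move_def M_def by (rule trans) simp
    also have "\<dots> \<ge> g * (\<alpha>\<^sup>2 / 4) / (2 * real Lv) / T" using 1 T0 by (intro divide_right_mono) auto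
    also have "g * (\<alpha>\<^sup>2 / 4) / (2 * real Lv) / T = move1 \<delta>"
      using T0 Lv0 by (simp add: g_def move1_def \<alpha>_def power2_eq_square power3_eq_cube)
    finally show ?thesis .
  qed
  show ?thesis using entropy_bound[OF A0 AM W1 B(1) S] n by (simp add: lessThan_empty_iff)
qed


section \<open>Cost of programs\<close>

primrec rbits :: "nat \<Rightarrow> bool list pmf" where
  "rbits 0 = return_pmf []"
| "rbits (Suc F) = bind_pmf (bernoulli_pmf (1 / 2)) (\<lambda>b. map_pmf (\<lambda>bs. b # bs) (rbits F))"

lemma set_rbits: "bs \<in> set_pmf (rbits F) \<Longrightarrow> length bs = F"
  by (induction F arbitrary: bs) auto

lemma finite_set_rbits: "finite (set_pmf (rbits F))"
  by (rule finite_subset[OF _ finite_len[of F]]) (auto dest: set_rbits)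

lemma expectation_rbits: "measure_pmf.expectation (rbits F) f = coin_avg F f"
proof (induction F arbitrary: f)
  case (Suc F)
  have "measure_pmf.expectation (rbits (Suc F)) f = (\<integral>b. (\<integral>bs. f (b # bs) \<partial>rbits F) \<partial>bernoulli_pmf (1 / 2))"
    unfolding rbits.simps by (subst pmf_expectation_bind[where A = UNIV]) (auto simp: finite_set_rbits integral_measure_pmf[of UNIV])
  also have "\<dots> = coin_avg (Suc F) f" by (simp add: integral_measure_pmf[of UNIV] UNIV_bool Suc coin_avg_Suc)
  finally show ?case .
qed simp

definition halts :: "(mem \<Rightarrow> nat set) \<Rightarrow> config \<Rightarrow> nat set pmf \<Rightarrow> nat \<Rightarrow> bool" where
  "halts out c Z B \<longleftrightarrow> (\<exists>m. (\<forall>c'\<in>set_pmf (run m c). fst c' = [] \<and> snd (snd c') \<le> B) \<and>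
     map_pmf (\<lambda>c'. out (fst (snd c'))) (run m c) = Z)"

lemma run_add: "run (m + k) c = bind_pmf (run m c) (run k)"
  by (induction m arbitrary: c) (auto simp: bind_return_pmf bind_assoc_pmf intro!: bind_pmf_cong)

lemma run_halted: "fst c = [] \<Longrightarrow> run k c = return_pmf c"
  by (cases c) (induction k, auto simp: bind_return_pmf)

lemma run_stable: "(\<And>c'. c' \<in> set_pmf (run m c) \<Longrightarrow> fst c' = []) \<Longrightarrow> run (m + k) c = run m c"
proof -
  assume h: "\<And>c'. c' \<in> set_pmf (run m c) \<Longrightarrow> fst c' = []"
  have "run (m + k) c = bind_pmf (run m c) return_pmf"
    unfolding run_add by (intro bind_pmf_cong refl run_halted h)
  then show ?thesis by (simp add: bind_return_pmf')
qed

text \<open>The branches of a coin toss may halt after different numbers of machine steps. Halted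
  configurations no longer change, so the maximum serves all branches.\<close>

lemma halts_bind:
  assumes fin: "finite (set_pmf (step c))" and h: "\<And>c'. c' \<in> set_pmf (step c) \<Longrightarrow> halts out c' (Z c') B"
  shows "halts out c (bind_pmf (step c) Z) B"
proof -
  have "\<forall>c'\<in>set_pmf (step c). \<exists>m. (\<forall>x\<in>set_pmf (run m c'). fst x = [] \<and> snd (snd x) \<le> B) \<and>
     map_pmf (\<lambda>x. out (fst (snd x))) (run m c') = Z c'"
    using h unfolding halts_def by blast
  then obtain m where m: "\<And>c'. c' \<in> set_pmf (step c) \<Longrightarrow> (\<forall>x\<in>set_pmf (run (m c') c'). fst x = [] \<and> snd (snd x) \<le> B) \<and>
     map_pmf (\<lambda>x. out (fst (snd x))) (run (m c') c') = Z c'"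
    by metis
  define M where "M = Max (m ` set_pmf (step c))"
  have eq: "run M c' = run (m c') c'" if "c' \<in> set_pmf (step c)" for c'
  proof -
    have "m c' \<le> M" unfolding M_def using fin that by (intro Max_ge) auto
    then obtain k where "M = m c' + k" using le_Suc_ex by blast
    then show ?thesis using run_stable[of "m c'" c' k] m[OF that] by auto
  qed
  have r: "run (Suc M) c = bind_pmf (step c) (\<lambda>c'. run (m c') c')"
    unfolding run.simps by (intro bind_pmf_cong refl eq)
  have "map_pmf (\<lambda>x. out (fst (snd x))) (run (Suc M) c) = bind_pmf (step c) Z"
    unfolding r map_bind_pmf by (intro bind_pmf_cong refl) (use m in auto)
  moreover have "\<forall>x\<in>set_pmf (run (Suc M) c). fst x = [] \<and> snd (snd x) \<le> B"
    unfolding r using m by auto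
  ultimately show ?thesis unfolding halts_def by blast
qed

lemma halts_det: "step c = return_pmf c' \<Longrightarrow> halts out c' Z B \<Longrightarrow> halts out c Z B"
  using halts_bind[of c out "\<lambda>_. Z" B] by simp

lemma halts_end: "t \<le> B \<Longrightarrow> halts out ([], s, t) (return_pmf (out s)) B"
  unfolding halts_def by (rule exI[of _ 0]) simp

text \<open>Continuation-passing Hoare triples: \<open>hoare c s Q b\<close> says that \<open>c\<close> started in \<open>s\<close> ends after cost at
  most \<open>b\<close> in a state satisfying \<open>Q\<close>.\<close>

definition hoare :: "com \<Rightarrow> mem \<Rightarrow> (mem \<Rightarrow> bool) \<Rightarrow> nat \<Rightarrow> bool" where
  "hoare c s Q b \<longleftrightarrow> (\<forall>out cs t Z B. (\<forall>s' t'. Q s' \<longrightarrow> t' \<le> t + b \<longrightarrow> halts out (cs, s', t') Z B) \<longrightarrow> halts out (c # cs, s, t) Z B)"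

lemma hoare_weaken: "hoare c s Q b \<Longrightarrow> (\<And>s'. Q s' \<Longrightarrow> Q' s') \<Longrightarrow> b \<le> b' \<Longrightarrow> hoare c s Q' b'"
  unfolding hoare_def by (meson add_left_mono order_trans)

lemma hoare_prim:
  assumes "\<And>cs t. step (c # cs, s, t) = return_pmf (cs, s', t + b)"
  shows "hoare c s (\<lambda>x. x = s') b"
  unfolding hoare_def using halts_det[OF assms] by auto

lemma hoare_Seq:
  assumes c: "hoare c s P b1" and d: "\<And>s'. P s' \<Longrightarrow> hoare d s' Q b2"
  shows "hoare (Seq c d) s Q (1 + b1 + b2)"
  unfolding hoare_def
proof (intro allI impI)
  fix out cs t Z B
  assume h: "\<forall>s' t'. Q s' \<longrightarrow> t' \<le> t + (1 + b1 + b2) \<longrightarrow> halts out (cs, s', t') Z B"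
  have "halts out (c # d # cs, s, t + 1) Z B"
  proof (rule c[unfolded hoare_def, rule_format])
    fix s' t' assume s': "P s'" "t' \<le> t + 1 + b1"
    show "halts out (d # cs, s', t') Z B"
      using s' h by (intro d[unfolded hoare_def, rule_format]) auto
  qed
  then show "halts out (Seq c d # cs, s, t) Z B" by (intro halts_det[of "(Seq c d # cs, s, t)"]) simp_all
qed

lemma hoare_Cond:
  assumes "test_val b s \<Longrightarrow> hoare c s Q k" "\<not> test_val b s \<Longrightarrow> hoare d s Q k" "test_cost b s \<le> w"
  shows "hoare (Cond b c d) s Q (w + k)"
  unfolding hoare_def
proof (intro allI impI)
  fix out cs t Z B
  assume h: "\<forall>s' t'. Q s' \<longrightarrow> t' \<le> t + (w + k) \<longrightarrow> halts out (cs, s', t') Z B"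
  have "halts out ((if test_val b s then c else d) # cs, s, t + test_cost b s) Z B"
  proof (cases "test_val b s")
    case True
    then show ?thesis using h assms(3) by (simp only: if_True, intro assms(1)[unfolded hoare_def, rule_format]) auto
  next
    case False
    then show ?thesis using h assms(3) by (simp only: if_False, intro assms(2)[unfolded hoare_def, rule_format]) auto
  qed
  then show "halts out (Cond b c d # cs, s, t) Z B" by (intro halts_det[of "(Cond b c d # cs, s, t)"]) simp_all
qed

text \<open>A uniform price for an instruction or test that reads integers up to \<open>U\<close>;
  the 3 leaves room for the unit costs of sequencing.\<close>

definition op_cost :: "nat \<Rightarrow> nat" where "op_cost U = 3 + 2 * bits U"

lemma bits_mono: "x \<le> y \<Longrightarrow> bits x \<le> bits y"
  unfolding bits_def by (rule floorlog_mono)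

text \<open>Meant for code without loops and coins. The last clause is correct for
  \<open>Skip\<close> and a mere default for \<open>While\<close> and \<open>Flip\<close>, which
  \<open>reads_le\<close> rejects.\<close>

fun exec :: "com \<Rightarrow> mem \<Rightarrow> mem" where
  "exec (IConst x c) s = s\<lparr>ireg := (ireg s)(x := c)\<rparr>"
| "exec (IOp f x y z) s = s\<lparr>ireg := (ireg s)(x := iop_val f (ireg s y) (ireg s z))\<rparr>"
| "exec (ILoad a x y) s = s\<lparr>ireg := (ireg s)(x := imem s a (ireg s y))\<rparr>"
| "exec (IStore a x y) s = s\<lparr>imem := (imem s)(a := (imem s a)(ireg s x := ireg s y))\<rparr>"
| "exec (ROfInt x y) s = s\<lparr>rreg := (rreg s)(x := real (ireg s y))\<rparr>"
| "exec (ROp f x y z) s = s\<lparr>rreg := (rreg s)(x := rop_val f (rreg s y) (rreg s z))\<rparr>"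
| "exec (RLoad a x y) s = s\<lparr>rreg := (rreg s)(x := rmem s a (ireg s y))\<rparr>"
| "exec (RStore a x y) s = s\<lparr>rmem := (rmem s)(a := (rmem s a)(ireg s x := rreg s y))\<rparr>"
| "exec (Seq c d) s = exec d (exec c s)"
| "exec (Cond b c d) s = (if test_val b s then exec c s else exec d s)"
| "exec _ s = s"

fun test_reads_le :: "nat \<Rightarrow> test \<Rightarrow> mem \<Rightarrow> bool" where
  "test_reads_le U (ILess x y) s \<longleftrightarrow> ireg s x \<le> U \<and> ireg s y \<le> U"
| "test_reads_le U (RLess x y) s \<longleftrightarrow> True"

fun reads_le :: "nat \<Rightarrow> com \<Rightarrow> mem \<Rightarrow> bool" where
  "reads_le U Skip s \<longleftrightarrow> True"
| "reads_le U (IConst x c) s \<longleftrightarrow> c \<le> U"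
| "reads_le U (IOp f x y z) s \<longleftrightarrow> ireg s y \<le> U \<and> ireg s z \<le> U"
| "reads_le U (ILoad a x y) s \<longleftrightarrow> ireg s y \<le> U \<and> imem s a (ireg s y) \<le> U"
| "reads_le U (IStore a x y) s \<longleftrightarrow> ireg s x \<le> U \<and> ireg s y \<le> U"
| "reads_le U (ROfInt x y) s \<longleftrightarrow> ireg s y \<le> U"
| "reads_le U (ROp f x y z) s \<longleftrightarrow> True"
| "reads_le U (RLoad a x y) s \<longleftrightarrow> ireg s y \<le> U"
| "reads_le U (RStore a x y) s \<longleftrightarrow> ireg s x \<le> U"
| "reads_le U (Seq c d) s \<longleftrightarrow> reads_le U c s \<and> reads_le U d (exec c s)"
| "reads_le U (Cond b c d) s \<longleftrightarrow> test_reads_le U b s \<and> (if test_val b s then reads_le U c s else reads_le U d s)"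
| "reads_le U _ s \<longleftrightarrow> False"

fun clen :: "com \<Rightarrow> nat" where
  "clen (Seq c d) = 1 + clen c + clen d"
| "clen (Cond b c d) = 1 + max (clen c) (clen d)"
| "clen _ = 1"

lemma test_reads_le_cost: "test_reads_le U b s \<Longrightarrow> test_cost b s \<le> op_cost U"
proof (cases b)
  case (ILess x y)
  then show "test_reads_le U b s \<Longrightarrow> ?thesis" using bits_mono[of "ireg s x" U] bits_mono[of "ireg s y" U] by (simp add: op_cost_def)
qed (simp add: op_cost_def)

lemma hoare_ex: "reads_le U c s \<Longrightarrow> hoare c s (\<lambda>s'. s' = exec c s) (clen c * op_cost U)"
proof (induction c arbitrary: s)
  case (Seq c d)
  have "hoare (Seq c d) s (\<lambda>s'. s' = exec (Seq c d) s) (1 + clen c * op_cost U + clen d * op_cost U)"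
    using Seq by (intro hoare_Seq[OF Seq.IH(1)]) auto
  then show ?case by (rule hoare_weaken) (auto simp: op_cost_def algebra_simps)
next
  case (Cond b c d)
  have "hoare (Cond b c d) s (\<lambda>s'. s' = exec (Cond b c d) s) (op_cost U + max (clen c) (clen d) * op_cost U)"
  proof (rule hoare_Cond)
    assume t: "test_val b s"
    show "hoare c s (\<lambda>s'. s' = exec (Cond b c d) s) (max (clen c) (clen d) * op_cost U)"
      using Cond.prems t by (intro hoare_weaken[OF Cond.IH(1)]) auto
  next
    assume t: "\<not> test_val b s"
    show "hoare d s (\<lambda>s'. s' = exec (Cond b c d) s) (max (clen c) (clen d) * op_cost U)"
      using Cond.prems t by (intro hoare_weaken[OF Cond.IH(2)]) auto
  qed (use Cond.prems test_reads_le_cost in auto)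
  then show ?case by (rule hoare_weaken) (auto simp: algebra_simps)
next
  case (IOp f x y z)
  show ?case by (rule hoare_weaken[OF hoare_prim[where b = "1 + bits (ireg s y) + bits (ireg s z)"]]) 
      (use IOp bits_mono[of "ireg s y" U] bits_mono[of "ireg s z" U] in \<open>auto simp: op_cost_def\<close>)
next
  case (IConst x c)
  show ?case by (rule hoare_weaken[OF hoare_prim[where b = "1 + bits c"]]) (use IConst bits_mono[of "c" U] in \<open>auto simp: op_cost_def\<close>)
next
  case (ILoad a x y)
  show ?case by (rule hoare_weaken[OF hoare_prim[where b = "1 + bits (ireg s y) + bits (imem s a (ireg s y))"]]) 
      (use ILoad bits_mono[of "ireg s y" U] bits_mono[of "imem s a (ireg s y)" U] in \<open>auto simp: op_cost_def\<close>)
next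
  case (IStore a x y)
  show ?case by (rule hoare_weaken[OF hoare_prim[where b = "1 + bits (ireg s x) + bits (ireg s y)"]]) 
      (use IStore bits_mono[of "ireg s x" U] bits_mono[of "ireg s y" U] in \<open>auto simp: op_cost_def\<close>)
next
  case (ROfInt x y)
  show ?case by (rule hoare_weaken[OF hoare_prim[where b = "1 + bits (ireg s y)"]]) (use ROfInt bits_mono[of "ireg s y" U] in \<open>auto simp: op_cost_def\<close>)
next
  case (ROp f x y z)
  show ?case by (rule hoare_weaken[OF hoare_prim[where b = 1]]) (auto simp: op_cost_def)
next
  case (RLoad a x y)
  show ?case by (rule hoare_weaken[OF hoare_prim[where b = "1 + bits (ireg s y)"]]) (use RLoad bits_mono[of "ireg s y" U] in \<open>auto simp: op_cost_def\<close>)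
next
  case (RStore a x y)
  show ?case by (rule hoare_weaken[OF hoare_prim[where b = "1 + bits (ireg s x)"]]) (use RStore bits_mono[of "ireg s x" U] in \<open>auto simp: op_cost_def\<close>)
next
  case Skip
  show ?case by (rule hoare_weaken[OF hoare_prim[where b = 1]]) (auto simp: op_cost_def)
qed auto

text \<open>Integer register 3 permanently holds the constant one.\<close>

definition For :: "nat \<Rightarrow> nat \<Rightarrow> com \<Rightarrow> com" where
  "For i lm body = Seq (IConst i 0) (While (ILess i lm) (Seq body (IOp IAdd i i 3)))"

lemma For_loop_halts:
  assumes inv: "\<And>j s. I j s \<Longrightarrow> ireg s i = j \<and> ireg s lm = N"
    and body: "\<And>j s. j < N \<Longrightarrow> I j s \<Longrightarrow> hoare body s (\<lambda>s'. ireg s' i = j \<and> ireg s' 3 = 1 \<and> I (Suc j) (s'\<lparr>ireg := (ireg s')(i := Suc j)\<rparr>)) b"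
    and U: "N \<le> U" "1 \<le> U" and j: "j \<le> N" "I j s"
    and fin: "\<forall>s' t'. I N s' \<longrightarrow> t' \<le> t + ((N - j) * (b + 4 * op_cost U) + op_cost U) \<longrightarrow> halts out (cs, s', t') Z B"
  shows "halts out (While (ILess i lm) (Seq body (IOp IAdd i i 3)) # cs, s, t) Z B"
  using j fin
proof (induction "N - j" arbitrary: j s t)
  case 0
  then have jN: "j = N" by simp
  have tv: "ireg s i = N" "ireg s lm = N" using inv[OF 0(3)] jN by auto
  have "test_cost (ILess i lm) s \<le> op_cost U" using tv U by (intro test_reads_le_cost) auto
  then have "halts out (cs, s, t + test_cost (ILess i lm) s) Z B" using 0 jN by auto
  then show ?case by (rule halts_det[rotated]) (simp add: tv)
next
  case (Suc d)
  have jN: "j < N" using Suc.hyps(2) by simp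
  have tv: "ireg s i = j" "ireg s lm = N" using inv[OF Suc.prems(2)] by auto
  let ?W = "While (ILess i lm) (Seq body (IOp IAdd i i 3))"
  have tc: "test_cost (ILess i lm) s \<le> op_cost U" using tv U jN by (intro test_reads_le_cost) auto
  let ?t = "t + test_cost (ILess i lm) s + 1"
  have "halts out (body # IOp IAdd i i 3 # ?W # cs, s, ?t) Z B"
  proof (rule body[OF jN Suc.prems(2), unfolded hoare_def, rule_format])
    fix s' t' assume s': "ireg s' i = j \<and> ireg s' 3 = 1 \<and> I (Suc j) (s'\<lparr>ireg := (ireg s')(i := Suc j)\<rparr>)" and t': "t' \<le> ?t + b"
    let ?c = "1 + bits (ireg s' i) + bits (ireg s' 3)"
    have c: "?c \<le> op_cost U" using s' jN U bits_mono[of j U] bits_mono[of 1 U] by (simp add: op_cost_def)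
    have "halts out (?W # cs, s'\<lparr>ireg := (ireg s')(i := Suc j)\<rparr>, t' + ?c) Z B"
    proof (rule Suc.hyps(1))
      show "d = N - Suc j" using Suc.hyps(2) by simp
      show "Suc j \<le> N" using jN by simp
      show "I (Suc j) (s'\<lparr>ireg := (ireg s')(i := Suc j)\<rparr>)" using s' by simp
      have "1 \<le> op_cost U" by (simp add: op_cost_def)
      then have le: "t' + ?c + ((N - Suc j) * (b + 4 * op_cost U) + op_cost U) \<le> t + ((N - j) * (b + 4 * op_cost U) + op_cost U)"
        using t' tc c jN by (simp add: Suc_diff_Suc[symmetric])
      show "\<forall>s'' t''. I N s'' \<longrightarrow> t'' \<le> t' + ?c + ((N - Suc j) * (b + 4 * op_cost U) + op_cost U) \<longrightarrow> halts out (cs, s'', t'') Z B"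
        using Suc.prems(3) le by (meson order_trans)
    qed
    then show "halts out (IOp IAdd i i 3 # ?W # cs, s', t') Z B"
      by (rule halts_det[rotated]) (use s' in \<open>simp add: add.assoc\<close>)
  qed
  then have "halts out (Seq body (IOp IAdd i i 3) # ?W # cs, s, t + test_cost (ILess i lm) s) Z B"
    by (rule halts_det[rotated]) simp
  then show ?case by (rule halts_det[rotated]) (use tv jN in simp)
qed

lemma hoare_For:
  assumes inv: "\<And>j s. I j s \<Longrightarrow> ireg s i = j \<and> ireg s lm = N"
    and body: "\<And>j s. j < N \<Longrightarrow> I j s \<Longrightarrow> hoare body s (\<lambda>s'. ireg s' i = j \<and> ireg s' 3 = 1 \<and> I (Suc j) (s'\<lparr>ireg := (ireg s')(i := Suc j)\<rparr>)) b"
    and U: "N \<le> U" "1 \<le> U" and init: "I 0 (s\<lparr>ireg := (ireg s)(i := 0)\<rparr>)"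
  shows "hoare (For i lm body) s (I N) (N * (b + 4 * op_cost U) + 3 * op_cost U)"
proof -
  let ?W = "While (ILess i lm) (Seq body (IOp IAdd i i 3))" and ?s = "s\<lparr>ireg := (ireg s)(i := 0)\<rparr>"
  have 1: "hoare (IConst i 0) s (\<lambda>x. x = ?s) (op_cost U)"
    by (rule hoare_weaken[OF hoare_ex[of U]]) auto
  have 2: "hoare ?W ?s (I N) (N * (b + 4 * op_cost U) + op_cost U)"
    unfolding hoare_def
    by (intro allI impI For_loop_halts[where I = I and N = N and b = b and U = U and j = 0, OF inv body U _ init]) auto
  have "hoare (For i lm body) s (I N) (1 + op_cost U + (N * (b + 4 * op_cost U) + op_cost U))"
    unfolding For_def using 2 by (intro hoare_Seq[OF 1]) auto
  then show ?thesis by (rule hoare_weaken) (auto simp: op_cost_def)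
qed

text \<open>The coin loop falls outside \<open>hoare\<close>, where the output distribution is fixed
  in advance: here it depends on the coins tossed. The list \<open>a\<close> holds the coins of the
  completed iterations.\<close>

lemma flips_halts:
  fixes s :: mem
  assumes lm: "ireg s lm = N" "ireg s 3 = 1" "ireg s i = j" and reg: "i \<noteq> lm" "i \<noteq> 3" "x \<noteq> lm" "x \<noteq> 3" "x \<noteq> i" "lm \<noteq> 3"
    and U: "N \<le> U" "1 \<le> U" and j: "length a = j" "j \<le> N" "\<forall>q<j. imem s A q = of_bool (a ! q)"
    and fin: "\<And>bs (s' :: mem) t'. length bs = N \<Longrightarrow> (\<forall>q<N. imem s' A q = of_bool (bs ! q)) \<Longrightarrow>
        (\<forall>y. y \<noteq> i \<and> y \<noteq> x \<longrightarrow> ireg s' y = ireg s y) \<Longrightarrow> rreg s' = rreg s \<Longrightarrow> rmem s' = rmem s \<Longrightarrow> (\<forall>B. B \<noteq> A \<longrightarrow> imem s' B = imem s B) \<Longrightarrow>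
        t' \<le> t + ((N - j) * (6 * op_cost U) + op_cost U) \<Longrightarrow> halts out (cs, s', t') (Z bs) B"
  shows "halts out (While (ILess i lm) (Seq (Seq (Flip x) (IStore A i x)) (IOp IAdd i i 3)) # cs, s, t) (bind_pmf (rbits (N - j)) (\<lambda>bs. Z (a @ bs))) B"
  using lm j fin
proof (induction "N - j" arbitrary: j a s t)
  case 0
  then have jN: "j = N" by simp
  have tv: "ireg s i = N" "ireg s lm = N" using 0(2,4) jN by auto
  have "test_cost (ILess i lm) s \<le> op_cost U" using tv U by (intro test_reads_le_cost) auto
  then have "halts out (cs, s, t + test_cost (ILess i lm) s) (Z a) B"
    using jN 0(5,7) by (intro 0(8)) auto
  then have "halts out (While (ILess i lm) (Seq (Seq (Flip x) (IStore A i x)) (IOp IAdd i i 3)) # cs, s, t) (Z a) B"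
    by (rule halts_det[rotated]) (simp add: tv)
  then show ?case using jN by (simp add: bind_return_pmf)
next
  case (Suc d)
  have jN: "j < N" using Suc.hyps(2) by simp
  have Nj: "N - j = Suc (N - Suc j)" using jN by simp
  let ?W = "While (ILess i lm) (Seq (Seq (Flip x) (IStore A i x)) (IOp IAdd i i 3))"
  let ?t = "t + test_cost (ILess i lm) s"
  have tc: "test_cost (ILess i lm) s \<le> op_cost U" using Suc.prems U jN by (intro test_reads_le_cost) auto
  define sb where "sb b = s\<lparr>ireg := (ireg s)(x := of_bool b, i := Suc j), imem := (imem s)(A := (imem s A)(j := of_bool b))\<rparr>" for b
  define s1 where "s1 b = s\<lparr>ireg := (ireg s)(x := of_bool b)\<rparr>" for b
  define Zb where "Zb c = bind_pmf (rbits (N - Suc j)) (\<lambda>bs. Z (a @ (0 < ireg (fst (snd c)) x) # bs))" for c :: config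
  have step_b: "halts out (IStore A i x # IOp IAdd i i 3 # ?W # cs, s1 b, ?t + 2 + 1) (bind_pmf (rbits (N - Suc j)) (\<lambda>bs. Z (a @ b # bs))) B" for b
  proof -
    let ?c1 = "1 + bits j + bits (of_bool b)" and ?c2 = "1 + bits j + bits 1"
    have bb: "bits (of_bool b) \<le> bits U" "bits j \<le> bits U" "bits 1 \<le> bits U" using U jN by (auto intro!: bits_mono)
    have "halts out (?W # cs, sb b, ?t + 2 + 1 + ?c1 + ?c2) (bind_pmf (rbits (N - Suc j)) (\<lambda>bs. Z ((a @ [b]) @ bs))) B"
    proof (rule Suc.hyps(1))
      show "d = N - Suc j" using Suc.hyps(2) by simp
      show "ireg (sb b) lm = N" "ireg (sb b) 3 = 1" "ireg (sb b) i = Suc j" using Suc.prems reg by (auto simp: sb_def)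
      show "length (a @ [b]) = Suc j" "Suc j \<le> N" using Suc.prems jN by auto
      show "\<forall>q<Suc j. imem (sb b) A q = of_bool ((a @ [b]) ! q)" using Suc.prems by (auto simp: sb_def nth_append less_Suc_eq)
      fix bs and s' :: mem and t'
      assume h: "length bs = N" "\<forall>q<N. imem s' A q = of_bool (bs ! q)" "\<forall>y. y \<noteq> i \<and> y \<noteq> x \<longrightarrow> ireg s' y = ireg (sb b) y"
        "rreg s' = rreg (sb b)" "rmem s' = rmem (sb b)" "\<forall>B. B \<noteq> A \<longrightarrow> imem s' B = imem (sb b) B"
        and t': "t' \<le> ?t + 2 + 1 + ?c1 + ?c2 + ((N - Suc j) * (6 * op_cost U) + op_cost U)"
      have "?c1 \<le> op_cost U" "?c2 \<le> op_cost U" "3 \<le> op_cost U" using bb by (auto simp: op_cost_def)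
      then have "t' \<le> t + ((N - j) * (6 * op_cost U) + op_cost U)" using t' tc unfolding Nj by simp
      then show "halts out (cs, s', t') (Z bs) B" using h by (intro Suc.prems(7)) (auto simp: sb_def)
    qed
    then have "halts out (IOp IAdd i i 3 # ?W # cs, (s1 b)\<lparr>imem := (imem s)(A := (imem s A)(j := of_bool b))\<rparr>, ?t + 2 + 1 + ?c1) (bind_pmf (rbits (N - Suc j)) (\<lambda>bs. Z ((a @ [b]) @ bs))) B"
      by (rule halts_det[rotated]) (use Suc.prems reg in \<open>simp add: s1_def sb_def add.assoc\<close>)
    then have "halts out (IStore A i x # IOp IAdd i i 3 # ?W # cs, s1 b, ?t + 2 + 1) (bind_pmf (rbits (N - Suc j)) (\<lambda>bs. Z ((a @ [b]) @ bs))) B"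
      by (rule halts_det[rotated]) (use Suc.prems reg in \<open>simp add: s1_def add.assoc\<close>)
    then show ?thesis by simp
  qed
  let ?c = "(Flip x # IStore A i x # IOp IAdd i i 3 # ?W # cs, s, ?t + 2)"
  have "halts out ?c (bind_pmf (step ?c) Zb) B"
  proof (rule halts_bind)
    show "finite (set_pmf (step ?c))" by simp
    fix c' assume "c' \<in> set_pmf (step ?c)"
    then obtain b where "c' = (IStore A i x # IOp IAdd i i 3 # ?W # cs, s1 b, ?t + 2 + 1)" by (auto simp: s1_def)
    then show "halts out c' (Zb c') B" using step_b[of b] by (cases b) (auto simp: Zb_def s1_def)
  qed
  also have "bind_pmf (step ?c) Zb = bind_pmf (rbits (N - j)) (\<lambda>bs. Z (a @ bs))"
    unfolding Nj by (simp add: Zb_def bind_map_pmf bind_assoc_pmf s1_def)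
  finally have "halts out ?c (bind_pmf (rbits (N - j)) (\<lambda>bs. Z (a @ bs))) B" .
  then have "halts out (Seq (Flip x) (IStore A i x) # IOp IAdd i i 3 # ?W # cs, s, ?t + 1) (bind_pmf (rbits (N - j)) (\<lambda>bs. Z (a @ bs))) B"
    by (rule halts_det[rotated]) simp
  then have "halts out (Seq (Seq (Flip x) (IStore A i x)) (IOp IAdd i i 3) # ?W # cs, s, ?t) (bind_pmf (rbits (N - j)) (\<lambda>bs. Z (a @ bs))) B"
    by (rule halts_det[rotated]) simp
  then show ?case by (rule halts_det[rotated]) (use Suc.prems jN in simp)
qed


section \<open>The program\<close>

definition ceil_log :: "nat \<Rightarrow> nat" where "ceil_log n = (LEAST l. n \<le> 2 ^ l)"

lemma ceil_log_le_iff: "ceil_log n \<le> l \<longleftrightarrow> n \<le> 2 ^ l"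
proof
  have "n \<le> 2 ^ ceil_log n" unfolding ceil_log_def by (rule LeastI[of _ n]) (simp add: less_imp_le)
  also assume "ceil_log n \<le> l"
  then have "(2::nat) ^ ceil_log n \<le> 2 ^ l" by simp
  finally show "n \<le> 2 ^ l" .
next
  show "n \<le> 2 ^ l \<Longrightarrow> ceil_log n \<le> l" unfolding ceil_log_def by (rule Least_le)
qed

lemma ceil_log_le_self: "ceil_log n \<le> n" by (simp add: ceil_log_le_iff less_imp_le)

lemma pow_ceil_log_less: "2 \<le> n \<Longrightarrow> 2 ^ ceil_log n < 2 * n"
proof -
  assume n: "2 \<le> n"
  have "ceil_log n \<noteq> 0" using ceil_log_le_iff[of n 0] n by auto
  then obtain l where l: "ceil_log n = Suc l" by (cases "ceil_log n") auto
  then show ?thesis using ceil_log_le_iff[of n l] by simp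
qed

definition ceil_loglog :: "nat \<Rightarrow> nat" where "ceil_loglog n = ceil_log (ceil_log n)"
text \<open>At once the length of the walk, the number of projections and, through 1 / (64
  \<open>n_proj n\<close>), its laziness. \<open>expansion_ge\<close> relies on its being a power of
  two, \<open>round_energy\<close> and \<open>good_strategy\<close> on its being at least (ln
  n)^3.\<close>

definition n_proj :: "nat \<Rightarrow> nat" where "n_proj n = (2 ^ ceil_loglog n) ^ 3"
text \<open>Squared norms may reach \<open>real n ^ k\<close>, which takes about \<open>k\<close>
  times log n dyadic levels. With a power of two a level is drawn from exactly
  \<open>ceil_loglog n + (k + 1)\<close> fair bits, the leading one of which decides the type of
  cut.\<close>

definition n_lev :: "nat \<Rightarrow> nat \<Rightarrow> nat" where "n_lev k n = 2 ^ ceil_loglog n * 2 ^ k"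
definition n_coins :: "nat \<Rightarrow> nat \<Rightarrow> nat" where "n_coins k n = n_proj n * n + (ceil_loglog n + (k + 1))"

primrec horner :: "bool list \<Rightarrow> nat \<Rightarrow> nat \<Rightarrow> nat" where
  "horner bs p 0 = 0"
| "horner bs p (Suc j) = 2 * horner bs p j + of_bool (bs ! (p + j))"

lemma horner_less: "horner bs p j < 2 ^ j" by (induction j) auto

notation Seq (infixr ";;" 60)

lemma hoare_Seq':
  assumes "hoare c s P (a * op_cost U)" "\<And>s'. P s' \<Longrightarrow> hoare d s' Q (b * op_cost U)"
  shows "hoare (c ;; d) s Q ((a + b + 1) * op_cost U)"
  by (rule hoare_weaken[OF hoare_Seq[OF assms]]) (auto simp: op_cost_def algebra_simps)

lemma hoare_Cond':
  assumes "test_val b s \<Longrightarrow> hoare c s Q (a * op_cost U)" "\<not> test_val b s \<Longrightarrow> hoare d s Q (a * op_cost U)" "test_reads_le U b s"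
  shows "hoare (Cond b c d) s Q ((a + 1) * op_cost U)"
  by (rule hoare_weaken[OF hoare_Cond[OF assms(1,2) test_reads_le_cost[OF assms(3)]]]) (auto simp: algebra_simps)

lemma hoare_line: "reads_le U c s \<Longrightarrow> Q (exec c s) \<Longrightarrow> clen c \<le> 40 \<Longrightarrow> hoare c s Q (40 * op_cost U)"
  by (rule hoare_weaken[OF hoare_ex]) auto

lemma hoare_For':
  assumes "\<And>j s. I j s \<Longrightarrow> ireg s i = j \<and> ireg s lm = N"
    and "\<And>j s. j < N \<Longrightarrow> I j s \<Longrightarrow> hoare body s (\<lambda>s'. ireg s' i = j \<and> ireg s' 3 = 1 \<and> I (Suc j) (s'\<lparr>ireg := (ireg s')(i := Suc j)\<rparr>)) (b * op_cost U)"
    and "N \<le> U" "1 \<le> U" and "I 0 (s\<lparr>ireg := (ireg s)(i := 0)\<rparr>)"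
  shows "hoare (For i lm body) s (I N) ((N * (b + 4) + 3) * op_cost U)"
  by (rule hoare_weaken[OF hoare_For[where I = I and i = i and lm = lm and N = N and body = body and U = U, OF assms]]) (auto simp: algebra_simps)

lemma hoare_For_line:
  assumes "\<And>j s. I j s \<Longrightarrow> ireg s i = j \<and> ireg s lm = N"
    and b: "\<And>j s. j < N \<Longrightarrow> I j s \<Longrightarrow> reads_le U body s \<and> ireg (exec body s) i = j \<and> ireg (exec body s) 3 = 1 \<and>
      I (Suc j) ((exec body s)\<lparr>ireg := (ireg (exec body s))(i := Suc j)\<rparr>)"
    and "N \<le> U" "1 \<le> U" and "I 0 (s\<lparr>ireg := (ireg s)(i := 0)\<rparr>)" and c: "clen body \<le> 40"
  shows "hoare (For i lm body) s (I N) ((N * 44 + 3) * op_cost U)"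
  using assms(1,3-5) b c by (intro hoare_weaken[OF hoare_For'[where I = I and b = 40 and U = U]] hoare_line) auto

text \<open>Register conventions: integer registers 0 and 2 hold \<open>n\<close> and the number of edges, 8 to 11 the
  parameters, 12 to 14 loop counters, 21 zero; real register 0 holds the total weight and 11 zero.
  Real arrays: 2 scales, 3 sums of squared projections, 4 current vector, 5 accumulator.
  Integer array 5 holds the coins.\<close>

locale machine =
  fixes k n m U :: nat and mu :: "nat \<Rightarrow> real" and ea eb :: "nat \<Rightarrow> nat" and ew :: "nat \<Rightarrow> real"
  assumes n2: "2 \<le> n" and ends: "\<And>e. e < m \<Longrightarrow> ea e < n \<and> eb e < n \<and> ea e \<noteq> eb e"
    and U: "2 * n \<le> U" "m \<le> U" "n_coins k n \<le> U" "64 * n_proj n \<le> U" "2 * n_lev k n \<le> U" "2 ^ k \<le> U" "k + 1 \<le> U"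
begin

definition tot :: real where "tot = (\<Sum>i<n. mu i)"
definition beta :: real where "beta = 1 / real (64 * n_proj n)"
definition rho :: "nat \<Rightarrow> real" where
  "rho i = ((\<lambda>r. if r * r * mu i * 4 < tot then r + r else r) ^^ n_lev k n) 1"

definition Inp :: "mem \<Rightarrow> bool" where
  "Inp s \<longleftrightarrow> ireg s 0 = n \<and> ireg s 2 = m \<and> ireg s 3 = 1 \<and> ireg s 21 = 0 \<and> rreg s 11 = 0 \<and>
     (\<forall>e<m. imem s 0 e = ea e \<and> imem s 1 e = eb e \<and> rmem s 1 e = ew e) \<and> (\<forall>i<n. rmem s 0 i = mu i)"

definition prog_consts :: com where
  "prog_consts = (IConst 3 1 ;; IConst 4 0 ;; IConst 5 1) ;;
     For 12 0 (Cond (ILess 5 0) (IOp IAdd 5 5 5 ;; IOp IAdd 4 4 3) Skip) ;;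
     (IConst 6 0 ;; IConst 7 1) ;;
     For 12 0 (Cond (ILess 7 4) (IOp IAdd 7 7 7 ;; IOp IAdd 6 6 3) Skip) ;;
     (IOp IMul 8 7 7 ;; IOp IMul 8 8 7 ;; IConst 16 (2 ^ k) ;; IOp IMul 9 7 16 ;; IOp IMul 10 8 0 ;;
      IConst 16 (k + 1) ;; IOp IAdd 22 6 16 ;; IOp IAdd 11 10 22 ;; IConst 16 64 ;; IOp IMul 16 16 8 ;;
      ROfInt 10 3 ;; ROfInt 1 16 ;; ROp RDiv 10 10 1)"

definition Con :: "mem \<Rightarrow> bool" where
  "Con s \<longleftrightarrow> Inp s \<and> ireg s 8 = n_proj n \<and> ireg s 9 = n_lev k n \<and> ireg s 10 = n_proj n * n \<and> ireg s 11 = n_coins k n \<and>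
     ireg s 22 = ceil_loglog n + (k + 1) \<and> rreg s 10 = beta"

text \<open>The guarded doubling saturates after \<open>ceil_log N\<close> iterations; a loop over
  all \<open>n\<close> vertices is long enough for that and still linear.\<close>

lemma hoare_lc:
  assumes s: "Inp s" "ireg s x = N" "N \<le> n" "ireg s w = 1" "ireg s l = 0" and xw: "x \<in> {0, 4}" "x \<noteq> w" "x \<noteq> l" "w \<noteq> l" "w \<in> {5, 7}" "l \<in> {4, 6}"
  shows "hoare (For 12 0 (Cond (ILess w x) (IOp IAdd w w w ;; IOp IAdd l l 3) Skip)) s
    (\<lambda>s'. Inp s' \<and> (\<forall>y. y \<noteq> 12 \<and> y \<noteq> w \<and> y \<noteq> l \<longrightarrow> ireg s' y = ireg s y) \<and> rreg s' = rreg s \<and> ireg s' l = ceil_log N \<and> ireg s' w = 2 ^ ceil_log N)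
    ((n * 44 + 3) * op_cost U)"
proof -
  have ne: "x \<noteq> 12" "w \<noteq> 12" "l \<noteq> 12" "w \<noteq> 0" "w \<noteq> 2" "w \<noteq> 3" "w \<noteq> 21" "l \<noteq> 0" "l \<noteq> 2" "l \<noteq> 3" "l \<noteq> 21"
    "x \<noteq> w" "x \<noteq> l" "w \<noteq> l" "l \<noteq> w"
    using xw by auto
  have lcN: "ceil_log N \<le> n" using ceil_log_le_self[of N] s(3) by simp
  define I where "I j s' \<longleftrightarrow> Inp s' \<and> (\<forall>y. y \<noteq> 12 \<and> y \<noteq> w \<and> y \<noteq> l \<longrightarrow> ireg s' y = ireg s y) \<and> rreg s' = rreg s \<and> ireg s' 12 = j \<and>
    ireg s' l = min j (ceil_log N) \<and> ireg s' w = 2 ^ min j (ceil_log N)" for j and s' :: mem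
  have "hoare (For 12 0 (Cond (ILess w x) (IOp IAdd w w w ;; IOp IAdd l l 3) Skip)) s (I n) ((n * 44 + 3) * op_cost U)"
  proof (rule hoare_For_line)
    show "n \<le> U" "1 \<le> U" using U n2 by auto
    show "I 0 (s\<lparr>ireg := (ireg s)(12 := 0)\<rparr>)" using s xw by (auto simp: I_def Inp_def)
    fix j and s' :: mem assume I: "I j s'"
    show "ireg s' 12 = j \<and> ireg s' 0 = n" using I by (simp add: I_def Inp_def)
    assume j: "j < n"
    have x: "ireg s' x = N" using I s xw by (auto simp: I_def)
    have t: "ireg s' w < N \<longleftrightarrow> j < ceil_log N" using I ceil_log_le_iff[of N j] ceil_log_le_iff[of N "ceil_log N"] by (auto simp: I_def min_def not_le[symmetric])
    have "ireg s' w < N \<Longrightarrow> ireg s' w \<le> U" using U s(3) by simp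
    moreover have "\<not> ireg s' w < N \<Longrightarrow> ireg s' w \<le> U"
    proof (cases "2 \<le> N")
      case True
      then show "ireg s' w \<le> U" if "\<not> ireg s' w < N" using pow_ceil_log_less[OF True] U s(3) t that I by (auto simp: I_def min_def)
    next
      case False
      then have "ceil_log N = 0" using ceil_log_le_iff[of N 0] by simp
      then show "ireg s' w \<le> U" if "\<not> ireg s' w < N" using I U n2 by (simp add: I_def)
    qed
    ultimately have wU: "ireg s' w \<le> U" by blast
    show "reads_le U (Cond (ILess w x) (IOp IAdd w w w ;; IOp IAdd l l 3) Skip) s' \<and>
       ireg (exec (Cond (ILess w x) (IOp IAdd w w w ;; IOp IAdd l l 3) Skip) s') 12 = j \<and>
       ireg (exec (Cond (ILess w x) (IOp IAdd w w w ;; IOp IAdd l l 3) Skip) s') 3 = 1 \<and>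
       I (Suc j) ((exec (Cond (ILess w x) (IOp IAdd w w w ;; IOp IAdd l l 3) Skip) s')\<lparr>ireg := (ireg (exec (Cond (ILess w x) (IOp IAdd w w w ;; IOp IAdd l l 3) Skip) s'))(12 := Suc j)\<rparr>)"
    proof (cases "j < ceil_log N")
      case True
      then have "min j (ceil_log N) = j" "min (Suc j) (ceil_log N) = Suc j" by auto
      then have v: "ireg s' w = 2 ^ j" "ireg s' l = j" using I by (auto simp: I_def)
      have "2 ^ j < N" using True ceil_log_le_iff[of N j] by simp
      moreover have "min (Suc j) (ceil_log N) = Suc j" using True by simp
      moreover have "(2::nat) ^ j \<le> U" "j \<le> U" "N \<le> U" using v wU j U s(3) by auto
      ultimately show ?thesis using I x U n2 s(1) by (simp add: I_def Inp_def ne v)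
    next
      case False
      then have "min j (ceil_log N) = ceil_log N" "min (Suc j) (ceil_log N) = ceil_log N" by auto
      then have v: "ireg s' w = 2 ^ ceil_log N" "ireg s' l = ceil_log N" using I by (auto simp: I_def)
      have "\<not> 2 ^ ceil_log N < N" using ceil_log_le_iff[of N "ceil_log N"] by simp
      moreover have "min (Suc j) (ceil_log N) = ceil_log N" using False by simp
      moreover have "(2::nat) ^ ceil_log N \<le> U" "N \<le> U" using v wU U s(3) by auto
      ultimately show ?thesis using I x U n2 s(1) by (simp add: I_def Inp_def ne v)
    qed
  qed simp
  then show ?thesis by (rule hoare_weaken) (use lcN in \<open>auto simp: I_def min_def\<close>)
qed

lemma hoare_consts:
  assumes s: "ireg s 0 = n \<and> ireg s 2 = m \<and> ireg s 21 = 0 \<and> rreg s = (\<lambda>_. 0) \<and>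
     (\<forall>e<m. imem s 0 e = ea e \<and> imem s 1 e = eb e \<and> rmem s 1 e = ew e) \<and> (\<forall>i<n. rmem s 0 i = mu i)"
  shows "hoare prog_consts s (\<lambda>s'. Con s' \<and> rreg s' 0 = 0) ((n * 88 + 250) * op_cost U)"
proof -
  have U1: "1 \<le> U" using U n2 by simp
  let ?P1 = "\<lambda>s. Inp s \<and> rreg s = (\<lambda>_. 0) \<and> ireg s 4 = 0 \<and> ireg s 5 = 1"
  let ?P2 = "\<lambda>s. Inp s \<and> rreg s = (\<lambda>_. 0) \<and> ireg s 4 = ceil_log n"
  let ?P3 = "\<lambda>s. ?P2 s \<and> ireg s 6 = 0 \<and> ireg s 7 = 1"
  let ?P4 = "\<lambda>s. Inp s \<and> rreg s = (\<lambda>_. 0) \<and> ireg s 6 = ceil_loglog n \<and> ireg s 7 = 2 ^ ceil_loglog n"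
  have q1: "(2::nat) ^ ceil_loglog n \<le> n_proj n" by (simp add: n_proj_def power3_eq_cube)
  have q2: "(2::nat) ^ ceil_loglog n * 2 ^ ceil_loglog n \<le> n_proj n" by (simp add: n_proj_def power3_eq_cube)
  have q3: "(2::nat) ^ ceil_loglog n * 2 ^ ceil_loglog n * 2 ^ ceil_loglog n = n_proj n" by (simp add: n_proj_def power3_eq_cube)
  have P0: "hoare ((IConst 3 1 ;; IConst 4 0 ;; IConst 5 1) ;; e) s Q ((40 + b + 1) * op_cost U)"
    if e: "\<And>s. ?P1 s \<Longrightarrow> hoare e s Q (b * op_cost U)" for e Q b
    by (rule hoare_Seq'[OF hoare_line[where Q = ?P1] e]) (use s U1 in \<open>simp_all add: Inp_def\<close>)
  have P1: "hoare (For 12 0 (Cond (ILess 5 0) (IOp IAdd 5 5 5 ;; IOp IAdd 4 4 3) Skip) ;; e) s Q ((n * 44 + 3 + b + 1) * op_cost U)"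
    if s: "?P1 s" and e: "\<And>s. ?P2 s \<Longrightarrow> hoare e s Q (b * op_cost U)" for e s Q b
    by (rule hoare_Seq'[OF hoare_lc[where N = n] e]) (use s ceil_log_le_self[of n] in \<open>simp_all add: Inp_def ceil_loglog_def\<close>)
  have P2: "hoare ((IConst 6 0 ;; IConst 7 1) ;; e) s Q ((40 + b + 1) * op_cost U)"
    if s: "?P2 s" and e: "\<And>s. ?P3 s \<Longrightarrow> hoare e s Q (b * op_cost U)" for e s Q b
    by (rule hoare_Seq'[OF hoare_line[where Q = ?P3] e]) (use s U1 in \<open>simp_all add: Inp_def\<close>)
  have P3: "hoare (For 12 0 (Cond (ILess 7 4) (IOp IAdd 7 7 7 ;; IOp IAdd 6 6 3) Skip) ;; e) s Q ((n * 44 + 3 + b + 1) * op_cost U)"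
    if s: "?P3 s" and e: "\<And>s. ?P4 s \<Longrightarrow> hoare e s Q (b * op_cost U)" for e s Q b
    by (rule hoare_Seq'[OF hoare_lc[where N = "ceil_log n"] e]) (use s ceil_log_le_self[of n] in \<open>simp_all add: Inp_def ceil_loglog_def\<close>)
  have gp: "1 \<le> n_proj n" by (simp add: n_proj_def)
  let ?c = "IOp IMul 8 7 7 ;; IOp IMul 8 8 7 ;; IConst 16 (2 ^ k) ;; IOp IMul 9 7 16 ;; IOp IMul 10 8 0 ;;
      IConst 16 (k + 1) ;; IOp IAdd 22 6 16 ;; IOp IAdd 11 10 22 ;; IConst 16 64 ;; IOp IMul 16 16 8 ;;
      ROfInt 10 3 ;; ROfInt 1 16 ;; ROp RDiv 10 10 1"
  have P4: "hoare ?c s (\<lambda>s'. Con s' \<and> rreg s' 0 = 0) (40 * op_cost U)" if s: "?P4 s" for s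
  proof (rule hoare_line)
    have b: "(2::nat) ^ ceil_loglog n \<le> U" "(2::nat) ^ ceil_loglog n * 2 ^ ceil_loglog n \<le> U" "n_proj n \<le> U" "n \<le> U" "64 \<le> U" "n_proj n * n \<le> U" "ceil_loglog n + (k + 1) \<le> U" "ceil_loglog n \<le> U"
      using q1 q2 U(1,3,4) gp n2 unfolding n_coins_def by linarith+
    show "reads_le U ?c s" using s U U1 b by (simp add: Inp_def q3)
    show "Con (exec ?c s) \<and> rreg (exec ?c s) 0 = 0" using s by (simp add: Con_def Inp_def q3 n_lev_def n_coins_def beta_def)
    show "clen ?c \<le> 40" by simp
  qed
  have "hoare prog_consts s (\<lambda>s'. Con s' \<and> rreg s' 0 = 0) ((40 + (n * 44 + 3 + (40 + (n * 44 + 3 + 40 + 1) + 1) + 1) + 1) * op_cost U)"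
    unfolding prog_consts_def by (intro P0 P1 P2 P3 P4) auto
  then show ?thesis by (rule hoare_weaken) auto
qed

end


section \<open>Vectors in memory, walk steps and projections\<close>

definition agree :: "nat \<Rightarrow> (nat \<Rightarrow> real) \<Rightarrow> (nat \<Rightarrow> real) \<Rightarrow> bool" where
  "agree n f g \<longleftrightarrow> (\<forall>i<n. f i = g i)"

text \<open>The state of an array in the middle of an in-place update.\<close>

definition pre :: "nat \<Rightarrow> (nat \<Rightarrow> real) \<Rightarrow> nat \<Rightarrow> (nat \<Rightarrow> real) \<Rightarrow> (nat \<Rightarrow> real) \<Rightarrow> bool" where
  "pre n f j g h \<longleftrightarrow> (\<forall>i<n. f i = (if i < j then g i else h i))"

lemma pre_0: "pre n f 0 g h = agree n f h" by (simp add: pre_def agree_def)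
lemma pre_n: "pre n f n g h = agree n f g" by (auto simp: pre_def agree_def)
lemma agree_refl: "agree n f f" by (simp add: agree_def)
lemma preD: "pre n f j g h \<Longrightarrow> j < n \<Longrightarrow> f j = h j" by (simp add: pre_def)
lemma pre_upd: "pre n f j g h \<Longrightarrow> v = g j \<Longrightarrow> pre n (f(j := v)) (Suc j) g h"
  by (auto simp: pre_def less_Suc_eq)

context machine
begin

definition Rdy :: "mem \<Rightarrow> bool" where "Rdy s \<longleftrightarrow> Con s \<and> rreg s 0 = tot \<and> (\<forall>i<n. rmem s 2 i = rho i)"

definition Env :: "bool list \<Rightarrow> mem \<Rightarrow> bool" where
  "Env bs s \<longleftrightarrow> Rdy s \<and> (\<forall>p<n_coins k n. imem s 5 p = of_bool (bs ! p))"

lemma U1: "1 \<le> U" "n \<le> U" "n_proj n \<le> U" "n_lev k n \<le> U" "n_proj n * n \<le> U" "ceil_loglog n + (k + 1) \<le> U" "64 \<le> U" "4 \<le> U"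
proof -
  have "1 \<le> n_proj n" by (simp add: n_proj_def)
  then show "1 \<le> U" "n \<le> U" "n_proj n \<le> U" "n_lev k n \<le> U" "n_proj n * n \<le> U" "ceil_loglog n + (k + 1) \<le> U" "64 \<le> U" "4 \<le> U"
    using n2 U unfolding n_coins_def by linarith+
qed

lemmas env = Inp_def Con_def

definition prog_vol :: com where
  "prog_vol = For 12 0 (RLoad 0 1 12 ;; ROp RAdd 0 0 1)"

lemma hoare_vol:
  assumes "Con s" "rreg s 0 = 0"
  shows "hoare prog_vol s (\<lambda>s. Con s \<and> rreg s 0 = tot) ((n * 44 + 3) * op_cost U)"
proof -
  have "hoare prog_vol s (\<lambda>s. Con s \<and> ireg s 12 = n \<and> rreg s 0 = (\<Sum>i<n. mu i)) ((n * 44 + 3) * op_cost U)"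
    unfolding prog_vol_def
    by (rule hoare_For_line[where I = "\<lambda>j s. Con s \<and> ireg s 12 = j \<and> rreg s 0 = (\<Sum>i<j. mu i)"])
      (use assms U1 in \<open>simp_all add: env\<close>)
  then show ?thesis by (rule hoare_weaken) (auto simp: tot_def)
qed

text \<open>Doubling replaces the square root, which the machine does not have: the result \<open>r\<close> satisfies
  \<open>tot / 4 \<le> r\<^sup>2 mu \<le> tot\<close>.\<close>

definition rstep :: "nat \<Rightarrow> real \<Rightarrow> real" where
  "rstep i r = (if r * r * mu i * 4 < tot then r + r else r)"

definition prog_rho :: com where
  "prog_rho = For 12 0 ((RLoad 0 1 12 ;; ROfInt 2 3 ;; IConst 16 4 ;; ROfInt 4 16) ;;
     For 13 9 (ROp RMul 3 2 2 ;; ROp RMul 3 3 1 ;; ROp RMul 3 3 4 ;; Cond (RLess 3 0) (ROp RAdd 2 2 2) Skip) ;;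
     RStore 2 12 2)"

lemma hoare_rho:
  assumes s: "Con s" "rreg s 0 = tot"
  shows "hoare prog_rho s Rdy ((n * (n_lev k n * 44 + 90) + 3) * op_cost U)"
proof -
  define I where "I j s \<longleftrightarrow> Con s \<and> rreg s 0 = tot \<and> ireg s 12 = j \<and> (\<forall>i<j. rmem s 2 i = rho i)" for j and s :: mem
  define J where "J j t s \<longleftrightarrow> I j s \<and> ireg s 13 = t \<and> rreg s 1 = mu j \<and> rreg s 4 = 4 \<and> rreg s 2 = (rstep j ^^ t) 1" for j t and s :: mem
  have rho: "rho j = (rstep j ^^ n_lev k n) 1" for j by (simp add: rho_def rstep_def[abs_def])
  have inner: "hoare (For 13 9 (ROp RMul 3 2 2 ;; ROp RMul 3 3 1 ;; ROp RMul 3 3 4 ;; Cond (RLess 3 0) (ROp RAdd 2 2 2) Skip)) s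
      (J j (n_lev k n)) ((n_lev k n * 44 + 3) * op_cost U)"
    if "I j s" "rreg s 1 = mu j" "rreg s 2 = 1" "rreg s 4 = 4" for j s
    by (rule hoare_For_line[where I = "J j"]) (use that U1 in \<open>simp_all add: env I_def J_def rstep_def\<close>)
  have "hoare prog_rho s (I n) ((n * (40 + ((n_lev k n * 44 + 3) + 40 + 1) + 1 + 4) + 3) * op_cost U)"
    unfolding prog_rho_def
  proof (rule hoare_For')
    fix j s assume j: "j < n" and I: "I j s"
    show "hoare ((RLoad 0 1 12 ;; ROfInt 2 3 ;; IConst 16 4 ;; ROfInt 4 16) ;;
       For 13 9 (ROp RMul 3 2 2 ;; ROp RMul 3 3 1 ;; ROp RMul 3 3 4 ;; Cond (RLess 3 0) (ROp RAdd 2 2 2) Skip) ;;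
       RStore 2 12 2) s
      (\<lambda>s'. ireg s' 12 = j \<and> ireg s' 3 = 1 \<and> I (Suc j) (s'\<lparr>ireg := (ireg s')(12 := Suc j)\<rparr>))
      ((40 + ((n_lev k n * 44 + 3) + 40 + 1) + 1) * op_cost U)"
    proof (rule hoare_Seq'[OF hoare_line])
      show "reads_le U (RLoad 0 1 12 ;; ROfInt 2 3 ;; IConst 16 4 ;; ROfInt 4 16) s" using I j U1 by (simp add: I_def env)
      show "(\<lambda>s. I j s \<and> rreg s 1 = mu j \<and> rreg s 2 = 1 \<and> rreg s 4 = 4) (exec (RLoad 0 1 12 ;; ROfInt 2 3 ;; IConst 16 4 ;; ROfInt 4 16) s)"
        using I j by (simp add: I_def env)
      fix s' assume "I j s' \<and> rreg s' 1 = mu j \<and> rreg s' 2 = 1 \<and> rreg s' 4 = 4"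
      then show "hoare (For 13 9 (ROp RMul 3 2 2 ;; ROp RMul 3 3 1 ;; ROp RMul 3 3 4 ;; Cond (RLess 3 0) (ROp RAdd 2 2 2) Skip) ;; RStore 2 12 2) s'
        (\<lambda>s'. ireg s' 12 = j \<and> ireg s' 3 = 1 \<and> I (Suc j) (s'\<lparr>ireg := (ireg s')(12 := Suc j)\<rparr>)) (((n_lev k n * 44 + 3) + 40 + 1) * op_cost U)"
        by (intro hoare_Seq'[OF inner[of j]] hoare_line) (use j U1 rho[of j] in \<open>simp_all add: I_def J_def env All_less_Suc\<close>)
    qed simp
  qed (use s U1 in \<open>simp_all add: I_def env\<close>)
  then show ?thesis by (rule hoare_weaken) (auto simp: I_def Rdy_def)
qed

lemmas env2 = env Rdy_def Env_def

definition St :: "bool list \<Rightarrow> nat \<Rightarrow> nat \<Rightarrow> (nat \<Rightarrow> real) \<Rightarrow> (nat \<Rightarrow> real) \<Rightarrow> (nat \<Rightarrow> real) \<Rightarrow> mem \<Rightarrow> bool" where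
  "St bs a t u N A s \<longleftrightarrow> Env bs s \<and> ireg s 12 = a \<and> ireg s 13 = t \<and> agree n (rmem s 4) u \<and> agree n (rmem s 3) N \<and> agree n (rmem s 5) A"

text \<open>The share of the first \<open>j\<close> listed edges in the Laplacian, before division
  by the weights. An edge is listed once and therefore pays into both of its endpoints.\<close>

definition accu :: "(nat \<Rightarrow> real) \<Rightarrow> nat \<Rightarrow> nat \<Rightarrow> real" where
  "accu u j i = (\<Sum>e<j. (if i = ea e then ew e * (u (ea e) - u (eb e)) else 0) - (if i = eb e then ew e * (u (ea e) - u (eb e)) else 0))"

definition prog_edges :: com where
  "prog_edges = For 14 2 (ILoad 0 16 14 ;; ILoad 1 18 14 ;; RLoad 4 1 16 ;; RLoad 4 2 18 ;; ROp RSub 1 1 2 ;; RLoad 1 2 14 ;;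
     ROp RMul 1 2 1 ;; RLoad 5 2 16 ;; ROp RAdd 2 2 1 ;; RStore 5 16 2 ;; RLoad 5 2 18 ;; ROp RSub 2 2 1 ;; RStore 5 18 2)"

lemma accu_step:
  assumes "agree n f (accu u j)" "d = ew j * (u (ea j) - u (eb j))" "j < m"
  shows "agree n (f(ea j := f (ea j) + d, eb j := f (eb j) - d)) (accu u (Suc j))"
  using assms ends[of j] by (auto simp: agree_def accu_def)

lemma hoare_edges:
  assumes "St bs a t u N (\<lambda>_. 0) s"
  shows "hoare prog_edges s (St bs a t u N (accu u m)) ((m * 44 + 3) * op_cost U)"
proof -
  have "hoare prog_edges s (\<lambda>s. St bs a t u N (accu u m) s \<and> ireg s 14 = m) ((m * 44 + 3) * op_cost U)"
    unfolding prog_edges_def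
  proof (rule hoare_For_line[where I = "\<lambda>j s. St bs a t u N (accu u j) s \<and> ireg s 14 = j"])
    let ?b = "ILoad 0 16 14 ;; ILoad 1 18 14 ;; RLoad 4 1 16 ;; RLoad 4 2 18 ;; ROp RSub 1 1 2 ;; RLoad 1 2 14 ;;
     ROp RMul 1 2 1 ;; RLoad 5 2 16 ;; ROp RAdd 2 2 1 ;; RStore 5 16 2 ;; RLoad 5 2 18 ;; ROp RSub 2 2 1 ;; RStore 5 18 2"
    fix j s assume j: "j < m" and I: "St bs a t u N (accu u j) s \<and> ireg s 14 = j"
    have e: "ea j < n" "eb j < n" "ea j \<noteq> eb j" "eb j \<noteq> ea j" using ends[OF j] by auto
    have le: "j \<le> U" "ea j \<le> U" "eb j \<le> U" using j e U1 U by auto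
    have v: "rmem s 4 (ea j) = u (ea j)" "rmem s 4 (eb j) = u (eb j)" "imem s 0 j = ea j" "imem s (Suc 0) j = eb j" "rmem s (Suc 0) j = ew j"
      using I j e by (auto simp: St_def env2 agree_def)
    have st: "agree n ((rmem s 5)(ea j := rmem s 5 (ea j) + ew j * (u (ea j) - u (eb j)), eb j := rmem s 5 (eb j) - ew j * (u (ea j) - u (eb j)))) (accu u (Suc j))"
      using I by (intro accu_step[OF _ refl j]) (simp add: St_def)
    show "reads_le U ?b s \<and> ireg (exec ?b s) 14 = j \<and> ireg (exec ?b s) 3 = 1 \<and>
      St bs a t u N (accu u (Suc j)) ((exec ?b s)\<lparr>ireg := (ireg (exec ?b s))(14 := Suc j)\<rparr>) \<and>
      ireg ((exec ?b s)\<lparr>ireg := (ireg (exec ?b s))(14 := Suc j)\<rparr>) 14 = Suc j"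
      using I j e le st by (simp add: St_def env2 v)
  qed (use assms U1 U in \<open>simp_all add: St_def env2 accu_def[abs_def]\<close>)
  then show ?thesis by (rule hoare_weaken) auto
qed

definition mv :: "(nat \<Rightarrow> real) \<Rightarrow> nat \<Rightarrow> real" where "mv u i = u i - beta * (accu u m i / mu i)"

definition prog_verts :: com where
  "prog_verts = For 14 0 (RLoad 5 1 14 ;; RLoad 0 2 14 ;; ROp RDiv 1 1 2 ;; ROp RMul 1 10 1 ;; RLoad 4 2 14 ;; ROp RSub 2 2 1 ;;
     RStore 4 14 2 ;; RStore 5 14 11)"

lemma hoare_verts:
  assumes "St bs a t u N (accu u m) s"
  shows "hoare prog_verts s (St bs a t (mv u) N (\<lambda>_. 0)) ((n * 44 + 3) * op_cost U)"
proof -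
  define I where "I j s \<longleftrightarrow> Env bs s \<and> ireg s 12 = a \<and> ireg s 13 = t \<and> ireg s 14 = j \<and> pre n (rmem s 4) j (mv u) u \<and>
      agree n (rmem s 3) N \<and> pre n (rmem s 5) j (\<lambda>_. 0) (accu u m)" for j and s :: mem
  have "hoare prog_verts s (I n) ((n * 44 + 3) * op_cost U)"
    unfolding prog_verts_def
  proof (rule hoare_For_line[where I = I])
    let ?b = "RLoad 5 1 14 ;; RLoad 0 2 14 ;; ROp RDiv 1 1 2 ;; ROp RMul 1 10 1 ;; RLoad 4 2 14 ;; ROp RSub 2 2 1 ;;
     RStore 4 14 2 ;; RStore 5 14 11"
    fix j s assume j: "j < n" and I: "I j s"
    have v: "rmem s 4 j = u j" "rmem s 5 j = accu u m j" using I j preD[of n "rmem s 4" j] preD[of n "rmem s 5" j] by (auto simp: I_def)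
    show "reads_le U ?b s \<and> ireg (exec ?b s) 14 = j \<and> ireg (exec ?b s) 3 = 1 \<and> I (Suc j) ((exec ?b s)\<lparr>ireg := (ireg (exec ?b s))(14 := Suc j)\<rparr>)"
      using I j U1 by (simp add: I_def env2 v pre_upd mv_def)
  qed (use assms U1 in \<open>simp_all add: St_def I_def env2 pre_0\<close>)
  then show ?thesis by (rule hoare_weaken) (auto simp: I_def St_def pre_n)
qed

lemma hoare_mat:
  assumes "St bs a t u N (\<lambda>_. 0) s"
  shows "hoare (For 13 8 (prog_edges ;; prog_verts)) s (St bs a (n_proj n) ((mv ^^ n_proj n) u) N (\<lambda>_. 0))
    ((n_proj n * ((m * 44 + 3) + (n * 44 + 3) + 1 + 4) + 3) * op_cost U)"
proof (rule hoare_For'[where I = "\<lambda>j. St bs a j ((mv ^^ j) u) N (\<lambda>_. 0)"])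
  fix j s assume "St bs a j ((mv ^^ j) u) N (\<lambda>_. 0) s"
  then have "hoare (prog_edges ;; prog_verts) s (St bs a j (mv ((mv ^^ j) u)) N (\<lambda>_. 0)) (((m * 44 + 3) + (n * 44 + 3) + 1) * op_cost U)"
    by (intro hoare_Seq'[OF hoare_edges] hoare_verts)
  then show "hoare (prog_edges ;; prog_verts) s
     (\<lambda>s'. ireg s' 13 = j \<and> ireg s' 3 = 1 \<and> St bs a (Suc j) ((mv ^^ Suc j) u) N (\<lambda>_. 0) (s'\<lparr>ireg := (ireg s')(13 := Suc j)\<rparr>))
     (((m * 44 + 3) + (n * 44 + 3) + 1) * op_cost U)"
    by (rule hoare_weaken) (simp_all add: St_def env2)
qed (use assms U1 in \<open>simp_all add: St_def env2\<close>)

text \<open>The scale \<open>rho\<close> is of the order of the root of total weight over vertex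
  weight. With it the second moment of the projections reproduces the weighted sum of squared
  columns that the potential controls.\<close>

definition u0 :: "bool list \<Rightarrow> nat \<Rightarrow> nat \<Rightarrow> real" where
  "u0 bs a i = (if bs ! (a * n + i) then rho i else - rho i)"

definition prog_init :: com where
  "prog_init = For 14 0 (IOp IAdd 16 17 14 ;; ILoad 5 16 16 ;; RLoad 2 1 14 ;; Cond (ILess 21 16) Skip (ROp RSub 1 11 1) ;; RStore 4 14 1)"

lemma hoare_init:
  assumes s: "Env bs s" "ireg s 12 = a" "ireg s 17 = a * n" "agree n (rmem s 3) N" "agree n (rmem s 5) (\<lambda>_. 0)" and a: "a < n_proj n"
  shows "hoare prog_init s (\<lambda>s. \<exists>t. St bs a t (u0 bs a) N (\<lambda>_. 0) s) ((n * 44 + 3) * op_cost U)"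
proof -
  define I where "I j s' \<longleftrightarrow> Env bs s' \<and> ireg s' 12 = a \<and> ireg s' 17 = a * n \<and> ireg s' 14 = j \<and> pre n (rmem s' 4) j (u0 bs a) (rmem s 4) \<and>
      agree n (rmem s' 3) N \<and> agree n (rmem s' 5) (\<lambda>_. 0)" for j and s' :: mem
  have "hoare prog_init s (I n) ((n * 44 + 3) * op_cost U)"
    unfolding prog_init_def
  proof (rule hoare_For_line[where I = I])
    let ?b = "IOp IAdd 16 17 14 ;; ILoad 5 16 16 ;; RLoad 2 1 14 ;; Cond (ILess 21 16) Skip (ROp RSub 1 11 1) ;; RStore 4 14 1"
    fix j s assume j: "j < n" and I: "I j s"
    have "a * n + j < (a + 1) * n" using j by simp
    also have "\<dots> \<le> n_proj n * n" using a by (intro mult_right_mono) auto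
    finally have p: "a * n + j < n_proj n * n" .
    then have f: "a * n + j < n_coins k n" by (simp add: n_coins_def)
    have p2: "a * n \<le> U" "a * n + j \<le> U" using p U1 by auto
    show "reads_le U ?b s \<and> ireg (exec ?b s) 14 = j \<and> ireg (exec ?b s) 3 = 1 \<and> I (Suc j) ((exec ?b s)\<lparr>ireg := (ireg (exec ?b s))(14 := Suc j)\<rparr>)"
      using I j U1 f p2 by (cases "bs ! (a * n + j)") (simp_all add: I_def env2 pre_upd u0_def)
  qed (use s U1 in \<open>simp_all add: I_def env2 pre_0 agree_refl\<close>)
  then show ?thesis by (rule hoare_weaken) (auto simp: I_def St_def pre_n)
qed

definition prog_mean :: com where
  "prog_mean = For 14 0 (RLoad 0 1 14 ;; RLoad 4 2 14 ;; ROp RMul 1 1 2 ;; ROp RAdd 5 5 1)"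

lemma hoare_mean:
  assumes "St bs a t u N A s" "rreg s 5 = 0"
  shows "hoare prog_mean s (\<lambda>s. St bs a t u N A s \<and> rreg s 5 = (\<Sum>i<n. mu i * u i)) ((n * 44 + 3) * op_cost U)"
proof -
  have "hoare prog_mean s (\<lambda>s. St bs a t u N A s \<and> ireg s 14 = n \<and> rreg s 5 = (\<Sum>i<n. mu i * u i)) ((n * 44 + 3) * op_cost U)"
    unfolding prog_mean_def
    by (rule hoare_For_line[where I = "\<lambda>j s. St bs a t u N A s \<and> ireg s 14 = j \<and> rreg s 5 = (\<Sum>i<j. mu i * u i)"])
      (use assms U1 in \<open>simp_all add: St_def env2 agree_def\<close>)
  then show ?thesis by (rule hoare_weaken) auto
qed

definition ctr :: "(nat \<Rightarrow> real) \<Rightarrow> nat \<Rightarrow> real" where "ctr u i = u i - (\<Sum>j<n. mu j * u j) / tot"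

definition prog_fin :: com where
  "prog_fin = For 14 0 (RLoad 4 1 14 ;; ROp RSub 1 1 5 ;; RStore 4 14 1 ;; ROp RMul 1 1 1 ;; RLoad 3 2 14 ;; ROp RAdd 2 2 1 ;; RStore 3 14 2)"

lemma hoare_fin:
  assumes "St bs a t u N A s" "rreg s 5 = (\<Sum>i<n. mu i * u i) / tot"
  shows "hoare prog_fin s (St bs a t (ctr u) (\<lambda>i. N i + ctr u i * ctr u i) A) ((n * 44 + 3) * op_cost U)"
proof -
  define I where "I j s \<longleftrightarrow> Env bs s \<and> ireg s 12 = a \<and> ireg s 13 = t \<and> ireg s 14 = j \<and> pre n (rmem s 4) j (ctr u) u \<and>
      pre n (rmem s 3) j (\<lambda>i. N i + ctr u i * ctr u i) N \<and> agree n (rmem s 5) A \<and> rreg s 5 = (\<Sum>i<n. mu i * u i) / tot" for j and s :: mem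
  have "hoare prog_fin s (I n) ((n * 44 + 3) * op_cost U)"
    unfolding prog_fin_def
  proof (rule hoare_For_line[where I = I])
    let ?b = "RLoad 4 1 14 ;; ROp RSub 1 1 5 ;; RStore 4 14 1 ;; ROp RMul 1 1 1 ;; RLoad 3 2 14 ;; ROp RAdd 2 2 1 ;; RStore 3 14 2"
    fix j s assume j: "j < n" and I: "I j s"
    have v: "rmem s 4 j = u j" "rmem s 3 j = N j" using I j preD[of n "rmem s 4" j] preD[of n "rmem s 3" j] by (auto simp: I_def)
    show "reads_le U ?b s \<and> ireg (exec ?b s) 14 = j \<and> ireg (exec ?b s) 3 = 1 \<and> I (Suc j) ((exec ?b s)\<lparr>ireg := (ireg (exec ?b s))(14 := Suc j)\<rparr>)"
      using I j U1 by (simp add: I_def env2 v pre_upd ctr_def)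
  qed (use assms U1 in \<open>simp_all add: St_def I_def env2 pre_0\<close>)
  then show ?thesis by (rule hoare_weaken) (auto simp: I_def St_def pre_n)
qed

definition uu :: "bool list \<Rightarrow> nat \<Rightarrow> nat \<Rightarrow> real" where "uu bs a = ctr ((mv ^^ n_proj n) (u0 bs a))"
definition NN :: "bool list \<Rightarrow> nat \<Rightarrow> nat \<Rightarrow> real" where "NN bs j i = (\<Sum>a<j. uu bs a i * uu bs a i)"

definition prog_proj :: com where
  "prog_proj = IOp IMul 17 12 0 ;; prog_init ;; For 13 8 (prog_edges ;; prog_verts) ;; ROp RAdd 5 11 11 ;; prog_mean ;; ROp RDiv 5 5 0 ;; prog_fin"

definition cost_proj :: nat where
  "cost_proj = 40 + (n * 44 + 3 + (n_proj n * ((m * 44 + 3) + (n * 44 + 3) + 1 + 4) + 3 + (40 + (n * 44 + 3 + (40 + (n * 44 + 3) + 1) + 1) + 1) + 1) + 1) + 1"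

lemma hoare_proj:
  assumes s: "Env bs s" "ireg s 12 = a" "agree n (rmem s 3) N" "agree n (rmem s 5) (\<lambda>_. 0)" and a: "a < n_proj n"
  shows "hoare prog_proj s (\<lambda>s. \<exists>t. St bs a t (uu bs a) (\<lambda>i. N i + uu bs a i * uu bs a i) (\<lambda>_. 0) s) (cost_proj * op_cost U)"
  unfolding prog_proj_def cost_proj_def
proof (rule hoare_Seq'[OF hoare_line[where Q = "\<lambda>s. Env bs s \<and> ireg s 12 = a \<and> ireg s 17 = a * n \<and> agree n (rmem s 3) N \<and> agree n (rmem s 5) (\<lambda>_. 0)"]])
  show "reads_le U (IOp IMul 17 12 0) s" using s a U1 by (simp add: env2)
  show "Env bs (exec (IOp IMul 17 12 0) s) \<and> ireg (exec (IOp IMul 17 12 0) s) 12 = a \<and> ireg (exec (IOp IMul 17 12 0) s) 17 = a * n \<and>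
      agree n (rmem (exec (IOp IMul 17 12 0) s) 3) N \<and> agree n (rmem (exec (IOp IMul 17 12 0) s) 5) (\<lambda>_. 0)" using s by (simp add: env2)
  let ?u = "(mv ^^ n_proj n) (u0 bs a)" and ?Q = "\<lambda>s. \<exists>t. St bs a t (uu bs a) (\<lambda>i. N i + uu bs a i * uu bs a i) (\<lambda>_. 0) s"
  let ?S = "\<lambda>s. St bs a (n_proj n) ?u N (\<lambda>_. 0) s"
  have f: "hoare prog_fin s ?Q ((n * 44 + 3) * op_cost U)" if "?S s \<and> rreg s 5 = (\<Sum>i<n. mu i * ?u i) / tot" for s
    by (rule hoare_weaken[OF hoare_fin]) (use that in \<open>auto simp: uu_def\<close>)
  have d: "hoare (ROp RDiv 5 5 0 ;; prog_fin) s ?Q ((40 + (n * 44 + 3) + 1) * op_cost U)" if "?S s \<and> rreg s 5 = (\<Sum>i<n. mu i * ?u i)" for s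
    by (rule hoare_Seq'[OF hoare_line[where Q = "\<lambda>s. ?S s \<and> rreg s 5 = (\<Sum>i<n. mu i * ?u i) / tot"] f]) (use that in \<open>simp_all add: St_def env2\<close>)
  have mn: "hoare (prog_mean ;; ROp RDiv 5 5 0 ;; prog_fin) s ?Q ((n * 44 + 3 + (40 + (n * 44 + 3) + 1) + 1) * op_cost U)" if "?S s \<and> rreg s 5 = 0" for s
    by (rule hoare_Seq'[OF hoare_mean d]) (use that in auto)
  have z: "hoare (ROp RAdd 5 11 11 ;; prog_mean ;; ROp RDiv 5 5 0 ;; prog_fin) s ?Q ((40 + (n * 44 + 3 + (40 + (n * 44 + 3) + 1) + 1) + 1) * op_cost U)" if "?S s" for s
    by (rule hoare_Seq'[OF hoare_line[where Q = "\<lambda>s. ?S s \<and> rreg s 5 = 0"] mn]) (use that in \<open>simp_all add: St_def env2\<close>)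
  have mt: "hoare (For 13 8 (prog_edges ;; prog_verts) ;; ROp RAdd 5 11 11 ;; prog_mean ;; ROp RDiv 5 5 0 ;; prog_fin) s ?Q
      ((n_proj n * ((m * 44 + 3) + (n * 44 + 3) + 1 + 4) + 3 + (40 + (n * 44 + 3 + (40 + (n * 44 + 3) + 1) + 1) + 1) + 1) * op_cost U)"
    if h: "\<exists>t. St bs a t (u0 bs a) N (\<lambda>_. 0) s" for s
  proof -
    obtain t where "St bs a t (u0 bs a) N (\<lambda>_. 0) s" using h by blast
    then show ?thesis by (intro hoare_Seq'[OF hoare_mat z])
  qed
  fix s' assume "Env bs s' \<and> ireg s' 12 = a \<and> ireg s' 17 = a * n \<and> agree n (rmem s' 3) N \<and> agree n (rmem s' 5) (\<lambda>_. 0)"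
  then show "hoare (prog_init ;; For 13 8 (prog_edges ;; prog_verts) ;; ROp RAdd 5 11 11 ;; prog_mean ;; ROp RDiv 5 5 0 ;; prog_fin) s' ?Q
      ((n * 44 + 3 + (n_proj n * ((m * 44 + 3) + (n * 44 + 3) + 1 + 4) + 3 + (40 + (n * 44 + 3 + (40 + (n * 44 + 3) + 1) + 1) + 1) + 1) + 1) * op_cost U)"
    by (intro hoare_Seq'[OF hoare_init mt]) (use a in auto)
qed simp

definition prog_zero :: com where "prog_zero = For 12 0 (RStore 3 12 11 ;; RStore 5 12 11)"

lemma hoare_zero:
  assumes "Env bs s"
  shows "hoare prog_zero s (\<lambda>s. Env bs s \<and> agree n (rmem s 3) (\<lambda>_. 0) \<and> agree n (rmem s 5) (\<lambda>_. 0)) ((n * 44 + 3) * op_cost U)"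
proof -
  have "hoare prog_zero s (\<lambda>s. Env bs s \<and> ireg s 12 = n \<and> (\<forall>i<n. rmem s 3 i = 0 \<and> rmem s 5 i = 0)) ((n * 44 + 3) * op_cost U)"
    unfolding prog_zero_def
    by (rule hoare_For_line[where I = "\<lambda>j s. Env bs s \<and> ireg s 12 = j \<and> (\<forall>i<j. rmem s 3 i = 0 \<and> rmem s 5 i = 0)"])
      (use assms U1 in \<open>simp_all add: env2 All_less_Suc\<close>)
  then show ?thesis by (rule hoare_weaken) (auto simp: agree_def)
qed

lemma hoare_projs:
  assumes s: "Env bs s" "agree n (rmem s 3) (\<lambda>_. 0)" "agree n (rmem s 5) (\<lambda>_. 0)"
  shows "hoare (For 12 8 prog_proj) s (\<lambda>s. Env bs s \<and> agree n (rmem s 4) (uu bs (n_proj n - 1)) \<and> agree n (rmem s 3) (NN bs (n_proj n)))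
    ((n_proj n * (cost_proj + 4) + 3) * op_cost U)"
proof -
  define I where "I j s \<longleftrightarrow> Env bs s \<and> ireg s 12 = j \<and> agree n (rmem s 3) (NN bs j) \<and> agree n (rmem s 5) (\<lambda>_. 0) \<and>
    (0 < j \<longrightarrow> agree n (rmem s 4) (uu bs (j - 1)))" for j and s :: mem
  have "hoare (For 12 8 prog_proj) s (I (n_proj n)) ((n_proj n * (cost_proj + 4) + 3) * op_cost U)"
  proof (rule hoare_For'[where I = I])
    fix j s assume j: "j < n_proj n" and I: "I j s"
    have e: "(\<lambda>i. NN bs j i + uu bs j i * uu bs j i) = NN bs (Suc j)" by (simp add: NN_def fun_eq_iff)
    show "hoare prog_proj s (\<lambda>s'. ireg s' 12 = j \<and> ireg s' 3 = 1 \<and> I (Suc j) (s'\<lparr>ireg := (ireg s')(12 := Suc j)\<rparr>)) (cost_proj * op_cost U)"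
    proof (rule hoare_weaken[OF hoare_proj[of bs s j "NN bs j"]])
      fix s' assume "\<exists>t. St bs j t (uu bs j) (\<lambda>i. NN bs j i + uu bs j i * uu bs j i) (\<lambda>_. 0) s'"
      then show "ireg s' 12 = j \<and> ireg s' 3 = 1 \<and> I (Suc j) (s'\<lparr>ireg := (ireg s')(12 := Suc j)\<rparr>)"
        unfolding e by (elim exE) (simp add: I_def St_def env2)
    qed (use I j in \<open>simp_all add: I_def\<close>)
  qed (use s U1 in \<open>simp_all add: I_def env2 NN_def[abs_def] agree_def\<close>)
  then show ?thesis by (rule hoare_weaken) (auto simp: I_def n_proj_def)
qed

end


section \<open>The random level, the threshold and the repaired cut in the program\<close>

context machine
begin

definition prog_level :: com where
  "prog_level = IConst 19 0 ;; For 12 22 (IOp IAdd 16 10 12 ;; ILoad 5 16 16 ;; IOp IAdd 19 19 19 ;; IOp IAdd 19 19 16)"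

definition lev :: "bool list \<Rightarrow> nat" where "lev bs = horner bs (n_proj n * n) (ceil_loglog n + (k + 1))"

lemma pow_level: "(2::nat) ^ (ceil_loglog n + (k + 1)) = 2 * n_lev k n"
  by (simp add: n_lev_def power_add)

lemma lev_less: "lev bs < 2 * n_lev k n"
  unfolding lev_def pow_level[symmetric] by (rule horner_less)

lemma hoare_level:
  assumes "Env bs s \<and> agree n (rmem s 4) f \<and> agree n (rmem s 3) g"
  shows "hoare prog_level s (\<lambda>s. Env bs s \<and> agree n (rmem s 4) f \<and> agree n (rmem s 3) g \<and> ireg s 19 = lev bs)
    ((40 + ((ceil_loglog n + (k + 1)) * 44 + 3) + 1) * op_cost U)"
  unfolding prog_level_def
proof (rule hoare_Seq'[OF hoare_line[where Q = "\<lambda>s. Env bs s \<and> agree n (rmem s 4) f \<and> agree n (rmem s 3) g \<and> ireg s 19 = 0"]])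
  show "reads_le U (IConst 19 0) s" by simp
  show "Env bs (exec (IConst 19 0) s) \<and> agree n (rmem (exec (IConst 19 0) s) 4) f \<and> agree n (rmem (exec (IConst 19 0) s) 3) g \<and> ireg (exec (IConst 19 0) s) 19 = 0"
    using assms by (simp add: env2)
  let ?b = "IOp IAdd 16 10 12 ;; ILoad 5 16 16 ;; IOp IAdd 19 19 19 ;; IOp IAdd 19 19 16"
  define K where "K = ceil_loglog n + (k + 1)"
  define I where "I j s \<longleftrightarrow> Env bs s \<and> agree n (rmem s 4) f \<and> agree n (rmem s 3) g \<and> ireg s 12 = j \<and> ireg s 19 = horner bs (n_proj n * n) j" for j and s :: mem
  fix s assume s: "Env bs s \<and> agree n (rmem s 4) f \<and> agree n (rmem s 3) g \<and> ireg s 19 = 0"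
  have "hoare (For 12 22 ?b) s (I K) ((K * 44 + 3) * op_cost U)"
  proof (rule hoare_For_line[where I = I])
    fix j s assume j: "j < K" and I: "I j s"
    have "horner bs (n_proj n * n) (Suc j) < 2 ^ Suc j" by (rule horner_less)
    also have "\<dots> \<le> 2 ^ K" using j by (intro power_increasing) auto
    finally have h: "2 * horner bs (n_proj n * n) j \<le> U" using U(5) pow_level by (simp add: K_def)
    have p: "n_proj n * n + j < n_coins k n" using j by (simp add: n_coins_def K_def)
    then have q: "n_proj n * n + j \<le> U" using U by simp
    show "reads_le U ?b s \<and> ireg (exec ?b s) 12 = j \<and> ireg (exec ?b s) 3 = 1 \<and> I (Suc j) ((exec ?b s)\<lparr>ireg := (ireg (exec ?b s))(12 := Suc j)\<rparr>)"
      using I p q h U1 by (cases "bs ! (n_proj n * n + j)") (simp_all add: I_def env2)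
  qed (use s U1 in \<open>simp_all add: I_def env2 K_def\<close>)
  then show "hoare (For 12 22 ?b) s (\<lambda>s. Env bs s \<and> agree n (rmem s 4) f \<and> agree n (rmem s 3) g \<and> ireg s 19 = lev bs) (((ceil_loglog n + (k + 1)) * 44 + 3) * op_cost U)"
    unfolding K_def[symmetric] by (rule hoare_weaken) (auto simp: I_def lev_def K_def)
qed simp

definition prog_copy :: com where
  "prog_copy = (IOp ISub 18 19 9 ;; IOp IAdd 18 18 3 ;; ROfInt 6 3) ;; For 14 18 (ROp RAdd 6 6 6) ;; For 14 0 (RLoad 3 1 14 ;; RStore 4 14 1)"

definition prog_score :: com where
  "prog_score = Cond (ILess 19 9) (ROfInt 6 19 ;; ROfInt 7 9 ;; ROp RDiv 6 6 7) prog_copy"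

definition score :: "bool list \<Rightarrow> nat \<Rightarrow> real" where
  "score bs = (if lev bs < n_lev k n then uu bs (n_proj n - 1) else NN bs (n_proj n))"

definition coef :: "bool list \<Rightarrow> real" where
  "coef bs = (if lev bs < n_lev k n then real (lev bs) / real (n_lev k n) else 2 ^ (lev bs - n_lev k n + 1))"

lemma hoare_score:
  assumes s: "Env bs s \<and> agree n (rmem s 4) (uu bs (n_proj n - 1)) \<and> agree n (rmem s 3) (NN bs (n_proj n)) \<and> ireg s 19 = lev bs"
  shows "hoare prog_score s (\<lambda>s. Env bs s \<and> agree n (rmem s 4) (score bs) \<and> rreg s 6 = coef bs)
    ((40 + (n_lev k n * 44 + 3 + (n * 44 + 3) + 1) + 1 + 1) * op_cost U)"
  unfolding prog_score_def
proof (rule hoare_Cond')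
  have l: "lev bs \<le> U" "Suc (lev bs - n_lev k n) \<le> n_lev k n" "lev bs - n_lev k n \<le> U" using lev_less[of bs] U(5) U1 by (auto simp: n_lev_def)
  show "test_reads_le U (ILess 19 9) s" using s l U1 by (simp add: env2)
  { assume t: "test_val (ILess 19 9) s"
    have "hoare (ROfInt 6 19 ;; ROfInt 7 9 ;; ROp RDiv 6 6 7) s (\<lambda>s. Env bs s \<and> agree n (rmem s 4) (score bs) \<and> rreg s 6 = coef bs) (40 * op_cost U)"
      by (rule hoare_line) (use t s l U1 in \<open>simp_all add: env2 score_def coef_def\<close>)
    then show "hoare (ROfInt 6 19 ;; ROfInt 7 9 ;; ROp RDiv 6 6 7) s (\<lambda>s. Env bs s \<and> agree n (rmem s 4) (score bs) \<and> rreg s 6 = coef bs)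
        ((40 + (n_lev k n * 44 + 3 + (n * 44 + 3) + 1) + 1) * op_cost U)" by (rule hoare_weaken) auto }
  assume t: "\<not> test_val (ILess 19 9) s"
  define D where "D = lev bs - n_lev k n + 1"
  have nl: "\<not> lev bs < n_lev k n" using t s by (simp add: env2)
  let ?A = "\<lambda>s. Env bs s \<and> agree n (rmem s 3) (score bs)"
  have c: "hoare (For 14 0 (RLoad 3 1 14 ;; RStore 4 14 1)) s (\<lambda>s. Env bs s \<and> agree n (rmem s 4) (score bs) \<and> rreg s 6 = coef bs) ((n * 44 + 3) * op_cost U)"
    if h: "?A s \<and> rreg s 6 = coef bs" for s
  proof -
    have "hoare (For 14 0 (RLoad 3 1 14 ;; RStore 4 14 1)) s
      (\<lambda>s. ?A s \<and> rreg s 6 = coef bs \<and> ireg s 14 = n \<and> (\<forall>i<n. rmem s 4 i = score bs i)) ((n * 44 + 3) * op_cost U)"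
      by (rule hoare_For_line[where I = "\<lambda>j s. ?A s \<and> rreg s 6 = coef bs \<and> ireg s 14 = j \<and> (\<forall>i<j. rmem s 4 i = score bs i)"])
        (use h U1 in \<open>simp_all add: env2 agree_def All_less_Suc\<close>)
    then show ?thesis by (rule hoare_weaken) (auto simp: agree_def)
  qed
  have p: "hoare (For 14 18 (ROp RAdd 6 6 6) ;; For 14 0 (RLoad 3 1 14 ;; RStore 4 14 1)) s
     (\<lambda>s. Env bs s \<and> agree n (rmem s 4) (score bs) \<and> rreg s 6 = coef bs) ((n_lev k n * 44 + 3 + (n * 44 + 3) + 1) * op_cost U)"
    if h: "?A s \<and> ireg s 18 = D \<and> rreg s 6 = 1" for s
  proof (rule hoare_Seq'[OF _ c])
    have "hoare (For 14 18 (ROp RAdd 6 6 6)) s (\<lambda>s. ?A s \<and> ireg s 18 = D \<and> ireg s 14 = D \<and> rreg s 6 = 2 ^ D) ((D * 44 + 3) * op_cost U)"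
      by (rule hoare_For_line[where I = "\<lambda>j s. ?A s \<and> ireg s 18 = D \<and> ireg s 14 = j \<and> rreg s 6 = 2 ^ j"])
        (use h U1 l in \<open>simp_all add: env2 D_def\<close>)
    then show "hoare (For 14 18 (ROp RAdd 6 6 6)) s (\<lambda>s. ?A s \<and> rreg s 6 = coef bs) ((n_lev k n * 44 + 3) * op_cost U)"
      by (rule hoare_weaken) (use nl l in \<open>auto simp: coef_def D_def\<close>)
  qed
  show "hoare prog_copy s (\<lambda>s. Env bs s \<and> agree n (rmem s 4) (score bs) \<and> rreg s 6 = coef bs)
    ((40 + (n_lev k n * 44 + 3 + (n * 44 + 3) + 1) + 1) * op_cost U)"
    unfolding prog_copy_def
    by (rule hoare_Seq'[OF hoare_line[where Q = "\<lambda>s. ?A s \<and> ireg s 18 = D \<and> rreg s 6 = 1"] p]) (use s nl l U1 in \<open>simp_all add: env2 D_def score_def\<close>)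
qed

definition Scr :: "bool list \<Rightarrow> mem \<Rightarrow> bool" where "Scr bs s \<longleftrightarrow> Env bs s \<and> agree n (rmem s 4) (score bs)"

definition prog_abs :: com where
  "prog_abs = For 14 0 (RLoad 4 1 14 ;; Cond (RLess 1 11) (ROp RSub 1 11 1) Skip ;; RLoad 0 2 14 ;; ROp RMul 1 2 1 ;; ROp RAdd 7 7 1)"

definition thr :: "bool list \<Rightarrow> real" where
  "thr bs = coef bs * (\<Sum>j<n. mu j * \<bar>score bs j\<bar>) / tot"

lemma hoare_abs:
  assumes "Scr bs s \<and> rreg s 6 = coef bs \<and> rreg s 7 = 0 \<and> rreg s 8 = 0"
  shows "hoare prog_abs s (\<lambda>s. Scr bs s \<and> rreg s 6 = coef bs \<and> rreg s 7 = (\<Sum>j<n. mu j * \<bar>score bs j\<bar>) \<and> rreg s 8 = 0) ((n * 44 + 3) * op_cost U)"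
proof -
  define I where "I j s \<longleftrightarrow> Scr bs s \<and> rreg s 6 = coef bs \<and> ireg s 14 = j \<and> rreg s 7 = (\<Sum>i<j. mu i * \<bar>score bs i\<bar>) \<and> rreg s 8 = 0" for j and s :: mem
  have "hoare prog_abs s (I n) ((n * 44 + 3) * op_cost U)"
    unfolding prog_abs_def
  proof (rule hoare_For_line[where I = I])
    let ?b = "RLoad 4 1 14 ;; Cond (RLess 1 11) (ROp RSub 1 11 1) Skip ;; RLoad 0 2 14 ;; ROp RMul 1 2 1 ;; ROp RAdd 7 7 1"
    fix j s assume j: "j < n" and I: "I j s"
    have v: "rmem s 4 j = score bs j" using I j by (simp add: I_def Scr_def agree_def)
    show "reads_le U ?b s \<and> ireg (exec ?b s) 14 = j \<and> ireg (exec ?b s) 3 = 1 \<and> I (Suc j) ((exec ?b s)\<lparr>ireg := (ireg (exec ?b s))(14 := Suc j)\<rparr>)"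
      using I j U1 by (cases "score bs j < 0") (simp_all add: I_def Scr_def env2 v)
  qed (use assms U1 in \<open>simp_all add: I_def Scr_def env2\<close>)
  then show ?thesis by (rule hoare_weaken) (auto simp: I_def)
qed

definition cut1 :: "bool list \<Rightarrow> nat set" where "cut1 bs = {i. i < n \<and> \<not> score bs i < thr bs}"

definition Out :: "bool list \<Rightarrow> nat set \<Rightarrow> mem \<Rightarrow> bool" where
  "Out bs S s \<longleftrightarrow> Env bs s \<and> (\<forall>i<n. imem s 4 i = of_bool (i \<in> S))"

definition prog_select :: com where
  "prog_select = For 14 0 (RLoad 4 1 14 ;; Cond (RLess 1 6) (IStore 4 14 21) (IStore 4 14 3 ;; RLoad 0 2 14 ;; ROp RAdd 8 8 2))"

definition mvol :: "nat set \<Rightarrow> real" where "mvol S = (\<Sum>i<n. if i \<in> S then mu i else 0)"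

lemma hoare_select:
  assumes "Scr bs s \<and> rreg s 6 = thr bs \<and> rreg s 8 = 0"
  shows "hoare prog_select s (\<lambda>s. Out bs (cut1 bs) s \<and> rreg s 8 = mvol (cut1 bs)) ((n * 44 + 3) * op_cost U)"
proof -
  define I where "I j s \<longleftrightarrow> Scr bs s \<and> rreg s 6 = thr bs \<and> ireg s 14 = j \<and> rreg s 8 = (\<Sum>i<j. if i \<in> cut1 bs then mu i else 0) \<and>
    (\<forall>i<j. imem s 4 i = of_bool (i \<in> cut1 bs))" for j and s :: mem
  have "hoare prog_select s (I n) ((n * 44 + 3) * op_cost U)"
    unfolding prog_select_def
  proof (rule hoare_For_line[where I = I])
    let ?b = "RLoad 4 1 14 ;; Cond (RLess 1 6) (IStore 4 14 21) (IStore 4 14 3 ;; RLoad 0 2 14 ;; ROp RAdd 8 8 2)"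
    fix j s assume j: "j < n" and I: "I j s"
    have v: "rmem s 4 j = score bs j" using I j by (simp add: I_def Scr_def agree_def)
    have c: "j \<in> cut1 bs \<longleftrightarrow> \<not> score bs j < thr bs" using j by (simp add: cut1_def)
    show "reads_le U ?b s \<and> ireg (exec ?b s) 14 = j \<and> ireg (exec ?b s) 3 = 1 \<and> I (Suc j) ((exec ?b s)\<lparr>ireg := (ireg (exec ?b s))(14 := Suc j)\<rparr>)"
      using I j U1 by (cases "score bs j < thr bs") (simp_all add: I_def Scr_def env2 v c All_less_Suc)
  qed (use assms U1 in \<open>simp_all add: I_def Scr_def env2\<close>)
  then show ?thesis by (rule hoare_weaken) (auto simp: I_def Out_def Scr_def mvol_def)
qed

definition prog_compl :: com where
  "prog_compl = For 14 0 (ILoad 4 16 14 ;; IOp ISub 16 3 16 ;; IStore 4 14 16)"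

lemma hoare_compl:
  assumes "Out bs S s"
  shows "hoare prog_compl s (Out bs ({..<n} - S)) ((n * 44 + 3) * op_cost U)"
proof -
  define I where "I j s \<longleftrightarrow> Env bs s \<and> ireg s 14 = j \<and> (\<forall>i<n. imem s 4 i = (if i < j then of_bool (i \<notin> S) else of_bool (i \<in> S)))" for j and s :: mem
  have "hoare prog_compl s (I n) ((n * 44 + 3) * op_cost U)"
    unfolding prog_compl_def
  proof (rule hoare_For_line[where I = I])
    let ?b = "ILoad 4 16 14 ;; IOp ISub 16 3 16 ;; IStore 4 14 16"
    fix j s assume j: "j < n" and I: "I j s"
    have v: "imem s 4 j = of_bool (j \<in> S)" using I j by (simp add: I_def)
    have a: "\<forall>i<n. ((imem s 4)(j := of_bool (j \<notin> S))) i = (if i < Suc j then of_bool (i \<notin> S) else of_bool (i \<in> S))"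
      using I by (auto simp: I_def less_Suc_eq)
    show "reads_le U ?b s \<and> ireg (exec ?b s) 14 = j \<and> ireg (exec ?b s) 3 = 1 \<and> I (Suc j) ((exec ?b s)\<lparr>ireg := (ireg (exec ?b s))(14 := Suc j)\<rparr>)"
      using I j U1 a by (cases "j \<in> S") (simp_all add: I_def env2 v)
  qed (use assms U1 in \<open>simp_all add: I_def Out_def env2\<close>)
  then show ?thesis by (rule hoare_weaken) (auto simp: I_def Out_def)
qed

definition cut2 :: "bool list \<Rightarrow> nat set" where
  "cut2 bs = (if tot < mvol (cut1 bs) + mvol (cut1 bs) then {..<n} - cut1 bs else cut1 bs)"

definition prog_count :: com where
  "prog_count = For 14 0 (ILoad 4 16 14 ;; IOp IAdd 18 18 16)"

lemma hoare_count:
  assumes "Out bs S s \<and> ireg s 18 = 0" and S: "S \<subseteq> {..<n}"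
  shows "hoare prog_count s (\<lambda>s. Out bs S s \<and> ireg s 18 = card S) ((n * 44 + 3) * op_cost U)"
proof -
  have le: "(\<Sum>i<j. of_bool (i \<in> S) :: nat) \<le> j" for j by (induction j) auto
  have "hoare prog_count s (\<lambda>s. Out bs S s \<and> ireg s 14 = n \<and> ireg s 18 = (\<Sum>i<n. of_bool (i \<in> S))) ((n * 44 + 3) * op_cost U)"
    unfolding prog_count_def
  proof (rule hoare_For_line[where I = "\<lambda>j s. Out bs S s \<and> ireg s 14 = j \<and> ireg s 18 = (\<Sum>i<j. of_bool (i \<in> S))"])
    let ?b = "ILoad 4 16 14 ;; IOp IAdd 18 18 16"
    fix j s assume j: "j < n" and I: "Out bs S s \<and> ireg s 14 = j \<and> ireg s 18 = (\<Sum>i<j. of_bool (i \<in> S))"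
    have v: "imem s 4 j = of_bool (j \<in> S)" using I j by (simp add: Out_def)
    have l: "(\<Sum>i<j. of_bool (i \<in> S) :: nat) \<le> U" using le[of j] j U1 by simp
    show "reads_le U ?b s \<and> ireg (exec ?b s) 14 = j \<and> ireg (exec ?b s) 3 = 1 \<and>
        Out bs S ((exec ?b s)\<lparr>ireg := (ireg (exec ?b s))(14 := Suc j)\<rparr>) \<and> ireg ((exec ?b s)\<lparr>ireg := (ireg (exec ?b s))(14 := Suc j)\<rparr>) 14 = Suc j \<and>
        ireg ((exec ?b s)\<lparr>ireg := (ireg (exec ?b s))(14 := Suc j)\<rparr>) 18 = (\<Sum>i<Suc j. of_bool (i \<in> S))"
      using I j U1 l by (cases "j \<in> S") (simp_all add: Out_def env2 v)
  qed (use assms U1 in \<open>simp_all add: Out_def env2\<close>)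
  then show ?thesis
  proof (rule hoare_weaken)
    have "(\<Sum>i<n. of_bool (i \<in> S) :: nat) = card S" using S by (simp add: sum_of_bool_eq Int_absorb1 Collect_mem_eq Int_def[symmetric])
    then show "Out bs S s \<and> ireg s 18 = card S" if "Out bs S s \<and> ireg s 14 = n \<and> ireg s 18 = (\<Sum>i<n. of_bool (i \<in> S))" for s
      using that by simp
  qed simp
qed

text \<open>\<open>amin\<close> on the real weights held in memory, with the same treatment of ties;
  \<open>cut3_eq\<close> identifies the two.\<close>

fun rmin :: "nat \<Rightarrow> nat" where
  "rmin 0 = 0"
| "rmin (Suc i) = (if mu i < mu (rmin i) then i else rmin i)"

lemma rmin_less: "rmin j < n \<or> j > n"
proof (induction j)
  case (Suc j) then show ?case by (cases "j < n") auto
qed (use n2 in auto)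

definition prog_min :: com where
  "prog_min = For 14 0 (RLoad 0 1 14 ;; RLoad 0 2 18 ;; Cond (RLess 1 2) (IOp IAdd 18 14 21) Skip) ;; IStore 4 18 3"

lemma hoare_min:
  assumes s: "Out bs {} s \<and> ireg s 18 = 0"
  shows "hoare prog_min s (Out bs {rmin n}) ((n * 44 + 3 + 40 + 1) * op_cost U)"
  unfolding prog_min_def
proof (rule hoare_Seq')
  show "hoare (For 14 0 (RLoad 0 1 14 ;; RLoad 0 2 18 ;; Cond (RLess 1 2) (IOp IAdd 18 14 21) Skip)) s
    (\<lambda>s. Out bs {} s \<and> ireg s 14 = n \<and> ireg s 18 = rmin n) ((n * 44 + 3) * op_cost U)"
  proof (rule hoare_For_line[where I = "\<lambda>j s. Out bs {} s \<and> ireg s 14 = j \<and> ireg s 18 = rmin j"])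
    let ?b = "RLoad 0 1 14 ;; RLoad 0 2 18 ;; Cond (RLess 1 2) (IOp IAdd 18 14 21) Skip"
    fix j s assume j: "j < n" and I: "Out bs {} s \<and> ireg s 14 = j \<and> ireg s 18 = rmin j"
    have r: "rmin j < n" "rmin j \<le> U" using rmin_less[of j] j U1 by auto
    show "reads_le U ?b s \<and> ireg (exec ?b s) 14 = j \<and> ireg (exec ?b s) 3 = 1 \<and>
        Out bs {} ((exec ?b s)\<lparr>ireg := (ireg (exec ?b s))(14 := Suc j)\<rparr>) \<and> ireg ((exec ?b s)\<lparr>ireg := (ireg (exec ?b s))(14 := Suc j)\<rparr>) 14 = Suc j \<and>
        ireg ((exec ?b s)\<lparr>ireg := (ireg (exec ?b s))(14 := Suc j)\<rparr>) 18 = rmin (Suc j)"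
      using I j U1 r by (cases "mu j < mu (rmin j)") (simp_all add: Out_def env2)
  qed (use s U1 in \<open>simp_all add: Out_def env2\<close>)
  fix s assume s: "Out bs {} s \<and> ireg s 14 = n \<and> ireg s 18 = rmin n"
  have r: "rmin n < n" "rmin n \<le> U" using rmin_less[of n] U1 by auto
  show "hoare (IStore 4 18 3) s (Out bs {rmin n}) (40 * op_cost U)"
    by (rule hoare_line) (use s r U1 in \<open>simp_all add: Out_def env2\<close>)
qed

definition cut3 :: "bool list \<Rightarrow> nat set" where
  "cut3 bs = (if cut2 bs = {} then {rmin n} else cut2 bs)"

definition prog_round :: com where
  "prog_round = (ROp RAdd 7 11 11 ;; ROp RAdd 8 11 11) ;; prog_abs ;; (ROp RMul 6 6 7 ;; ROp RDiv 6 6 0) ;; prog_select ;; ROp RAdd 8 8 8 ;;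
     Cond (RLess 0 8) prog_compl Skip ;; IConst 18 0 ;; prog_count ;; Cond (ILess 21 18) Skip (IConst 18 0 ;; prog_min)"

lemma hoare_round:
  assumes s: "Scr bs s \<and> rreg s 6 = coef bs"
  shows "hoare prog_round s (Out bs (cut3 bs)) ((n * 240 + 400) * op_cost U)"
proof -
  let ?Q = "Out bs (cut3 bs)"
  have c1: "cut1 bs \<subseteq> {..<n}" by (auto simp: cut1_def)
  have c2: "cut2 bs \<subseteq> {..<n}" using c1 by (auto simp: cut2_def)
  have cU: "card (cut2 bs) \<le> U" using card_mono[OF _ c2] U1 by simp
  have f2: "finite (cut2 bs)" using c2 finite_subset by blast
  have d1: "hoare (Cond (ILess 21 18) Skip (IConst 18 0 ;; prog_min)) s ?Q ((40 + (n * 44 + 3 + 40 + 1) + 1 + 1) * op_cost U)"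
    if h: "Out bs (cut2 bs) s \<and> ireg s 18 = card (cut2 bs)" for s
  proof (rule hoare_Cond')
    show "test_reads_le U (ILess 21 18) s" using h cU by (simp add: Out_def env2)
    { assume "test_val (ILess 21 18) s"
      then have "cut2 bs \<noteq> {}" using h by (auto simp: Out_def env2)
      then have "hoare Skip s ?Q (40 * op_cost U)" using h by (intro hoare_line) (simp_all add: cut3_def)
      then show "hoare Skip s ?Q ((40 + (n * 44 + 3 + 40 + 1) + 1) * op_cost U)" by (rule hoare_weaken) auto }
    assume t: "\<not> test_val (ILess 21 18) s"
    have e: "cut2 bs = {}" using t h f2 by (simp add: Out_def env2)
    have q: "cut3 bs = {rmin n}" using e by (simp add: cut3_def)
    show "hoare (IConst 18 0 ;; prog_min) s ?Q ((40 + (n * 44 + 3 + 40 + 1) + 1) * op_cost U)"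
    proof (rule hoare_Seq'[OF hoare_line[where Q = "\<lambda>s. Out bs {} s \<and> ireg s 18 = 0"]])
      fix s assume "Out bs {} s \<and> ireg s 18 = 0"
      then show "hoare prog_min s ?Q ((n * 44 + 3 + 40 + 1) * op_cost U)" unfolding q by (rule hoare_min)
    qed (use h e in \<open>simp_all add: Out_def env2\<close>)
  qed
  have d2: "hoare (prog_count ;; Cond (ILess 21 18) Skip (IConst 18 0 ;; prog_min)) s ?Q
     ((n * 44 + 3 + (40 + (n * 44 + 3 + 40 + 1) + 1 + 1) + 1) * op_cost U)" if "Out bs (cut2 bs) s \<and> ireg s 18 = 0" for s
    by (rule hoare_Seq'[OF hoare_count[OF that c2] d1])
  have d3: "hoare (IConst 18 0 ;; prog_count ;; Cond (ILess 21 18) Skip (IConst 18 0 ;; prog_min)) s ?Q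
     ((40 + (n * 44 + 3 + (40 + (n * 44 + 3 + 40 + 1) + 1 + 1) + 1) + 1) * op_cost U)" if "Out bs (cut2 bs) s" for s
    by (rule hoare_Seq'[OF hoare_line[where Q = "\<lambda>s. Out bs (cut2 bs) s \<and> ireg s 18 = 0"] d2]) (use that in \<open>simp_all add: Out_def env2\<close>)
  have d4: "hoare (Cond (RLess 0 8) prog_compl Skip ;; IConst 18 0 ;; prog_count ;; Cond (ILess 21 18) Skip (IConst 18 0 ;; prog_min)) s ?Q
     ((40 + (n * 44 + 3) + 1 + (40 + (n * 44 + 3 + (40 + (n * 44 + 3 + 40 + 1) + 1 + 1) + 1) + 1) + 1) * op_cost U)"
    if h: "Out bs (cut1 bs) s \<and> rreg s 8 = mvol (cut1 bs) + mvol (cut1 bs)" for s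
  proof (rule hoare_Seq'[OF hoare_Cond' d3])
    have t: "test_val (RLess 0 8) s \<longleftrightarrow> tot < mvol (cut1 bs) + mvol (cut1 bs)" using h by (simp add: Out_def env2)
    show "test_reads_le U (RLess 0 8) s" by simp
    show "test_val (RLess 0 8) s \<Longrightarrow> hoare prog_compl s (Out bs (cut2 bs)) ((40 + (n * 44 + 3)) * op_cost U)"
      by (rule hoare_weaken[OF hoare_compl[of bs "cut1 bs"]]) (use h t in \<open>simp_all add: cut2_def\<close>)
    show "hoare Skip s (Out bs (cut2 bs)) ((40 + (n * 44 + 3)) * op_cost U)" if "\<not> test_val (RLess 0 8) s"
    proof -
      have "Out bs (cut2 bs) s" using that h t by (simp add: cut2_def)
      then have "hoare Skip s (Out bs (cut2 bs)) (40 * op_cost U)" by (intro hoare_line) auto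
      then show ?thesis by (rule hoare_weaken) auto
    qed
  qed
  note e1 = hoare_Seq'[OF hoare_line[where Q = "\<lambda>s. Out bs (cut1 bs) s \<and> rreg s 8 = mvol (cut1 bs) + mvol (cut1 bs)"] d4]
  let ?c5 = "ROp RAdd 8 8 8 ;; Cond (RLess 0 8) prog_compl Skip ;; IConst 18 0 ;; prog_count ;; Cond (ILess 21 18) Skip (IConst 18 0 ;; prog_min)"
  have d5: "hoare ?c5 s ?Q ((40 + (40 + (n * 44 + 3) + 1 + (40 + (n * 44 + 3 + (40 + (n * 44 + 3 + 40 + 1) + 1 + 1) + 1) + 1) + 1) + 1) * op_cost U)"
    if "Out bs (cut1 bs) s \<and> rreg s 8 = mvol (cut1 bs)" for s
    by (rule e1) (use that in \<open>simp_all add: Out_def env2\<close>)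
  have d6: "hoare (prog_select ;; ?c5) s ?Q ((n * 44 + 3 + (40 + (40 + (n * 44 + 3) + 1 + (40 + (n * 44 + 3 + (40 + (n * 44 + 3 + 40 + 1) + 1 + 1) + 1) + 1) + 1) + 1) + 1) * op_cost U)"
    if "Scr bs s \<and> rreg s 6 = thr bs \<and> rreg s 8 = 0" for s
    by (rule hoare_Seq'[OF hoare_select[OF that] d5])
  let ?T = "n * 44 + 3 + (40 + (40 + (n * 44 + 3) + 1 + (40 + (n * 44 + 3 + (40 + (n * 44 + 3 + 40 + 1) + 1 + 1) + 1) + 1) + 1) + 1) + 1"
  note e7 = hoare_Seq'[OF hoare_line[where Q = "\<lambda>s. Scr bs s \<and> rreg s 6 = thr bs \<and> rreg s 8 = 0"] d6]
  have d7: "hoare ((ROp RMul 6 6 7 ;; ROp RDiv 6 6 0) ;; prog_select ;; ?c5) s ?Q ((40 + ?T + 1) * op_cost U)"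
    if "Scr bs s \<and> rreg s 6 = coef bs \<and> rreg s 7 = (\<Sum>j<n. mu j * \<bar>score bs j\<bar>) \<and> rreg s 8 = 0" for s
    by (rule e7) (use that in \<open>simp_all add: Scr_def env2 thr_def\<close>)
  have d8: "hoare (prog_abs ;; (ROp RMul 6 6 7 ;; ROp RDiv 6 6 0) ;; prog_select ;; ?c5) s ?Q ((n * 44 + 3 + (40 + ?T + 1) + 1) * op_cost U)"
    if "Scr bs s \<and> rreg s 6 = coef bs \<and> rreg s 7 = 0 \<and> rreg s 8 = 0" for s
    by (rule hoare_Seq'[OF hoare_abs[OF that] d7])
  note e9 = hoare_Seq'[OF hoare_line[where Q = "\<lambda>s. Scr bs s \<and> rreg s 6 = coef bs \<and> rreg s 7 = 0 \<and> rreg s 8 = 0"] d8]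
  have "hoare prog_round s ?Q ((40 + (n * 44 + 3 + (40 + ?T + 1) + 1) + 1) * op_cost U)"
    unfolding prog_round_def by (rule e9) (use s in \<open>simp_all add: Scr_def env2\<close>)
  then show ?thesis by (rule hoare_weaken) auto
qed

end


section \<open>The whole program and the cut that it computes\<close>

definition prog_flips :: com where "prog_flips = For 14 11 ((Flip 16 ;; IStore 5 14 16))"

context machine
begin

definition prog_main :: com where
  "prog_main = prog_zero ;; For 12 8 prog_proj ;; prog_level ;; prog_score ;; prog_round"

text \<open>Each of the \<open>n_proj n\<close> projections takes \<open>n_proj n\<close> walk steps
  of cost proportional to \<open>n + m\<close>, and the doublings that compute \<open>rho\<close>
  bring in \<open>n_lev k n\<close>. One product of all factors dominates every term.\<close>

definition cost_all :: nat where
  "cost_all = 3000 * (n_proj n * n_proj n * n_lev k n * (n + m))"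

lemma hoare_main:
  assumes s: "Env bs s"
  shows "hoare prog_main s (Out bs (cut3 bs)) ((n * 44 + 3 + (n_proj n * (cost_proj + 4) + 3 + ((40 + ((ceil_loglog n + (k + 1)) * 44 + 3) + 1) +
     ((40 + (n_lev k n * 44 + 3 + (n * 44 + 3) + 1) + 1 + 1) + (n * 240 + 400) + 1) + 1) + 1) + 1) * op_cost U)"
proof -
  let ?Q = "Out bs (cut3 bs)"
  have a: "hoare (prog_score ;; prog_round) s ?Q (((40 + (n_lev k n * 44 + 3 + (n * 44 + 3) + 1) + 1 + 1) + (n * 240 + 400) + 1) * op_cost U)"
    if "Env bs s \<and> agree n (rmem s 4) (uu bs (n_proj n - 1)) \<and> agree n (rmem s 3) (NN bs (n_proj n)) \<and> ireg s 19 = lev bs" for s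
    by (rule hoare_Seq'[OF hoare_score[OF that]]) (rule hoare_round, simp add: Scr_def)
  have b: "hoare (prog_level ;; prog_score ;; prog_round) s ?Q (((40 + ((ceil_loglog n + (k + 1)) * 44 + 3) + 1) +
     ((40 + (n_lev k n * 44 + 3 + (n * 44 + 3) + 1) + 1 + 1) + (n * 240 + 400) + 1) + 1) * op_cost U)"
    if "Env bs s \<and> agree n (rmem s 4) (uu bs (n_proj n - 1)) \<and> agree n (rmem s 3) (NN bs (n_proj n))" for s
    by (rule hoare_Seq'[OF hoare_level[OF that] a])
  have c: "hoare (For 12 8 prog_proj ;; prog_level ;; prog_score ;; prog_round) s ?Q ((n_proj n * (cost_proj + 4) + 3 + ((40 + ((ceil_loglog n + (k + 1)) * 44 + 3) + 1) +
     ((40 + (n_lev k n * 44 + 3 + (n * 44 + 3) + 1) + 1 + 1) + (n * 240 + 400) + 1) + 1) + 1) * op_cost U)"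
    if h: "Env bs s \<and> agree n (rmem s 3) (\<lambda>_. 0) \<and> agree n (rmem s 5) (\<lambda>_. 0)" for s
    by (rule hoare_Seq'[OF hoare_projs b]) (use h in auto)
  show ?thesis unfolding prog_main_def by (rule hoare_Seq'[OF hoare_zero[OF s] c])
qed

definition prog_all :: com where
  "prog_all = (prog_consts ;; prog_vol ;; prog_rho) ;; prog_flips ;; prog_main"

lemma hoare_setup:
  assumes s: "ireg s 0 = n \<and> ireg s 2 = m \<and> ireg s 21 = 0 \<and> rreg s = (\<lambda>_. 0) \<and>
     (\<forall>e<m. imem s 0 e = ea e \<and> imem s 1 e = eb e \<and> rmem s 1 e = ew e) \<and> (\<forall>i<n. rmem s 0 i = mu i)"
  shows "hoare (prog_consts ;; prog_vol ;; prog_rho) s Rdy ((n * 88 + 250 + ((n * 44 + 3) + (n * (n_lev k n * 44 + 90) + 3) + 1) + 1) * op_cost U)"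
proof -
  have a: "hoare (prog_vol ;; prog_rho) s Rdy (((n * 44 + 3) + (n * (n_lev k n * 44 + 90) + 3) + 1) * op_cost U)" if "Con s \<and> rreg s 0 = 0" for s
    by (rule hoare_Seq'[OF hoare_vol]) (use that in \<open>auto intro: hoare_rho\<close>)
  show ?thesis by (rule hoare_Seq'[OF hoare_consts[OF s] a])
qed

lemma cost_all_ge:
  "(n * 88 + 250 + ((n * 44 + 3) + (n * (n_lev k n * 44 + 90) + 3) + 1) + 1) + 5 + n_coins k n * 6 +
    (n * 44 + 3 + (n_proj n * (cost_proj + 4) + 3 + ((40 + ((ceil_loglog n + (k + 1)) * 44 + 3) + 1) +
     ((40 + (n_lev k n * 44 + 3 + (n * 44 + 3) + 1) + 1 + 1) + (n * 240 + 400) + 1) + 1) + 1) + 1) \<le> cost_all"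
proof -
  define X where "X = n_proj n * n_proj n * n_lev k n * (n + m)"
  have G: "1 \<le> n_proj n" and L: "1 \<le> n_lev k n" by (auto simp: n_proj_def n_lev_def)
  have kk: "ceil_loglog n + (k + 1) \<le> 2 * n_lev k n" unfolding pow_level[symmetric] by (simp add: less_imp_le del: power_Suc)
  have mo: "a * b * c * d \<le> X" if "a \<le> n_proj n" "b \<le> n_proj n" "c \<le> n_lev k n" "d \<le> n + m" for a b c d
    unfolding X_def using that by (intro mult_mono) auto
  have "1 \<le> X" using mo[of 1 1 1 1] G L n2 by simp
  moreover have "n \<le> X" using mo[of 1 1 1 n] G L by simp
  moreover have "n_lev k n \<le> X" using mo[of 1 1 "n_lev k n" 1] G L n2 by simp
  moreover have "n_lev k n * n \<le> X" using mo[of 1 1 "n_lev k n" n] G L by simp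
  moreover have "n_proj n \<le> X" using mo[of 1 "n_proj n" 1 1] G L n2 by simp
  moreover have "n_proj n * n \<le> X" using mo[of 1 "n_proj n" 1 n] G L by simp
  moreover have "n_proj n * n_proj n \<le> X" using mo[of "n_proj n" "n_proj n" 1 1] G L n2 by simp
  moreover have "n_proj n * n_proj n * n \<le> X" "n_proj n * n_proj n * m \<le> X" using mo[of "n_proj n" "n_proj n" 1 n] mo[of "n_proj n" "n_proj n" 1 m] G L by auto
  ultimately show ?thesis using kk unfolding cost_all_def X_def[symmetric] cost_proj_def n_coins_def by (simp add: algebra_simps)
qed

lemma halts_all:
  assumes s: "ireg s 0 = n \<and> ireg s 2 = m \<and> ireg s 21 = 0 \<and> rreg s = (\<lambda>_. 0) \<and>
     (\<forall>e<m. imem s 0 e = ea e \<and> imem s 1 e = eb e \<and> rmem s 1 e = ew e) \<and> (\<forall>i<n. rmem s 0 i = mu i)"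
  shows "halts (\<lambda>s. {i. i < n \<and> imem s 4 i \<noteq> 0}) ([prog_all], s, 0) (map_pmf cut3 (rbits (n_coins k n))) (cost_all * op_cost U)"
proof -
  let ?out = "\<lambda>s. {i. i < n \<and> imem s 4 i \<noteq> 0}" and ?B = "cost_all * op_cost U" and ?Z = "map_pmf cut3 (rbits (n_coins k n))"
  define c1 where "c1 = n * 88 + 250 + ((n * 44 + 3) + (n * (n_lev k n * 44 + 90) + 3) + 1) + 1"
  define c3 where "c3 = n * 44 + 3 + (n_proj n * (cost_proj + 4) + 3 + ((40 + ((ceil_loglog n + (k + 1)) * 44 + 3) + 1) +
     ((40 + (n_lev k n * 44 + 3 + (n * 44 + 3) + 1) + 1 + 1) + (n * 240 + 400) + 1) + 1) + 1) + 1"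
  have cb: "c1 + 5 + n_coins k n * 6 + c3 \<le> cost_all" unfolding c1_def c3_def by (rule cost_all_ge)
  have om1: "3 \<le> op_cost U" by (simp add: op_cost_def)
  let ?W = "While (ILess 14 11) (Seq (Seq (Flip 16) (IStore 5 14 16)) (IOp IAdd 14 14 3))"
  have main: "halts ?out ([prog_main], s', t') (return_pmf (cut3 bs)) ?B"
    if e: "Env bs s'" and t': "t' \<le> (c1 + 5 + n_coins k n * 6) * op_cost U" for bs s' t'
  proof (rule hoare_main[OF e, folded c3_def, unfolded hoare_def, rule_format])
    fix s2 t2 assume o: "Out bs (cut3 bs) s2" and t2: "t2 \<le> t' + c3 * op_cost U"
    have "t2 \<le> (c1 + 5 + n_coins k n * 6 + c3) * op_cost U" using t' t2 by (simp add: algebra_simps)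
    also have "\<dots> \<le> ?B" using cb by (intro mult_right_mono) auto
    finally have "halts ?out ([], s2, t2) (return_pmf (?out s2)) ?B" by (rule halts_end)
    moreover have "?out s2 = cut3 bs" using o rmin_less[of n] by (auto simp: Out_def cut3_def cut2_def cut1_def split: if_splits)
    ultimately show "halts ?out ([], s2, t2) (return_pmf (cut3 bs)) ?B" by simp
  qed
  have "halts ?out ((prog_consts ;; prog_vol ;; prog_rho) # [prog_flips ;; prog_main], s, 1) ?Z ?B"
  proof (rule hoare_setup[OF s, folded c1_def, unfolded hoare_def, rule_format])
    fix s1 t1 assume r: "Rdy s1" and t1: "t1 \<le> 1 + c1 * op_cost U"
    let ?s = "s1\<lparr>ireg := (ireg s1)(14 := 0)\<rparr>"
    have "halts ?out (?W # [prog_main], ?s, t1 + 3) (bind_pmf (rbits (n_coins k n - 0)) (\<lambda>bs. return_pmf (cut3 ([] @ bs)))) ?B"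
    proof (rule flips_halts[where N = "n_coins k n" and U = U])
      show "ireg ?s 11 = n_coins k n" "ireg ?s 3 = 1" "ireg ?s 14 = 0" using r by (simp_all add: env2)
      show "n_coins k n \<le> U" "1 \<le> U" using U U1 by auto
      fix bs and s' :: mem and t'
      assume h: "\<forall>q<n_coins k n. imem s' 5 q = of_bool (bs ! q)" "\<forall>y. y \<noteq> 14 \<and> y \<noteq> 16 \<longrightarrow> ireg s' y = ireg ?s y"
        "rreg s' = rreg ?s" "rmem s' = rmem ?s" "\<forall>B. B \<noteq> 5 \<longrightarrow> imem s' B = imem ?s B" and t': "t' \<le> t1 + 3 + ((n_coins k n - 0) * (6 * op_cost U) + op_cost U)"
      have "Env bs s'" using r h by (simp add: env2)
      moreover have "t' \<le> (c1 + 5 + n_coins k n * 6) * op_cost U" using t' t1 om1 by (simp add: algebra_simps)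
      ultimately show "halts ?out ([prog_main], s', t') (return_pmf (cut3 bs)) ?B" by (rule main)
    qed auto
    then have "halts ?out (?W # [prog_main], ?s, t1 + 3) ?Z ?B" by (simp add: map_pmf_def)
    then have "halts ?out (IConst 14 0 # ?W # [prog_main], s1, t1 + 2) ?Z ?B" by (rule halts_det[rotated]) (simp add: bits_def floorlog_def)
    then have "halts ?out (prog_flips # [prog_main], s1, t1 + 1) ?Z ?B" unfolding prog_flips_def For_def by (rule halts_det[rotated]) simp
    then show "halts ?out ([prog_flips ;; prog_main], s1, t1) ?Z ?B" by (rule halts_det[rotated]) simp
  qed
  then show ?thesis unfolding prog_all_def by (rule halts_det[rotated]) simp
qed

lemma mv_cong: "agree n f g \<Longrightarrow> agree n (mv f) (mv g)"
  unfolding agree_def mv_def accu_def using ends by (auto intro!: sum.cong)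

lemma mv_pow_cong: "agree n f g \<Longrightarrow> agree n ((mv ^^ t) f) ((mv ^^ t) g)"
  by (induction t) (auto intro: mv_cong)

lemma mv_sum: "mv (\<lambda>i. \<Sum>l<(N::nat). c l * f l i) = (\<lambda>i. \<Sum>l<N. c l * mv (f l) i)"
proof (induction N)
  case 0
  have "accu (\<lambda>i. 0) m i = 0" for i unfolding accu_def by (rule sum.neutral) auto
  then show ?case by (simp add: mv_def fun_eq_iff)
next
  case (Suc N)
  have add: "mv (\<lambda>i. g i + a * h i) = (\<lambda>i. mv g i + a * mv h i)" for g h a
  proof
    fix i
    have "accu (\<lambda>i. g i + a * h i) m i = accu g m i + a * accu h m i"
      unfolding accu_def sum_distrib_left sum.distrib[symmetric] by (intro sum.cong refl) (simp add: algebra_simps)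
    then show "mv (\<lambda>i. g i + a * h i) i = mv g i + a * mv h i" by (simp add: mv_def algebra_simps add_divide_distrib)
  qed
  show ?case by (simp add: add Suc)
qed

lemma mv_pow_sum: "(mv ^^ t) (\<lambda>i. \<Sum>l<(N::nat). c l * f l i) = (\<lambda>i. \<Sum>l<N. c l * (mv ^^ t) (f l) i)"
  by (induction t) (simp_all add: mv_sum)

text \<open>The centred walk operator with scaled columns. The program never forms this matrix and
  meets it only through its projections.\<close>

definition wv :: "nat \<Rightarrow> nat \<Rightarrow> real" where
  "wv i l = ctr ((mv ^^ n_proj n) (\<lambda>j. if j = l then rho l else 0)) i"

text \<open>Linearity of walk and centring: run on a sign vector they give the signed sum of their
  values on the scaled basis vectors.\<close>

lemma uu_eq:
  assumes a: "a < n_proj n" and len: "n_proj n * n \<le> length bs" and i: "i < n"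
  shows "uu bs a i = rsum n (wv i) (blk n a bs)"
proof -
  have "a * n + n \<le> n_proj n * n" using a by (metis add.commute mult_Suc Suc_leI mult_le_mono1)
  then have b: "blk n a bs ! l = bs ! (a * n + l)" if "l < n" for l using that len by (simp add: blk_def)
  let ?e = "\<lambda>l j. if j = l then rho l else 0" and ?s = "\<lambda>l. sg (blk n a bs ! l)"
  have "agree n (u0 bs a) (\<lambda>j. \<Sum>l<n. ?s l * ?e l j)"
  proof (unfold agree_def, intro allI impI)
    fix j assume j: "j < n"
    have "(\<Sum>l<n. ?s l * ?e l j) = (\<Sum>l<n. if l = j then ?s j * rho j else 0)" by (intro sum.cong) auto
    also have "\<dots> = ?s j * rho j" using j by simp
    finally show "u0 bs a j = (\<Sum>l<n. ?s l * ?e l j)" using j by (simp add: u0_def b sg_def)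
  qed
  from mv_pow_cong[OF this, of "n_proj n"] have A: "(mv ^^ n_proj n) (u0 bs a) j = (\<Sum>l<n. ?s l * (mv ^^ n_proj n) (?e l) j)" if "j < n" for j
    using that unfolding mv_pow_sum by (simp add: agree_def)
  have "(\<Sum>j<n. mu j * (mv ^^ n_proj n) (u0 bs a) j) = (\<Sum>j<n. \<Sum>l<n. ?s l * (mu j * (mv ^^ n_proj n) (?e l) j))"
    by (intro sum.cong refl) (simp add: A sum_distrib_left algebra_simps)
  also have "\<dots> = (\<Sum>l<n. ?s l * (\<Sum>j<n. mu j * (mv ^^ n_proj n) (?e l) j))"
    by (subst sum.swap) (simp add: sum_distrib_left)
  finally have B: "(\<Sum>j<n. mu j * (mv ^^ n_proj n) (u0 bs a) j) = (\<Sum>l<n. ?s l * (\<Sum>j<n. mu j * (mv ^^ n_proj n) (?e l) j))" .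
  define g where "g l = (\<Sum>j<n. mu j * (mv ^^ n_proj n) (?e l) j)" for l
  have "uu bs a i = (\<Sum>l<n. ?s l * ((mv ^^ n_proj n) (?e l) i - g l / tot))"
    unfolding uu_def ctr_def A[OF i] B g_def[symmetric] by (simp add: right_diff_distrib sum_subtractf sum_divide_distrib)
  then show ?thesis by (simp add: rsum_def wv_def ctr_def g_def mult.commute)
qed

lemma cut3_eq:
  assumes mu: "\<And>i. i < n \<Longrightarrow> mu i = real (\<mu> i)" and len: "n_proj n * n \<le> length bs"
  shows "cut3 bs = round_cut n \<mu> (n_lev k n) (n_proj n) wv (lev bs) bs"
proof -
  have G: "n_proj n - 1 < n_proj n" by (simp add: n_proj_def)
  have t: "tot = vol \<mu> {..<n}" unfolding tot_def vol_def by (intro sum.cong) (auto simp: mu)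
  have tc: "thr_cut n \<mu> c sc = {i. i < n \<and> \<not> sc' i < c * (\<Sum>j<n. mu j * \<bar>sc' j\<bar>) / tot}"
    if "\<And>i. i < n \<Longrightarrow> sc i = sc' i" for c sc sc'
  proof -
    have "(\<Sum>j<n. real (\<mu> j) * \<bar>sc j\<bar>) = (\<Sum>j<n. mu j * \<bar>sc' j\<bar>)" by (intro sum.cong) (auto simp: mu that)
    then show ?thesis unfolding thr_cut_def t by (auto simp: that)
  qed
  have nn: "NN bs (n_proj n) i = sq_sum n (n_proj n) (wv i) bs" if "i < n" for i
    unfolding NN_def sq_sum_def using uu_eq[OF _ len that] by (intro sum.cong) (auto simp: power2_eq_square)
  have c1: "(if lev bs < n_lev k n then thr_cut n \<mu> (real (lev bs) / real (n_lev k n)) (\<lambda>i. rsum n (wv i) (blk n (n_proj n - 1) bs))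
      else thr_cut n \<mu> (2 ^ (lev bs - n_lev k n + 1)) (\<lambda>i. sq_sum n (n_proj n) (wv i) bs)) = cut1 bs"
    unfolding cut1_def thr_def score_def coef_def using tc[of "\<lambda>i. rsum n (wv i) (blk n (n_proj n - 1) bs)" "uu bs (n_proj n - 1)"]
      tc[of "\<lambda>i. sq_sum n (n_proj n) (wv i) bs" "NN bs (n_proj n)"] uu_eq[OF G len] nn by simp
  have v: "mvol S = vol \<mu> S" if "S \<subseteq> {..<n}" for S
  proof -
    have "mvol S = (\<Sum>i\<in>{..<n} \<inter> S. mu i)" unfolding mvol_def by (simp add: sum.inter_restrict)
    also have "\<dots> = vol \<mu> S" unfolding vol_def using that by (intro sum.cong) (auto simp: mu)
    finally show ?thesis .
  qed
  have "rmin j = amin \<mu> j" if "j \<le> n" for j using that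
  proof (induction j)
    case (Suc j)
    have "amin \<mu> j < n" using Suc rmin_less[of j] by auto
    then show ?case using Suc by (simp add: mu)
  qed simp
  then have r: "rmin n = amin \<mu> n" by simp
  have s: "cut1 bs \<subseteq> {..<n}" by (auto simp: cut1_def)
  show ?thesis unfolding round_cut_def c1 fix_cut_def cut3_def cut2_def Let_def v[OF s] t r by simp
qed

end


section \<open>The strategy as a function of the union of the matchings\<close>

definition wop :: "nat \<Rightarrow> (nat \<Rightarrow> nat) \<Rightarrow> nat wgraph \<Rightarrow> (nat \<Rightarrow> real) \<Rightarrow> nat \<Rightarrow> real" where
  "wop n \<mu> H u i = u i - 1 / real (64 * n_proj n) * ((\<Sum>j<n. H i j * (u i - u j)) / real (\<mu> i))"

definition rhoF :: "nat \<Rightarrow> nat \<Rightarrow> (nat \<Rightarrow> nat) \<Rightarrow> nat \<Rightarrow> real" where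
  "rhoF k n \<mu> i = ((\<lambda>r. if r * r * real (\<mu> i) * 4 < vol \<mu> {..<n} then r + r else r) ^^ n_lev k n) 1"

definition wF :: "nat \<Rightarrow> nat \<Rightarrow> (nat \<Rightarrow> nat) \<Rightarrow> nat wgraph \<Rightarrow> nat \<Rightarrow> nat \<Rightarrow> real" where
  "wF k n \<mu> H i l = (wop n \<mu> H ^^ n_proj n) (\<lambda>j. if j = l then rhoF k n \<mu> l else 0) i
     - (\<Sum>j<n. real (\<mu> j) * (wop n \<mu> H ^^ n_proj n) (\<lambda>j. if j = l then rhoF k n \<mu> l else 0) j) / vol \<mu> {..<n}"

definition levF :: "nat \<Rightarrow> nat \<Rightarrow> bool list \<Rightarrow> nat" where
  "levF k n bs = horner bs (n_proj n * n) (ceil_loglog n + (k + 1))"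

definition roundF :: "nat \<Rightarrow> nat \<Rightarrow> (nat \<Rightarrow> nat) \<Rightarrow> nat wgraph \<Rightarrow> bool list \<Rightarrow> nat set" where
  "roundF k n \<mu> H bs = round_cut n \<mu> (n_lev k n) (n_proj n) (wF k n \<mu> H) (levF k n bs) bs"

text \<open>Free of the machine, so that the analysis does not see any memory. Of the history only
  the union of the matchings enters, \<epsilon> does not occur, and one string of coins is all the
  randomness of a round.\<close>

definition walk_cut_strategy :: "nat \<Rightarrow> cut_strategy" where
  "walk_cut_strategy k n \<mu> h = map_pmf (roundF k n \<mu> (edge_sum h)) (rbits (n_coins k n))"

lemma sum_list_concat_map: "(\<Sum>x\<leftarrow>concat (map f xs). (\<phi> x :: real)) = (\<Sum>x\<leftarrow>xs. \<Sum>y\<leftarrow>f x. \<phi> y)"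
  by (induction xs) auto

text \<open>The list holds each edge once, smaller end first. The two conditional terms restore the
  symmetric sum, as \<open>i\<close> is the smaller end of some of its edges and the larger end of
  the others.\<close>

lemma edge_list_sum:
  assumes D: "weighted_graph {..<n} D" and i: "i < n"
  shows "(\<Sum>(a, b, w)\<leftarrow>edge_list n D. (if i = a then w * (u a - u b) else 0) - (if i = b then w * (u a - u b) else 0)) =
    (\<Sum>j<n. D i j * (u i - u j :: real))"
proof -
  let ?\<phi> = "\<lambda>(a, b, w). (if i = a then w * (u a - u b) else 0) - (if i = b then w * (u a - u b) else 0)"
  have sym: "D a b = D b a" for a b using D by (simp add: weighted_graph_def)
  have "(\<Sum>x\<leftarrow>edge_list n D. ?\<phi> x) = (\<Sum>a<n. \<Sum>b<n. if a < b \<and> D a b \<noteq> 0 then ?\<phi> (a, b, D a b) else 0)"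
    unfolding edge_list_def sum_list_concat_map
    by (simp add: sum_list_map_filter' interv_sum_list_conv_sum_set_nat comp_def atLeast0LessThan cong: if_cong)
  also have "\<dots> = (\<Sum>a<n. \<Sum>b<n. (if i = a then (if i < b then D i b * (u i - u b) else 0) else 0)) +
      (\<Sum>a<n. \<Sum>b<n. (if i = b then (if a < i then D i a * (u i - u a) else 0) else 0))"
    unfolding sum.distrib[symmetric] by (intro sum.cong refl) (auto simp: sym algebra_simps)
  also have "(\<Sum>a<n. \<Sum>b<n. (if i = a then (if i < b then D i b * (u i - u b) else 0) else 0)) = (\<Sum>b<n. if i < b then D i b * (u i - u b) else 0)"
    by (subst sum.swap) (use i in \<open>simp add: sum.delta\<close>)
  also have "(\<Sum>a<n. \<Sum>b<n. (if i = b then (if a < i then D i a * (u i - u a) else 0) else 0)) = (\<Sum>a<n. if a < i then D i a * (u i - u a) else 0)"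
    using i by (simp add: sum.delta)
  also have "(\<Sum>b<n. if i < b then D i b * (u i - u b) else 0) + (\<Sum>a<n. if a < i then D i a * (u i - u a) else 0) = (\<Sum>j<n. D i j * (u i - u j))"
    unfolding sum.distrib[symmetric] by (intro sum.cong refl) auto
  finally show ?thesis .
qed

lemma all_edges_sum:
  assumes D: "\<forall>(S, D)\<in>set h. weighted_graph {..<n} D" and i: "i < n"
  shows "(\<Sum>(a, b, w)\<leftarrow>all_edges n h. (if i = a then w * (u a - u b) else 0) - (if i = b then w * (u a - u b) else 0)) =
    (\<Sum>j<n. edge_sum h i j * (u i - u j :: real))"
  using D
proof (induction h)
  case (Cons x h)
  obtain S D where x: "x = (S, D)" by (cases x) auto
  have "all_edges n (x # h) = edge_list n D @ all_edges n h" by (simp add: all_edges_def x)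
  moreover have "edge_sum (x # h) i j = D i j + edge_sum h i j" for j by (simp add: edge_sum_def x)
  ultimately show ?case using Cons x edge_list_sum[of n D i u] i by (simp add: distrib_right sum.distrib)
qed (simp add: all_edges_def edge_sum_def)

lemma set_all_edges: "(a, b, w) \<in> set (all_edges n h) \<Longrightarrow> a < b \<and> b < n"
  by (auto simp: all_edges_def edge_list_def)

lemma length_all_edges: "length (all_edges n h) \<le> length h * (n * n)"
proof (induction h)
  case (Cons x h)
  have "length (edge_list n D) \<le> n * n" for D
  proof -
    have "length (edge_list n D) \<le> (\<Sum>i\<leftarrow>[0..<n]. n)"
      unfolding edge_list_def length_concat map_map comp_def length_map
      by (intro sum_list_mono) (simp add: length_filter_le order_trans[OF length_filter_le])
    then show ?thesis by (simp add: sum_list_triv)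
  qed
  then show ?case using Cons by (cases x) (simp add: all_edges_def add_mono)
qed (simp add: all_edges_def)

text \<open>The sum of everything that the locale \<open>machine\<close> requires \<open>U\<close>
  to dominate.\<close>

definition bigU :: "nat \<Rightarrow> nat \<Rightarrow> nat \<Rightarrow> nat" where
  "bigU k n m = 2 * n + m + n_coins k n + 64 * n_proj n + 2 * n_lev k n + 2 ^ k + (k + 1)"

lemma outputs_strategy:
  assumes n: "2 \<le> n" and D: "\<forall>(S, D)\<in>set h. weighted_graph {..<n} D" and m: "m = length (all_edges n h)"
  shows "outputs_within (machine.prog_all k) n \<mu> h (walk_cut_strategy k n \<mu> h)
    (real (3000 * (n_proj n * n_proj n * n_lev k n * (n + m)) * op_cost (bigU k n m)))"
proof -
  define E where "E = all_edges n h"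
  define mu where "mu = (\<lambda>i. if i < n then real (\<mu> i) else 0)"
  define ea where "ea e = (if e < m then fst (E ! e) else 0)" for e
  define eb where "eb e = (if e < m then fst (snd (E ! e)) else 0)" for e
  define ew where "ew e = (if e < m then snd (snd (E ! e)) else 0)" for e
  interpret machine k n m "bigU k n m" mu ea eb ew
  proof
    fix e assume e: "e < m"
    then have "(ea e, eb e, ew e) \<in> set E" using m by (simp add: E_def ea_def eb_def ew_def)
    then show "ea e < n \<and> eb e < n \<and> ea e \<noteq> eb e" using set_all_edges[of "ea e" "eb e" "ew e" n h] by (auto simp: E_def)
  qed (use n in \<open>auto simp: bigU_def\<close>)
  let ?s = "input_mem n \<mu> h"
  have "halts (\<lambda>s. {i. i < n \<and> imem s 4 i \<noteq> 0}) ([prog_all], ?s, 0) (map_pmf cut3 (rbits (n_coins k n))) (cost_all * op_cost (bigU k n m))"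
    by (rule halts_all) (auto simp: input_mem_def Let_def E_def[symmetric] m[folded E_def, symmetric] ea_def eb_def ew_def mu_def)
  moreover have "map_pmf cut3 (rbits (n_coins k n)) = walk_cut_strategy k n \<mu> h"
    unfolding walk_cut_strategy_def
  proof (rule map_pmf_cong[OF refl])
    fix bs assume "bs \<in> set_pmf (rbits (n_coins k n))"
    then have len: "n_proj n * n \<le> length bs" using set_rbits[of bs "n_coins k n"] by (simp add: n_coins_def)
    have t: "tot = vol \<mu> {..<n}" unfolding tot_def vol_def by (intro sum.cong) (auto simp: mu_def)
    have mui: "mu i = real (\<mu> i)" if "i < n" for i using that by (simp add: mu_def)
    have r: "rho l = rhoF k n \<mu> l" if "l < n" for l using that by (simp add: rho_def rhoF_def t mui)
    have acc: "accu u m i = (\<Sum>j<n. edge_sum h i j * (u i - u j))" if i: "i < n" for u i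
    proof -
      let ?\<phi> = "\<lambda>(a, b, w). (if i = a then w * (u a - u b) else 0) - (if i = b then w * (u a - u b) else 0)"
      have "accu u m i = (\<Sum>e<m. ?\<phi> (E ! e))" unfolding accu_def by (intro sum.cong refl) (simp add: ea_def eb_def ew_def split_beta)
      also have "\<dots> = (\<Sum>x\<leftarrow>E. ?\<phi> x)" using m by (simp add: sum_list_sum_nth E_def atLeast0LessThan)
      finally show ?thesis using all_edges_sum[OF D i, of u] by (simp add: E_def)
    qed
    have mvw: "agree n (mv u) (wop n \<mu> (edge_sum h) u)" for u
      by (simp add: agree_def mv_def wop_def acc mui beta_def)
    have wcong: "agree n u v \<Longrightarrow> agree n (wop n \<mu> (edge_sum h) u) (wop n \<mu> (edge_sum h) v)" for u v
      by (simp add: agree_def wop_def)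
    have pw: "agree n ((mv ^^ t) u) ((wop n \<mu> (edge_sum h) ^^ t) u)" for t u
    proof (induction t)
      case (Suc t)
      show ?case using mvw[of "(mv ^^ t) u"] wcong[OF Suc] by (simp add: agree_def)
    qed (simp add: agree_def)
    have w: "wv i l = wF k n \<mu> (edge_sum h) i l" if "i < n" "l < n" for i l
      using that pw[of "n_proj n" "\<lambda>j. if j = l then rho l else 0"]
      by (simp add: wv_def wF_def ctr_def t agree_def r mui cong: if_cong)
    have ruw: "rsum n (wv i) x = rsum n (wF k n \<mu> (edge_sum h) i) x" if "i < n" for i x
      unfolding rsum_def by (intro sum.cong refl) (simp add: w that)
    have tc: "thr_cut n \<mu> c sc = thr_cut n \<mu> c sc'" if "\<And>i. i < n \<Longrightarrow> sc i = sc' i" for c sc sc'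
      unfolding thr_cut_def using that by (auto intro!: sum.cong)
    have "thr_cut n \<mu> c (\<lambda>i. rsum n (wv i) x) = thr_cut n \<mu> c (\<lambda>i. rsum n (wF k n \<mu> (edge_sum h) i) x)"
      "thr_cut n \<mu> c (\<lambda>i. sq_sum n K (wv i) x) = thr_cut n \<mu> c (\<lambda>i. sq_sum n K (wF k n \<mu> (edge_sum h) i) x)" for c x K
      by (intro tc; simp add: ruw sq_sum_def)+
    then show "cut3 bs = roundF k n \<mu> (edge_sum h) bs"
      unfolding roundF_def levF_def lev_def[symmetric] using cut3_eq[of \<mu> bs] len by (simp add: round_cut_def mui)
  qed
  ultimately have "halts (\<lambda>s. {i. i < n \<and> imem s 4 i \<noteq> 0}) ([prog_all], ?s, 0) (walk_cut_strategy k n \<mu> h) (cost_all * op_cost (bigU k n m))" by simp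
  then obtain r where r: "\<forall>c'\<in>set_pmf (run r ([prog_all], ?s, 0)). fst c' = [] \<and> snd (snd c') \<le> cost_all * op_cost (bigU k n m)"
    "map_pmf (\<lambda>c'. (\<lambda>s. {i. i < n \<and> imem s 4 i \<noteq> 0}) (fst (snd c'))) (run r ([prog_all], ?s, 0)) = walk_cut_strategy k n \<mu> h"
    unfolding halts_def by blast
  have o: "output_cut n = (\<lambda>c'. (\<lambda>s. {i. i < n \<and> imem s 4 i \<noteq> 0}) (fst (snd c')))" by (auto simp: output_cut_def fun_eq_iff)
  show ?thesis unfolding outputs_within_def Let_def o
  proof (rule exI[of _ r], intro conjI ballI)
    fix c' assume c': "c' \<in> set_pmf (run r ([prog_all], input_mem n \<mu> h, 0))"
    obtain cs s t where c: "c' = (cs, s, t)" by (cases c') auto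
    have "cs = []" "t \<le> cost_all * op_cost (bigU k n m)" using r(1) c' c by auto
    then have "real t \<le> real (cost_all * op_cost (bigU k n m))" by (simp only: of_nat_le_iff)
    then show "case c' of (cs, s, t) \<Rightarrow> cs = [] \<and> real t \<le> real (3000 * (n_proj n * n_proj n * n_lev k n * (n + m)) * op_cost (bigU k n m))"
      using \<open>cs = []\<close> unfolding c cost_all_def by simp
  qed (rule r(2))
qed


section \<open>Numerical bounds for the parameters and the running time\<close>

lemma ceil_log_bounds:
  assumes n: "2 \<le> n"
  shows "1 \<le> ceil_log n" "ln (real n) \<le> real (ceil_log n)" "real (ceil_log n) \<le> 3 * ln (real n)" "1 / 2 \<le> ln (real n)"
proof -
  have l2: "2 / 3 \<le> ln (2::real)" "ln (2::real) \<le> 1" using ln2_ge_two_thirds ln_le_minus_one[of "2::real"] by auto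
  have "ln 2 \<le> ln (real n)" using n by simp
  then show "1 / 2 \<le> ln (real n)" using l2 by simp
  show "1 \<le> ceil_log n" using ceil_log_le_iff[of n 0] n by (cases "ceil_log n") auto
  have "n \<le> 2 ^ ceil_log n" using ceil_log_le_iff by blast
  then have "real n \<le> 2 ^ ceil_log n" by (metis of_nat_le_iff of_nat_numeral of_nat_power)
  then have "ln (real n) \<le> ln (2 ^ ceil_log n)" using n by (subst ln_le_cancel_iff) auto
  also have "\<dots> = real (ceil_log n) * ln 2" by (simp add: ln_realpow)
  also have "\<dots> \<le> real (ceil_log n) * 1" using l2 by (intro mult_left_mono) auto
  finally show "ln (real n) \<le> real (ceil_log n)" by simp
  have "2 ^ ceil_log n < 2 * n" by (rule pow_ceil_log_less[OF n])
  then have "2 ^ ceil_log n < 2 * real n" by (metis of_nat_less_iff of_nat_mult of_nat_numeral of_nat_power)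
  then have "ln (2 ^ ceil_log n) < ln (2 * real n)" using n by (subst ln_less_cancel_iff) auto
  then have "real (ceil_log n) * ln 2 \<le> ln 2 + ln (real n)" using n by (simp add: ln_realpow ln_mult)
  also have "\<dots> \<le> 2 * ln (real n)" using \<open>ln 2 \<le> ln (real n)\<close> by simp
  finally have "real (ceil_log n) * (2 / 3) \<le> 2 * ln (real n)" using mult_left_mono[OF l2(1), of "real (ceil_log n)"] by simp
  then show "real (ceil_log n) \<le> 3 * ln (real n)" by simp
qed

lemma ceil_loglog_bounds:
  assumes n: "2 \<le> n"
  shows "ceil_log n \<le> 2 ^ ceil_loglog n" "2 ^ ceil_loglog n \<le> 2 * ceil_log n"
proof -
  show "ceil_log n \<le> 2 ^ ceil_loglog n" using ceil_log_le_iff[of "ceil_log n" "ceil_loglog n"] by (simp add: ceil_loglog_def)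
  show "2 ^ ceil_loglog n \<le> 2 * ceil_log n"
  proof (cases "2 \<le> ceil_log n")
    case True
    then show ?thesis using pow_ceil_log_less[of "ceil_log n"] by (simp add: ceil_loglog_def)
  next
    case False
    then have "ceil_log n = 1" using ceil_log_bounds(1)[OF n] by simp
    moreover have "ceil_log 1 = 0" using ceil_log_le_iff[of 1 0] by simp
    ultimately show ?thesis by (simp add: ceil_loglog_def)
  qed
qed

lemma pow_ceil_loglog_ln:
  assumes n: "2 \<le> n"
  shows "ln (real n) \<le> 2 ^ ceil_loglog n" "2 ^ ceil_loglog n \<le> 6 * ln (real n)"
proof -
  have a: "real (ceil_log n) \<le> 2 ^ ceil_loglog n" using ceil_loglog_bounds(1)[OF n] by (metis of_nat_le_iff of_nat_numeral of_nat_power)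
  have b: "2 ^ ceil_loglog n \<le> 2 * real (ceil_log n)" using ceil_loglog_bounds(2)[OF n] by (metis of_nat_le_iff of_nat_numeral of_nat_power of_nat_mult)
  show "ln (real n) \<le> 2 ^ ceil_loglog n" using a ceil_log_bounds(2)[OF n] by linarith
  show "2 ^ ceil_loglog n \<le> 6 * ln (real n)" using b ceil_log_bounds(3)[OF n] by simp
qed

text \<open>All integers are polynomial in \<open>n\<close>, so bit lengths cost only a factor ln n
  (\<open>op_cost_le\<close>). The fourth power allows for order n^2 edges in each of order n^2
  rounds.\<close>

lemma bigU_le:
  assumes n: "2 \<le> n" and m: "real m \<le> a * real n ^ 4" and a: "0 \<le> a"
  shows "real (bigU k n m) \<le> (600 + a + 5 * 2 ^ k + 2 * real (k + 1)) * real n ^ 4"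
proof -
  have n1: "1 \<le> real n" using n by simp
  have p: "1 \<le> real n ^ 4" "real n \<le> real n ^ 4" "real n ^ 3 \<le> real n ^ 4"
    using n1 power_increasing[of 1 4 "real n"] power_increasing[of 3 4 "real n"] by auto
  have "2 ^ ceil_loglog n \<le> 2 * n" using ceil_loglog_bounds(2)[OF n] ceil_log_le_self[of n] by simp
  then have q: "2 ^ ceil_loglog n \<le> 2 * real n" by (metis of_nat_le_iff of_nat_numeral of_nat_power of_nat_mult)
  have "real (n_proj n) = (2 ^ ceil_loglog n) ^ 3" by (simp add: n_proj_def)
  also have "\<dots> \<le> (2 * real n) ^ 3" using q by (intro power_mono) auto
  finally have G: "real (n_proj n) \<le> 8 * real n ^ 3" by (simp add: power_mult_distrib)
  have "real (n_proj n) * real n \<le> 8 * real n ^ 3 * real n" using G by (intro mult_right_mono) auto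
  then have n_proj: "real (n_proj n) * real n \<le> 8 * real n ^ 4" by (simp add: power_numeral_reduce)
  have "ceil_loglog n \<le> n" using ceil_log_le_self[of n] ceil_log_le_self[of "ceil_log n"] by (simp add: ceil_loglog_def)
  then have kn: "real (ceil_loglog n) \<le> real n ^ 4" using p by linarith
  have "real (n_lev k n) = 2 ^ k * 2 ^ ceil_loglog n" by (simp add: n_lev_def)
  also have "\<dots> \<le> 2 ^ k * (2 * real n ^ 4)" using p(2) by (intro mult_left_mono order_trans[OF q]) auto
  finally have L: "real (n_lev k n) \<le> 2 ^ k * (2 * real n ^ 4)" .
  have k1: "2 ^ k \<le> 2 ^ k * real n ^ 4" "real (k + 1) \<le> real (k + 1) * real n ^ 4"
    using mult_left_mono[OF p(1), of "2 ^ k"] mult_left_mono[OF p(1), of "real (k + 1)"] by simp_all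
  have "real (bigU k n m) = 2 * real n + real m + (real (n_proj n) * real n + (real (ceil_loglog n) + real (k + 1))) + 64 * real (n_proj n) + 2 * real (n_lev k n) + 2 ^ k + real (k + 1)"
    by (simp add: bigU_def n_coins_def)
  also have "\<dots> \<le> 2 * real n ^ 4 + a * real n ^ 4 + (8 * real n ^ 4 + (real n ^ 4 + real (k + 1) * real n ^ 4)) + 512 * real n ^ 4 + 2 * (2 ^ k * (2 * real n ^ 4)) + 2 ^ k * real n ^ 4 + real (k + 1) * real n ^ 4"
    by (intro add_mono) ((rule k1 | use p m n_proj kn L G in linarith)+)
  also have "\<dots> \<le> (600 + a + 5 * 2 ^ k + 2 * real (k + 1)) * real n ^ 4" by (simp add: algebra_simps)
  finally show ?thesis .
qed

lemma op_cost_le: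
  assumes n: "2 \<le> n" and U: "0 < U" "real U \<le> A * real n ^ 4" "1 \<le> A"
  shows "real (op_cost U) \<le> (26 + 4 * log 2 A) * ln (real n)"
proof -
  have l: "1 / 2 \<le> ln (real n)" by (rule ceil_log_bounds(4)[OF n])
  have lA: "0 \<le> log 2 A" using U by (simp add: zero_le_log_cancel_iff)
  have A2: "(10 + 4 * log 2 A) * (1 / 2) \<le> (10 + 4 * log 2 A) * ln (real n)" using lA by (intro mult_left_mono l) simp
  have "real (bits U) \<le> log 2 (real U) + 1"
    using U(1) unfolding bits_def floorlog_def by (simp add: of_nat_nat zero_le_log_cancel_iff)
  also have "log 2 (real U) \<le> log 2 (A * real n ^ 4)" using U by (subst log_le_cancel_iff) (auto intro: mult_pos_pos)
  also have "\<dots> = log 2 A + 4 * log 2 (real n)" using U n by (simp add: log_mult log_nat_power)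
  also have "log 2 (real n) \<le> 3 / 2 * ln (real n)"
    using ln2_ge_two_thirds l mult_left_mono[of "2 / 3" "ln (2::real)" "ln (real n)"] by (simp add: log_def field_simps)
  finally have "real (bits U) \<le> log 2 A + 4 * (3 / 2 * ln (real n)) + 1" by simp
  then have "real (op_cost U) \<le> 5 + 2 * log 2 A + 12 * ln (real n)" by (simp add: op_cost_def)
  also have "5 + 2 * log 2 A = (10 + 4 * log 2 A) * (1 / 2)" by simp
  also note A2
  finally have "real (op_cost U) \<le> (10 + 4 * log 2 A) * ln (real n) + 12 * ln (real n)" by simp
  also have "\<dots> \<le> (26 + 4 * log 2 A) * ln (real n)" using l by (simp add: algebra_simps)
  finally show ?thesis .
qed

lemma outputs_within_mono: "outputs_within P n \<mu> h X B \<Longrightarrow> B \<le> B' \<Longrightarrow> outputs_within P n \<mu> h X B'"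
  unfolding outputs_within_def Let_def by (fastforce intro: order_trans)

lemma nearly_linear_strategy:
  assumes g: "\<And>n \<epsilon>. 2 \<le> n \<Longrightarrow> 0 < \<epsilon> \<Longrightarrow> \<epsilon> < 1 \<Longrightarrow> real (g n \<epsilon>) \<le> c * (ln (real n))\<^sup>2 / (1 - \<epsilon>)" and c: "0 \<le> c"
  shows "nearly_linear_time k g (walk_cut_strategy k)"
  unfolding nearly_linear_time_def
\<comment> \<open>The exponent 8 is 3 + 3 + 1 for \<open>n_proj n * n_proj n * n_lev k n\<close> and
  one more for the bit lengths.\<close>
proof (rule exI[of _ "machine.prog_all k"], rule exI[of _ 8], intro allI impI)
  fix \<epsilon> :: real assume e: "0 < \<epsilon> \<and> \<epsilon> < 1"
  define a where "a = c / (1 - \<epsilon>)"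
  define A where "A = 600 + a + 5 * 2 ^ k + 2 * real (k + 1)"
  define K where "K = 3000 * 2 ^ k * 6 ^ 7 * (26 + 4 * log 2 A)"
  have a0: "0 \<le> a" using c e by (simp add: a_def)
  have A1: "1 \<le> A" using a0 by (simp add: A_def)
  show "\<exists>K. \<forall>n\<ge>2. \<forall>\<mu> h. balanced_weighting k n \<mu> \<and> legal_history {..<n} \<mu> \<epsilon> h \<and> length h < g n \<epsilon> \<longrightarrow>
        outputs_within (machine.prog_all k) n \<mu> h (walk_cut_strategy k n \<mu> h) (K * real (n + length (all_edges n h)) * ln (real n) ^ 8)"
  proof (intro exI[of _ K] allI impI)
    fix n \<mu> h assume n: "2 \<le> (n::nat)" and h: "balanced_weighting k n \<mu> \<and> legal_history {..<n} \<mu> \<epsilon> h \<and> length h < g n \<epsilon>"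
    define m where "m = length (all_edges n h)"
    have l: "1 / 2 \<le> ln (real n)" "ln (real n) \<le> real n" using ceil_log_bounds(4)[OF n] ln_le_minus_one[of "real n"] n by auto
    have "real (length h) \<le> c * (ln (real n))\<^sup>2 / (1 - \<epsilon>)" using h g[OF n] e by fastforce
    also have "\<dots> = a * (ln (real n))\<^sup>2" by (simp add: a_def)
    also have "\<dots> \<le> a * (real n)\<^sup>2" using a0 l by (intro mult_left_mono power_mono) auto
    finally have lh: "real (length h) \<le> a * (real n)\<^sup>2" .
    have "real m \<le> real (length h) * (real n)\<^sup>2"
      using length_all_edges[of n h] unfolding m_def power2_eq_square by (metis of_nat_le_iff of_nat_mult)
    also have "\<dots> \<le> a * (real n)\<^sup>2 * (real n)\<^sup>2" using lh by (intro mult_right_mono) auto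
    finally have m: "real m \<le> a * real n ^ 4" by (simp add: power2_eq_square power4_eq_xxxx mult.assoc)
    have U: "real (op_cost (bigU k n m)) \<le> (26 + 4 * log 2 A) * ln (real n)"
      by (rule op_cost_le[OF n _ bigU_le[OF n m a0, of k, folded A_def] A1]) (simp add: bigU_def)
    have q: "2 ^ ceil_loglog n \<le> 6 * ln (real n)" by (rule pow_ceil_loglog_ln[OF n])
    have "real (n_proj n * n_proj n * n_lev k n) = 2 ^ k * (2 ^ ceil_loglog n) ^ 7" by (simp add: n_proj_def n_lev_def power_add[symmetric] flip: power_Suc2 power_mult)
    also have "\<dots> \<le> 2 ^ k * (6 * ln (real n)) ^ 7" using q by (intro mult_left_mono power_mono) auto
    finally have GL: "real (n_proj n * n_proj n * n_lev k n) \<le> 2 ^ k * 6 ^ 7 * ln (real n) ^ 7" by (simp add: power_mult_distrib)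
    have lA: "0 \<le> log 2 A" using A1 by (simp add: zero_le_log_cancel_iff)
    have "real (n_proj n * n_proj n * n_lev k n) * real (op_cost (bigU k n m)) \<le> (2 ^ k * 6 ^ 7 * ln (real n) ^ 7) * ((26 + 4 * log 2 A) * ln (real n))"
      using l by (intro mult_mono GL U) auto
    also have "\<dots> = 2 ^ k * 6 ^ 7 * (26 + 4 * log 2 A) * ln (real n) ^ 8" by (simp add: power_numeral_reduce)
    finally have "3000 * real (n + m) * (real (n_proj n * n_proj n * n_lev k n) * real (op_cost (bigU k n m))) \<le> 3000 * real (n + m) * (2 ^ k * 6 ^ 7 * (26 + 4 * log 2 A) * ln (real n) ^ 8)"
      by (rule mult_left_mono) simp
    then have B: "real (3000 * (n_proj n * n_proj n * n_lev k n * (n + m)) * op_cost (bigU k n m)) \<le> K * real (n + length (all_edges n h)) * ln (real n) ^ 8"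
      unfolding K_def m_def[symmetric] of_nat_mult by (simp only: of_nat_numeral mult_ac)
    have "\<forall>(S, D)\<in>set h. weighted_graph {..<n} D" using h by (auto simp: legal_history_def matching_action_def)
    from outputs_within_mono[OF outputs_strategy[OF n this m_def] B]
    show "outputs_within (machine.prog_all k) n \<mu> h (walk_cut_strategy k n \<mu> h) (K * real (n + length (all_edges n h)) * ln (real n) ^ 8)" .
  qed
qed


section \<open>Expected decrease of the potential\<close>

lemma sum_even_odd: "(\<Sum>l<2 * N. f l :: real) = (\<Sum>l<(N::nat). f (2 * l) + f (2 * l + 1))"
  by (induction N) (auto simp: algebra_simps)

lemma horner_cong: "(\<And>q. q < p + j \<Longrightarrow> bs ! q = cs ! q) \<Longrightarrow> horner bs p j = horner cs p j"
  by (induction j) auto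

text \<open>A number read from fair bits is uniform. The most significant bit comes first, so the
  induction peels off the last bit, which extends a shorter number to an even or an odd one.\<close>

lemma coin_avg_horner: "coin_avg J (\<lambda>y. f (horner (x @ y) (length x) J)) = (\<Sum>l<2 ^ J. f l) / 2 ^ J"
proof (induction J arbitrary: f)
  case (Suc J)
  have h: "horner (x @ y @ z) (length x) J = horner (x @ y) (length x) J" if "length y = J" for y z
    by (rule horner_cong) (use that in \<open>auto simp: nth_append\<close>)
  have "coin_avg (J + 1) (\<lambda>y. f (horner (x @ y) (length x) (Suc J))) =
      coin_avg J (\<lambda>y. (f (2 * horner (x @ y) (length x) J) + f (2 * horner (x @ y) (length x) J + 1)) / 2)"
    unfolding coin_avg_append by (intro coin_avg_cong) (simp add: h coin_avg_Suc nth_append)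
  also have "\<dots> = (\<Sum>l<2 ^ J. (f (2 * l) + f (2 * l + 1)) / 2) / 2 ^ J" by (rule Suc)
  also have "\<dots> = (\<Sum>l<2 * 2 ^ J. f l) / 2 ^ Suc J" unfolding sum_even_odd by (simp add: sum_divide_distrib[symmetric])
  finally show ?case by simp
qed simp

lemma blk_prefix: "a < K \<Longrightarrow> length x = K * n \<Longrightarrow> blk n a (x @ y) = blk n a x"
proof -
  assume "a < K" and l: "length x = K * n"
  then have "a * n + n \<le> K * n" by (metis add.commute mult_Suc Suc_leI mult_le_mono1)
  then show ?thesis using l by (simp add: blk_def)
qed

text \<open>The level is read from coins that follow those of the projections, so it is uniform and
  independent of them.\<close>

lemma round_split:
  "coin_avg (n_coins k n) (\<lambda>bs. \<psi> (roundF k n \<mu> H bs)) =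
    (\<Sum>l<2 * n_lev k n. coin_avg (n_proj n * n) (\<lambda>x. \<psi> (round_cut n \<mu> (n_lev k n) (n_proj n) (wF k n \<mu> H) l x))) / (2 * real (n_lev k n))"
proof -
  let ?J = "ceil_loglog n + (k + 1)"
  have pw: "(2::nat) ^ ?J = 2 * n_lev k n" by (simp add: n_lev_def power_add)
  have pr: "(2::real) ^ ?J = 2 * real (n_lev k n)" by (simp add: n_lev_def power_add)
  have G: "n_proj n - 1 < n_proj n" by (simp add: n_proj_def)
  have rc: "round_cut n \<mu> (n_lev k n) (n_proj n) w l (x @ y) = round_cut n \<mu> (n_lev k n) (n_proj n) w l x" if "length x = n_proj n * n" for w l x y
    unfolding round_cut_def sq_sum_def using blk_prefix[OF G that] blk_prefix[OF _ that] by simp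
  have "coin_avg (n_coins k n) (\<lambda>bs. \<psi> (roundF k n \<mu> H bs)) =
      coin_avg (n_proj n * n) (\<lambda>x. coin_avg ?J (\<lambda>y. \<psi> (round_cut n \<mu> (n_lev k n) (n_proj n) (wF k n \<mu> H) (horner (x @ y) (length x) ?J) x)))"
    unfolding n_coins_def coin_avg_append by (intro coin_avg_cong) (simp add: roundF_def rc levF_def)
  also have "\<dots> = coin_avg (n_proj n * n) (\<lambda>x. (\<Sum>l<2 * n_lev k n. \<psi> (round_cut n \<mu> (n_lev k n) (n_proj n) (wF k n \<mu> H) l x)) / (2 * real (n_lev k n)))"
    by (intro coin_avg_cong) (subst coin_avg_horner[where f = "\<lambda>h. \<psi> (round_cut n \<mu> (n_lev k n) (n_proj n) (wF k n \<mu> H) h _)"], simp only: pw pr)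
  finally show ?thesis by (simp add: coin_avg_divide coin_avg_sum)
qed

lemma round_cut_scale:
  assumes a: "0 < a" and w: "\<And>i l. i < n \<Longrightarrow> l < n \<Longrightarrow> w' i l = a * w i l"
  shows "round_cut n \<mu> Lv K w' l bs = round_cut n \<mu> Lv K w l bs"
proof -
  have r: "rsum n (w' i) x = a * rsum n (w i) x" if "i < n" for i x
    unfolding rsum_def sum_distrib_left by (intro sum.cong refl) (simp add: w that)
  have s: "sq_sum n K (w' i) x = a\<^sup>2 * sq_sum n K (w i) x" if "i < n" for i x
    unfolding sq_sum_def sum_distrib_left by (intro sum.cong refl) (simp add: r that power_mult_distrib)
  have c: "thr_cut n \<mu> c sc = thr_cut n \<mu> c sc'" if "\<And>i. i < n \<Longrightarrow> sc i = sc' i" for c sc sc'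
    unfolding thr_cut_def using that by (auto intro!: sum.cong)
  have "thr_cut n \<mu> c (\<lambda>i. rsum n (w' i) x) = thr_cut n \<mu> c (\<lambda>i. rsum n (w i) x)" for c x
    using c[of "\<lambda>i. rsum n (w' i) x" "\<lambda>i. a * rsum n (w i) x"] thr_cut_scale[OF a] r by simp
  moreover have "thr_cut n \<mu> c (\<lambda>i. sq_sum n K (w' i) x) = thr_cut n \<mu> c (\<lambda>i. sq_sum n K (w i) x)" for c x
    using c[of "\<lambda>i. sq_sum n K (w' i) x" "\<lambda>i. a\<^sup>2 * sq_sum n K (w i) x"] thr_cut_scale[of "a\<^sup>2"] a s by simp
  ultimately show ?thesis by (simp add: round_cut_def)
qed

lemma balanced_pos:
  assumes "2 \<le> n" "balanced_weighting k n \<mu>" "i < n"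
  shows "0 < \<mu> i" "0 < vol \<mu> {..<n}" "vol \<mu> {..<n} \<le> real (\<mu> i) * real n ^ k"
proof -
  have b: "1 / real n ^ k \<le> real (\<mu> i) / vol \<mu> {..<n}" using assms by (simp add: balanced_weighting_def)
  moreover have "0 < 1 / real n ^ k" using assms by simp
  ultimately have q: "0 < real (\<mu> i) / vol \<mu> {..<n}" by linarith
  have "0 \<le> vol \<mu> {..<n}" by (simp add: vol_def sum_nonneg)
  then show v: "0 < vol \<mu> {..<n}" using q by (cases "vol \<mu> {..<n} = 0") auto
  then show "0 < \<mu> i" using q by (simp add: zero_less_divide_iff)
  show "vol \<mu> {..<n} \<le> real (\<mu> i) * real n ^ k" using b v assms(1) by (simp add: field_simps)
qed

lemma pow_n_lev:
  assumes n: "2 \<le> n"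
  shows "real n ^ k \<le> 2 ^ n_lev k n"
proof -
  have "n \<le> 2 ^ ceil_log n" using ceil_log_le_iff by blast
  then have "real n \<le> 2 ^ ceil_log n" by (metis of_nat_le_iff of_nat_numeral of_nat_power)
  then have "real n ^ k \<le> (2 ^ ceil_log n) ^ k" by (intro power_mono) auto
  also have "\<dots> = 2 ^ (ceil_log n * k)" by (simp add: power_mult)
  also have "ceil_log n * k \<le> n_lev k n" unfolding n_lev_def using ceil_loglog_bounds(1)[OF n] by (intro mult_mono) (auto intro: less_imp_le)
  then have "(2::real) ^ (ceil_log n * k) \<le> 2 ^ n_lev k n" by (intro power_increasing) auto
  finally show ?thesis .
qed

text \<open>A doubling is made only if it does not overshoot, and the first refusal certifies a
  factor 4. If no doubling is ever refused, the scale is \<open>2 ^ n_lev k n\<close>, which is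
  large enough because \<mu> is balanced.\<close>

lemma rhoF_bounds:
  assumes n: "2 \<le> n" and bal: "balanced_weighting k n \<mu>" and i: "i < n"
  shows "0 < rhoF k n \<mu> i" "(rhoF k n \<mu> i)\<^sup>2 * real (\<mu> i) \<le> vol \<mu> {..<n}" "vol \<mu> {..<n} \<le> 4 * ((rhoF k n \<mu> i)\<^sup>2 * real (\<mu> i))"
proof -
  let ?m = "real (\<mu> i)" and ?v = "vol \<mu> {..<n}"
  define f where "f = (\<lambda>r::real. if r * r * ?m * 4 < ?v then r + r else r)"
  have m: "0 < ?m" "?v \<le> ?m * real n ^ k" using balanced_pos[OF n bal i] by auto
  have "?m \<le> ?v" unfolding vol_def using i by (intro member_le_sum) auto
  then have inv: "0 < (f ^^ t) 1 \<and> ((f ^^ t) 1)\<^sup>2 * ?m \<le> ?v" for t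
  proof (induction t)
    case (Suc t)
    let ?r = "(f ^^ t) 1"
    show ?case using Suc by (auto simp: f_def power2_eq_square algebra_simps)
  qed simp
  have alt: "?v \<le> 4 * (((f ^^ t) 1)\<^sup>2 * ?m) \<or> (f ^^ t) 1 = 2 ^ t" for t
  proof (induction t)
    case (Suc t)
    show ?case using Suc by (auto simp: f_def power2_eq_square algebra_simps)
  qed simp
  have r: "rhoF k n \<mu> i = (f ^^ n_lev k n) 1" by (simp add: rhoF_def f_def)
  show "0 < rhoF k n \<mu> i" "(rhoF k n \<mu> i)\<^sup>2 * ?m \<le> ?v" using inv[of "n_lev k n"] by (simp_all add: r)
  have "?v \<le> 4 * ((2 ^ n_lev k n)\<^sup>2 * ?m)"
  proof -
    have "?v \<le> ?m * 2 ^ n_lev k n" using m mult_left_mono[OF pow_n_lev[OF n, of k], of ?m] by linarith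
    also have "\<dots> \<le> ?m * (2 ^ n_lev k n)\<^sup>2" using m one_le_power[of "2::real" "n_lev k n"] by (intro mult_left_mono) (auto simp: power2_eq_square)
    finally have *: "?v \<le> (2 ^ n_lev k n)\<^sup>2 * ?m" by (simp add: mult.commute)
    have "0 \<le> (2 ^ n_lev k n)\<^sup>2 * ?m" using m by simp
    then show ?thesis using * by linarith
  qed
  then show "?v \<le> 4 * ((rhoF k n \<mu> i)\<^sup>2 * ?m)" using alt[of "n_lev k n"] unfolding r by auto
qed

lemma eventually_ln_large: "eventually (\<lambda>n. c \<le> ln (real n)) sequentially"
  by real_asymp

text \<open>The claimed rate, linear in \<delta>, is dictated by the long vectors
  (\<open>round_norm\<close>). For bounded vectors one doubling of time would only give a power of
  \<open>move1 \<delta>\<close>; a number \<open>S\<close> of doublings chosen in terms of \<delta>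
  makes up for it once \<open>n\<close> is large.\<close>

lemma round_energy:
  assumes d: "0 < \<delta>" "\<delta> \<le> 1"
  shows "\<exists>n0. \<forall>n\<ge>n0. \<forall>\<mu> v D. balanced_weighting k n \<mu> \<longrightarrow>
    (\<Sum>i<n. real (\<mu> i) * norm_sq n (v i)) = vol \<mu> {..<n} \<longrightarrow> (\<forall>l<n. (\<Sum>i<n. real (\<mu> i) * v i l) = 0) \<longrightarrow>
    (\<forall>l bs. l < 2 * n_lev k n \<longrightarrow> length bs = n_proj n * n \<longrightarrow>
      matching_action {..<n} \<mu> (1 - \<delta>) (round_cut n \<mu> (n_lev k n) (n_proj n) v l bs) (D l bs)) \<longrightarrow>
    2 * real (n_lev k n) * (\<delta> / (400000 * 2 ^ k * ln (real n))) * vol \<mu> {..<n} \<le> Etot n (n_lev k n) (n_proj n) v D"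
proof -
  \<comment> \<open>If the claimed energy were missed, each doubling would earn entropy
    \<open>M * ln (real n)\<close>; 12500 is 400000 / 32. More than 1 / \<open>M\<close> doublings
    then exceed the maximal entropy.\<close>
  define M where "M = (move1 \<delta>)\<^sup>2 * 2 ^ k * 12500 / \<delta>"
  have M: "0 < M" using move1_pos[OF d(1)] d by (simp add: M_def)
  obtain S :: nat where S: "1 / M < real S" using reals_Archimedean2 by blast
  have ev: "eventually (\<lambda>n::nat. 48 * ln (4 * real n) \<le> ln (real n) ^ 3) sequentially" by real_asymp
  have "eventually (\<lambda>n::nat. 2 \<le> n \<and> 48 * ln (4 * real n) \<le> ln (real n) ^ 3 \<and> 16 / (\<delta> * mass3 \<delta>) \<le> ln (real n) \<and> 2 ^ S / M \<le> ln (real n)) sequentially"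
    using ev by (intro eventually_conj eventually_ge_at_top eventually_ln_large)
  then obtain n0 where n0: "\<And>n::nat. n0 \<le> n \<Longrightarrow> 2 \<le> n \<and> 48 * ln (4 * real n) \<le> ln (real n) ^ 3 \<and> 16 / (\<delta> * mass3 \<delta>) \<le> ln (real n) \<and> 2 ^ S / M \<le> ln (real n)"
    by (auto simp: eventually_sequentially)
  show ?thesis
  proof (intro exI[of _ n0] allI impI)
    fix n \<mu> v D assume nn: "n0 \<le> n" and bal: "balanced_weighting k n \<mu>"
      and tot: "(\<Sum>i<n. real (\<mu> i) * norm_sq n (v i)) = vol \<mu> {..<n}" and mean: "\<forall>l<n. (\<Sum>i<n. real (\<mu> i) * v i l) = 0"
      and D: "\<forall>l bs. l < 2 * n_lev k n \<longrightarrow> length bs = n_proj n * n \<longrightarrow>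
        matching_action {..<n} \<mu> (1 - \<delta>) (round_cut n \<mu> (n_lev k n) (n_proj n) v l bs) (D l bs)"
    note nb = n0[OF nn]
    have n: "2 \<le> n" using nb by simp
    let ?T = "vol \<mu> {..<n}" and ?E = "Etot n (n_lev k n) (n_proj n) v D" and ?L = "ln (real n)"
    have pos: "0 < \<mu> i" and vp: "0 < ?T" and mk: "?T \<le> real (\<mu> i) * real n ^ k" if "i < n" for i using balanced_pos[OF n bal that] by auto
    have vp: "0 < ?T" using vp[of 0] n by simp
    have lp: "1 / 2 \<le> ?L" by (rule ceil_log_bounds(4)[OF n])
    have q: "?L \<le> 2 ^ ceil_loglog n" "2 ^ ceil_loglog n \<le> 6 * ?L" using pow_ceil_loglog_ln[OF n] by auto
    have "?L ^ 3 \<le> (2 ^ ceil_loglog n) ^ 3" using q lp by (intro power_mono) auto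
    moreover have "real (n_proj n) = (2 ^ ceil_loglog n) ^ 3" by (simp add: n_proj_def)
    ultimately have K: "48 * ln (4 * real n) \<le> real (n_proj n)" using nb by linarith
    have Lv: "real (n_lev k n) = 2 ^ ceil_loglog n * 2 ^ k" by (simp add: n_lev_def)
    have "?L * 1 \<le> 2 ^ ceil_loglog n * 2 ^ k" using q lp by (intro mult_mono) auto
    then have Lv1: "16 / (\<delta> * mass3 \<delta>) \<le> real (n_lev k n)" using nb Lv by simp
    have G1: "1 \<le> n_proj n" by (simp add: n_proj_def)
    let ?B = "\<delta> / (400000 * 2 ^ k * ?L)"
    have B: "0 < ?B" using d lp by simp
    show "2 * real (n_lev k n) * ?B * ?T \<le> ?E"
    proof (cases "?T / 2 \<le> (\<Sum>i | i < n \<and> 2 ^ 15 / \<delta> \<le> norm_sq n (v i). real (\<mu> i) * norm_sq n (v i))")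
      case True
      have nv: "norm_sq n (v i) \<le> 2 ^ n_lev k n" if i: "i < n" for i
      proof -
        have "real (\<mu> i) * norm_sq n (v i) \<le> ?T"
          unfolding tot[symmetric] using i by (intro member_le_sum) (auto simp: norm_sq_def sum_nonneg)
        also note mk[OF i]
        finally have "norm_sq n (v i) \<le> real n ^ k" using pos[OF i] by simp
        also note pow_n_lev[OF n, of k]
        finally show ?thesis .
      qed
      have "\<delta> * ?T / 32768 \<le> ?E"
        using D by (intro round_norm[OF n pos d refl K tot nv _ True]) auto
      moreover have "2 * real (n_lev k n) * ?B * ?T \<le> \<delta> * ?T / 32768"
      proof -
        \<comment> \<open>The 6 determines the constant of the rate: 2 * 6 / 400000 is just below 1
          / 32768.\<close>
        have "real (n_lev k n) / (2 ^ k * ?L) \<le> 6" using q lp by (simp add: Lv field_simps)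
        then have "real (n_lev k n) / (2 ^ k * ?L) * (2 * \<delta> * ?T / 400000) \<le> 6 * (2 * \<delta> * ?T / 400000)"
          using d vp by (intro mult_right_mono) auto
        also have "\<dots> \<le> \<delta> * ?T / 32768" using d vp by simp
        finally show ?thesis by (simp add: field_simps)
      qed
      ultimately show ?thesis by linarith
    next
      case False
      show ?thesis
      proof (rule ccontr)
        assume "\<not> 2 * real (n_lev k n) * ?B * ?T \<le> ?E"
        then have E: "?E \<le> 2 * real (n_lev k n) * ?B * ?T" by simp
        have eq: "(move1 \<delta>)\<^sup>2 / (32 * ?B) = M * ?L" using d lp by (simp add: M_def field_simps)
        have "2 ^ S \<le> M * ?L" using nb M by (simp add: field_simps)
        then have "real (S + 1) * (M * ?L) \<le> ?L"
          using round_bulk[OF n pos d refl G1 tot _ Lv1 _ False B E, of S] mean D unfolding eq by simp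
        then have "real (S + 1) * M * ?L \<le> 1 * ?L" by (simp add: mult_ac)
        then have "real (S + 1) * M \<le> 1" using mult_right_le_imp_le[of "real (S + 1) * M" ?L 1] lp by linarith
        moreover have "1 < real S * M" using S M by (simp add: field_simps)
        ultimately show False using M by (simp add: algebra_simps)
      qed
    qed
  qed
qed


section \<open>The potential and its expected drop in one round\<close>

definition pot :: "nat \<Rightarrow> (nat \<Rightarrow> nat) \<Rightarrow> nat wgraph \<Rightarrow> real" where
  "pot n \<mu> H = wspace.hs {..<n} (\<lambda>i. real (\<mu> i)) (wop n \<mu> H ^^ n_proj n) (wop n \<mu> H \<circ> wop n \<mu> H ^^ n_proj n) - 1"

text \<open>The denominator is 400000 from \<open>round_energy\<close>, times 4 for the rounding of
  the scales \<open>rhoF\<close>, times 128 because half of \<open>n_proj n\<close> times \<beta> is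
  1 / 128.\<close>

definition rate :: "nat \<Rightarrow> real" where "rate k = 1 / (204800000 * 2 ^ k)"

lemma edge_sum_props:
  fixes n :: nat
  assumes h: "legal_history {..<n} \<mu> \<epsilon> h" and pos: "\<And>i. i < n \<Longrightarrow> 0 < \<mu> i"
  shows "edge_sum h i j = edge_sum h j i" "0 \<le> edge_sum h i j"
    "i < n \<Longrightarrow> (\<Sum>j<n. edge_sum h i j) \<le> real (length h) * real (\<mu> i)"
proof -
  have "edge_sum h i j = edge_sum h j i \<and> 0 \<le> edge_sum h i j \<and> (i < n \<longrightarrow> (\<Sum>j<n. edge_sum h i j) \<le> real (length h) * real (\<mu> i))" for i j
    using h
  proof (induction h arbitrary: i j)
    case (Cons x h)
    obtain S D where x: "x = (S, D)" by (cases x) auto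
    have l: "legal_history {..<n} \<mu> \<epsilon> h" and D: "valid_cut {..<n} \<mu> S" "matching_action {..<n} \<mu> \<epsilon> S D"
      using Cons.prems by (auto simp: legal_history_def x)
    have e: "edge_sum (x # h) i j = D i j + edge_sum h i j" for i j by (simp add: edge_sum_def x)
    have w: "D i j = D j i" "0 \<le> D i j" for i j using D by (auto simp: matching_action_def weighted_graph_def)
    have "(\<Sum>j<n. D i j) \<le> real (\<mu> i)" if "i < n"
      using matching_degree_le[OF finite_lessThan D(1) _ D(2), of i] pos that by (simp add: wdegree_def)
    then show ?case using Cons.IH[OF l, of i j] w[of i j] by (auto simp: e sum.distrib distrib_right)
  qed (simp add: edge_sum_def)
  then show "edge_sum h i j = edge_sum h j i" "0 \<le> edge_sum h i j"
    "i < n \<Longrightarrow> (\<Sum>j<n. edge_sum h i j) \<le> real (length h) * real (\<mu> i)" by blast+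
qed

lemma wop_walk_op:
  assumes "wspace {..<n} (\<lambda>i. real (\<mu> i))"
  shows "wop n \<mu> H = wspace.walk_op {..<n} (\<lambda>i. real (\<mu> i)) (1 / real (64 * n_proj n)) H"
  by (intro ext) (simp add: wop_def wspace.walk_op_def[OF assms] wspace.lap_def[OF assms])

lemma sum_rotate: "(\<Sum>i\<in>A. \<Sum>j\<in>B. \<Sum>l\<in>C. f i j l) = (\<Sum>l\<in>C. \<Sum>i\<in>A. \<Sum>j\<in>B. f i j l)"
proof -
  have "(\<Sum>i\<in>A. \<Sum>j\<in>B. \<Sum>l\<in>C. f i j l) = (\<Sum>i\<in>A. \<Sum>l\<in>C. \<Sum>j\<in>B. f i j l)" by (rule sum.cong[OF refl]) (rule sum.swap)
  also have "\<dots> = (\<Sum>l\<in>C. \<Sum>i\<in>A. \<Sum>j\<in>B. f i j l)" by (rule sum.swap)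
  finally show ?thesis .
qed

lemma Etot_scale:
  assumes "\<And>i l. i < n \<Longrightarrow> l < n \<Longrightarrow> v' i l = a * v i l"
  shows "Etot n Lv K v' D = a\<^sup>2 * Etot n Lv K v D"
proof -
  have "dist_sq n v' i j = a\<^sup>2 * dist_sq n v i j" if "i < n" "j < n" for i j
    unfolding dist_sq_def sum_distrib_left
    by (intro sum.cong refl) (simp add: assms that power_mult_distrib[symmetric] right_diff_distrib)
  then have "(\<Sum>i<n. \<Sum>j<n. D l bs i j * dist_sq n v' i j) = a\<^sup>2 * (\<Sum>i<n. \<Sum>j<n. D l bs i j * dist_sq n v i j)" for l bs
    unfolding sum_distrib_left by (intro sum.cong refl) simp
  then show ?thesis unfolding Etot_def by (simp only: coin_avg_scale sum_distrib_left[symmetric])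
qed

text \<open>The energy is a share of the total \<open>N\<close> of the vectors actually used. By
  \<open>rhoF_bounds\<close> this total is at least a quarter of \<open>Q\<close> times the weight
  of all vertices, and \<open>Q\<close> is at least the potential by \<open>trace_ge\<close>. The
  bound on the number of rounds keeps \<beta> times the degrees below 1/4 of the weights, so the
  walk stays tight after the new matching.\<close>

lemma pot_step:
  assumes d: "0 < \<delta>" "\<delta> \<le> 1"
  shows "\<exists>n0\<ge>2. \<forall>n\<ge>n0. \<forall>\<mu> h M. balanced_weighting k n \<mu> \<longrightarrow> legal_history {..<n} \<mu> (1 - \<delta>) h \<longrightarrow>
    length h + 1 \<le> 16 * n_proj n \<longrightarrow> matching_strategy {..<n} \<mu> (1 - \<delta>) M \<longrightarrow>
    coin_avg (n_coins k n) (\<lambda>bs. pot n \<mu> (edge_sum (h @ [(roundF k n \<mu> (edge_sum h) bs, M h (roundF k n \<mu> (edge_sum h) bs))])))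
      \<le> (1 - rate k * \<delta> / ln (real n)) * pot n \<mu> (edge_sum h)"
proof -
  obtain n1 where n1: "\<forall>n\<ge>n1. \<forall>\<mu> v D. balanced_weighting k n \<mu> \<longrightarrow>
    (\<Sum>i<n. real (\<mu> i) * norm_sq n (v i)) = vol \<mu> {..<n} \<longrightarrow> (\<forall>l<n. (\<Sum>i<n. real (\<mu> i) * v i l) = 0) \<longrightarrow>
    (\<forall>l bs. l < 2 * n_lev k n \<longrightarrow> length bs = n_proj n * n \<longrightarrow>
      matching_action {..<n} \<mu> (1 - \<delta>) (round_cut n \<mu> (n_lev k n) (n_proj n) v l bs) (D l bs)) \<longrightarrow>
    2 * real (n_lev k n) * (\<delta> / (400000 * 2 ^ k * ln (real n))) * vol \<mu> {..<n} \<le> Etot n (n_lev k n) (n_proj n) v D"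
    using round_energy[OF d, of k] by blast
  show ?thesis
  proof (intro exI[of _ "max 2 n1"] conjI allI impI)
    fix n \<mu> h M assume nn: "max 2 n1 \<le> n" and bal: "balanced_weighting k n \<mu>" and h: "legal_history {..<n} \<mu> (1 - \<delta>) h"
      and len: "length h + 1 \<le> 16 * n_proj n" and M: "matching_strategy {..<n} \<mu> (1 - \<delta>) M"
    have n: "2 \<le> n" using nn by simp
    have pos: "0 < \<mu> i" if "i < n" for i using balanced_pos[OF n bal that] by simp
    have vp: "0 < vol \<mu> {..<n}" using balanced_pos(2)[OF n bal, of 0] n by simp
    have lp: "1 / 2 \<le> ln (real n)" by (rule ceil_log_bounds(4)[OF n])
    have G1: "1 \<le> n_proj n" by (simp add: n_proj_def)
    have Lv: "0 < n_lev k n" by (simp add: n_lev_def)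
    interpret W: wspace "{..<n}" "\<lambda>i. real (\<mu> i)" by unfold_locales (auto simp: pos)
    let ?H = "edge_sum h" and ?\<beta> = "1 / real (64 * n_proj n)" and ?v = "vol \<mu> {..<n}"
    define A where "A = W.walk_op ?\<beta> ?H"
    define T where "T = A ^^ n_proj n"
    have wop: "wop n \<mu> H = W.walk_op ?\<beta> H" for H by (rule wop_walk_op[OF W.wspace_axioms])
    have vt: "W.vtot = ?v" by (simp add: W.vtot_def vol_def)
    have "0 \<in> {..<n}" using n by simp
    then have ne: "{..<n} \<noteq> {}" by blast
    note Hp = edge_sum_props[OF h pos]
    have "real (length h) + 1 \<le> real (16 * n_proj n)" using len by (metis of_nat_1 of_nat_add of_nat_le_iff)
    then have bl1: "?\<beta> * (real (length h) + 1) \<le> 1 / 4" using G1 by (simp add: field_simps)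
    moreover have "?\<beta> * real (length h) \<le> ?\<beta> * (real (length h) + 1)" by (intro mult_left_mono) auto
    ultimately have bl: "?\<beta> * real (length h) \<le> 1 / 4" by linarith
    have tA: "W.tight A" unfolding A_def using Hp bl by (intro W.tight_walk_op[where c = "real (length h)"]) auto
    have A1: "A (\<lambda>_. 1) i = 1" for i unfolding A_def by (rule W.walk_op_one)
    have saA: "W.sa A" using tA by (simp add: W.tight_def)
    have saT: "W.sa T" unfolding T_def by (rule W.sa_funpow[OF saA])
    have linT: "W.lin T" using saT by (simp add: W.sa_def)
    have T1: "T (\<lambda>_. 1) i = 1" for i
    proof -
      have "A (\<lambda>_. 1) = (\<lambda>_. 1)" by (rule ext) (rule A1)
      then have "(A ^^ t) (\<lambda>_. 1) = (\<lambda>_. 1)" for t by (induction t) auto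
      then show ?thesis by (simp add: T_def)
    qed
    define \<rho> where "\<rho> = rhoF k n \<mu>"
    have \<rho>: "0 < \<rho> l" "(\<rho> l)\<^sup>2 * real (\<mu> l) \<le> ?v" "?v \<le> 4 * ((\<rho> l)\<^sup>2 * real (\<mu> l))" if "l < n" for l
      using rhoF_bounds[OF n bal that] by (auto simp: \<rho>_def)
    define w where "w = wF k n \<mu> ?H"
    \<comment> \<open>\<open>T\<close> preserves the weighted sum of a function, so centring the
      computed column subtracts exactly the mean that \<open>col\<close> removes.\<close>
    have w: "w i l = \<rho> l * W.col T l i" if i: "i < n" and l: "l < n" for i l
    proof -
      have Tl: "T (\<lambda>j. if j = l then \<rho> l else 0) j = \<rho> l * T (W.e l) j" if "j < n" for j
      proof -
        have "T (\<lambda>j. if j = l then \<rho> l else 0) j = (\<Sum>p<n. (if p = l then \<rho> l else 0) * T (W.e p) j)"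
          using linT that unfolding W.lin_def by blast
        also have "\<dots> = (\<Sum>p<n. if p = l then \<rho> l * T (W.e p) j else 0)" by (intro sum.cong) auto
        also have "\<dots> = \<rho> l * T (W.e l) j" using l by simp
        finally show ?thesis .
      qed
      have "(\<Sum>j<n. real (\<mu> j) * T (\<lambda>j. if j = l then \<rho> l else 0) j) = \<rho> l * W.ip (\<lambda>_. 1) (T (W.e l))"
        unfolding W.ip_def sum_distrib_left by (intro sum.cong refl) (simp add: Tl)
      also have "W.ip (\<lambda>_. 1) (T (W.e l)) = real (\<mu> l)" by (rule W.col_props(1)[OF saT]) (use T1 l in auto)
      finally show ?thesis unfolding w_def wF_def wop T_def[symmetric, unfolded A_def] \<rho>_def[symmetric]
        using Tl[OF i] by (simp add: W.col_def vt A_def T_def right_diff_distrib)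
    qed
    define Q where "Q = (\<Sum>l<n. W.ip (W.col T l) (W.col T l) / real (\<mu> l))"
    define N where "N = (\<Sum>i<n. real (\<mu> i) * norm_sq n (w i))"
    have N_eq: "N = (\<Sum>l<n. (\<rho> l)\<^sup>2 * W.ip (W.col T l) (W.col T l))"
    proof -
      have "N = (\<Sum>i<n. \<Sum>l<n. (\<rho> l)\<^sup>2 * (real (\<mu> i) * W.col T l i * W.col T l i))"
        unfolding N_def norm_sq_def sum_distrib_left by (intro sum.cong refl) (simp add: w power2_eq_square)
      then show ?thesis by (subst (asm) sum.swap) (simp add: W.ip_def sum_distrib_left)
    qed
    have ip0: "0 \<le> W.ip f f" for f unfolding W.ip_def by (intro sum_nonneg) (simp add: mult.assoc)
    have NQ: "?v * Q / 4 \<le> N" "0 \<le> Q"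
    proof -
      have "?v * Q / 4 = (\<Sum>l<n. ?v / (4 * real (\<mu> l)) * W.ip (W.col T l) (W.col T l))"
        unfolding Q_def sum_distrib_left sum_divide_distrib by (intro sum.cong refl) simp
      also have "\<dots> \<le> N" unfolding N_eq
      proof (intro sum_mono mult_right_mono ip0)
        fix l assume "l \<in> {..<n}"
        then show "?v / (4 * real (\<mu> l)) \<le> (\<rho> l)\<^sup>2" using \<rho>(3)[of l] pos[of l] by (simp add: field_simps)
      qed
      finally show "?v * Q / 4 \<le> N" .
      show "0 \<le> Q" unfolding Q_def by (intro sum_nonneg) (simp add: ip0)
    qed
    define \<Psi> where "\<Psi> = pot n \<mu> ?H"
    have \<Psi>: "\<Psi> \<le> Q" "Q \<le> 2 * \<Psi>"
      using W.trace_ge(2,3)[OF tA _ ne, of "n_proj n"] A1 unfolding \<Psi>_def pot_def wop Q_def A_def[symmetric] T_def[symmetric] by auto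
    define D where "D S = M h S" for S
    define en where "en S = (\<Sum>i<n. \<Sum>j<n. D S i j * dist_sq n w i j)" for S
    have vc: "valid_cut {..<n} \<mu> (round_cut n \<mu> Lv K x l bs)" for Lv K x l bs
      unfolding round_cut_def by (rule valid_fix_cut[OF n pos]) (auto simp: thr_cut_def)
    have Dm: "matching_action {..<n} \<mu> (1 - \<delta>) S (D S)" if "valid_cut {..<n} \<mu> S" for S
      using M that by (simp add: matching_strategy_def D_def)
    have drop: "pot n \<mu> (edge_sum (h @ [(S, D S)])) \<le> \<Psi> - en S / (128 * ?v)" if S: "valid_cut {..<n} \<mu> S" for S
    proof -
      have e: "edge_sum (h @ [(S, D S)]) = (\<lambda>i j. ?H i j + D S i j)" by (simp add: edge_sum_def fun_eq_iff)
      have Ds: "D S i j = D S j i" "0 \<le> D S i j" for i j using Dm[OF S] by (auto simp: matching_action_def weighted_graph_def)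
      have Dd: "(\<Sum>j<n. D S i j) \<le> real (\<mu> i)" if "i < n" for i
        using matching_degree_le[of "{..<n}" \<mu> S "1 - \<delta>" "D S" i] S Dm[OF S] pos that by (simp add: wdegree_def)
      define X where "X = (\<Sum>l<n. (\<Sum>i<n. \<Sum>j<n. D S i j * (T (W.e l) i - T (W.e l) j)\<^sup>2) / real (\<mu> l))"
      have "pot n \<mu> (edge_sum (h @ [(S, D S)])) \<le> \<Psi> - real (n_proj n) * ?\<beta> / 2 * X"
        using W.walk_trace_drop[of ?H "real (length h)" "D S" ?\<beta> "n_proj n", OF Hp(1,2) _ Ds _ _ bl1] Hp(3) Dd G1
        unfolding \<Psi>_def pot_def wop e X_def T_def A_def by simp
      also have "real (n_proj n) * ?\<beta> / 2 = 1 / 128" using G1 by simp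
      finally have 1: "pot n \<mu> (edge_sum (h @ [(S, D S)])) \<le> \<Psi> - 1 / 128 * X" .
      \<comment> \<open>Distances between rows do not see the centring, so the energy is the one of
        \<open>walk_trace_drop\<close> with squared scales in place of the reciprocal
        weights.\<close>
      have "en S = (\<Sum>i<n. \<Sum>j<n. \<Sum>l<n. (\<rho> l)\<^sup>2 * (D S i j * (T (W.e l) i - T (W.e l) j)\<^sup>2))"
        unfolding en_def dist_sq_def sum_distrib_left
        by (intro sum.cong refl) (simp add: w W.col_def power2_eq_square algebra_simps)
      also have "\<dots> = (\<Sum>l<n. (\<rho> l)\<^sup>2 * (\<Sum>i<n. \<Sum>j<n. D S i j * (T (W.e l) i - T (W.e l) j)\<^sup>2))"
        unfolding sum_distrib_left by (rule sum_rotate)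
      also have "\<dots> \<le> (\<Sum>l<n. ?v * ((\<Sum>i<n. \<Sum>j<n. D S i j * (T (W.e l) i - T (W.e l) j)\<^sup>2) / real (\<mu> l)))"
      proof (rule sum_mono)
        fix l assume l: "l \<in> {..<n}"
        let ?s = "\<Sum>i<n. \<Sum>j<n. D S i j * (T (W.e l) i - T (W.e l) j)\<^sup>2"
        have "0 \<le> ?s" by (intro sum_nonneg mult_nonneg_nonneg Ds) auto
        moreover have "(\<rho> l)\<^sup>2 \<le> ?v / real (\<mu> l)" using \<rho>(2)[of l] pos[of l] l by (simp add: field_simps)
        ultimately have "(\<rho> l)\<^sup>2 * ?s \<le> ?v / real (\<mu> l) * ?s" by (intro mult_right_mono) auto
        then show "(\<rho> l)\<^sup>2 * ?s \<le> ?v * (?s / real (\<mu> l))" by simp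
      qed
      also have "\<dots> = ?v * X" by (simp add: X_def sum_distrib_left)
      finally have "en S / (128 * ?v) \<le> 1 / 128 * X" using vp by (simp add: field_simps)
      then show ?thesis using 1 by linarith
    qed
    have en0: "0 \<le> en S" if "valid_cut {..<n} \<mu> S" for S
      unfolding en_def dist_sq_def using Dm[OF that] by (intro sum_nonneg mult_nonneg_nonneg) (auto simp: matching_action_def weighted_graph_def)
    have rv: "valid_cut {..<n} \<mu> (roundF k n \<mu> ?H bs)" for bs unfolding roundF_def by (rule vc)
    let ?E = "coin_avg (n_coins k n) (\<lambda>bs. en (roundF k n \<mu> ?H bs))"
    have En: "\<delta> / (400000 * 2 ^ k * ln (real n)) * N \<le> ?E"
    proof (cases "N \<le> 0")
      case True
      have "0 \<le> ?E" by (intro coin_avg_nonneg en0 rv)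
      moreover have "\<delta> / (400000 * 2 ^ k * ln (real n)) * N \<le> 0" using True d lp by (intro mult_nonneg_nonpos) auto
      ultimately show ?thesis by linarith
    next
      case False
      \<comment> \<open>\<open>round_energy\<close> is normalized to average squared norm 1. Cuts
        are invariant under scaling, so the rescaled vectors lead to the same cuts and to the same
        answers.\<close>
      define a where "a = sqrt (?v / N)"
      have a: "0 < a" "a\<^sup>2 = ?v / N" using False vp by (auto simp: a_def)
      let ?w = "\<lambda>i l. a * w i l"
      have c: "round_cut n \<mu> Lv K ?w l bs = round_cut n \<mu> Lv K w l bs" for Lv K l bs
        by (rule round_cut_scale[OF a(1)]) auto
      have "(\<Sum>i<n. real (\<mu> i) * norm_sq n (?w i)) = a\<^sup>2 * N"
        unfolding N_def norm_sq_def sum_distrib_left by (intro sum.cong refl) (simp add: power_mult_distrib)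
      then have t: "(\<Sum>i<n. real (\<mu> i) * norm_sq n (?w i)) = ?v" using False a by simp
      have mean: "\<forall>l<n. (\<Sum>i<n. real (\<mu> i) * ?w i l) = 0"
      proof (intro allI impI)
        fix l assume l: "l < n"
        have "(\<Sum>i<n. real (\<mu> i) * ?w i l) = a * \<rho> l * W.ip (W.col T l) (\<lambda>_. 1)"
          unfolding W.ip_def sum_distrib_left by (intro sum.cong refl) (simp add: w l)
        also have "W.ip (W.col T l) (\<lambda>_. 1) = 0" by (rule W.col_props(2)[OF saT]) (use T1 l in auto)
        finally show "(\<Sum>i<n. real (\<mu> i) * ?w i l) = 0" by simp
      qed
      let ?D = "\<lambda>l bs. D (round_cut n \<mu> (n_lev k n) (n_proj n) w l bs)"
      have "2 * real (n_lev k n) * (\<delta> / (400000 * 2 ^ k * ln (real n))) * ?v \<le> Etot n (n_lev k n) (n_proj n) ?w ?D"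
        using n1[rule_format, of n \<mu> ?w ?D] nn bal t mean Dm[OF vc] by (simp add: c)
      also have "\<dots> = ?v / N * Etot n (n_lev k n) (n_proj n) w ?D" unfolding a(2)[symmetric] by (rule Etot_scale) auto
      also have "Etot n (n_lev k n) (n_proj n) w ?D = 2 * real (n_lev k n) * ?E"
        using Lv unfolding round_split[of k n en \<mu> ?H] by (simp add: Etot_def en_def w_def)
      finally have "(\<delta> / (400000 * 2 ^ k * ln (real n)) * N) * (2 * real (n_lev k n) * ?v / N) \<le> ?E * (2 * real (n_lev k n) * ?v / N)"
        using False by (simp add: field_simps)
      then show ?thesis by (rule mult_right_le_imp_le) (use False vp in \<open>simp add: n_lev_def\<close>)
    qed
    have "coin_avg (n_coins k n) (\<lambda>bs. pot n \<mu> (edge_sum (h @ [(roundF k n \<mu> ?H bs, D (roundF k n \<mu> ?H bs))]))) \<le>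
        coin_avg (n_coins k n) (\<lambda>bs. \<Psi> - en (roundF k n \<mu> ?H bs) / (128 * ?v))"
      by (intro coin_avg_mono drop rv)
    also have "\<dots> = \<Psi> - ?E / (128 * ?v)" by (simp add: coin_avg_diff coin_avg_divide)
    also have "\<dots> \<le> \<Psi> - \<delta> / (400000 * 2 ^ k * ln (real n)) * (?v * Q / 4) / (128 * ?v)"
    proof -
      have "\<delta> / (400000 * 2 ^ k * ln (real n)) * (?v * Q / 4) \<le> \<delta> / (400000 * 2 ^ k * ln (real n)) * N"
        using NQ d lp by (intro mult_left_mono) auto
      also note En
      finally show ?thesis using vp by (intro diff_left_mono divide_right_mono) auto
    qed
    also have "\<dots> = \<Psi> - rate k * \<delta> / ln (real n) * Q" using vp lp by (simp add: rate_def field_simps)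
    also have "\<dots> \<le> \<Psi> - rate k * \<delta> / ln (real n) * \<Psi>"
      using \<Psi>(1) d lp by (intro diff_left_mono mult_left_mono) (auto simp: rate_def)
    finally show "coin_avg (n_coins k n) (\<lambda>bs. pot n \<mu> (edge_sum (h @ [(roundF k n \<mu> ?H bs, M h (roundF k n \<mu> ?H bs))])))
      \<le> (1 - rate k * \<delta> / ln (real n)) * pot n \<mu> ?H"
      by (simp add: D_def \<Psi>_def left_diff_distrib)
  qed simp
qed


section \<open>Expansion after all rounds\<close>

lemma wop_tight:
  fixes n :: nat
  assumes pos: "\<And>i. i < n \<Longrightarrow> 0 < \<mu> i" and h: "legal_history {..<n} \<mu> \<epsilon> h" and len: "length h \<le> 16 * n_proj n"
  shows "wspace.tight {..<n} (\<lambda>i. real (\<mu> i)) (wop n \<mu> (edge_sum h))"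
proof -
  interpret W: wspace "{..<n}" "\<lambda>i. real (\<mu> i)" by unfold_locales (auto simp: pos)
  note Hp = edge_sum_props[OF h pos]
  have "real (length h) \<le> 16 * real (n_proj n)" using len by (metis of_nat_le_iff of_nat_mult of_nat_numeral)
  moreover have "0 < n_proj n" by (simp add: n_proj_def)
  ultimately have "1 / real (64 * n_proj n) * real (length h) \<le> 1 / 4" by (simp add: field_simps)
  then show ?thesis
    unfolding wop_walk_op[OF W.wspace_axioms] using Hp by (intro W.tight_walk_op[where c = "real (length h)"]) auto
qed

lemma pot_nonneg:
  assumes n: "2 \<le> n" and pos: "\<And>i. i < n \<Longrightarrow> 0 < \<mu> i" and h: "legal_history {..<n} \<mu> \<epsilon> h" and len: "length h \<le> 16 * n_proj n"
  shows "0 \<le> pot n \<mu> (edge_sum h)"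
proof -
  interpret W: wspace "{..<n}" "\<lambda>i. real (\<mu> i)" by unfold_locales (auto simp: pos)
  let ?A = "wop n \<mu> (edge_sum h)"
  have "0 \<in> {..<n}" using n by simp
  then have ne: "{..<n} \<noteq> {}" by blast
  have one: "?A (\<lambda>_. 1) i = 1" for i by (simp add: wop_def)
  have "0 \<le> (\<Sum>l<n. W.ip (W.col (?A ^^ n_proj n) l) (W.col (?A ^^ n_proj n) l) / real (\<mu> l))"
    by (intro sum_nonneg divide_nonneg_nonneg W.ip_self_nonneg) auto
  also have "\<dots> \<le> 2 * pot n \<mu> (edge_sum h)"
    unfolding pot_def by (rule W.trace_ge(3)[OF wop_tight[OF pos h len] one ne])
  finally show ?thesis by simp
qed

lemma pot_init:
  fixes n :: nat
  assumes pos: "\<And>i. i < n \<Longrightarrow> 0 < \<mu> i"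
  shows "pot n \<mu> (edge_sum []) \<le> real n"
proof -
  interpret W: wspace "{..<n}" "\<lambda>i. real (\<mu> i)" by unfold_locales (auto simp: pos)
  have "(edge_sum [] :: nat wgraph) = (\<lambda>_ _. 0)" by (simp add: edge_sum_def fun_eq_iff)
  then show ?thesis unfolding pot_def wop_walk_op[OF W.wspace_axioms] using W.walk_trace_init[where \<beta> = "1 / real (64 * n_proj n)" and a = "n_proj n"] by simp
qed

text \<open>The centred indicator of a side has Rayleigh quotient 1 - x, with x equal to \<beta>
  times the cut over its squared norm. The potential bounds the power \<open>2 * n_proj n\<close> of
  1 - x by 2 / n, so x is at least of order ln n over \<open>n_proj n\<close>; dividing by \<beta>
  cancels \<open>n_proj n\<close>.\<close>

lemma expansion_ge:
  assumes n: "4 \<le> n" and pos: "\<And>i. i < n \<Longrightarrow> 0 < \<mu> i" and h: "legal_history {..<n} \<mu> \<epsilon> h" and len: "length h \<le> 16 * n_proj n"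
    and P: "pot n \<mu> (edge_sum h) < 1 / real n"
  shows "ln (real n) \<le> expansion {..<n} \<mu> (edge_sum h)"
proof -
  interpret W: wspace "{..<n}" "\<lambda>i. real (\<mu> i)" by unfold_locales (auto simp: pos)
  let ?H = "edge_sum h" and ?v = "vol \<mu> {..<n}" and ?\<beta> = "1 / real (64 * n_proj n)"
  let ?A = "wop n \<mu> ?H"
  have Aw: "?A = W.walk_op ?\<beta> ?H" by (rule wop_walk_op[OF W.wspace_axioms])
  note Hp = edge_sum_props[OF h pos]
  have G: "0 < n_proj n" by (simp add: n_proj_def)
  have zn: "0 \<in> {..<n}" using n by simp
  then have ne: "{..<n} \<noteq> {}" by blast
  have one: "?A (\<lambda>_. 1) i = 1" for i by (simp add: wop_def)
  have main: "ln (real n) \<le> cut_weight {..<n} ?H S / min (vol \<mu> S) (vol \<mu> ({..<n} - S))" if S: "S \<noteq> {}" "S \<subset> {..<n}" for S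
  proof -
    let ?a = "vol \<mu> S" and ?b = "vol \<mu> ({..<n} - S)"
    have fS: "finite S" using S finite_subset by blast
    have Sn: "i < n" if "i \<in> S" for i using S that by auto
    have a: "0 < ?a" unfolding vol_def using S fS pos Sn by (intro sum_pos) auto
    have b: "0 < ?b" unfolding vol_def using S pos by (intro sum_pos) auto
    have ab: "?v = ?a + ?b" using vol_compl[of S n \<mu>] S by auto
    define f where "f i = indicator S i - ?a / ?v" for i
    define c where "c = cut_weight {..<n} ?H S"
    have spl: "(\<Sum>i<n. real (\<mu> i) * g (indicator S i)) = ?a * g 1 + ?b * g (0::real)" for g :: "real \<Rightarrow> real"
    proof -
      have "(\<Sum>i<n. real (\<mu> i) * g (indicator S i)) = (\<Sum>i\<in>{..<n} - S. real (\<mu> i) * g (indicator S i)) + (\<Sum>i\<in>S. real (\<mu> i) * g (indicator S i))"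
        using S by (intro sum.subset_diff) auto
      then show ?thesis by (simp add: vol_def sum_distrib_right)
    qed
    have f1: "W.ip (\<lambda>_. 1) f = 0"
      unfolding W.ip_def f_def using spl[of "\<lambda>x. x - ?a / ?v"] a b ab by (simp add: field_simps)
    have ff: "W.ip f f = ?a * ?b / ?v"
    proof -
      have alg: "p * (q / V * (q / V)) + q * ((0 - p / V) * (0 - p / V)) = p * q * (p + q) / (V * V)" for p q V :: real
        by (cases "V = 0") (simp_all add: field_simps)
      have "W.ip f f = ?a * ((1 - ?a / ?v) * (1 - ?a / ?v)) + ?b * ((0 - ?a / ?v) * (0 - ?a / ?v))"
        unfolding W.ip_def f_def mult.assoc by (rule spl[of "\<lambda>x. (x - ?a / ?v) * (x - ?a / ?v)"])
      also have "1 - ?a / ?v = ?b / ?v" using a b ab by (simp add: field_simps)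
      also have "?a * (?b / ?v * (?b / ?v)) + ?b * ((0 - ?a / ?v) * (0 - ?a / ?v)) = ?a * ?b * (?a + ?b) / (?v * ?v)" by (rule alg)
      also have "\<dots> = ?a * ?b / ?v" unfolding ab[symmetric] using a b ab by simp
      finally show ?thesis .
    qed
    have ffp: "0 < W.ip f f" unfolding ff using a b ab by simp
    have "(\<Sum>i<n. \<Sum>j<n. ?H i j * (f i - f j)\<^sup>2) = 2 * c"
    proof -
      have "(\<Sum>i<n. \<Sum>j<n. ?H i j * (f i - f j)\<^sup>2) =
          (\<Sum>i<n. \<Sum>j<n. if i \<in> S \<and> j \<notin> S then ?H i j else 0) + (\<Sum>i<n. \<Sum>j<n. if i \<notin> S \<and> j \<in> S then ?H i j else 0)"
        unfolding sum.distrib[symmetric] by (intro sum.cong refl) (auto simp: f_def indicator_def)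
      also have "(\<Sum>i<n. \<Sum>j<n. if i \<notin> S \<and> j \<in> S then ?H i j else 0) = (\<Sum>i<n. \<Sum>j<n. if i \<in> S \<and> j \<notin> S then ?H i j else 0)"
        by (subst sum.swap) (intro sum.cong refl, auto simp: Hp(1))
      also have "(\<Sum>i<n. \<Sum>j<n. if i \<in> S \<and> j \<notin> S then ?H i j else 0) = c"
      proof -
        have "(\<Sum>i<n. \<Sum>j<n. if i \<in> S \<and> j \<notin> S then ?H i j else 0) = (\<Sum>i\<in>S. \<Sum>j<n. if i \<in> S \<and> j \<notin> S then ?H i j else 0)"
          using S by (intro sum.mono_neutral_right) auto
        also have "\<dots> = (\<Sum>i\<in>S. \<Sum>j\<in>{..<n} - S. ?H i j)"
        proof (rule sum.cong[OF refl])
          fix i assume i: "i \<in> S"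
          have "(\<Sum>j<n. if i \<in> S \<and> j \<notin> S then ?H i j else 0) = (\<Sum>j\<in>{..<n} - S. if i \<in> S \<and> j \<notin> S then ?H i j else 0)"
            by (intro sum.mono_neutral_right) auto
          then show "(\<Sum>j<n. if i \<in> S \<and> j \<notin> S then ?H i j else 0) = (\<Sum>j\<in>{..<n} - S. ?H i j)" using i by simp
        qed
        finally show ?thesis by (simp add: c_def cut_weight_def)
      qed
      finally show ?thesis by simp
    qed
    then have lap: "W.ip f (W.lap ?H f) = c" using W.ip_lap_self[of ?H f] Hp(1) by simp
    have fA: "W.ip f (?A f) = W.ip f f - ?\<beta> * c"
      unfolding Aw W.walk_op_def[abs_def] lap[symmetric] by (simp only: W.ip_simps)
    define x where "x = ?\<beta> * c / W.ip f f"
    have c0: "0 \<le> c" unfolding c_def cut_weight_def by (intro sum_nonneg) (simp add: Hp(2))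
    have x0: "0 \<le> x" unfolding x_def using c0 ffp by simp
    have ratio: "W.ip f (?A f) / W.ip f f = 1 - x" using ffp by (simp add: fA x_def diff_divide_distrib)
    have "W.ip f f / 2 \<le> W.ip f (?A f)" using wop_tight[OF pos h len] by (simp add: W.tight_def)
    then have "1 / 2 \<le> W.ip f (?A f) / W.ip f f" using ffp by (simp add: field_simps)
    then have xh: "x \<le> 1 / 2" using ratio by simp
    have p2: "2 * n_proj n = 2 ^ (3 * ceil_loglog n + 1)" by (simp add: n_proj_def power_mult[symmetric] mult.commute)
    have "(1 - x) ^ (2 * n_proj n) \<le> 2 * pot n \<mu> ?H"
      unfolding ratio[symmetric] pot_def by (rule W.rayleigh_power_le[OF wop_tight[OF pos h len] one ne f1 ffp p2])
    also have "\<dots> \<le> 2 / real n" using P by simp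
    finally have "ln ((1 - x) ^ (2 * n_proj n)) \<le> ln (2 / real n)" using xh n by (subst ln_le_cancel_iff) auto
    then have 1: "real (2 * n_proj n) * ln (1 - x) \<le> ln 2 - ln (real n)" using xh n by (simp add: ln_realpow ln_div)
    \<comment> \<open>Tightness has given x at most 1/2, and in this range the logarithm is bounded
      below by a linear function.\<close>
    have "- x - 2 * x\<^sup>2 \<le> ln (1 - x)" by (rule ln_one_minus_pos_lower_bound[OF x0 xh])
    moreover have "2 * x\<^sup>2 \<le> x" using x0 xh mult_left_mono[of x "1 / 2" "2 * x"] by (simp add: power2_eq_square)
    ultimately have "- 2 * x \<le> ln (1 - x)" by linarith
    then have "real (2 * n_proj n) * (- 2 * x) \<le> real (2 * n_proj n) * ln (1 - x)" by (intro mult_left_mono) auto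
    moreover have "real (2 * n_proj n) * (- 2 * x) = - (4 * real (n_proj n) * x)" by simp
    ultimately have 2: "ln (real n) - ln 2 \<le> 4 * real (n_proj n) * x" using 1 by linarith
    \<comment> \<open>\<open>n \<ge> 4\<close> enters here: ln 2 is at most half of ln n.\<close>
    have "2 * ln 2 = ln (2\<^sup>2 :: real)" by (subst ln_realpow) auto
    also have "\<dots> \<le> ln (real n)" using n by (subst ln_le_cancel_iff) auto
    finally have "ln (real n) \<le> 8 * real (n_proj n) * x" using 2 by simp
    also have "\<dots> = c / W.ip f f / 8" using G by (simp add: x_def field_simps)
    finally have 3: "8 * ln (real n) \<le> c / W.ip f f" by simp
    \<comment> \<open>The larger side carries at least half of the total weight.\<close>
    have mn: "min ?a ?b / 2 \<le> W.ip f f"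
    proof -
      have "min ?a ?b * ?v \<le> 2 * (?a * ?b)" using a b ab by (cases "?a \<le> ?b") (auto simp: min_def algebra_simps intro: mult_mono)
      then show ?thesis unfolding ff using a b ab by (simp add: field_simps)
    qed
    have mp: "0 < min ?a ?b" using a b by simp
    have ln0: "0 \<le> ln (real n)" using n by simp
    have "8 * ln (real n) * W.ip f f \<le> c" using 3 ffp by (simp add: field_simps)
    moreover have "8 * ln (real n) * (min ?a ?b / 2) \<le> 8 * ln (real n) * W.ip f f" using mn ln0 by (intro mult_left_mono) auto
    moreover have "ln (real n) * min ?a ?b \<le> 8 * ln (real n) * (min ?a ?b / 2)" using mp ln0 by simp
    ultimately have "ln (real n) * min ?a ?b \<le> c" by linarith
    then show ?thesis using mp by (simp add: c_def pos_le_divide_eq)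
  qed
  have "finite {S. S \<noteq> {} \<and> S \<subset> {..<n}}" by (rule finite_subset[of _ "Pow {..<n}"]) auto
  moreover have "{0} \<in> {S. S \<noteq> {} \<and> S \<subset> {..<n}}"
  proof -
    have "1 \<in> {..<n}" "(1::nat) \<notin> {0}" using n by auto
    then show ?thesis using zn by blast
  qed
  ultimately show ?thesis unfolding expansion_def
  proof (intro Min.boundedI)
    fix x assume "x \<in> (\<lambda>S. cut_weight {..<n} ?H S / min (vol \<mu> S) (vol \<mu> ({..<n} - S))) ` {S. S \<noteq> {} \<and> S \<subset> {..<n}}"
    then show "ln (real n) \<le> x" using main by blast
  qed blast+
qed

section \<open>Playing the game: expectation, decay and failure probability\<close>

lemma valid_roundF:
  assumes "2 \<le> n" "balanced_weighting k n \<mu>"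
  shows "valid_cut {..<n} \<mu> (roundF k n \<mu> H bs)"
  unfolding roundF_def round_cut_def
  by (rule valid_fix_cut[OF assms(1) balanced_pos(1)[OF assms]]) (auto simp: thr_cut_def)

lemma legal_strategy: "legal_cut_strategy k (walk_cut_strategy k)"
  unfolding legal_cut_strategy_def walk_cut_strategy_def using valid_roundF by auto

lemma play_legal:
  assumes n: "2 \<le> n" and bal: "balanced_weighting k n \<mu>" and M: "matching_strategy {..<n} \<mu> \<epsilon> M"
    and h: "h \<in> set_pmf (play (walk_cut_strategy k n \<mu>) M t)"
  shows "legal_history {..<n} \<mu> \<epsilon> h \<and> length h = t"
  using h
proof (induction t arbitrary: h)
  case (Suc t)
  then obtain h' S where h': "h' \<in> set_pmf (play (walk_cut_strategy k n \<mu>) M t)" and S: "S \<in> set_pmf (walk_cut_strategy k n \<mu> h')" and h: "h = h' @ [(S, M h' S)]"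
    by auto
  have "valid_cut {..<n} \<mu> S" using S valid_roundF[OF n bal] by (auto simp: walk_cut_strategy_def)
  moreover from this have "matching_action {..<n} \<mu> \<epsilon> S (M h' S)" using M by (simp add: matching_strategy_def)
  ultimately show ?case using Suc.IH[OF h'] by (auto simp: legal_history_def h)
qed (simp add: legal_history_def)

lemma finite_play: "finite (set_pmf (play (walk_cut_strategy k n \<mu>) M t))"
  by (induction t) (auto simp: walk_cut_strategy_def finite_set_rbits)

text \<open>Coins are fresh in every round, so given the history the expectation is a plain average
  over coin strings, the answer being a function of history and coins. This is how
  \<open>pot_step\<close>, which concerns one history, covers adaptive opponents.\<close>

lemma expectation_play_Suc:
  "measure_pmf.expectation (play (walk_cut_strategy k n \<mu>) M (Suc t)) f =
    measure_pmf.expectation (play (walk_cut_strategy k n \<mu>) M t)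
      (\<lambda>h. coin_avg (n_coins k n) (\<lambda>bs. f (h @ [(roundF k n \<mu> (edge_sum h) bs, M h (roundF k n \<mu> (edge_sum h) bs))])) :: real)"
proof -
  let ?p = "play (walk_cut_strategy k n \<mu>) M t"
  have e: "bind_pmf (walk_cut_strategy k n \<mu> h) (\<lambda>S. return_pmf (h @ [(S, M h S)])) =
      map_pmf (\<lambda>bs. h @ [(roundF k n \<mu> (edge_sum h) bs, M h (roundF k n \<mu> (edge_sum h) bs))]) (rbits (n_coins k n))" for h
    by (simp add: walk_cut_strategy_def map_pmf_def bind_assoc_pmf bind_return_pmf)
  show ?thesis
    unfolding play.simps e
    by (subst pmf_expectation_bind[where A = "set_pmf ?p"], (auto simp: finite_play finite_set_rbits)[3],
        subst integral_measure_pmf[where A = "set_pmf ?p"]) (auto simp: finite_play expectation_rbits)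
qed

lemma expectation_pmf_mono:
  assumes "finite (set_pmf p)" "\<And>x. x \<in> set_pmf p \<Longrightarrow> f x \<le> (g x :: real)"
  shows "measure_pmf.expectation p f \<le> measure_pmf.expectation p g"
  using assms by (simp add: integral_measure_pmf[of "set_pmf p"] sum_mono mult_left_mono)

lemma rate_pos: "0 < rate k" by (simp add: rate_def)

lemma rate_le: "rate k \<le> 1 / 2"
proof -
  have "(1::real) \<le> 2 ^ k" by simp
  then have "(2::real) \<le> 204800000 * 2 ^ k" by linarith
  then show ?thesis unfolding rate_def by (intro divide_left_mono) auto
qed

lemma pot_decay:
  assumes d: "0 < \<delta>" "\<delta> \<le> 1"
  shows "\<exists>n0\<ge>2. \<forall>n\<ge>n0. \<forall>\<mu> M t. balanced_weighting k n \<mu> \<longrightarrow> matching_strategy {..<n} \<mu> (1 - \<delta>) M \<longrightarrow> t \<le> 16 * n_proj n \<longrightarrow>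
    measure_pmf.expectation (play (walk_cut_strategy k n \<mu>) M t) (\<lambda>h. pot n \<mu> (edge_sum h)) \<le> real n * (1 - rate k * \<delta> / ln (real n)) ^ t"
proof -
  obtain n0 where n0: "2 \<le> n0" and st: "\<forall>n\<ge>n0. \<forall>\<mu> h M. balanced_weighting k n \<mu> \<longrightarrow> legal_history {..<n} \<mu> (1 - \<delta>) h \<longrightarrow>
    length h + 1 \<le> 16 * n_proj n \<longrightarrow> matching_strategy {..<n} \<mu> (1 - \<delta>) M \<longrightarrow>
    coin_avg (n_coins k n) (\<lambda>bs. pot n \<mu> (edge_sum (h @ [(roundF k n \<mu> (edge_sum h) bs, M h (roundF k n \<mu> (edge_sum h) bs))])))
      \<le> (1 - rate k * \<delta> / ln (real n)) * pot n \<mu> (edge_sum h)"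
    using pot_step[OF d, of k] by blast
  show ?thesis
  proof (intro exI[of _ n0] conjI n0 allI impI)
    fix n \<mu> M t assume nn: "n0 \<le> n" and bal: "balanced_weighting k n \<mu>" and M: "matching_strategy {..<n} \<mu> (1 - \<delta>) M" and t: "t \<le> 16 * n_proj n"
    have n: "2 \<le> n" using nn n0 by simp
    have pos: "0 < \<mu> i" if "i < n" for i using balanced_pos[OF n bal that] by simp
    let ?r = "1 - rate k * \<delta> / ln (real n)"
    have lp: "1 / 2 \<le> ln (real n)" by (rule ceil_log_bounds(4)[OF n])
    have "rate k * \<delta> \<le> 1 / 2 * 1" using d rate_pos[of k] by (intro mult_mono rate_le) auto
    \<comment> \<open>Nonnegativity of the factor lets the induction hypothesis be multiplied by
      it.\<close>
    then have r0: "0 \<le> ?r" using lp by (simp add: field_simps)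
    show "measure_pmf.expectation (play (walk_cut_strategy k n \<mu>) M t) (\<lambda>h. pot n \<mu> (edge_sum h)) \<le> real n * ?r ^ t"
      using t
    proof (induction t)
      case 0
      then show ?case using pot_init[of n \<mu>] pos by simp
    next
      case (Suc t)
      have "measure_pmf.expectation (play (walk_cut_strategy k n \<mu>) M (Suc t)) (\<lambda>h. pot n \<mu> (edge_sum h)) \<le>
          measure_pmf.expectation (play (walk_cut_strategy k n \<mu>) M t) (\<lambda>h. ?r * pot n \<mu> (edge_sum h))"
        unfolding expectation_play_Suc
      proof (rule expectation_pmf_mono[OF finite_play])
        fix h assume "h \<in> set_pmf (play (walk_cut_strategy k n \<mu>) M t)"
        then have "legal_history {..<n} \<mu> (1 - \<delta>) h \<and> length h = t" by (rule play_legal[OF n bal M])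
        then show "coin_avg (n_coins k n) (\<lambda>bs. pot n \<mu> (edge_sum (h @ [(roundF k n \<mu> (edge_sum h) bs, M h (roundF k n \<mu> (edge_sum h) bs))])))
            \<le> ?r * pot n \<mu> (edge_sum h)" using Suc.prems by (intro st[rule_format] nn bal M) auto
      qed
      also have "\<dots> = ?r * measure_pmf.expectation (play (walk_cut_strategy k n \<mu>) M t) (\<lambda>h. pot n \<mu> (edge_sum h))" by simp
      also have "\<dots> \<le> ?r * (real n * ?r ^ t)" using Suc r0 by (intro mult_left_mono) auto
      finally show ?case by (simp add: mult_ac)
    qed
  qed
qed

text \<open>The 3 pays for three factors \<open>n\<close>: the initial potential, the threshold 1 /
  n of \<open>expansion_ge\<close> and the failure probability. Rounding down keeps the required
  upper bound and costs at most a factor e in the decay.\<close>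

definition rounds :: "nat \<Rightarrow> nat \<Rightarrow> real \<Rightarrow> nat" where
  "rounds k n \<epsilon> = nat \<lfloor>3 / rate k * (ln (real n))\<^sup>2 / (1 - \<epsilon>)\<rfloor>"

lemma rounds_le: "\<epsilon> < 1 \<Longrightarrow> real (rounds k n \<epsilon>) \<le> 3 / rate k * (ln (real n))\<^sup>2 / (1 - \<epsilon>)"
  unfolding rounds_def using rate_pos[of k] by (intro of_nat_floor) (auto intro!: divide_nonneg_nonneg mult_nonneg_nonneg)

lemma rounds_mono:
  assumes "n \<le> n'" "\<epsilon> \<le> \<epsilon>'" "\<epsilon>' < 1"
  shows "rounds k n \<epsilon> \<le> rounds k n' \<epsilon>'"
proof -
  have l: "0 \<le> ln (real n)" "ln (real n) \<le> ln (real n')" using assms(1) by (cases "n = 0"; cases "n' = 0"; simp)+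
  have "(ln (real n))\<^sup>2 \<le> (ln (real n'))\<^sup>2" using l by (intro power_mono) auto
  then have "3 / rate k * (ln (real n))\<^sup>2 / (1 - \<epsilon>) \<le> 3 / rate k * (ln (real n'))\<^sup>2 / (1 - \<epsilon>')"
    using assms rate_pos[of k] by (intro frac_le mult_left_mono) auto
  then show ?thesis unfolding rounds_def by (intro nat_mono floor_mono)
qed

lemma good_strategy:
  assumes e: "0 < \<epsilon>" "\<epsilon> < 1"
  shows "\<exists>n0. \<forall>n\<ge>n0. \<forall>\<mu>. balanced_weighting k n \<mu> \<longrightarrow>
    good_with_probability {..<n} \<mu> \<epsilon> (walk_cut_strategy k n \<mu>) (ln (real n)) (rounds k n \<epsilon>) (1 - 3 / real n)"
proof -
  define \<delta> where "\<delta> = 1 - \<epsilon>"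
  have d: "0 < \<delta>" "\<delta> \<le> 1" and ed: "\<epsilon> = 1 - \<delta>" using e by (auto simp: \<delta>_def)
  obtain n1 where n1: "2 \<le> n1" and dec: "\<forall>n\<ge>n1. \<forall>\<mu> M t. balanced_weighting k n \<mu> \<longrightarrow> matching_strategy {..<n} \<mu> \<epsilon> M \<longrightarrow> t \<le> 16 * n_proj n \<longrightarrow>
    measure_pmf.expectation (play (walk_cut_strategy k n \<mu>) M t) (\<lambda>h. pot n \<mu> (edge_sum h)) \<le> real n * (1 - rate k * \<delta> / ln (real n)) ^ t"
    using pot_decay[OF d, of k] unfolding ed by blast
  \<comment> \<open>For \<open>n\<close> large in terms of \<epsilon>, \<open>c\<close> is at most
    \<open>16 * ln (real n)\<close>, so the number of rounds stays within the
    \<open>16 * n_proj n\<close> of \<open>pot_decay\<close>. Here \<epsilon> only decides how large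
    \<open>n\<close> has to be.\<close>
  define c where "c = 3 / rate k / (1 - \<epsilon>)"
  obtain n2 :: nat where n2: "\<And>n. n2 \<le> n \<Longrightarrow> c / 16 \<le> ln (real n)"
    using eventually_ln_large[of "c / 16"] unfolding eventually_sequentially by blast
  show ?thesis
  proof (intro exI[of _ "max 4 (max n1 n2)"] allI impI)
    fix n \<mu> assume nn: "max 4 (max n1 n2) \<le> n" and bal: "balanced_weighting k n \<mu>"
    have n: "4 \<le> n" "2 \<le> n" using nn by auto
    have pos: "0 < \<mu> i" if "i < n" for i using balanced_pos[OF n(2) bal that] by simp
    let ?T = "rounds k n \<epsilon>" and ?L = "ln (real n)"
    have lp: "1 / 2 \<le> ?L" by (rule ceil_log_bounds(4)[OF n(2)])
    have "real ?T \<le> c * ?L\<^sup>2" using rounds_le[OF e(2), of k n] by (simp add: c_def)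
    also have "\<dots> \<le> 16 * ?L * ?L\<^sup>2" using n2[of n] nn by (intro mult_right_mono) (simp_all add: field_simps)
    also have "\<dots> = 16 * ?L ^ 3" by (simp add: power3_eq_cube power2_eq_square)
    also have "\<dots> \<le> 16 * (2 ^ ceil_loglog n) ^ 3" using pow_ceil_loglog_ln[OF n(2)] lp by (intro mult_left_mono power_mono) auto
    also have "\<dots> = real (16 * n_proj n)" by (simp add: n_proj_def)
    finally have T: "?T \<le> 16 * n_proj n" by (simp only: of_nat_le_iff)
    have rp: "0 < rate k" by (rule rate_pos)
    have "3 / rate k * ?L\<^sup>2 / (1 - \<epsilon>) - 1 \<le> real ?T" unfolding rounds_def by linarith
    then have "3 / rate k * ?L\<^sup>2 / \<delta> - 1 \<le> real ?T" by (simp add: \<delta>_def)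
    then have "rate k * \<delta> / ?L * (3 / rate k * ?L\<^sup>2 / \<delta> - 1) \<le> rate k * \<delta> / ?L * real ?T"
      using rp d lp by (intro mult_left_mono) auto
    moreover have "rate k * \<delta> / ?L * (3 / rate k * ?L\<^sup>2 / \<delta> - 1) = 3 * ?L - rate k * \<delta> / ?L"
      using rp d lp by (simp add: field_simps power2_eq_square)
    moreover have "rate k * \<delta> / ?L \<le> 1"
    proof -
      have "rate k * \<delta> \<le> 1 / 2 * 1" using d rp by (intro mult_mono rate_le) auto
      then show ?thesis using lp by (simp add: field_simps)
    qed
    ultimately have exec: "3 * ?L - 1 \<le> rate k * \<delta> / ?L * real ?T" and r1: "rate k * \<delta> / ?L \<le> 1" by linarith+
    have "(1 - rate k * \<delta> / ?L) ^ ?T \<le> exp (- (rate k * \<delta> / ?L)) ^ ?T"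
      using r1 exp_ge_add_one_self[of "- (rate k * \<delta> / ?L)"] by (intro power_mono) auto
    also have "\<dots> = exp (- (rate k * \<delta> / ?L * real ?T))" by (simp add: exp_of_nat_mult[symmetric] mult.commute)
    also have "\<dots> \<le> exp (1 - 3 * ?L)" using exec by simp
    also have "\<dots> = exp 1 / real n ^ 3"
    proof -
      have "exp (3 * ?L) = real n ^ 3" using n exp_of_nat_mult[of 3 ?L] by simp
      then show ?thesis by (simp add: exp_diff)
    qed
    also have "\<dots> \<le> 3 / real n ^ 3" using exp_le by (intro divide_right_mono) auto
    finally have pw: "(1 - rate k * \<delta> / ?L) ^ ?T \<le> 3 / real n ^ 3" .
    show "good_with_probability {..<n} \<mu> \<epsilon> (walk_cut_strategy k n \<mu>) ?L ?T (1 - 3 / real n)"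
      unfolding good_with_probability_def
    proof (intro allI impI)
      fix M assume M: "matching_strategy {..<n} \<mu> \<epsilon> M"
      let ?p = "play (walk_cut_strategy k n \<mu>) M ?T"
      let ?f = "\<lambda>h. pot n \<mu> (edge_sum h)"
      have legal: "legal_history {..<n} \<mu> \<epsilon> h" "length h \<le> 16 * n_proj n" if "h \<in> set_pmf ?p" for h
        using play_legal[OF n(2) bal M that] T by auto
      have "measure_pmf.expectation ?p ?f \<le> real n * (1 - rate k * \<delta> / ?L) ^ ?T"
        using dec nn bal M T by auto
      also have "\<dots> \<le> real n * (3 / real n ^ 3)" using pw by (intro mult_left_mono) auto
      finally have E: "measure_pmf.expectation ?p ?f \<le> 3 / real n ^ 2" using n by (simp add: power3_eq_cube power2_eq_square)
      have "measure_pmf.prob ?p {h \<in> space (measure_pmf ?p). 1 / real n \<le> ?f h} \<le> measure_pmf.expectation ?p ?f / (1 / real n)"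
      proof (rule integral_Markov_inequality_measure)
        show "integrable (measure_pmf ?p) ?f" by (rule integrable_measure_pmf_finite[OF finite_play])
        show "AE h in measure_pmf ?p. 0 \<le> ?f h"
          by (rule AE_pmfI) (blast intro: pot_nonneg[OF n(2) pos legal])
      qed (use n in auto)
      also have "\<dots> \<le> 3 / real n ^ 2 / (1 / real n)" using E by (intro divide_right_mono) auto
      also have "\<dots> = 3 / real n" using n by (simp add: power2_eq_square)
      finally have bad: "measure_pmf.prob ?p {h. 1 / real n \<le> ?f h} \<le> 3 / real n" by simp
      have "1 - 3 / real n \<le> 1 - measure_pmf.prob ?p {h. 1 / real n \<le> ?f h}" using bad by simp
      also have "\<dots> = measure_pmf.prob ?p (- {h. 1 / real n \<le> ?f h})"
        using measure_pmf.prob_compl[of "{h. 1 / real n \<le> ?f h}" ?p] by (simp add: Compl_eq_Diff_UNIV)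
      also have "\<dots> \<le> measure_pmf.prob ?p {h. ?L \<le> expansion {..<n} \<mu> (edge_sum h)}"
      proof (rule measure_pmf.finite_measure_mono_AE)
        show "AE h in measure_pmf ?p. h \<in> - {h. 1 / real n \<le> ?f h} \<longrightarrow> h \<in> {h. ?L \<le> expansion {..<n} \<mu> (edge_sum h)}"
        proof (rule AE_pmfI)
          fix h assume "h \<in> set_pmf ?p"
          then show "h \<in> - {h. 1 / real n \<le> ?f h} \<longrightarrow> h \<in> {h. ?L \<le> expansion {..<n} \<mu> (edge_sum h)}"
            using expansion_ge[OF n(1) pos legal(1) legal(2), of h] by (auto simp: not_le)
        qed
      qed auto
      finally show "1 - 3 / real n \<le> measure_pmf.prob ?p {h. ?L \<le> expansion {..<n} \<mu> (edge_sum h)}" .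
    qed
  qed
qed

theorem mainTheorem2:
  fixes k :: nat
  shows "\<exists>(C :: cut_strategy) (f :: nat \<Rightarrow> real) (g :: nat \<Rightarrow> real \<Rightarrow> nat).
      legal_cut_strategy k C \<and>
      mono f \<and> f \<in> \<Omega>(\<lambda>n. ln (real n)) \<and>
      (\<forall>n n' \<epsilon> \<epsilon>'. n \<le> n' \<and> 0 < \<epsilon> \<and> \<epsilon> \<le> \<epsilon>' \<and> \<epsilon>' < 1 \<longrightarrow> g n \<epsilon> \<le> g n' \<epsilon>') \<and>
      (\<exists>c. \<forall>n\<ge>2. \<forall>\<epsilon>. 0 < \<epsilon> \<and> \<epsilon> < 1 \<longrightarrow> real (g n \<epsilon>) \<le> c * (ln (real n))\<^sup>2 / (1 - \<epsilon>)) \<and>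
      (\<forall>\<epsilon>. 0 < \<epsilon> \<and> \<epsilon> < 1 \<longrightarrow>
        (\<exists>err :: nat \<Rightarrow> real. err \<longlonglongrightarrow> 0 \<and>
          (\<forall>n\<ge>2. \<forall>\<mu>. balanced_weighting k n \<mu> \<longrightarrow>
            good_with_probability {..<n} \<mu> \<epsilon> (C n \<mu>) (f n) (g n \<epsilon>) (1 - err n)))) \<and>
      nearly_linear_time k g C"
proof (rule exI[of _ "walk_cut_strategy k"], rule exI[of _ "\<lambda>n. ln (real n)"], rule exI[of _ "rounds k"], intro conjI allI impI)
  show "legal_cut_strategy k (walk_cut_strategy k)" by (rule legal_strategy)
  show "mono (\<lambda>n::nat. ln (real n))"
  proof (rule monoI)
    fix a b :: nat assume "a \<le> b"
    then show "ln (real a) \<le> ln (real b)" by (cases "a = 0"; cases "b = 0"; simp)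
  qed
  show "(\<lambda>n. ln (real n)) \<in> \<Omega>(\<lambda>n. ln (real n))" by simp
  show "rounds k n \<epsilon> \<le> rounds k n' \<epsilon>'" if "n \<le> n' \<and> 0 < \<epsilon> \<and> \<epsilon> \<le> \<epsilon>' \<and> \<epsilon>' < 1" for n n' \<epsilon> \<epsilon>'
    using that by (intro rounds_mono) auto
  show "\<exists>c. \<forall>n\<ge>2. \<forall>\<epsilon>. 0 < \<epsilon> \<and> \<epsilon> < 1 \<longrightarrow> real (rounds k n \<epsilon>) \<le> c * (ln (real n))\<^sup>2 / (1 - \<epsilon>)"
    using rounds_le by blast
  show "nearly_linear_time k (rounds k) (walk_cut_strategy k)"
    by (rule nearly_linear_strategy[of _ "3 / rate k"]) (use rounds_le rate_pos[of k] in auto)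
next
  fix \<epsilon> :: real assume e: "0 < \<epsilon> \<and> \<epsilon> < 1"
  then obtain n0 where n0: "\<forall>n\<ge>n0. \<forall>\<mu>. balanced_weighting k n \<mu> \<longrightarrow>
    good_with_probability {..<n} \<mu> \<epsilon> (walk_cut_strategy k n \<mu>) (ln (real n)) (rounds k n \<epsilon>) (1 - 3 / real n)"
    using good_strategy[of \<epsilon> k] by auto
  \<comment> \<open>Below \<open>n0\<close> the error is 1, which makes the probability claim
    trivial there and leaves the limit unchanged.\<close>
  let ?err = "\<lambda>n. if n0 \<le> n then 3 / real n else 1"
  have "(\<lambda>n::nat. 3 / real n) \<longlonglongrightarrow> 0" by real_asymp
  moreover have "eventually (\<lambda>n. 3 / real n = ?err n) sequentially"
    using eventually_ge_at_top[of n0] by eventually_elim simp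
  ultimately have "?err \<longlonglongrightarrow> 0" by (rule Lim_transform_eventually)
  moreover have "good_with_probability {..<n} \<mu> \<epsilon> (walk_cut_strategy k n \<mu>) (ln (real n)) (rounds k n \<epsilon>) (1 - ?err n)"
    if "balanced_weighting k n \<mu>" for n \<mu>
    using n0 that by (auto simp: good_with_probability_def)
  ultimately show "\<exists>err :: nat \<Rightarrow> real. err \<longlonglongrightarrow> 0 \<and> (\<forall>n\<ge>2. \<forall>\<mu>. balanced_weighting k n \<mu> \<longrightarrow>
      good_with_probability {..<n} \<mu> \<epsilon> (walk_cut_strategy k n \<mu>) (ln (real n)) (rounds k n \<epsilon>) (1 - err n))" by blast
qed

end
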